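(* Consider the system of $N$ interacting reinforced stochastic processes $(\mathbf{Z}_n)_{n\ge0}$ described in the context, with a.s. limit $Z_\infty\mathbf{1}$. The following hold. (a) If $1/2<\gamma<1$, then $$n^{\gamma-\frac12}(\mathbf{Z}_n-Z_\infty\mathbf{1})\longrightarrow \mathcal{N}\big(0,\,Z_\infty(1-Z_\infty)\widetilde{\Sigma}_\gamma\big)\quad\text{stably},$$ where $\widetilde{\Sigma}_\gamma=\widetilde\sigma_\gamma^2\,\mathbf{1}\mathbf{1}^{\top}$ and $\widetilde\sigma_\gamma^2=\dfrac{c^2\|\mathbf{v}_1\|^2}{N(2\gamma-1)}>0$. (b) If $\gamma=1$ and $\mathrm{Re}(\lambda^* )<1-(2c)^{-1}$, then $$\sqrt{n}\,(\mathbf{Z}_n-Z_\infty\mathbf{1})\longrightarrow \mathcal{N}\big(0,\,Z_\infty(1-Z_\infty)(\widetilde{\Sigma}_1+\widehat{\Sigma}_1)\big)\quad\text{stably},$$ where $\widetilde\Sigma_1$ is given by the formula in (a) with $\gamma=1$, $\widehat\Sigma_1=U\widehat S_1U^{\top}$, and $$[\widehat S_1]_{h,j}=\frac{c^2}{2c-c(\lambda_h+\lambda_j)-1}\,(\mathbf{v}_h^{\top}\mathbf{v}_j),\qquad 2\le h,j\le N.$$ (c) If $\gamma=1$, $\mathrm{Re}(\lambda^* )=1-(2c)^{-1}$ and $n r_n-c=O(n^{-1})$, then $$\frac{\sqrt n}{\sqrt{\ln n}}(\mathbf{Z}_n-Z_\infty\mathbf{1})\longrightarrow \mathcal{N}\big(0,\,Z_\infty(1-Z_\infty)\widehat{\Sigma}_1^*\big)\quad\text{stably},$$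 where $\widehat\Sigma_1^*=U\widehat S_1^*U^{\top}$ and, for $2\le h,j\le N$, $[\widehat S_1^*]_{h,j}=c^2(\mathbf{v}_h^{\top}\mathbf{v}_j)$ if $\lambda_h+\lambda_j=2-c^{-1}$ and $[\widehat S_1^*]_{h,j}=0$ otherwise.
   Context: Model. Let $N\ge 1$ be an integer and let $\mathbf{1}\in\mathbb{R}^N$ be the vector of all ones. Let $W=[w_{j,k}]$ be a real $N\times N$ matrix with $w_{j,k}\ge 0$ and $W^{\top}\mathbf{1}=\mathbf{1}$ (i.e. $\sum_{j=1}^N w_{j,k}=1$ for every $k$). Assume that $W$ is irreducible and diagonalizable (over $\mathbb{C}$). Let $(r_n)_{n\ge 0}$ be real constants with $0\le r_n<1$ such that $\lim_n n^{\gamma}r_n=c$ for some $c>0$ and $1/2<\gamma\le 1$. On a probability space $(\Omega,\mathcal{A},P)$ let $\mathbf{Z}_0=(Z_{0,1},\dots,Z_{0,N})^{\top}$ be a (possibly random) vector with values in $[0,1]^N$, and let $\mathbf{X}_n=(X_{n,1},\dots,X_{n,N})^{\top}$, $n\ge 1$, be $\{0,1\}^N$-valued random vectors. Put $\mathcal{F}_n=\sigma(\mathbf{Z}_0,\mathbf{X}_m: 1\le m\le n)$. For every $n\ge 0$, the variables $X_{n+1,1},\dots,X_{n+1,N}$ are conditionally independent given $\mathcal{F}_n$, with $P(X_{n+1,j}=1\mid\mathcal{F}_n)=\sum_{k=1}^N w_{k,j}Z_{n,k}$, and $\mathbf{Z}_{n+1}=(1-r_n)\mathbf{Z}_n+r_n\mathbf{X}_{n+1}$.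 Under these assumptions $\mathbf{Z}_n\to Z_\infty\mathbf{1}$ a.s. for a random variable $Z_\infty$ with values in $[0,1]$; this defines $Z_\infty$. Spectral notation. Let $\lambda_1=1,\lambda_2,\dots,\lambda_N$ be the eigenvalues of $W$ repeated with multiplicity ($1$ is a simple eigenvalue and $\mathrm{Re}(\lambda_j)<1$ for $j\ge2$). Let $\mathbf{u}_1,\dots,\mathbf{u}_N\in\mathbb{C}^N$ be a basis of left eigenvectors, $\mathbf{u}_j^{\top}W=\lambda_j\mathbf{u}_j^{\top}$, with $\|\mathbf{u}_j\|=1$ (where $\|\mathbf{v}\|^2=\overline{\mathbf{v}}^{\top}\mathbf{v}$), those corresponding to the same multiple eigenvalue being orthogonal, and $\mathbf{u}_1=N^{-1/2}\mathbf{1}$. Let $\mathbf{v}_1,\dots,\mathbf{v}_N$ be the right eigenvectors, $W\mathbf{v}_j=\lambda_j\mathbf{v}_j$, determined by $\mathbf{u}_h^{\top}\mathbf{v}_j=\delta_{h,j}$; $\mathbf{v}_1$ has strictly positive real entries and $N^{-1/2}\mathbf{1}^{\top}\mathbf{v}_1=1$. Let $U$ and $V$ be the $N\times(N-1)$ matrices with columns $\mathbf{u}_2,\dots,\mathbf{u}_N$ and $\mathbf{v}_2,\dots,\mathbf{v}_N$ respectively; $(N-1)\times(N-1)$ matrices are indexed by $2\le h,j\le N$. $\lambda^*$ (defined when $N\ge2$) is an eigenvalue among $\lambda_2,\dots,\lambda_N$ with maximal real part. Stable convergence. Random vectors $Y_n$ on $(\Omega,\mathcal{A},P)$ converge stably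 to the Gaussian kernel $\mathcal{N}(0,\Sigma)$, with $\Sigma$ a random positive semi-definite matrix, if for every $H\in\mathcal{A}$ with $P(H)>0$ and every bounded continuous real function $f$, $E[f(Y_n)\mid H]\to E\big[\int f\,d\mathcal{N}(0,\Sigma)\,\big|\,H\big]$. *)

theory Defs
  imports "HOL-Probability.Probability" "HOL-Library.Landau_Symbols"
begin

section \<open>Matrices\<close>

text \<open>Irreducible: no simultaneous permutation of rows and columns brings \<open>A\<close> to block triangular
  form with two nonempty diagonal blocks; \<open>S\<close> is the index set of one of the blocks.\<close>

definition irreducible_matrix :: "'a::zero^'n^'n \<Rightarrow> bool" where
  "irreducible_matrix A \<longleftrightarrow>
     \<not> (\<exists>S. S \<noteq> {} \<and> S \<noteq> UNIV \<and> (\<forall>j\<in>S. \<forall>k\<in>- S. A $ j $ k = 0))"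

definition diagonalizable_matrix :: "'a::field^'n^'n \<Rightarrow> bool" where
  "diagonalizable_matrix A \<longleftrightarrow>
     (\<exists>(P :: 'a^'n^'n) (D :: 'a^'n^'n). invertible P \<and>
        (\<forall>i j. i \<noteq> j \<longrightarrow> D $ i $ j = 0) \<and> A = P ** D ** matrix_inv P)"

definition pos_semidef :: "real^'n^'n \<Rightarrow> bool" where
  "pos_semidef S \<longleftrightarrow> transpose S = S \<and> (\<forall>x. 0 \<le> x \<bullet> (S *v x))"

text \<open>The bilinear product \<open>x\<^sup>T y\<close>, without conjugation.\<close>

definition dot :: "complex^'n \<Rightarrow> complex^'n \<Rightarrow> complex" where
  "dot x y = (\<Sum>i\<in>UNIV. x $ i * y $ i)"

section \<open>Gaussian kernels and stable convergence\<close>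

text \<open>The law \<open>N(0, S)\<close>: the image of the standard Gaussian law under some square \<open>A\<close> with \<open>A A\<^sup>T = S\<close>.
  Such an \<open>A\<close> exists if \<open>S\<close> is positive semi-definite, and the law does not depend on its
  choice; for other \<open>S\<close> the value is arbitrary.\<close>

definition gaussian_measure :: "real^'n^'n \<Rightarrow> (real^'n) measure" where
  "gaussian_measure S =
     distr (density lborel (\<lambda>x :: real^'n. ennreal (\<Prod>i\<in>UNIV. std_normal_density (x $ i)))) borel
       (\<lambda>x. (SOME A :: real^'n^'n. A ** transpose A = S) *v x)"

text \<open>\<open>uniform_measure M H\<close> is the conditional probability given the event \<open>H\<close>.\<close>

definition stably_to_gaussian ::
    "'a measure \<Rightarrow> (nat \<Rightarrow> 'a \<Rightarrow> real^'n) \<Rightarrow> ('a \<Rightarrow> real^'n^'n) \<Rightarrow> bool" where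
  "stably_to_gaussian M Y \<Sigma> \<longleftrightarrow>
     (\<forall>n. Y n \<in> borel_measurable M) \<and>
     \<Sigma> \<in> borel_measurable M \<and>
     (\<forall>\<omega>\<in>space M. pos_semidef (\<Sigma> \<omega>)) \<and>
     (\<forall>H\<in>sets M. measure M H > 0 \<longrightarrow>
        (\<forall>f :: real^'n \<Rightarrow> real. continuous_on UNIV f \<and> bounded (range f) \<longrightarrow>
           (\<lambda>n. \<integral>\<omega>. f (Y n \<omega>) \<partial>uniform_measure M H) \<longlonglongrightarrow>
           (\<integral>\<omega>. (\<integral>x. f x \<partial>gaussian_measure (\<Sigma> \<omega>)) \<partial>uniform_measure M H)))"

section \<open>The model\<close>

text \<open>\<open>history M Z0 X n\<close> is the \<open>\<sigma>\<close>-algebra generated by \<open>Z0, X 1, \<dots>, X n\<close>.\<close>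

definition history ::
    "'a measure \<Rightarrow> ('a \<Rightarrow> real^'n) \<Rightarrow> (nat \<Rightarrow> 'a \<Rightarrow> real^'n) \<Rightarrow> nat \<Rightarrow> 'a measure" where
  "history M Z0 X n = sigma (space M)
     ({Z0 -` B \<inter> space M | B. B \<in> sets borel} \<union>
      {X m -` B \<inter> space M | m B. m \<in> {1..n} \<and> B \<in> sets borel})"

definition cond_prob :: "'a measure \<Rightarrow> 'a measure \<Rightarrow> 'a set \<Rightarrow> 'a \<Rightarrow> real" where
  "cond_prob M F B = real_cond_exp M F (indicator B)"

text \<open>Subfamilies are covered by taking \<open>A j = UNIV\<close> for the remaining indices.\<close>

definition cond_indep_components :: "'a measure \<Rightarrow> 'a measure \<Rightarrow> ('a \<Rightarrow> real^'n) \<Rightarrow> bool" where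
  "cond_indep_components M F Y \<longleftrightarrow>
     (\<forall>A :: 'n \<Rightarrow> real set. (\<forall>j. A j \<in> sets borel) \<longrightarrow>
        (AE \<omega> in M. cond_prob M F {\<omega>' \<in> space M. \<forall>j. Y \<omega>' $ j \<in> A j} \<omega> =
           (\<Prod>j\<in>UNIV. cond_prob M F {\<omega>' \<in> space M. Y \<omega>' $ j \<in> A j} \<omega>)))"

text \<open>\<open>W $ j $ k\<close> is the weight \<open>w\<^bsub>j,k\<^esub>\<close>. The value \<open>X 0\<close>
  plays no role. The constant \<open>1\<close> of type \<open>real^'n\<close> is the all-ones vector.\<close>

locale interacting_rsp = prob_space M
  for M :: "'a measure" +
  fixes W :: "real^'n^'n"
    and r :: "nat \<Rightarrow> real"
    and c \<gamma> :: real
    and Z X :: "nat \<Rightarrow> 'a \<Rightarrow> real^'n"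
  assumes W_nonneg: "\<And>j k. 0 \<le> W $ j $ k"
    and W_columns: "transpose W *v 1 = 1"
    and W_irreducible: "irreducible_matrix W"
    and W_diagonalizable: "diagonalizable_matrix (map_matrix complex_of_real W)"
    and r_range: "\<And>n. 0 \<le> r n \<and> r n < 1"
    and r_limit: "(\<lambda>n. real n powr \<gamma> * r n) \<longlonglongrightarrow> c"
    and c_pos: "0 < c"
    and \<gamma>_range: "1/2 < \<gamma>" "\<gamma> \<le> 1"
    and Z0_measurable: "Z 0 \<in> borel_measurable M"
    and Z0_range: "\<And>\<omega> j. \<omega> \<in> space M \<Longrightarrow> Z 0 \<omega> $ j \<in> {0..1}"
    and X_measurable: "\<And>n. 1 \<le> n \<Longrightarrow> X n \<in> borel_measurable M"
    and X_range: "\<And>n \<omega> j. 1 \<le> n \<Longrightarrow> \<omega> \<in> space M \<Longrightarrow> X n \<omega> $ j \<in> {0, 1}"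
    and X_cond_indep: "\<And>n. cond_indep_components M (history M (Z 0) X n) (X (Suc n))"
    and X_cond_prob: "\<And>n j. AE \<omega> in M.
          cond_prob M (history M (Z 0) X n) {\<omega>' \<in> space M. X (Suc n) \<omega>' $ j = 1} \<omega> =
          (\<Sum>k\<in>UNIV. W $ k $ j * Z n \<omega> $ k)"
    and Z_step: "\<And>n \<omega>. \<omega> \<in> space M \<Longrightarrow>
          Z (Suc n) \<omega> = (1 - r n) *\<^sub>R Z n \<omega> + r n *\<^sub>R X (Suc n) \<omega>"

section \<open>Spectral notation\<close>

text \<open>The eigenvalues \<open>lam j\<close>, left eigenvectors \<open>u j\<close> and right eigenvectors \<open>v j\<close> are indexed by
  \<open>1 \<le> j \<le> N\<close>, where \<open>N = CARD('n)\<close>; values at other indices are irrelevant. Linear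
  independence and span are over the complex field.\<close>

locale spectral_data =
  fixes W :: "real^'n^'n"
    and lam :: "nat \<Rightarrow> complex"
    and u v :: "nat \<Rightarrow> complex^'n"
  assumes lam_1: "lam 1 = 1"
    and u_1: "u 1 = (\<chi> i. complex_of_real (1 / sqrt (real CARD('n))))"
    and u_basis: "inj_on u {1..CARD('n)}" "vec.independent (u ` {1..CARD('n)})"
          "vec.span (u ` {1..CARD('n)}) = UNIV"
    and u_eigen: "\<And>j. j \<in> {1..CARD('n)} \<Longrightarrow> u j v* map_matrix complex_of_real W = lam j *s u j"
    and u_norm: "\<And>j. j \<in> {1..CARD('n)} \<Longrightarrow> norm (u j) = 1"
    and u_orthogonal: "\<And>h j. h \<in> {1..CARD('n)} \<Longrightarrow> j \<in> {1..CARD('n)} \<Longrightarrow> h \<noteq> j \<Longrightarrow>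
          lam h = lam j \<Longrightarrow> (\<Sum>i\<in>UNIV. cnj (u h $ i) * u j $ i) = 0"
    and v_eigen: "\<And>j. j \<in> {1..CARD('n)} \<Longrightarrow> map_matrix complex_of_real W *v v j = lam j *s v j"
    and uv_dual: "\<And>h j. h \<in> {1..CARD('n)} \<Longrightarrow> j \<in> {1..CARD('n)} \<Longrightarrow>
          dot (u h) (v j) = (if h = j then 1 else 0)"

definition sigma_tilde_sq :: "real \<Rightarrow> real \<Rightarrow> complex^'n \<Rightarrow> real" where
  "sigma_tilde_sq c \<gamma> v1 = c\<^sup>2 * (norm v1)\<^sup>2 / (real CARD('n) * (2 * \<gamma> - 1))"

text \<open>\<open>\<Sigma>_tilde\<close> is \<open>sigma_tilde_sq c \<gamma> v1\<close> times the all-ones matrix \<open>1 1\<^sup>T\<close>.\<close>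

definition Sigma_tilde :: "real \<Rightarrow> real \<Rightarrow> complex^'n \<Rightarrow> real^'n^'n" where
  "Sigma_tilde c \<gamma> v1 = (\<chi> a b. sigma_tilde_sq c \<gamma> v1)"

definition S_hat :: "real \<Rightarrow> (nat \<Rightarrow> complex) \<Rightarrow> (nat \<Rightarrow> complex^'n) \<Rightarrow> nat \<Rightarrow> nat \<Rightarrow> complex" where
  "S_hat c lam v h j =
     of_real (c\<^sup>2) / (2 * of_real c - of_real c * (lam h + lam j) - 1) * dot (v h) (v j)"

definition S_hat_star ::
    "real \<Rightarrow> (nat \<Rightarrow> complex) \<Rightarrow> (nat \<Rightarrow> complex^'n) \<Rightarrow> nat \<Rightarrow> nat \<Rightarrow> complex" where
  "S_hat_star c lam v h j =
     (if lam h + lam j = 2 - of_real (1 / c) then of_real (c\<^sup>2) * dot (v h) (v j) else 0)"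

text \<open>The product \<open>U S U\<^sup>T\<close>, where \<open>U\<close> has columns \<open>u 2, \<dots>, u N\<close> and \<open>S\<close> is indexed by
  \<open>2 \<le> h, j \<le> N\<close>.\<close>

definition U_S_Ut :: "(nat \<Rightarrow> complex^'n) \<Rightarrow> (nat \<Rightarrow> nat \<Rightarrow> complex) \<Rightarrow> complex^'n^'n" where
  "U_S_Ut u S = (\<chi> a b. \<Sum>h\<in>{2..CARD('n)}. \<Sum>j\<in>{2..CARD('n)}. u h $ a * S h j * u j $ b)"

end

theory Submission
  imports Defs "HOL-Real_Asymp.Real_Asymp"
begin

text \<open>
  Fix \<open>\<theta> \<in> \<real>\<^sup>N\<close>. Unrolling the recursion for \<open>Z\<close> backwards, up to an asymptotically negligible term
  \<open>a\<^sub>n \<theta> \<bullet> (Z\<^sub>n - Z\<^sub>\<infinity> 1)\<close> is one weighted sum of the bounded martingale differences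
  \<open>D\<^sub>k = X\<^sub>k\<^sub>+\<^sub>1 - W\<^sup>T Z\<^sub>k\<close> with deterministic weights: the times \<open>k < n\<close> carry the components along
  \<open>u\<^sub>2, \<dots>, u\<^sub>N\<close>, and the times \<open>k \<ge> n\<close> carry the tail of the martingale \<open>v\<^sub>1\<^sup>T Z\<close>. The conditional
  covariance of \<open>D\<^sub>k\<close> is diagonal and tends to \<open>Z\<^sub>\<infinity> (1 - Z\<^sub>\<infinity>)\<close> times the identity, so the limiting
  variance is \<open>Z\<^sub>\<infinity> (1 - Z\<^sub>\<infinity>)\<close> times the limit of the sum of the squared weights.

  Convergence of the characteristic functions on every event is McLeish's argument:
  \<open>exp (i x) \<approx> (1 + i x) exp (- x\<^sup>2 / 2)\<close>, and the products of the factors \<open>1 + i x\<close> are bounded by a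
  constant and converge weakly to \<open>1\<close>. Trigonometric polynomials and tightness then yield stable convergence.

  In the eigenbasis the sums of squared weights satisfy linear recursions
  \<open>L\<^sub>n\<^sub>+\<^sub>1 = (1 - r\<^sub>n (1 - \<lambda>\<^sub>h)) (1 - r\<^sub>n (1 - \<lambda>\<^sub>j)) L\<^sub>n + r\<^sub>n\<^sup>2\<close>, and the three regimes of the theorem are the
  different limits of \<open>a\<^sub>n\<^sup>2 L\<^sub>n\<close>. As limits of real nonnegative quadratic forms the covariances are real and
  positive semi-definite.
\<close>

section \<open>Positive semi-definite matrices\<close>

text \<open>Past and future of time \<open>n\<close> enter one array because they are fluctuations
  of the same martingale differences over disjoint ranges of time: their squared weights just add,
  and no joint convergence of two separate limits is needed. The future is an infinite range; it is
  cut at a time \<open>K n\<close> so late that the scaled remainder is below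
  \<open>1 / Suc n\<close>. The limit variance \<open>V\<close> is random but independent of
  \<open>n\<close>. Hence the indicator of an event times \<open>exp (- V / 2)\<close> is one fixed
  integrable function, and weak convergence of the products to 1, tested against it, is all that is
  required. Such test functions are not measurable for any finite time, so convergence on events of
  the filtration has to be extended to all of \<open>M\<close>. The eigenvectors may be complex
  while the array must be real. The weights are therefore defined by a real backward recursion, and
  only their inner products are evaluated in the eigenbasis. In the critical regime a pair with real
  part of \<open>lam h + lam j\<close> equal to \<open>2 - 1 / c\<close> but nonzero imaginary part
  produces a rotation instead of growth; there the recursion stays of order \<open>1 / n\<close> and
  the logarithm removes it.\<close>

lemma matrix_mult_transpose_columns:
  fixes b :: "'n::finite \<Rightarrow> real^'n"
  shows "(\<chi> i k. b k $ i) ** transpose (\<chi> i k. b k $ i) = (\<chi> i j. \<Sum>k\<in>UNIV. b k $ i * b k $ j)"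
  by (simp add: matrix_matrix_mult_def transpose_def)

lemma inner_matrix_vector_sum:
  fixes S :: "real^'n^'n"
  shows "x \<bullet> (S *v y) = (\<Sum>i\<in>UNIV. \<Sum>j\<in>UNIV. x $ i * S $ i $ j * y $ j)"
  by (simp add: inner_vec_def matrix_vector_mult_def sum_distrib_left ac_simps)

lemma pos_semidef_sym: "pos_semidef S \<Longrightarrow> S $ i $ j = S $ j $ i"
  unfolding pos_semidef_def by (drule conjunct1, drule arg_cong[where f = "\<lambda>A. A $ j $ i"]) (simp add: transpose_def)

lemma pos_semidef_diag:
  fixes S :: "real^'n^'n"
  assumes "pos_semidef S" shows "0 \<le> S $ i $ i"
proof -
  have "axis i 1 \<bullet> (S *v axis i 1) = S $ i $ i"
    by (simp add: inner_axis' matrix_vector_mult_basis column_def)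
  then show ?thesis using assms by (metis pos_semidef_def)
qed

text \<open>The form at \<open>x + t e\<close> with \<open>e = axis i 1\<close> is a polynomial of
  degree at most two in \<open>t\<close> that is never negative; the inequality says that its
  discriminant is not positive.\<close>

lemma pos_semidef_cauchy_schwarz:
  fixes S :: "real^'n^'n"
  assumes S: "pos_semidef S"
  shows "((S *v x) $ i)\<^sup>2 \<le> S $ i $ i * (x \<bullet> (S *v x))"
proof -
  define y where "y = (S *v x) $ i"
  have Sii: "axis i 1 \<bullet> (S *v axis i 1) = S $ i $ i"
    by (simp add: inner_axis' matrix_vector_mult_basis column_def)
  have iS: "axis i 1 \<bullet> (S *v x) = y"
    by (simp add: inner_axis' y_def)
  have tS: "x \<bullet> (S *v axis i 1) = y"
    using iS S unfolding pos_semidef_def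
    by (metis dot_lmul_matrix inner_commute vector_transpose_matrix)
  have q: "0 \<le> x \<bullet> (S *v x) + 2 * t * y + t\<^sup>2 * S $ i $ i" for t
  proof -
    have "0 \<le> (x + t *\<^sub>R axis i 1) \<bullet> (S *v (x + t *\<^sub>R axis i 1))"
      using S by (simp add: pos_semidef_def)
    also have "\<dots> = x \<bullet> (S *v x) + 2 * t * y + t\<^sup>2 * S $ i $ i"
      by (simp add: matrix_vector_right_distrib matrix_vector_mult_scaleR inner_add_left
          inner_add_right iS tS Sii power2_eq_square algebra_simps)
    finally show ?thesis .
  qed
  show ?thesis
  proof (cases "S $ i $ i = 0")
    case True
    have "y = 0"
    proof (rule ccontr)
      assume "y \<noteq> 0"
      \<comment> \<open>With a zero diagonal entry the polynomial is affine in \<open>t\<close>; at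
        this \<open>t\<close> its value would be -1.\<close>
      with q[of "- (x \<bullet> (S *v x) + 1) / (2 * y)"] True show False
        by (simp add: field_simps)
    qed
    with True show ?thesis by (simp add: y_def)
  next
    case False
    then have pos: "S $ i $ i > 0" using pos_semidef_diag[OF S, of i] by simp
    have "0 \<le> x \<bullet> (S *v x) - y\<^sup>2 / S $ i $ i"
      \<comment> \<open>The minimiser of the quadratic polynomial.\<close>
      using q[of "- y / S $ i $ i"] pos by (simp add: field_simps power2_eq_square)
    then show ?thesis using pos by (simp add: y_def field_simps)
  qed
qed

text \<open>Gaussian elimination: each step splits off a rank-one part and clears one more row.\<close>

lemma pos_semidef_sum_of_squares:
  fixes S :: "real^'n^'n"
  assumes "pos_semidef S"
  shows "\<exists>b :: 'n \<Rightarrow> real^'n. \<forall>i j. S $ i $ j = (\<Sum>k\<in>UNIV. b k $ i * b k $ j)"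
proof -
  \<comment> \<open>Generalised for the induction: \<open>I\<close> contains all indices with a
    nonzero diagonal entry, and the vectors \<open>b k\<close> are supported on \<open>I\<close>,
    which keeps the slot of the next pivot free.\<close>
  have "\<exists>b :: 'n \<Rightarrow> real^'n. (\<forall>k. k \<notin> I \<longrightarrow> b k = 0) \<and> (\<forall>i j. S $ i $ j = (\<Sum>k\<in>UNIV. b k $ i * b k $ j))"
    if "finite I" "pos_semidef S" "\<forall>i. i \<notin> I \<longrightarrow> S $ i $ i = 0" for I and S :: "real^'n^'n"
    using that
  proof (induction I arbitrary: S rule: finite_induct)
    case empty
    \<comment> \<open>A positive semi-definite matrix with zero diagonal vanishes, by the
      Cauchy-Schwarz inequality for the form.\<close>
    have "S $ i $ j = 0" for i j
      using pos_semidef_cauchy_schwarz[OF empty(1), of "axis j 1" i] empty(2)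
      by (simp add: matrix_vector_mult_basis column_def)
    then show ?case by (intro exI[of _ "\<lambda>_. 0"]) simp
  next
    case (insert m I)
    note S = insert.prems(1)
    define s where "s = S $ m $ m"
    \<comment> \<open>The pivot column over the root of the pivot. For a zero pivot, division by
      zero gives \<open>c = 0\<close> and \<open>S' = S\<close>, which is right because the diagonal
      entry at \<open>m\<close> is then already cleared.\<close>
    define c :: "real^'n" where "c = (\<chi> i. S $ i $ m / sqrt s)"
    define S' :: "real^'n^'n" where "S' = (\<chi> i j. S $ i $ j - c $ i * c $ j)"
    have s0: "s \<ge> 0" using pos_semidef_diag[OF S] by (simp add: s_def)
    have Sv: "(S *v x) $ m = (\<Sum>i\<in>UNIV. S $ i $ m * x $ i)" for x
      using pos_semidef_sym[OF S] by (simp add: matrix_vector_mult_def)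
    have cx: "c \<bullet> x = (S *v x) $ m / sqrt s" for x
      by (simp add: c_def inner_vec_def Sv sum_divide_distrib)
    have quad: "x \<bullet> (S' *v x) = x \<bullet> (S *v x) - (c \<bullet> x)\<^sup>2" for x
      unfolding inner_matrix_vector_sum
      by (simp add: S'_def inner_vec_def power2_eq_square sum_product sum_subtractf algebra_simps)
    have S'p: "pos_semidef S'"
      unfolding pos_semidef_def
    proof (intro conjI allI)
      show "transpose S' = S'"
        using pos_semidef_sym[OF S] by (simp add: S'_def transpose_def vec_eq_iff mult.commute)
      show "0 \<le> x \<bullet> (S' *v x)" for x
      proof -
        have "(c \<bullet> x)\<^sup>2 \<le> x \<bullet> (S *v x)"
        proof (cases "s = 0")
          case True
          then show ?thesis using S unfolding pos_semidef_def by (simp add: cx)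
        next
          case False
          then have "(c \<bullet> x)\<^sup>2 = ((S *v x) $ m)\<^sup>2 / s" using s0 by (simp add: cx power_divide)
          also have "\<dots> \<le> x \<bullet> (S *v x)"
            using pos_semidef_cauchy_schwarz[OF S, of x m] s0 False
            by (simp add: s_def[symmetric] divide_le_eq mult.commute)
          finally show ?thesis .
        qed
        then show ?thesis unfolding quad by simp
      qed
    qed
    have "S' $ i $ i = 0" if "i \<notin> I" for i
    proof (cases "i = m")
      case True
      have "c $ m * c $ m = s" using s0 by (cases "s = 0") (simp_all add: c_def s_def[symmetric])
      then show ?thesis using True by (simp add: S'_def s_def)
    next
      case False
      then have "S $ i $ i = 0" using that insert.prems by auto
      moreover have "S' $ i $ i \<ge> 0" by (rule pos_semidef_diag[OF S'p])
      moreover have "c $ i * c $ i \<ge> 0" by simp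
      ultimately show ?thesis by (simp add: S'_def)
    qed
    from insert.IH[OF S'p] this obtain b where b: "\<forall>k. k \<notin> I \<longrightarrow> b k = 0"
      "\<forall>i j. S' $ i $ j = (\<Sum>k\<in>UNIV. b k $ i * b k $ j)" by blast
    define b' where "b' = b(m := c)"
    have bm: "b m = 0" using b insert.hyps by auto
    have "S $ i $ j = (\<Sum>k\<in>UNIV. b' k $ i * b' k $ j)" for i j
    proof -
      have "(\<Sum>k\<in>UNIV. b' k $ i * b' k $ j) = c $ i * c $ j + (\<Sum>k\<in>UNIV-{m}. b k $ i * b k $ j)"
        by (subst sum.remove[of _ m]) (auto simp: b'_def)
      also have "(\<Sum>k\<in>UNIV-{m}. b k $ i * b k $ j) = (\<Sum>k\<in>UNIV. b k $ i * b k $ j)"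
        by (subst (2) sum.remove[of _ m]) (auto simp: bm)
      finally show ?thesis
        using b(2)[rule_format, of i j] by (simp add: S'_def)
    qed
    moreover have "\<forall>k. k \<notin> insert m I \<longrightarrow> b' k = 0" using b by (auto simp: b'_def)
    ultimately show ?case by blast
  qed
  from this[of UNIV] assms show ?thesis by auto
qed

text \<open>This makes the choice in \<open>gaussian_measure\<close> pick a genuine factor of the
  covariance.\<close>

lemma pos_semidef_factor:
  fixes S :: "real^'n^'n"
  assumes "pos_semidef S"
  shows "\<exists>A :: real^'n^'n. A ** transpose A = S"
proof -
  obtain b :: "'n \<Rightarrow> real^'n" where "\<forall>i j. S $ i $ j = (\<Sum>k\<in>UNIV. b k $ i * b k $ j)"
    using pos_semidef_sum_of_squares[OF assms] by blast
  then have "(\<chi> i k. b k $ i) ** transpose (\<chi> i k. b k $ i) = S"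
    unfolding matrix_mult_transpose_columns by (simp add: vec_eq_iff)
  then show ?thesis by blast
qed

section \<open>Gaussian measures and trigonometric polynomials\<close>

text \<open>Bridge between two indexings: \<open>lborel\<close> is a product measure over
  \<open>Basis\<close>, the density is a product over the index type. The choice operator recovers
  \<open>i\<close> from the basis vector \<open>axis i 1\<close>.\<close>

lemma prod_Basis_vec:
  fixes h :: "'n::finite \<Rightarrow> real \<Rightarrow> 'b::comm_monoid_mult" and x :: "real^'n"
  shows "(\<Prod>b\<in>Basis. (\<lambda>b. h (SOME i. b = axis i 1)) b (x \<bullet> b)) = (\<Prod>i\<in>UNIV. h i (x $ i))"
proof -
  have B: "(Basis :: (real^'n) set) = range (\<lambda>i. axis i 1)" by (auto simp: Basis_vec_def)
  have s: "(SOME k. axis i (1::real) = axis k 1) = i" for i :: 'n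
    by (rule some_equality) (auto simp: axis_eq_axis)
  show ?thesis unfolding B
    by (subst prod.reindex) (auto simp: inj_on_def axis_eq_axis inner_axis s)
qed

text \<open>By Fubini the integral factors over the coordinates, and each factor is the
  characteristic function of the one-dimensional standard normal law.\<close>

lemma std_gaussian_vec_char:
  fixes w :: "real^'n"
  shows "(\<integral>x. iexp (w \<bullet> x) \<partial>density lborel (\<lambda>x :: real^'n. ennreal (\<Prod>i\<in>UNIV. std_normal_density (x $ i))))
         = complex_of_real (exp (- (w \<bullet> w) / 2))"
proof -
  define g :: "real^'n \<Rightarrow> real \<Rightarrow> complex" where
    "g = (\<lambda>b t. (\<lambda>i t. std_normal_density t *\<^sub>R iexp (w $ i * t)) (SOME i. b = axis i 1) t)"
  interpret P: product_sigma_finite "\<lambda>_::real^'n. lborel :: real measure" ..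
  have gi: "integrable lborel (g b)" for b
  proof -
    have "integrable lborel (\<lambda>t. std_normal_density t *\<^sub>R iexp (s * t))" for s
      by (rule Bochner_Integration.integrable_bound[of _ std_normal_density]) (auto simp: norm_mult)
    then show ?thesis by (simp add: g_def)
  qed
  have gv: "integral\<^sup>L lborel (g b) = complex_of_real (exp (- ((w $ (SOME i. b = axis i 1))\<^sup>2) / 2))" for b
  proof -
    have "integral\<^sup>L lborel (\<lambda>t. std_normal_density t *\<^sub>R iexp (s * t)) = char std_normal_distribution s" for s
      unfolding char_def by (subst integral_density) (auto simp: normal_density_nonneg)
    then show ?thesis by (simp add: g_def char_std_normal_distribution)
  qed
  have "(\<integral>x. iexp (w \<bullet> x) \<partial>density lborel (\<lambda>x :: real^'n. ennreal (\<Prod>i\<in>UNIV. std_normal_density (x $ i))))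
      = (\<integral>x. (\<Prod>i\<in>UNIV. std_normal_density (x $ i)) *\<^sub>R iexp (w \<bullet> x) \<partial>(lborel :: (real^'n) measure))"
    by (subst integral_density) (auto intro!: prod_nonneg AE_I2 normal_density_nonneg)
  also have "\<dots> = (\<integral>x. (\<Prod>b\<in>Basis. g b (x \<bullet> b)) \<partial>lborel)"
  proof (rule Bochner_Integration.integral_cong[OF refl])
    fix x :: "real^'n"
    have "(\<Prod>i\<in>UNIV. std_normal_density (x $ i)) *\<^sub>R iexp (w \<bullet> x) = (\<Prod>i\<in>UNIV. std_normal_density (x $ i) *\<^sub>R iexp (w $ i * x $ i))"
      by (simp add: scaleR_conv_of_real prod.distrib inner_vec_def sum_distrib_left exp_sum)
    also have "\<dots> = (\<Prod>b\<in>Basis. g b (x \<bullet> b))"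
      using prod_Basis_vec[of "\<lambda>i t. std_normal_density t *\<^sub>R iexp (w $ i * t)" x] by (simp add: g_def)
    finally show "(\<Prod>i\<in>UNIV. std_normal_density (x $ i)) *\<^sub>R iexp (w \<bullet> x) = (\<Prod>b\<in>Basis. g b (x \<bullet> b))" .
  qed
  also have "\<dots> = (\<integral>f. (\<Prod>b\<in>Basis. g b ((\<Sum>c\<in>Basis. f c *\<^sub>R c) \<bullet> b)) \<partial>(\<Pi>\<^sub>M b\<in>Basis. lborel))"
    by (subst lborel_eq, subst integral_distr)
       (auto simp: g_def intro!: borel_measurable_prod)
  also have "\<dots> = (\<integral>f. (\<Prod>b\<in>Basis. g b (f b)) \<partial>(\<Pi>\<^sub>M b\<in>Basis. lborel))"
    by (intro Bochner_Integration.integral_cong prod.cong refl) simp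
  also have "\<dots> = (\<Prod>b\<in>Basis. integral\<^sup>L lborel (g b))"
    by (rule P.product_integral_prod) (auto simp: gi)
  also have "\<dots> = complex_of_real (\<Prod>b\<in>Basis. (\<lambda>b. (\<lambda>i t. exp (- ((w $ i)\<^sup>2) / 2)) (SOME i. b = axis i 1)) b ((w::real^'n) \<bullet> b))"
    by (simp add: gv)
  also have "\<dots> = complex_of_real (\<Prod>i\<in>UNIV. exp (- ((w $ i)\<^sup>2) / 2))"
    using prod_Basis_vec[of "\<lambda>i t. exp (- ((w $ i)\<^sup>2) / 2)" w] by simp
  also have "\<dots> = complex_of_real (exp (- (w \<bullet> w) / 2))"
    by (simp add: exp_sum[symmetric] inner_vec_def power2_eq_square sum_negf sum_divide_distrib)
  finally show ?thesis .
qed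

text \<open>Moving the factor \<open>A\<close> to the other side turns \<open>w\<close> into
  \<open>transpose A *v w\<close>, whose squared length is the form of
  \<open>A ** transpose A = S\<close> at \<open>w\<close>; so the choice of \<open>A\<close>
  disappears.\<close>

lemma gaussian_measure_char:
  fixes S :: "real^'n^'n"
  assumes "pos_semidef S"
  shows "(\<integral>x. iexp (w \<bullet> x) \<partial>gaussian_measure S) = complex_of_real (exp (- (w \<bullet> (S *v w)) / 2))"
proof -
  define A where "A = (SOME A :: real^'n^'n. A ** transpose A = S)"
  have A: "A ** transpose A = S"
    unfolding A_def by (rule someI_ex[OF pos_semidef_factor[OF assms]])
  have m: "(*v) A \<in> borel_measurable borel"
    by (intro borel_measurable_continuous_onI linear_continuous_on matrix_vector_mul_bounded_linear)
  have tw: "w \<bullet> (A *v x) = (transpose A *v w) \<bullet> x" for x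
    by (simp add: dot_lmul_matrix)
  have "(\<integral>x. iexp (w \<bullet> x) \<partial>gaussian_measure S) =
    (\<integral>x. iexp ((transpose A *v w) \<bullet> x) \<partial>density lborel (\<lambda>x :: real^'n. ennreal (\<Prod>i\<in>UNIV. std_normal_density (x $ i))))"
    unfolding gaussian_measure_def A_def[symmetric]
    by (subst integral_distr) (use m in \<open>auto simp: tw\<close>)
  also have "\<dots> = complex_of_real (exp (- ((transpose A *v w) \<bullet> (transpose A *v w)) / 2))"
    by (rule std_gaussian_vec_char)
  also have "(transpose A *v w) \<bullet> (transpose A *v w) = w \<bullet> (A *v (transpose A *v w))"
    by (rule tw[symmetric])
  also have "\<dots> = w \<bullet> (S *v w)" by (simp only: matrix_vector_mul_assoc A)
  finally show ?thesis .
qed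

lemma sets_gaussian_measure [simp, measurable_cong]: "sets (gaussian_measure S) = sets borel"
  by (simp add: gaussian_measure_def)

lemma space_gaussian_measure [simp]: "space (gaussian_measure S) = UNIV"
  by (simp add: gaussian_measure_def)

lemma prob_space_gaussian_measure:
  fixes S :: "real^'n^'n"
  assumes "pos_semidef S"
  shows "prob_space (gaussian_measure S)"
proof -
  have "(\<integral>x. (1::complex) \<partial>gaussian_measure S) = 1"
    using gaussian_measure_char[OF assms, of 0] by simp
  then have "measure (gaussian_measure S) (space (gaussian_measure S)) = 1"
    by (simp add: scaleR_conv_of_real)
  \<comment> \<open>An infinite total mass would have \<open>measure\<close> equal to 0, so the
    value 1 also shows finiteness.\<close>
  then have "emeasure (gaussian_measure S) (space (gaussian_measure S)) = 1"
    by (metis emeasure_eq_ennreal_measure ennreal_1 measure_zero_top zero_neq_one)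
  then show ?thesis by (rule prob_spaceI)
qed

text \<open>The phase \<open>b\<close> covers sines and, with \<open>w = 0\<close>, constants. One
  kind of generator thus suffices, and the product-to-sum formula for cosines closes the class under
  multiplication. The frequencies are arbitrary real vectors, so these functions are linear
  combinations of characters on the whole space, not only periodic ones.\<close>

inductive trig_poly :: "('e::euclidean_space \<Rightarrow> real) \<Rightarrow> bool" where
  cos: "trig_poly (\<lambda>x. a * cos (w \<bullet> x + b))"
| add: "trig_poly p \<Longrightarrow> trig_poly q \<Longrightarrow> trig_poly (\<lambda>x. p x + q x)"

lemma trig_poly_const: "trig_poly (\<lambda>x. a)"
  using trig_poly.cos[of a 0 0] by simp

lemma trig_poly_sin: "trig_poly (\<lambda>x. sin (w \<bullet> x))"
proof -
  have "(\<lambda>x. sin (w \<bullet> x)) = (\<lambda>x. 1 * cos (w \<bullet> x + (- pi / 2)))"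
    by (simp add: cos_diff)
  then show ?thesis by (simp only: trig_poly.cos)
qed

lemma trig_poly_mult:
  assumes "trig_poly p" "trig_poly q"
  shows "trig_poly (\<lambda>x. p x * q x)"
  using assms
proof (induction p rule: trig_poly.induct)
  case (cos a w b)
  from cos show ?case
  proof (induction q rule: trig_poly.induct)
    case (cos a' w' b')
    have "a * cos (w \<bullet> x + b) * (a' * cos (w' \<bullet> x + b')) =
      (a * a' / 2) * cos ((w - w') \<bullet> x + (b - b')) + (a * a' / 2) * cos ((w + w') \<bullet> x + (b + b'))" for x
    proof -
      have "cos (w \<bullet> x + b) * cos (w' \<bullet> x + b') =
        (cos ((w \<bullet> x + b) - (w' \<bullet> x + b')) + cos ((w \<bullet> x + b) + (w' \<bullet> x + b'))) / 2"
        by (rule cos_times_cos)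
      moreover have "(w - w') \<bullet> x + (b - b') = (w \<bullet> x + b) - (w' \<bullet> x + b')"
          "(w + w') \<bullet> x + (b + b') = (w \<bullet> x + b) + (w' \<bullet> x + b')"
        by (simp_all add: inner_diff_left inner_add_left)
      ultimately show ?thesis by (simp only: ) (simp add: field_simps)
    qed
    then show ?case by (simp only: trig_poly.intros)
  next
    case (add p q)
    then show ?case by (simp add: distrib_left trig_poly.intros)
  qed
next
  case (add p1 p2)
  then show ?case by (simp add: distrib_right trig_poly.intros)
qed

lemma trig_poly_continuous: "trig_poly p \<Longrightarrow> continuous_on A p"
  by (induction rule: trig_poly.induct) (auto intro!: continuous_intros)

lemma trig_poly_bounded: "trig_poly p \<Longrightarrow> \<exists>B. \<forall>x. \<bar>p x\<bar> \<le> B"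
proof (induction rule: trig_poly.induct)
  case (cos a w b)
  have "\<bar>a * cos (w \<bullet> x + b)\<bar> \<le> \<bar>a\<bar> * 1" for x
    unfolding abs_mult by (intro mult_left_mono) auto
  then show ?case by blast
next
  case (add p q)
  then obtain B C where "\<forall>x. \<bar>p x\<bar> \<le> B" "\<forall>x. \<bar>q x\<bar> \<le> C" by blast
  then have "\<forall>x. \<bar>p x + q x\<bar> \<le> B + C" by (meson abs_triangle_ineq add_mono order_trans)
  then show ?case by blast
qed

lemma trig_poly_compose_polynomial:
  fixes q :: "real \<Rightarrow> real"
  assumes "real_polynomial_function q" "trig_poly p"
  shows "trig_poly (\<lambda>x. q (p x))"
  using assms(1)
proof induction
  case (linear f)
  then have "f = (\<lambda>x. f 1 * x)" by (metis linear_simps(5) mult.commute mult.right_neutral real_scaleR_def)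
  then show ?case using trig_poly_mult[OF trig_poly_const assms(2)] by metis
qed (auto intro: trig_poly_const trig_poly.add trig_poly_mult)

text \<open>The approximant is composed with a polynomial approximation of the clamp to \<^term>\<open>{-B..B}\<close>,
  which keeps it under control outside the compact set as well.\<close>

lemma trig_poly_approx:
  fixes f :: "'e::euclidean_space \<Rightarrow> real"
  assumes f: "continuous_on UNIV f" and B: "\<And>x. \<bar>f x\<bar> \<le> B" and K: "compact K" and e: "0 < e"
  shows "\<exists>p. trig_poly p \<and> (\<forall>x\<in>K. \<bar>f x - p x\<bar> < e) \<and> (\<forall>x. \<bar>p x\<bar> < B + e)"
proof -
  have sep: "\<exists>p. trig_poly p \<and> p x \<noteq> p y" if "x \<noteq> y" for x y :: 'e
  proof -
    \<comment> \<open>The scaling brings both arguments into \<open>{-1..1}\<close>, where the sine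
      is injective.\<close>
    define t where "t = 1 / (1 + \<bar>(x - y) \<bullet> x\<bar> + \<bar>(x - y) \<bullet> y\<bar>)"
    define w where "w = t *\<^sub>R (x - y)"
    have pos: "0 < 1 + \<bar>(x - y) \<bullet> x\<bar> + \<bar>(x - y) \<bullet> y\<bar>" by linarith
    then have t: "t > 0" by (simp add: t_def)
    have "\<bar>w \<bullet> x\<bar> \<le> 1" "\<bar>w \<bullet> y\<bar> \<le> 1"
      using pos by (simp_all add: w_def t_def abs_mult divide_le_eq)
    moreover have "w \<bullet> x \<noteq> w \<bullet> y"
    proof -
      have "(x - y) \<bullet> (x - y) \<noteq> 0" using that by simp
      then show ?thesis using t by (simp add: w_def inner_diff_right)
    qed
    moreover have "1 \<le> pi / 2" using pi_gt3 by simp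
    ultimately have "sin (w \<bullet> x) \<noteq> sin (w \<bullet> y)"
      using sin_inj_pi[of "w \<bullet> x" "w \<bullet> y"] by (auto simp: abs_le_iff)
    then show ?thesis using trig_poly_sin by blast
  qed
  have "\<exists>g. trig_poly g \<and> (\<forall>x\<in>K. \<bar>f x - g x\<bar> < e / 2)"
  proof (rule Stone_Weierstrass_HOL[OF K])
    show "continuous_on K f" using f continuous_on_subset by blast
  qed (use e sep in \<open>auto intro: trig_poly_const trig_poly.add trig_poly_mult trig_poly_continuous\<close>)
  then obtain g where g: "trig_poly g" "\<forall>x\<in>K. \<bar>f x - g x\<bar> < e / 2" by blast
  obtain C where C: "\<forall>x. \<bar>g x\<bar> \<le> C" using trig_poly_bounded[OF g(1)] by blast
  define \<phi> where "\<phi> t = max (- B) (min B t)" for t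
  have B0: "B \<ge> 0" using B[of undefined] by linarith
  have "continuous_on {-C..C} \<phi>" unfolding \<phi>_def by (intro continuous_intros)
  then obtain q where q: "real_polynomial_function q" "\<And>t. t \<in> {-C..C} \<Longrightarrow> \<bar>\<phi> t - q t\<bar> < e / 2"
    using Stone_Weierstrass_real_polynomial_function[of "{-C..C}" \<phi> "e / 2"] e by auto
  have qg: "\<bar>\<phi> (g x) - q (g x)\<bar> < e / 2" for x
    using C[rule_format, of x] by (intro q(2)) (auto simp: abs_le_iff)
  have "\<bar>f x - q (g x)\<bar> < e" if "x \<in> K" for x
  proof -
    \<comment> \<open>Since \<open>f x\<close> lies between \<open>- B\<close> and \<open>B\<close>,
      clamping \<open>g x\<close> to this interval cannot increase its distance from
      \<open>f x\<close>.\<close>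
    have "\<bar>f x - \<phi> (g x)\<bar> < e / 2" using g(2)[rule_format, OF that] B[of x] unfolding \<phi>_def by linarith
    with qg[of x] show ?thesis by linarith
  qed
  moreover have "\<bar>q (g x)\<bar> < B + e" for x
  proof -
    have "\<bar>\<phi> (g x)\<bar> \<le> B" unfolding \<phi>_def using B0 by linarith
    with qg[of x] e show ?thesis by linarith
  qed
  ultimately show ?thesis using trig_poly_compose_polynomial[OF q(1) g(1)] by blast
qed

section \<open>Stable convergence from characteristic functions\<close>

lemma integral_uniform_measure:
  fixes g :: "'a \<Rightarrow> real"
  assumes "g \<in> borel_measurable M" "H \<in> sets M" "measure M H > 0"
  shows "(\<integral>\<omega>. g \<omega> \<partial>uniform_measure M H) = (\<integral>\<omega>. indicator H \<omega> * g \<omega> \<partial>M) / measure M H"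
proof -
  have fin: "emeasure M H = ennreal (measure M H)"
    using assms(3) by (metis emeasure_eq_ennreal_measure less_irrefl measure_zero_top)
  have "uniform_measure M H = density M (\<lambda>\<omega>. ennreal (indicator H \<omega> / measure M H))"
    unfolding uniform_measure_def using assms(3)
    using assms(2) by (intro density_cong) (measurable, auto simp: fin divide_ennreal indicator_def simp flip: ennreal_1)
  then have "(\<integral>\<omega>. g \<omega> \<partial>uniform_measure M H) = (\<integral>\<omega>. (indicator H \<omega> / measure M H) * g \<omega> \<partial>M)"
    using assms by (simp add: integral_density)
  then show ?thesis by simp
qed

context prob_space
begin

text \<open>By linearity a trigonometric polynomial inherits the convergence of the characteristic
  functions. Measurability of the Gaussian integral in \<omega> is part of the induction: for a
  cosine the closed form \<open>a * cos b * exp ...\<close> supplies it, and in a sum it is needed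
  to add the outer integrals.\<close>

lemma gaussian_trig_convergence:
  fixes Y :: "nat \<Rightarrow> 'a \<Rightarrow> real^'n" and S :: "'a \<Rightarrow> real^'n^'n"
  assumes Y: "\<And>n. Y n \<in> borel_measurable M" and S: "S \<in> borel_measurable M"
    and psd: "\<And>\<omega>. \<omega> \<in> space M \<Longrightarrow> pos_semidef (S \<omega>)"
    and H: "H \<in> sets M"
    and char: "\<And>w. (\<lambda>n. \<integral>\<omega>. indicator H \<omega> *\<^sub>R iexp (w \<bullet> Y n \<omega>) \<partial>M) \<longlonglongrightarrow>
        (\<integral>\<omega>. indicator H \<omega> *\<^sub>R complex_of_real (exp (- (w \<bullet> (S \<omega> *v w)) / 2)) \<partial>M)"
    and p: "trig_poly p"
  shows "(\<lambda>\<omega>. \<integral>x. p x \<partial>gaussian_measure (S \<omega>)) \<in> borel_measurable M \<and>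
     (\<lambda>n. \<integral>\<omega>. indicator H \<omega> * p (Y n \<omega>) \<partial>M) \<longlonglongrightarrow>
     (\<integral>\<omega>. indicator H \<omega> * (\<integral>x. p x \<partial>gaussian_measure (S \<omega>)) \<partial>M)"
  using p
proof induction
  case (cos a w b)
  have sm: "(\<lambda>\<omega>. w \<bullet> (S \<omega> *v w)) \<in> borel_measurable M"
    by (rule borel_measurable_continuous_on[OF _ S, where f = "\<lambda>A. w \<bullet> (A *v w)"])
       (simp add: matrix_vector_mult_def inner_vec_def, intro continuous_intros)
  have re: "a * cos (w \<bullet> x + b) = Re (of_real a * iexp b * iexp (w \<bullet> x))" for x
    by (simp add: cos_add Re_exp Im_exp algebra_simps)
  have g: "(\<integral>x. a * cos (w \<bullet> x + b) \<partial>gaussian_measure (S \<omega>)) = a * cos b * exp (- (w \<bullet> (S \<omega> *v w)) / 2)"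
    if "\<omega> \<in> space M" for \<omega>
  proof -
    interpret G: prob_space "gaussian_measure (S \<omega>)" by (rule prob_space_gaussian_measure[OF psd[OF that]])
    have i: "integrable (gaussian_measure (S \<omega>)) (\<lambda>x. iexp (w \<bullet> x))"
      by (rule G.integrable_const_bound[of _ 1]) auto
    have "(\<integral>x. a * cos (w \<bullet> x + b) \<partial>gaussian_measure (S \<omega>)) = (\<integral>x. Re (of_real a * iexp b * iexp (w \<bullet> x)) \<partial>gaussian_measure (S \<omega>))"
      by (simp only: re)
    also have "\<dots> = Re (\<integral>x. of_real a * iexp b * iexp (w \<bullet> x) \<partial>gaussian_measure (S \<omega>))"
      by (rule integral_Re) (use i in simp)
    also have "\<dots> = Re (of_real a * iexp b * complex_of_real (exp (- (w \<bullet> (S \<omega> *v w)) / 2)))"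
      by (simp only: integral_mult_right_zero gaussian_measure_char[OF psd[OF that]])
    also have "\<dots> = a * cos b * exp (- (w \<bullet> (S \<omega> *v w)) / 2)" by (simp add: Re_exp)
    finally show ?thesis .
  qed
  have int: "integrable M (\<lambda>\<omega>. indicator H \<omega> *\<^sub>R iexp (w \<bullet> Y n \<omega>))" for n
    by (rule integrable_const_bound[of _ 1]) (use H Y in \<open>auto simp: indicator_def\<close>)
  have int2: "integrable M (\<lambda>\<omega>. indicator H \<omega> *\<^sub>R complex_of_real (exp (- (w \<bullet> (S \<omega> *v w)) / 2)))"
  proof (rule integrable_const_bound[of _ 1])
    show "AE \<omega> in M. norm (indicator H \<omega> *\<^sub>R complex_of_real (exp (- (w \<bullet> (S \<omega> *v w)) / 2))) \<le> 1"
      using psd by (intro AE_I2) (auto simp: indicator_def pos_semidef_def)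
  qed (use sm H in measurable)
  have "(\<lambda>n. Re (of_real a * iexp b * (\<integral>\<omega>. indicator H \<omega> *\<^sub>R iexp (w \<bullet> Y n \<omega>) \<partial>M))) \<longlonglongrightarrow>
     Re (of_real a * iexp b * (\<integral>\<omega>. indicator H \<omega> *\<^sub>R complex_of_real (exp (- (w \<bullet> (S \<omega> *v w)) / 2)) \<partial>M))"
    by (intro tendsto_intros char)
  moreover have "Re (of_real a * iexp b * (\<integral>\<omega>. indicator H \<omega> *\<^sub>R iexp (w \<bullet> Y n \<omega>) \<partial>M)) =
     (\<integral>\<omega>. indicator H \<omega> * (a * cos (w \<bullet> Y n \<omega> + b)) \<partial>M)" for n
  proof -
    have "Re (of_real a * iexp b * (\<integral>\<omega>. indicator H \<omega> *\<^sub>R iexp (w \<bullet> Y n \<omega>) \<partial>M)) =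
       (\<integral>\<omega>. Re (of_real a * iexp b * (indicator H \<omega> *\<^sub>R iexp (w \<bullet> Y n \<omega>))) \<partial>M)"
      by (simp only: integral_mult_right_zero[symmetric], rule integral_Re[symmetric], intro integrable_mult_right int)
    also have "\<dots> = (\<integral>\<omega>. indicator H \<omega> * (a * cos (w \<bullet> Y n \<omega> + b)) \<partial>M)"
      by (intro Bochner_Integration.integral_cong refl) (simp add: re indicator_def)
    finally show ?thesis .
  qed
  moreover have "Re (of_real a * iexp b * (\<integral>\<omega>. indicator H \<omega> *\<^sub>R complex_of_real (exp (- (w \<bullet> (S \<omega> *v w)) / 2)) \<partial>M)) =
     (\<integral>\<omega>. indicator H \<omega> * (\<integral>x. a * cos (w \<bullet> x + b) \<partial>gaussian_measure (S \<omega>)) \<partial>M)"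
  proof -
    have "Re (of_real a * iexp b * (\<integral>\<omega>. indicator H \<omega> *\<^sub>R complex_of_real (exp (- (w \<bullet> (S \<omega> *v w)) / 2)) \<partial>M)) =
       (\<integral>\<omega>. Re (of_real a * iexp b * (indicator H \<omega> *\<^sub>R complex_of_real (exp (- (w \<bullet> (S \<omega> *v w)) / 2)))) \<partial>M)"
      by (simp only: integral_mult_right_zero[symmetric], rule integral_Re[symmetric], intro integrable_mult_right int2)
    also have "\<dots> = (\<integral>\<omega>. indicator H \<omega> * (\<integral>x. a * cos (w \<bullet> x + b) \<partial>gaussian_measure (S \<omega>)) \<partial>M)"
      by (intro Bochner_Integration.integral_cong refl, subst g) (auto simp: indicator_def Re_exp)
    finally show ?thesis .
  qed
  moreover have "(\<lambda>\<omega>. \<integral>x. a * cos (w \<bullet> x + b) \<partial>gaussian_measure (S \<omega>)) \<in> borel_measurable M"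
    using sm by (subst measurable_cong[OF g]) auto
  ultimately show ?case by simp
next
  case (add p q)
  have pi: "integrable (gaussian_measure (S \<omega>)) p'" if w: "\<omega> \<in> space M" and t: "trig_poly p'" for \<omega> p'
  proof -
    interpret G: prob_space "gaussian_measure (S \<omega>)" by (rule prob_space_gaussian_measure[OF psd[OF w]])
    obtain B where "\<forall>x. \<bar>p' x\<bar> \<le> B" using trig_poly_bounded[OF t] by blast
    moreover have [measurable]: "p' \<in> borel_measurable borel"
      by (intro borel_measurable_continuous_onI trig_poly_continuous t)
    ultimately show ?thesis
      by (intro G.integrable_const_bound[of _ B]) auto
  qed
  have s: "(\<integral>x. p x + q x \<partial>gaussian_measure (S \<omega>)) = (\<integral>x. p x \<partial>gaussian_measure (S \<omega>)) + (\<integral>x. q x \<partial>gaussian_measure (S \<omega>))"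
    if "\<omega> \<in> space M" for \<omega>
    using pi[OF that] add.hyps by simp
  have i1: "integrable M (\<lambda>\<omega>. indicator H \<omega> * p' (Y n \<omega>))" if t: "trig_poly p'" for p' n
  proof -
    obtain B where B: "\<forall>x. \<bar>p' x\<bar> \<le> B" using trig_poly_bounded[OF t] by blast
    have [measurable]: "p' \<in> borel_measurable borel" by (auto intro: borel_measurable_continuous_onI trig_poly_continuous t)
    have "0 \<le> B" using B abs_ge_zero order_trans by blast
    with B H Y show ?thesis
      by (intro integrable_const_bound[of _ B]) (auto simp: indicator_def)
  qed
  have i2: "integrable M (\<lambda>\<omega>. indicator H \<omega> * (\<integral>x. p' x \<partial>gaussian_measure (S \<omega>)))"
    if t: "trig_poly p'" and [measurable]: "(\<lambda>\<omega>. \<integral>x. p' x \<partial>gaussian_measure (S \<omega>)) \<in> borel_measurable M" for p'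
  proof -
    obtain B where B: "\<forall>x. \<bar>p' x\<bar> \<le> B" using trig_poly_bounded[OF t] by blast
    have "\<bar>\<integral>x. p' x \<partial>gaussian_measure (S \<omega>)\<bar> \<le> B" if "\<omega> \<in> space M" for \<omega>
    proof -
      interpret G: prob_space "gaussian_measure (S \<omega>)" by (rule prob_space_gaussian_measure[OF psd[OF that(1)]])
      have "\<bar>\<integral>x. p' x \<partial>gaussian_measure (S \<omega>)\<bar> \<le> (\<integral>x. \<bar>p' x\<bar> \<partial>gaussian_measure (S \<omega>))"
        by (rule integral_abs_bound)
      also have "\<dots> \<le> (\<integral>x. B \<partial>gaussian_measure (S \<omega>))"
        using pi[OF that t] B by (intro integral_mono) auto
      finally show ?thesis by (simp add: G.prob_space[simplified])
    qed
    moreover have "0 \<le> B" using B abs_ge_zero order_trans by blast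
    ultimately show ?thesis using H
      by (intro integrable_const_bound[of _ B]) (auto simp: indicator_def)
  qed
  have "(\<lambda>n. (\<integral>\<omega>. indicator H \<omega> * p (Y n \<omega>) \<partial>M) + (\<integral>\<omega>. indicator H \<omega> * q (Y n \<omega>) \<partial>M)) \<longlonglongrightarrow>
     (\<integral>\<omega>. indicator H \<omega> * (\<integral>x. p x \<partial>gaussian_measure (S \<omega>)) \<partial>M) + (\<integral>\<omega>. indicator H \<omega> * (\<integral>x. q x \<partial>gaussian_measure (S \<omega>)) \<partial>M)"
    using add.IH by (intro tendsto_add) auto
  moreover have "(\<integral>\<omega>. indicator H \<omega> * p (Y n \<omega>) \<partial>M) + (\<integral>\<omega>. indicator H \<omega> * q (Y n \<omega>) \<partial>M) =
     (\<integral>\<omega>. indicator H \<omega> * (p (Y n \<omega>) + q (Y n \<omega>)) \<partial>M)" for n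
    using i1[OF add.hyps(1)] i1[OF add.hyps(2)] by (simp add: distrib_left)
  moreover have "(\<integral>\<omega>. indicator H \<omega> * (\<integral>x. p x \<partial>gaussian_measure (S \<omega>)) \<partial>M) + (\<integral>\<omega>. indicator H \<omega> * (\<integral>x. q x \<partial>gaussian_measure (S \<omega>)) \<partial>M)
     = (\<integral>\<omega>. indicator H \<omega> * (\<integral>x. p x + q x \<partial>gaussian_measure (S \<omega>)) \<partial>M)"
  proof -
    have "(\<integral>\<omega>. indicator H \<omega> * (\<integral>x. p x \<partial>gaussian_measure (S \<omega>)) \<partial>M) + (\<integral>\<omega>. indicator H \<omega> * (\<integral>x. q x \<partial>gaussian_measure (S \<omega>)) \<partial>M)
      = (\<integral>\<omega>. indicator H \<omega> * (\<integral>x. p x \<partial>gaussian_measure (S \<omega>)) + indicator H \<omega> * (\<integral>x. q x \<partial>gaussian_measure (S \<omega>)) \<partial>M)"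
      by (rule Bochner_Integration.integral_add[symmetric]) (use i2 add in auto)
    also have "\<dots> = (\<integral>\<omega>. indicator H \<omega> * (\<integral>x. p x + q x \<partial>gaussian_measure (S \<omega>)) \<partial>M)"
      by (intro Bochner_Integration.integral_cong refl) (simp add: s distrib_left)
    finally show ?thesis .
  qed
  moreover have "(\<lambda>\<omega>. \<integral>x. p x + q x \<partial>gaussian_measure (S \<omega>)) \<in> borel_measurable M"
    using add.IH by (subst measurable_cong[OF s]) auto
  ultimately show ?case by simp
qed

text \<open>Tightness is supplied as a bound on first moments. The test function is replaced by
  trigonometric polynomials \<open>p k\<close>, close on the ball of radius \<open>k\<close> and
  bounded by \<open>B + 1\<close> everywhere; what happens outside the ball costs at most a multiple
  of \<open>C / k\<close>, uniformly in \<open>n\<close>.\<close>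

lemma stably_to_gaussianI:
  fixes Y :: "nat \<Rightarrow> 'a \<Rightarrow> real^'n" and S :: "'a \<Rightarrow> real^'n^'n"
  assumes Y [measurable]: "\<And>n. Y n \<in> borel_measurable M" and S: "S \<in> borel_measurable M"
    and psd: "\<And>\<omega>. \<omega> \<in> space M \<Longrightarrow> pos_semidef (S \<omega>)"
    and int: "\<And>n. integrable M (\<lambda>\<omega>. norm (Y n \<omega>))"
    and tight: "eventually (\<lambda>n. (\<integral>\<omega>. norm (Y n \<omega>) \<partial>M) \<le> C) sequentially"
    and char: "\<And>H w. H \<in> sets M \<Longrightarrow> (\<lambda>n. \<integral>\<omega>. indicator H \<omega> *\<^sub>R iexp (w \<bullet> Y n \<omega>) \<partial>M) \<longlonglongrightarrow>
        (\<integral>\<omega>. indicator H \<omega> *\<^sub>R complex_of_real (exp (- (w \<bullet> (S \<omega> *v w)) / 2)) \<partial>M)"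
  shows "stably_to_gaussian M Y S"
  unfolding stably_to_gaussian_def
proof (intro conjI allI ballI impI)
  fix H and f :: "real^'n \<Rightarrow> real"
  assume H [measurable]: "H \<in> sets M" and pos: "0 < measure M H"
    and f: "continuous_on UNIV f \<and> bounded (range f)"
  from f obtain B where B: "\<And>x. \<bar>f x\<bar> \<le> B" unfolding bounded_iff by auto
  have B0: "B \<ge> 0" using B[of undefined] by linarith
  have [measurable]: "f \<in> borel_measurable borel" using f by (intro borel_measurable_continuous_onI) auto
  define P where "P k p \<longleftrightarrow> trig_poly p \<and> (\<forall>x\<in>cball 0 (real k). \<bar>f x - p x\<bar> < 1 / Suc k) \<and> (\<forall>x. \<bar>p x\<bar> < B + 1)"
    for k and p :: "real^'n \<Rightarrow> real"
  have "\<exists>p. P k p" for k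
  proof -
    obtain p where "trig_poly p" "\<forall>x\<in>cball 0 (real k). \<bar>f x - p x\<bar> < 1 / Suc k" "\<forall>x. \<bar>p x\<bar> < B + 1 / Suc k"
      using trig_poly_approx[of f B "cball 0 (real k)" "1 / Suc k"] f B by auto
    moreover have "B + 1 / Suc k \<le> B + 1" by simp
    ultimately show ?thesis unfolding P_def by (meson less_le_trans)
  qed
  then obtain p where P: "\<And>k. P k (p k)" by metis
  have tp: "trig_poly (p k)" and pB: "\<bar>p k x\<bar> \<le> B + 1" for k x
    using P[of k] by (auto simp: P_def less_imp_le)
  have [measurable]: "p k \<in> borel_measurable borel" for k
    by (intro borel_measurable_continuous_onI trig_poly_continuous tp)
  have fp: "\<bar>f x - p k x\<bar> < 1 / Suc k" if "norm x \<le> k" for x k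
    using P[of k] that by (auto simp: P_def dist_norm)
  have lim: "(\<lambda>k. p k x) \<longlonglongrightarrow> f x" for x
  proof (rule LIM_zero_cancel, rule Lim_null_comparison)
    show "eventually (\<lambda>k. norm (p k x - f x) \<le> 1 / Suc k) sequentially"
      using eventually_ge_at_top[of "nat \<lceil>norm x\<rceil>"]
      by eventually_elim (use fp in \<open>force simp: abs_minus_commute intro: less_imp_le\<close>)
    show "(\<lambda>k. 1 / real (Suc k)) \<longlonglongrightarrow> 0" using LIMSEQ_inverse_real_of_nat by (simp add: inverse_eq_divide)
  qed
  define G where "G h \<omega> = (\<integral>x. h x \<partial>gaussian_measure (S \<omega>))" for h :: "real^'n \<Rightarrow> real" and \<omega>
  have Gm [measurable]: "G (p k) \<in> borel_measurable M" for k
    unfolding G_def using gaussian_trig_convergence[OF Y S psd H char[OF H] tp] by auto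
  have Gl: "(\<lambda>k. G (p k) \<omega>) \<longlonglongrightarrow> G f \<omega>" and Gb: "\<And>k. \<bar>G (p k) \<omega>\<bar> \<le> B + 1" if "\<omega> \<in> space M" for \<omega>
  proof -
    interpret G: prob_space "gaussian_measure (S \<omega>)" by (rule prob_space_gaussian_measure[OF psd[OF that]])
    show "(\<lambda>k. G (p k) \<omega>) \<longlonglongrightarrow> G f \<omega>" unfolding G_def
      by (rule integral_dominated_convergence[where w = "\<lambda>_. B + 1"]) (auto simp: lim pB)
    show "\<bar>G (p k) \<omega>\<bar> \<le> B + 1" for k
    proof -
      have "\<bar>G (p k) \<omega>\<bar> \<le> (\<integral>x. \<bar>p k x\<bar> \<partial>gaussian_measure (S \<omega>))"
        unfolding G_def by (rule integral_abs_bound)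
      also have "\<dots> \<le> (\<integral>x. B + 1 \<partial>gaussian_measure (S \<omega>))"
        by (intro integral_mono G.integrable_const_bound[of _ "B + 1"]) (use B0 in \<open>auto simp: pB\<close>)
      finally show ?thesis by (simp add: G.prob_space[simplified])
    qed
  qed
  \<comment> \<open>Measurability in \<omega> for a general continuous \<open>f\<close> comes from
    the pointwise limit along \<open>p k\<close>.\<close>
  have Gfm [measurable]: "G f \<in> borel_measurable M"
    by (rule borel_measurable_LIMSEQ_real[of _ "\<lambda>k. G (p k)"]) (auto intro: Gl)
  have GfB: "\<bar>G f \<omega>\<bar> \<le> B + 1" if "\<omega> \<in> space M" for \<omega>
    by (rule Lim_bounded[OF tendsto_rabs[OF Gl[OF that]], of 0]) (use Gb[OF that] in auto)
  have c1: "(\<lambda>k. \<integral>\<omega>. indicator H \<omega> * G (p k) \<omega> \<partial>M) \<longlonglongrightarrow> (\<integral>\<omega>. indicator H \<omega> * G f \<omega> \<partial>M)"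
    by (rule integral_dominated_convergence[where w = "\<lambda>_. B + 1"])
       (use B0 in \<open>auto intro!: AE_I2 tendsto_intros Gl simp: Gb indicator_def\<close>)
  have C0: "C \<ge> 0"
  proof -
    from tight obtain n where "(\<integral>\<omega>. norm (Y n \<omega>) \<partial>M) \<le> C" by (auto simp: eventually_sequentially)
    moreover have "0 \<le> (\<integral>\<omega>. norm (Y n \<omega>) \<partial>M)" by simp
    ultimately show ?thesis by linarith
  qed
  have main: "(\<lambda>n. \<integral>\<omega>. indicator H \<omega> * f (Y n \<omega>) \<partial>M) \<longlonglongrightarrow> (\<integral>\<omega>. indicator H \<omega> * G f \<omega> \<partial>M)"
  proof (rule LIMSEQ_I)
    fix e :: real assume e: "0 < e"
    \<comment> \<open>The radius \<open>k\<close> is fixed before \<open>n\<close>: the replacement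
      error is made small uniformly in \<open>n\<close>, and only then the convergence for the
      single polynomial \<open>p k\<close> is used.\<close>
    have "(\<lambda>k. 1 / real (Suc k) + (2 * B + 1) * C / real k) \<longlonglongrightarrow> 0 + 0"
      using LIMSEQ_inverse_real_of_nat by (intro tendsto_add lim_const_over_n) (simp add: inverse_eq_divide)
    then have "eventually (\<lambda>k. 1 / real (Suc k) + (2 * B + 1) * C / real k < e / 3) sequentially"
      using e by (intro order_tendstoD) auto
    moreover have "eventually (\<lambda>k. \<bar>(\<integral>\<omega>. indicator H \<omega> * G (p k) \<omega> \<partial>M) - (\<integral>\<omega>. indicator H \<omega> * G f \<omega> \<partial>M)\<bar> < e / 3) sequentially"
      using tendstoD[OF c1, of "e / 3"] e by (simp add: dist_real_def)
    ultimately have "eventually (\<lambda>k. 1 / real (Suc k) + (2 * B + 1) * C / real k < e / 3 \<and>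
       \<bar>(\<integral>\<omega>. indicator H \<omega> * G (p k) \<omega> \<partial>M) - (\<integral>\<omega>. indicator H \<omega> * G f \<omega> \<partial>M)\<bar> < e / 3 \<and> k > 0) sequentially"
      using eventually_gt_at_top[of 0] by eventually_elim auto
    then obtain k where k: "1 / real (Suc k) + (2 * B + 1) * C / real k < e / 3"
       "\<bar>(\<integral>\<omega>. indicator H \<omega> * G (p k) \<omega> \<partial>M) - (\<integral>\<omega>. indicator H \<omega> * G f \<omega> \<partial>M)\<bar> < e / 3" "k > 0"
      by (auto simp: eventually_sequentially)
    have "(\<lambda>n. \<integral>\<omega>. indicator H \<omega> * p k (Y n \<omega>) \<partial>M) \<longlonglongrightarrow> (\<integral>\<omega>. indicator H \<omega> * G (p k) \<omega> \<partial>M)"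
      unfolding G_def using gaussian_trig_convergence[OF Y S psd H char[OF H] tp] by auto
    then have "eventually (\<lambda>n. \<bar>(\<integral>\<omega>. indicator H \<omega> * p k (Y n \<omega>) \<partial>M) - (\<integral>\<omega>. indicator H \<omega> * G (p k) \<omega> \<partial>M)\<bar> < e / 3) sequentially"
      using tendstoD[of _ _ _ "e / 3"] e by (force simp: dist_real_def)
    with tight have "eventually (\<lambda>n. \<bar>(\<integral>\<omega>. indicator H \<omega> * f (Y n \<omega>) \<partial>M) - (\<integral>\<omega>. indicator H \<omega> * G f \<omega> \<partial>M)\<bar> < e) sequentially"
    proof eventually_elim
      case (elim n)
      have i1: "integrable M (\<lambda>\<omega>. indicator H \<omega> * f (Y n \<omega>))"
        using B B0 by (intro integrable_const_bound[of _ B]) (auto simp: indicator_def)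
      have i2: "integrable M (\<lambda>\<omega>. indicator H \<omega> * p k (Y n \<omega>))"
        using pB B0 by (intro integrable_const_bound[of _ "B + 1"]) (auto simp: indicator_def)
      have pt: "\<bar>indicator H \<omega> * f (Y n \<omega>) - indicator H \<omega> * p k (Y n \<omega>)\<bar> \<le> 1 / Suc k + (2 * B + 1) / k * norm (Y n \<omega>)" for \<omega>
      proof -
        have "\<bar>f (Y n \<omega>) - p k (Y n \<omega>)\<bar> \<le> 1 / Suc k + (2 * B + 1) / k * norm (Y n \<omega>)"
        proof (cases "norm (Y n \<omega>) \<le> k")
          case True
          have "0 \<le> (2 * B + 1) / k * norm (Y n \<omega>)" using B0 by simp
          with fp[OF True] show ?thesis by linarith
        next
          case False
          \<comment> \<open>Markov's inequality in pointwise form: outside the ball the constant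
            \<open>2 * B + 1\<close> is at most \<open>(2 * B + 1) / k\<close> times the
            norm.\<close>
          have "\<bar>f (Y n \<omega>) - p k (Y n \<omega>)\<bar> \<le> 2 * B + 1"
            using B[of "Y n \<omega>"] pB[of k "Y n \<omega>"] by linarith
          also have "\<dots> \<le> (2 * B + 1) / k * norm (Y n \<omega>)"
          proof -
            have "(2 * B + 1) * k \<le> (2 * B + 1) * norm (Y n \<omega>)"
              using False B0 by (intro mult_left_mono) auto
            then show ?thesis using k(3) by (simp add: pos_le_divide_eq)
          qed
          finally show ?thesis by (simp add: add_increasing)
        qed
        moreover have "0 \<le> 1 / Suc k + (2 * B + 1) / k * norm (Y n \<omega>)" using B0 by simp
        ultimately show ?thesis by (simp add: indicator_def)
      qed
      have "\<bar>(\<integral>\<omega>. indicator H \<omega> * f (Y n \<omega>) \<partial>M) - (\<integral>\<omega>. indicator H \<omega> * p k (Y n \<omega>) \<partial>M)\<bar>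
         = \<bar>\<integral>\<omega>. indicator H \<omega> * f (Y n \<omega>) - indicator H \<omega> * p k (Y n \<omega>) \<partial>M\<bar>"
        using i1 i2 by simp
      also have "\<dots> \<le> (\<integral>\<omega>. \<bar>indicator H \<omega> * f (Y n \<omega>) - indicator H \<omega> * p k (Y n \<omega>)\<bar> \<partial>M)"
        by (rule integral_abs_bound)
      also have "\<dots> \<le> (\<integral>\<omega>. 1 / Suc k + (2 * B + 1) / k * norm (Y n \<omega>) \<partial>M)"
        using i1 i2 int[of n] pt by (intro integral_mono) auto
      also have "\<dots> = 1 / Suc k + (2 * B + 1) / k * (\<integral>\<omega>. norm (Y n \<omega>) \<partial>M)"
        using int[of n] by (simp add: prob_space)
      also have "\<dots> \<le> 1 / Suc k + (2 * B + 1) / k * C"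
        using elim(1) B0 by (intro add_mono mult_left_mono) auto
      also have "\<dots> < e / 3" using k(1) by simp
      finally show ?case using elim(2) k(2) by linarith
    qed
    then show "\<exists>no. \<forall>n\<ge>no. norm ((\<integral>\<omega>. indicator H \<omega> * f (Y n \<omega>) \<partial>M) - (\<integral>\<omega>. indicator H \<omega> * G f \<omega> \<partial>M)) < e"
      by (simp add: eventually_sequentially)
  qed
  show "(\<lambda>n. \<integral>\<omega>. f (Y n \<omega>) \<partial>uniform_measure M H) \<longlonglongrightarrow>
      (\<integral>\<omega>. (\<integral>x. f x \<partial>gaussian_measure (S \<omega>)) \<partial>uniform_measure M H)"
    using tendsto_divide[OF main tendsto_const[of "measure M H"]] pos H Gfm
    unfolding G_def by (simp add: integral_uniform_measure)
qed (use S psd in auto)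

end

section \<open>A stable central limit theorem for martingale arrays\<close>

context prob_space
begin

text \<open>Because of the bound on \<open>T n\<close>, exchanging \<open>h\<close> for
  \<open>s i\<close> changes the integrals by at most \<open>B\<close> times their \<open>L1\<close>
  distance, whatever \<open>n\<close> is.\<close>

lemma weak_null_L1_closed:
  fixes T :: "nat \<Rightarrow> 'a \<Rightarrow> real"
  assumes T: "\<And>n. T n \<in> borel_measurable M" "\<And>n \<omega>. \<omega> \<in> space M \<Longrightarrow> \<bar>T n \<omega>\<bar> \<le> B"
    and s: "\<And>i. integrable M (s i)" "\<And>i. (\<lambda>n. \<integral>\<omega>. s i \<omega> * T n \<omega> \<partial>M) \<longlonglongrightarrow> 0"
    and h: "integrable M h" and L1: "(\<lambda>i. \<integral>\<omega>. \<bar>s i \<omega> - h \<omega>\<bar> \<partial>M) \<longlonglongrightarrow> 0"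
  shows "(\<lambda>n. \<integral>\<omega>. h \<omega> * T n \<omega> \<partial>M) \<longlonglongrightarrow> 0"
proof (rule LIMSEQ_I)
  fix e :: real assume e: "0 < e"
  have int: "integrable M (\<lambda>\<omega>. g \<omega> * T n \<omega>)" if "integrable M g" for g n
  proof (rule Bochner_Integration.integrable_bound[OF integrable_mult_left[OF that, of B]])
    show "AE \<omega> in M. norm (g \<omega> * T n \<omega>) \<le> norm (g \<omega> * B)"
      using T(2) by (intro AE_I2) (simp add: abs_mult, meson mult_left_mono abs_ge_zero abs_ge_self order_trans)
  qed (use T(1) that in auto)
  have B0: "B \<ge> 0" using T(2) not_empty by (metis abs_ge_zero all_not_in_conv order_trans)
  have "eventually (\<lambda>i. (\<integral>\<omega>. \<bar>s i \<omega> - h \<omega>\<bar> \<partial>M) < e / (2 * (B + 1))) sequentially"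
    using e B0 by (intro order_tendstoD[OF L1]) auto
  then obtain i where i: "(\<integral>\<omega>. \<bar>s i \<omega> - h \<omega>\<bar> \<partial>M) < e / (2 * (B + 1))" by (auto simp: eventually_sequentially)
  from LIMSEQ_D[OF s(2)[of i], of "e / 2"] e obtain N where N: "\<And>n. n \<ge> N \<Longrightarrow> \<bar>\<integral>\<omega>. s i \<omega> * T n \<omega> \<partial>M\<bar> < e / 2" by auto
  have "\<bar>\<integral>\<omega>. h \<omega> * T n \<omega> \<partial>M\<bar> < e" if "n \<ge> N" for n
  proof -
    have "\<bar>(\<integral>\<omega>. s i \<omega> * T n \<omega> \<partial>M) - (\<integral>\<omega>. h \<omega> * T n \<omega> \<partial>M)\<bar> = \<bar>\<integral>\<omega>. s i \<omega> * T n \<omega> - h \<omega> * T n \<omega> \<partial>M\<bar>"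
      using int[OF s(1)] int[OF h] by simp
    also have "\<dots> \<le> (\<integral>\<omega>. \<bar>s i \<omega> * T n \<omega> - h \<omega> * T n \<omega>\<bar> \<partial>M)" by (rule integral_abs_bound)
    also have "\<dots> \<le> (\<integral>\<omega>. \<bar>s i \<omega> - h \<omega>\<bar> * B \<partial>M)"
    proof (rule integral_mono)
      fix \<omega> assume "\<omega> \<in> space M"
      then show "\<bar>s i \<omega> * T n \<omega> - h \<omega> * T n \<omega>\<bar> \<le> \<bar>s i \<omega> - h \<omega>\<bar> * B"
        using T(2) by (simp add: left_diff_distrib[symmetric] abs_mult mult_left_mono)
    qed (use int[OF s(1)] int[OF h] s(1) h in auto)
    also have "\<dots> = (\<integral>\<omega>. \<bar>s i \<omega> - h \<omega>\<bar> \<partial>M) * B" by simp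
    also have "\<dots> \<le> (\<integral>\<omega>. \<bar>s i \<omega> - h \<omega>\<bar> \<partial>M) * (B + 1)" using B0 by (intro mult_left_mono) auto
    also have "\<dots> < e / 2" using i B0 by (simp add: field_simps)
    finally show ?thesis using N[OF that] by linarith
  qed
  then show "\<exists>N. \<forall>n\<ge>N. norm ((\<integral>\<omega>. h \<omega> * T n \<omega> \<partial>M) - 0) < e" by auto
qed

text \<open>Let \<open>Fi\<close> be generated by all the \<open>F m\<close>. A monotone class
  argument passes from the events of the filtration to those of \<open>Fi\<close>, and
  \<open>L1\<close> limits pass from simple functions to all \<open>Fi\<close>-integrable ones. A
  general \<open>h\<close> is reduced to its conditional expectation, because every
  \<open>T n\<close> is \<open>Fi\<close>-measurable.\<close>

lemma weak_null_extend:
  fixes T :: "nat \<Rightarrow> 'a \<Rightarrow> real" and F :: "nat \<Rightarrow> 'a measure"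
  assumes F: "\<And>m. subalgebra M (F m)" and mono: "\<And>m. sets (F m) \<subseteq> sets (F (Suc m))"
    and T: "\<And>n. T n \<in> borel_measurable (F (K n))" "\<And>n \<omega>. \<omega> \<in> space M \<Longrightarrow> \<bar>T n \<omega>\<bar> \<le> B"
    and lim: "\<And>m A. A \<in> sets (F m) \<Longrightarrow> (\<lambda>n. \<integral>\<omega>. indicator A \<omega> * T n \<omega> \<partial>M) \<longlonglongrightarrow> 0"
    and h: "integrable M h"
  shows "(\<lambda>n. \<integral>\<omega>. h \<omega> * T n \<omega> \<partial>M) \<longlonglongrightarrow> 0"
proof -
  define U where "U = (\<Union>m. sets (F m))"
  define Fi where "Fi = sigma (space M) U"
  have sp: "space (F m) = space M" and sub: "sets (F m) \<subseteq> sets M" for m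
    using F by (auto simp: subalgebra_def)
  have UP: "U \<subseteq> Pow (space M)" unfolding U_def using sets.sets_into_space sp by fastforce
  have sFi: "sets Fi = sigma_sets (space M) U" "space Fi = space M"
    using UP by (auto simp: Fi_def sets_measure_of space_measure_of)
  have subalg: "subalgebra M Fi"
    unfolding subalgebra_def sFi using sub by (auto simp: U_def intro!: sets.sigma_sets_subset)
  have FFi: "subalgebra Fi (F m)" for m
    unfolding subalgebra_def sFi by (auto simp: sp U_def)
  have Tm [measurable]: "T n \<in> borel_measurable M" for n
    by (rule measurable_from_subalg[OF F T(1)])
  have TFi: "T n \<in> borel_measurable Fi" for n by (rule measurable_from_subalg[OF FFi T(1)])
  have int: "integrable M (\<lambda>\<omega>. g \<omega> * T n \<omega>)" if "integrable M g" for g n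
  proof (rule Bochner_Integration.integrable_bound[OF integrable_mult_left[OF that, of B]])
    show "AE \<omega> in M. norm (g \<omega> * T n \<omega>) \<le> norm (g \<omega> * B)"
      using T(2) by (intro AE_I2) (simp add: abs_mult, meson mult_left_mono abs_ge_zero abs_ge_self order_trans)
  qed (use that in auto)
  note closed = weak_null_L1_closed[of T B, OF Tm T(2)]
  \<comment> \<open>The filtration increases, so two events of the union already lie in one common
    \<open>F m\<close>.\<close>
  have stable: "Int_stable U"
  proof (rule Int_stableI)
    fix A A' assume "A \<in> U" "A' \<in> U"
    then obtain m m' where "A \<in> sets (F m)" "A' \<in> sets (F m')" by (auto simp: U_def)
    then have "A \<in> sets (F (max m m'))" "A' \<in> sets (F (max m m'))"
      using lift_Suc_mono_le[of "\<lambda>m. sets (F m)", OF mono] by (meson max.cobounded1 max.cobounded2 subsetD)+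
    then show "A \<inter> A' \<in> U" by (auto simp: U_def)
  qed
  have one: "(\<lambda>n. \<integral>\<omega>. indicator (space M) \<omega> * T n \<omega> \<partial>M) \<longlonglongrightarrow> 0"
    using lim[of "space M" 0] sets.top[of "F 0"] by (simp add: sp)
  have ind: "(\<lambda>n. \<integral>\<omega>. indicator A \<omega> * T n \<omega> \<partial>M) \<longlonglongrightarrow> 0" if "A \<in> sets Fi" for A
    using stable UP that[unfolded sFi]
  proof (induction A rule: sigma_sets_induct_disjoint)
    case (basic A)
    then show ?case using lim by (auto simp: U_def)
  next
    case empty
    show ?case by simp
  next
    case (compl A)
    then have A: "A \<in> sets M" using subalg sFi by (auto simp: subalgebra_def)
    have "(\<integral>\<omega>. indicator (space M - A) \<omega> * T n \<omega> \<partial>M) =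
       (\<integral>\<omega>. indicator (space M) \<omega> * T n \<omega> \<partial>M) - (\<integral>\<omega>. indicator A \<omega> * T n \<omega> \<partial>M)" for n
    proof -
      have "(\<integral>\<omega>. indicator (space M) \<omega> * T n \<omega> \<partial>M) - (\<integral>\<omega>. indicator A \<omega> * T n \<omega> \<partial>M) =
         (\<integral>\<omega>. indicator (space M) \<omega> * T n \<omega> - indicator A \<omega> * T n \<omega> \<partial>M)"
        by (rule Bochner_Integration.integral_diff[symmetric]) (use A in \<open>auto intro!: int simp: less_top[symmetric]\<close>)
      also have "\<dots> = (\<integral>\<omega>. indicator (space M - A) \<omega> * T n \<omega> \<partial>M)"
        by (intro Bochner_Integration.integral_cong) (auto simp: indicator_def)
      finally show ?thesis by simp
    qed
    with tendsto_diff[OF one compl.IH] show ?case by (simp only: diff_self)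
  next
    case (union A)
    then have A [measurable]: "A i \<in> sets M" for i
      using subalg unfolding subalgebra_def sFi(1) by blast
    \<comment> \<open>Finite partial unions approximate the countable union in \<open>L1\<close>, by
      dominated convergence.\<close>
    define s where "s i = (indicator (\<Union>j<i. A j) :: 'a \<Rightarrow> real)" for i :: nat
    have dis: "indicator (\<Union>j<Suc i. A j) \<omega> = indicator (\<Union>j<i. A j) \<omega> + (indicator (A i) \<omega> :: real)" for i \<omega>
    proof -
      have dij: "A j \<inter> A i = {}" if "j < i" for j
        using disjoint_family_onD[OF union.hyps(1), of j i] that by simp
      have "(\<Union>j<i. A j) \<inter> A i = {}" using dij by blast
      moreover have "(\<Union>j<Suc i. A j) = (\<Union>j<i. A j) \<union> A i" by (auto simp: less_Suc_eq)
      ultimately show ?thesis by (simp add: indicator_add[symmetric] Int_commute)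
    qed
    have si: "integrable M (s i)" for i unfolding s_def by (simp add: less_top[symmetric])
    have "(\<lambda>n. \<integral>\<omega>. s i \<omega> * T n \<omega> \<partial>M) \<longlonglongrightarrow> 0" for i
    proof (induction i)
      case 0 show ?case by (simp add: s_def)
    next
      case (Suc i)
      have "(\<integral>\<omega>. s (Suc i) \<omega> * T n \<omega> \<partial>M) = (\<integral>\<omega>. s i \<omega> * T n \<omega> \<partial>M) + (\<integral>\<omega>. indicator (A i) \<omega> * T n \<omega> \<partial>M)" for n
        unfolding s_def dis distrib_right
        by (rule Bochner_Integration.integral_add) (auto intro!: int simp: less_top[symmetric])
      with tendsto_add[OF Suc union.IH[of i]] show ?case by (simp only: add_0_left)
    qed
    moreover have "(\<lambda>i. \<integral>\<omega>. \<bar>s i \<omega> - indicator (\<Union>i. A i) \<omega>\<bar> \<partial>M) \<longlonglongrightarrow> (\<integral>\<omega>. 0 \<partial>M)"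
    proof (rule integral_dominated_convergence[where w = "\<lambda>_. 1"])
      show "AE \<omega> in M. (\<lambda>i. \<bar>s i \<omega> - indicator (\<Union>i. A i) \<omega>\<bar>) \<longlonglongrightarrow> 0"
      proof (intro AE_I2, rule tendsto_eventually)
        fix \<omega>
        show "eventually (\<lambda>i. \<bar>s i \<omega> - indicator (\<Union>i. A i) \<omega>\<bar> = 0) sequentially"
        proof (cases "\<omega> \<in> (\<Union>i. A i)")
          case True
          then obtain k where "\<omega> \<in> A k" by blast
          then show ?thesis by (intro eventually_mono[OF eventually_gt_at_top[of k]]) (auto simp: s_def indicator_def)
        qed (auto simp: s_def indicator_def)
      qed
      show "(\<lambda>\<omega>. \<bar>s i \<omega> - indicator (\<Union>i. A i) \<omega>\<bar>) \<in> borel_measurable M" for i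
        unfolding s_def by measurable
      show "AE \<omega> in M. norm \<bar>s i \<omega> - indicator (\<Union>i. A i) \<omega>\<bar> \<le> 1" for i
        unfolding s_def by (intro AE_I2) (simp add: indicator_def)
    qed simp_all
    ultimately show ?case
      using si by (rule_tac closed[of s]) (simp_all add: less_top[symmetric])
  qed
  interpret S: finite_measure_subalgebra M Fi by unfold_locales (rule subalg)
  have good: "(\<lambda>n. \<integral>\<omega>. g \<omega> * T n \<omega> \<partial>M) \<longlonglongrightarrow> 0" if "integrable (restr_to_subalg M Fi) g" for g :: "'a \<Rightarrow> real"
    using that
  proof (induction g rule: integrable_induct)
    case (base A c)
    then have "A \<in> sets Fi" using sets_restr_to_subalg[OF subalg] by simp
    from tendsto_mult_left[OF ind[OF this], of c]
    show ?case by (simp add: algebra_simps)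
  next
    case (add f g)
    have fg: "integrable M f" "integrable M g"
      using add.hyps by (auto intro: integrable_from_subalg[OF subalg])
    have "(\<integral>\<omega>. (f \<omega> + g \<omega>) * T n \<omega> \<partial>M) = (\<integral>\<omega>. f \<omega> * T n \<omega> \<partial>M) + (\<integral>\<omega>. g \<omega> * T n \<omega> \<partial>M)" for n
      unfolding distrib_right by (intro Bochner_Integration.integral_add int fg)
    with tendsto_add[OF add.IH] show ?case by (simp only: add_0_left)
  next
    case (lim f s)
    have sM: "integrable M (s i)" "integrable M f" for i
      using lim.hyps by (auto intro: integrable_from_subalg[OF subalg])
    have sl: "(\<lambda>i. s i \<omega>) \<longlonglongrightarrow> f \<omega>" and sb: "\<bar>s i \<omega>\<bar> \<le> 2 * \<bar>f \<omega>\<bar>" if "\<omega> \<in> space M" for \<omega> i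
      using lim.hyps(2)[of \<omega>] lim.hyps(3)[of \<omega> i] that by (simp_all add: space_restr_to_subalg)
    have "(\<lambda>i. \<integral>\<omega>. \<bar>s i \<omega> - f \<omega>\<bar> \<partial>M) \<longlonglongrightarrow> (\<integral>\<omega>. 0 \<partial>M)"
    proof (rule integral_dominated_convergence[where w = "\<lambda>\<omega>. 3 * \<bar>f \<omega>\<bar>"])
      show "AE \<omega> in M. (\<lambda>i. \<bar>s i \<omega> - f \<omega>\<bar>) \<longlonglongrightarrow> 0"
        using sl by (intro AE_I2 tendsto_rabs_zero LIM_zero)
      show "AE \<omega> in M. norm \<bar>s i \<omega> - f \<omega>\<bar> \<le> 3 * \<bar>f \<omega>\<bar>" for i
      proof (intro AE_I2)
        fix \<omega> assume "\<omega> \<in> space M"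
        from sb[OF this, of i] show "norm \<bar>s i \<omega> - f \<omega>\<bar> \<le> 3 * \<bar>f \<omega>\<bar>" by simp
      qed
      show "integrable M (\<lambda>\<omega>. 3 * \<bar>f \<omega>\<bar>)" using sM(2) by simp
      show "(\<lambda>\<omega>. \<bar>s i \<omega> - f \<omega>\<bar>) \<in> borel_measurable M" for i
        using sM by measurable
    qed simp
    then show ?case by (rule_tac closed[of s, OF _ sM(1) lim.IH sM(2)]) simp_all
  qed
  have hm: "h \<in> borel_measurable M" using h by simp
  \<comment> \<open>Against the \<open>Fi\<close>-measurable functions \<open>T n\<close>, the
    function \<open>h\<close> and its conditional expectation have the same integrals.\<close>
  have "integrable (restr_to_subalg M Fi) (real_cond_exp M Fi h)"
    by (rule integrable_in_subalg[OF subalg borel_measurable_cond_exp S.real_cond_exp_int(1)[OF h]])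
  note good[OF this]
  moreover have "(\<integral>\<omega>. real_cond_exp M Fi h \<omega> * T n \<omega> \<partial>M) = (\<integral>\<omega>. h \<omega> * T n \<omega> \<partial>M)" for n
    using S.real_cond_exp_intg(2)[OF _ TFi hm, of n] int[OF h, of n] by (simp only: mult.commute[of "T n _"])
  ultimately show ?thesis by simp
qed

end

section \<open>Elementary estimates behind McLeish's approximation\<close>

lemma exp_minus_approx: "0 \<le> (y::real) \<Longrightarrow> \<bar>exp (- y) - (1 - y)\<bar> \<le> y\<^sup>2 / 2"
proof -
  assume y: "0 \<le> y"
  have 1: "1 - y \<le> exp (- y)" using exp_ge_add_one_self[of "- y"] by simp
  have "exp (- y) \<le> 1 - y + y\<^sup>2 / 2"
  proof -
    have "(\<lambda>t. 1 - t + t\<^sup>2 / 2 - exp (- t)) 0 \<le> (\<lambda>t. 1 - t + t\<^sup>2 / 2 - exp (- t)) y"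
    proof (rule DERIV_nonneg_imp_nondecreasing[OF y], intro exI conjI)
      fix t :: real
      show "((\<lambda>t. 1 - t + t\<^sup>2 / 2 - exp (- t)) has_real_derivative (- 1 + t + exp (- t))) (at t)"
        by (auto intro!: derivative_eq_intros)
      show "0 \<le> - 1 + t + exp (- t)" using exp_ge_add_one_self[of "- t"] by simp
    qed
    then show ?thesis by simp
  qed
  with 1 show ?thesis by simp
qed

text \<open>All three rest on \<open>norm (1 + i x) = sqrt (1 + x^2)\<close>, which is at most
  \<open>exp (x^2 / 2)\<close>. That the approximant has norm at most 1 is what later allows
  products to be compared factor by factor; the third bound controls the products of the factors
  \<open>1 + i x\<close> alone.\<close>

lemma iexp_mcleish_approx: "norm (iexp x - (1 + \<i> * of_real x) * of_real (exp (- (x\<^sup>2) / 2))) \<le> 2 * \<bar>x\<bar> ^ 3"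
  and one_plus_mcleish_le: "norm ((1 + \<i> * of_real x) * of_real (exp (- (x\<^sup>2) / 2))) \<le> 1"
  and one_plus_ix_le: "norm (1 + \<i> * of_real x) \<le> exp (x\<^sup>2 / 2)"
proof -
  have n: "norm (1 + \<i> * of_real x) = sqrt (1 + x\<^sup>2)" by (simp add: cmod_def)
  have "sqrt (1 + x\<^sup>2) \<le> sqrt (exp (x\<^sup>2))" using exp_ge_add_one_self[of "x\<^sup>2"] by simp
  also have "sqrt (exp (x\<^sup>2)) = exp (x\<^sup>2 / 2)"
    by (rule real_sqrt_unique) (auto simp: exp_double[symmetric])
  finally show a: "norm (1 + \<i> * of_real x) \<le> exp (x\<^sup>2 / 2)" using n by simp
  then have "norm (1 + \<i> * of_real x) * exp (- (x\<^sup>2) / 2) \<le> exp (x\<^sup>2 / 2) * exp (- (x\<^sup>2) / 2)"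
    by (intro mult_right_mono) auto
  then show b: "norm ((1 + \<i> * of_real x) * of_real (exp (- (x\<^sup>2) / 2))) \<le> 1"
    unfolding norm_mult norm_of_real abs_exp_cancel by (simp add: exp_add[symmetric])
  show "norm (iexp x - (1 + \<i> * of_real x) * of_real (exp (- (x\<^sup>2) / 2))) \<le> 2 * \<bar>x\<bar> ^ 3"
  proof (cases "\<bar>x\<bar> \<le> 1")
    case False
    \<comment> \<open>For large \<open>x\<close> the estimate is trivial since both terms have norm
      at most 1; this case fixes the constant 2.\<close>
    then have "1 \<le> \<bar>x\<bar> ^ 3" by (intro one_le_power) simp
    moreover have "norm (iexp x - (1 + \<i> * of_real x) * of_real (exp (- (x\<^sup>2) / 2))) \<le> 1 + 1"
      by (rule order_trans[OF norm_triangle_ineq4]) (intro add_mono b, simp)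
    ultimately show ?thesis by simp
  next
    case True
    have "norm (iexp x - (\<Sum>k\<le>2. (\<i> * x) ^ k / fact k)) \<le> \<bar>x\<bar> ^ Suc 2 / fact (Suc 2)"
      by (rule iexp_approx1)
    also have "(\<Sum>k\<le>2. (\<i> * x) ^ k / fact k) = 1 + \<i> * of_real x - of_real (x\<^sup>2 / 2)"
      by (simp add: numeral_2_eq_2 power_mult_distrib)
    finally have 1: "norm (iexp x - (1 + \<i> * of_real x - of_real (x\<^sup>2 / 2))) \<le> \<bar>x\<bar> ^ 3 / 6"
      by (simp add: numeral_3_eq_3 fact_numeral)
    have "norm ((1 + \<i> * of_real x - of_real (x\<^sup>2 / 2)) - (1 + \<i> * of_real x) * of_real (1 - x\<^sup>2 / 2)) = norm (\<i> * of_real (x ^ 3 / 2))"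
      by (rule arg_cong[where f = norm]) (simp add: field_simps power2_eq_square power3_eq_cube)
    then have 2: "norm ((1 + \<i> * of_real x - of_real (x\<^sup>2 / 2)) - (1 + \<i> * of_real x) * of_real (1 - x\<^sup>2 / 2)) \<le> \<bar>x\<bar> ^ 3 / 2"
      by (simp add: norm_mult norm_power power_abs)
    have "norm ((1 + \<i> * of_real x) * of_real (1 - x\<^sup>2 / 2) - (1 + \<i> * of_real x) * of_real (exp (- (x\<^sup>2) / 2)))
       = norm (1 + \<i> * of_real x) * \<bar>exp (- (x\<^sup>2 / 2)) - (1 - x\<^sup>2 / 2)\<bar>"
      unfolding right_diff_distrib[symmetric] norm_mult of_real_diff[symmetric] norm_of_real by (simp add: abs_minus_commute)
    also have "\<dots> \<le> 2 * ((x\<^sup>2 / 2)\<^sup>2 / 2)"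
    proof (rule mult_mono)
      have "norm (1 + \<i> * of_real x) \<le> norm (1::complex) + norm (\<i> * of_real x)" by (rule norm_triangle_ineq)
      then show "norm (1 + \<i> * of_real x) \<le> 2" using True by (simp add: norm_mult)
    qed (use exp_minus_approx[of "x\<^sup>2 / 2"] in auto)
    also have "\<dots> = \<bar>x\<bar> ^ 3 * \<bar>x\<bar> / 4"
    proof -
      have "(x\<^sup>2)\<^sup>2 = \<bar>x\<bar> ^ 4" by (simp add: power_mult[symmetric])
      also have "\<dots> = \<bar>x\<bar> ^ 3 * \<bar>x\<bar>" by (simp add: eval_nat_numeral)
      finally show ?thesis by (simp add: power_divide)
    qed
    also have "\<dots> \<le> \<bar>x\<bar> ^ 3 * 1 / 4" using True by (intro divide_right_mono mult_left_mono) auto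
    finally have 3: "norm ((1 + \<i> * of_real x) * of_real (1 - x\<^sup>2 / 2) - (1 + \<i> * of_real x) * of_real (exp (- (x\<^sup>2) / 2))) \<le> \<bar>x\<bar> ^ 3 / 4"
      by simp
    \<comment> \<open>Three errors add up: Taylor expansion to second order, factoring out
      \<open>1 + i x\<close>, and replacing \<open>1 - x^2 / 2\<close> by the exponential. Their sum
      11/12 is well below 2.\<close>
    have "norm (iexp x - (1 + \<i> * of_real x) * of_real (exp (- (x\<^sup>2) / 2))) \<le> \<bar>x\<bar> ^ 3 / 6 + (\<bar>x\<bar> ^ 3 / 2 + \<bar>x\<bar> ^ 3 / 4)"
      by (rule norm_diff_triangle_le[OF 1 norm_diff_triangle_le[OF 2 3]])
    also have "\<dots> \<le> 2 * \<bar>x\<bar> ^ 3" by simp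
    finally show ?thesis .
  qed
qed

lemma (in prob_space) expectation_abs_le_sqrt:
  fixes f :: "'a \<Rightarrow> real"
  assumes "integrable M f" "integrable M (\<lambda>\<omega>. (f \<omega>)\<^sup>2)"
  shows "(\<integral>\<omega>. \<bar>f \<omega>\<bar> \<partial>M) \<le> sqrt (\<integral>\<omega>. (f \<omega>)\<^sup>2 \<partial>M)"
proof -
  have "0 \<le> variance (\<lambda>\<omega>. \<bar>f \<omega>\<bar>)" by (rule variance_positive)
  also have "variance (\<lambda>\<omega>. \<bar>f \<omega>\<bar>) = (\<integral>\<omega>. (f \<omega>)\<^sup>2 \<partial>M) - (\<integral>\<omega>. \<bar>f \<omega>\<bar> \<partial>M)\<^sup>2"
    by (subst variance_eq) (use assms in auto)
  finally show ?thesis by (intro real_le_rsqrt) simp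
qed

text \<open>The conditional mean and variance are expressed by integrals against bounded
  \<open>F k\<close>-measurable functions, the form in which they are applied, so no version of a
  conditional expectation has to be chosen. The deterministic bounds \<open>b\<close> play the part
  of a Lindeberg condition: bounded sums of squares and vanishing sums of fourth powers.\<close>

locale martingale_array = prob_space M
  for M :: "'a measure" +
  fixes F :: "nat \<Rightarrow> 'a measure" and K :: "nat \<Rightarrow> nat"
    and x v :: "nat \<Rightarrow> nat \<Rightarrow> 'a \<Rightarrow> real" and b :: "nat \<Rightarrow> nat \<Rightarrow> real" and Q :: real
  assumes F: "\<And>m. subalgebra M (F m)" and F_mono: "\<And>m. sets (F m) \<subseteq> sets (F (Suc m))"
    and K: "filterlim K at_top sequentially"
    and x_meas: "\<And>n k. x n k \<in> borel_measurable (F (Suc k))"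
    and v_meas: "\<And>n k. v n k \<in> borel_measurable (F k)"
    and x_bound: "\<And>n k \<omega>. \<omega> \<in> space M \<Longrightarrow> \<bar>x n k \<omega>\<bar> \<le> b n k"
    and v_bound: "\<And>n k \<omega>. \<omega> \<in> space M \<Longrightarrow> 0 \<le> v n k \<omega> \<and> v n k \<omega> \<le> (b n k)\<^sup>2"
    and x_mean: "\<And>n k G. G \<in> borel_measurable (F k) \<Longrightarrow> (\<exists>B. \<forall>\<omega>\<in>space M. \<bar>G \<omega>\<bar> \<le> B) \<Longrightarrow>
        (\<integral>\<omega>. G \<omega> * x n k \<omega> \<partial>M) = 0"
    and x_var: "\<And>n k G. G \<in> borel_measurable (F k) \<Longrightarrow> (\<exists>B. \<forall>\<omega>\<in>space M. \<bar>G \<omega>\<bar> \<le> B) \<Longrightarrow>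
        (\<integral>\<omega>. G \<omega> * (x n k \<omega>)\<^sup>2 \<partial>M) = (\<integral>\<omega>. G \<omega> * v n k \<omega> \<partial>M)"
    and b2: "\<And>n. (\<Sum>k<K n. (b n k)\<^sup>2) \<le> Q"
    and b4: "(\<lambda>n. \<Sum>k<K n. (b n k) ^ 4) \<longlonglongrightarrow> 0"
begin

lemma F_le: "k \<le> l \<Longrightarrow> subalgebra (F l) (F k)"
  using F lift_Suc_mono_le[of "\<lambda>m. sets (F m)", OF F_mono] by (auto simp: subalgebra_def)

lemma b_nonneg: "0 \<le> b n k"
  using x_bound not_empty by (metis abs_ge_zero all_not_in_conv order_trans)

lemma Q_nonneg: "0 \<le> Q" using b2[of 0] by (meson order_trans sum_nonneg zero_le_power2)

lemma xM [measurable]: "x n k \<in> borel_measurable M"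
  and vM [measurable]: "v n k \<in> borel_measurable M"
  using measurable_from_subalg[OF F x_meas] measurable_from_subalg[OF F v_meas] by auto

lemma bounded_integrable:
  fixes f :: "'a \<Rightarrow> 'b::{banach,second_countable_topology}"
  shows "f \<in> borel_measurable M \<Longrightarrow> (\<And>\<omega>. \<omega> \<in> space M \<Longrightarrow> norm (f \<omega>) \<le> B) \<Longrightarrow> integrable M f"
  by (rule integrable_const_bound[of _ B]) auto

text \<open>A fixed column is eventually one term of the vanishing sum of fourth powers.
  Consequently any fixed initial block of the array is negligible.\<close>

lemma b_tendsto_0: "(\<lambda>n. b n k) \<longlonglongrightarrow> 0"
proof -
  have "(\<lambda>n. b n k ^ 4) \<longlonglongrightarrow> 0"
  proof (rule Lim_null_comparison[OF _ b4])
    from K have "eventually (\<lambda>n. Suc k \<le> K n) sequentially"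
      unfolding filterlim_at_top by blast
    then show "eventually (\<lambda>n. norm (b n k ^ 4) \<le> (\<Sum>k<K n. b n k ^ 4)) sequentially"
    proof eventually_elim
      case (elim n)
      then have "b n k ^ 4 \<le> (\<Sum>k<K n. b n k ^ 4)"
        by (intro member_le_sum[of k "{..<K n}" "\<lambda>k. b n k ^ 4"]) auto
      then show ?case by simp
    qed
  qed
  then have "(\<lambda>n. sqrt (sqrt (b n k ^ 4))) \<longlonglongrightarrow> sqrt (sqrt 0)" by (intro tendsto_real_sqrt)
  moreover have "sqrt (sqrt (b n k ^ 4)) = b n k" for n
  proof -
    have "b n k ^ 4 = ((b n k)\<^sup>2)\<^sup>2" by simp
    then show ?thesis using b_nonneg[of n k] by (simp only: real_sqrt_abs abs_power2 abs_of_nonneg)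
  qed
  ultimately show ?thesis by simp
qed

text \<open>The conditional mean zero property makes \<^term>\<open>\<lambda>m. T n m\<close> a martingale, and \<open>b2\<close> bounds it
  by a constant up to time \<^term>\<open>K n\<close>.\<close>

definition T :: "nat \<Rightarrow> nat \<Rightarrow> 'a \<Rightarrow> complex" where
  "T n m \<omega> = (\<Prod>k<m. 1 + \<i> * of_real (x n k \<omega>))"

lemma T_meas: "T n m \<in> borel_measurable (F m)"
proof -
  have "x n k \<in> borel_measurable (F m)" if "k < m" for k
    using measurable_from_subalg[OF F_le x_meas] that by (meson Suc_leI)
  then show ?thesis unfolding T_def by (intro borel_measurable_prod) auto
qed

lemma T_bound_gen:
  assumes "\<omega> \<in> space M"
  shows "norm (T n m \<omega>) \<le> exp ((\<Sum>k<m. (b n k)\<^sup>2) / 2)"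
proof -
  have "norm (T n m \<omega>) = (\<Prod>k<m. norm (1 + \<i> * of_real (x n k \<omega>)))" by (simp add: T_def prod_norm)
  also have "\<dots> \<le> (\<Prod>k<m. exp ((b n k)\<^sup>2 / 2))"
  proof (rule prod_mono)
    fix k
    have "norm (1 + \<i> * of_real (x n k \<omega>)) \<le> exp ((x n k \<omega>)\<^sup>2 / 2)" by (rule one_plus_ix_le)
    also have "\<dots> \<le> exp ((b n k)\<^sup>2 / 2)"
      using x_bound[OF assms, of n k] by (simp add: abs_le_square_iff[symmetric] b_nonneg)
    finally show "0 \<le> norm (1 + \<i> * of_real (x n k \<omega>)) \<and> norm (1 + \<i> * of_real (x n k \<omega>)) \<le> exp ((b n k)\<^sup>2 / 2)"
      by simp
  qed
  also have "\<dots> = exp ((\<Sum>k<m. (b n k)\<^sup>2) / 2)" by (simp add: exp_sum sum_divide_distrib)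
  finally show ?thesis .
qed

lemma T_bound:
  assumes "\<omega> \<in> space M" "m \<le> K n"
  shows "norm (T n m \<omega>) \<le> exp (Q / 2)"
proof -
  have "(\<Sum>k<m. (b n k)\<^sup>2) \<le> (\<Sum>k<K n. (b n k)\<^sup>2)" using assms(2) by (intro sum_mono2) auto
  also have "\<dots> \<le> Q" by (rule b2)
  finally show ?thesis using T_bound_gen[OF assms(1), of n m] by (meson order_trans exp_le_cancel_iff divide_right_mono zero_le_numeral)
qed

lemma T_measM [measurable]: "T n m \<in> borel_measurable M"
  by (rule measurable_from_subalg[OF F T_meas])

text \<open>The new factor adds \<open>i x\<close> times an \<open>F m\<close>-measurable bounded
  function, and \<open>x_mean\<close> removes this term, applied to real and imaginary parts
  separately.\<close>

lemma T_step:
  assumes A: "A \<in> sets (F m)" and m: "m < K n"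
  shows "(\<integral>\<omega>. indicator A \<omega> *\<^sub>R T n (Suc m) \<omega> \<partial>M) = (\<integral>\<omega>. indicator A \<omega> *\<^sub>R T n m \<omega> \<partial>M)"
proof -
  have AM [measurable]: "A \<in> sets M" using A F by (auto simp: subalgebra_def)
  have bd: "norm (indicator A \<omega> *\<^sub>R T n m \<omega>) \<le> exp (Q / 2)" if "\<omega> \<in> space M" for \<omega>
    using T_bound[OF that less_imp_le[OF m]] by (simp add: indicator_def)
  have bdx: "norm ((indicator A \<omega> *\<^sub>R T n m \<omega>) * of_real (x n m \<omega>)) \<le> exp (Q / 2) * b n m" if "\<omega> \<in> space M" for \<omega>
    unfolding norm_mult by (intro mult_mono bd that) (use x_bound[OF that] in auto)
  have ix: "integrable M (\<lambda>\<omega>. (indicator A \<omega> *\<^sub>R T n m \<omega>) * of_real (x n m \<omega>))"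
    by (rule bounded_integrable[OF _ bdx]) auto
  have iT: "integrable M (\<lambda>\<omega>. indicator A \<omega> *\<^sub>R T n m \<omega>)"
    by (rule bounded_integrable[OF _ bd]) auto
  have mT [measurable]: "(\<lambda>\<omega>. indicator A \<omega> *\<^sub>R T n m \<omega>) \<in> borel_measurable (F m)"
    using A T_meas by (intro borel_measurable_scaleR) auto
  have bRe: "\<exists>B. \<forall>\<omega>\<in>space M. \<bar>Re (indicator A \<omega> *\<^sub>R T n m \<omega>)\<bar> \<le> B"
    using bd abs_Re_le_cmod order_trans by blast
  have bIm: "\<exists>B. \<forall>\<omega>\<in>space M. \<bar>Im (indicator A \<omega> *\<^sub>R T n m \<omega>)\<bar> \<le> B"
    using bd abs_Im_le_cmod order_trans by blast
  have "(\<integral>\<omega>. (indicator A \<omega> *\<^sub>R T n m \<omega>) * of_real (x n m \<omega>) \<partial>M) = 0"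
  proof (rule complex_eqI)
    have "Re (\<integral>\<omega>. (indicator A \<omega> *\<^sub>R T n m \<omega>) * of_real (x n m \<omega>) \<partial>M) = (\<integral>\<omega>. Re (indicator A \<omega> *\<^sub>R T n m \<omega>) * x n m \<omega> \<partial>M)"
      by (subst integral_Re[OF ix, symmetric]) (simp add: mult.assoc)
    also have "\<dots> = 0" by (rule x_mean[OF _ bRe]) measurable
    finally show "Re (\<integral>\<omega>. (indicator A \<omega> *\<^sub>R T n m \<omega>) * of_real (x n m \<omega>) \<partial>M) = Re 0" by simp
    have "Im (\<integral>\<omega>. (indicator A \<omega> *\<^sub>R T n m \<omega>) * of_real (x n m \<omega>) \<partial>M) = (\<integral>\<omega>. Im (indicator A \<omega> *\<^sub>R T n m \<omega>) * x n m \<omega> \<partial>M)"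
      by (subst integral_Im[OF ix, symmetric]) (simp add: mult.assoc)
    also have "\<dots> = 0" by (rule x_mean[OF _ bIm]) measurable
    finally show "Im (\<integral>\<omega>. (indicator A \<omega> *\<^sub>R T n m \<omega>) * of_real (x n m \<omega>) \<partial>M) = Im 0" by simp
  qed
  moreover have "(\<integral>\<omega>. indicator A \<omega> *\<^sub>R T n (Suc m) \<omega> \<partial>M) =
      (\<integral>\<omega>. indicator A \<omega> *\<^sub>R T n m \<omega> + \<i> * ((indicator A \<omega> *\<^sub>R T n m \<omega>) * of_real (x n m \<omega>)) \<partial>M)"
    by (intro Bochner_Integration.integral_cong refl) (simp add: T_def algebra_simps)
  moreover have "\<dots> = (\<integral>\<omega>. indicator A \<omega> *\<^sub>R T n m \<omega> \<partial>M) + \<i> * (\<integral>\<omega>. (indicator A \<omega> *\<^sub>R T n m \<omega>) * of_real (x n m \<omega>) \<partial>M)"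
    by (simp only: Bochner_Integration.integral_add[OF iT integrable_mult_right[OF ix]] integral_mult_right_zero)
  ultimately show ?thesis by simp
qed

text \<open>On an event known at time \<open>m\<close> the martingale property moves the product
  from time \<open>K n\<close> back to time \<open>m\<close>; the first \<open>m\<close> factors
  tend to 1 as \<open>n\<close> grows.\<close>

lemma T_weak_basic:
  assumes A: "A \<in> sets (F m)"
  shows "(\<lambda>n. \<integral>\<omega>. indicator A \<omega> *\<^sub>R T n (K n) \<omega> \<partial>M) \<longlonglongrightarrow> (\<integral>\<omega>. indicator A \<omega> *\<^sub>R 1 \<partial>M)"
proof -
  have AM [measurable]: "A \<in> sets M" using A F by (auto simp: subalgebra_def)
  have "(\<integral>\<omega>. indicator A \<omega> *\<^sub>R T n (m + j) \<omega> \<partial>M) = (\<integral>\<omega>. indicator A \<omega> *\<^sub>R T n m \<omega> \<partial>M)"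
    if "m + j \<le> K n" for n j
    using that
  proof (induction j)
    case (Suc j)
    have "A \<in> sets (F (m + j))" using A F_le[of m "m + j"] by (auto simp: subalgebra_def)
    from T_step[OF this, of n] Suc show ?case by simp
  qed simp
  then have eq: "(\<integral>\<omega>. indicator A \<omega> *\<^sub>R T n (K n) \<omega> \<partial>M) = (\<integral>\<omega>. indicator A \<omega> *\<^sub>R T n m \<omega> \<partial>M)"
    if "m \<le> K n" for n
    using that by (metis le_add_diff_inverse order_refl)
  from K have ev: "eventually (\<lambda>n. m \<le> K n) sequentially" unfolding filterlim_at_top by blast
  \<comment> \<open>The uniform bound on \<open>T n m\<close> holds up to time \<open>K n\<close>
    only. For the finitely many \<open>n\<close> with \<open>K n < m\<close> the index 0, with value
    1, is substituted so that dominated convergence applies to the whole sequence.\<close>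
  have bb: "norm (indicator A \<omega> *\<^sub>R T n (if m \<le> K n then m else 0) \<omega>) \<le> exp (Q / 2)" if "\<omega> \<in> space M" for n \<omega>
    using T_bound[OF that, of m n] T_bound[OF that, of 0 n] by (simp add: indicator_def)
  have "(\<lambda>n. \<integral>\<omega>. indicator A \<omega> *\<^sub>R T n (if m \<le> K n then m else 0) \<omega> \<partial>M) \<longlonglongrightarrow> (\<integral>\<omega>. indicator A \<omega> *\<^sub>R 1 \<partial>M)"
  proof (rule integral_dominated_convergence[where w = "\<lambda>_. exp (Q / 2)"])
    show "AE \<omega> in M. (\<lambda>n. indicator A \<omega> *\<^sub>R T n (if m \<le> K n then m else 0) \<omega>) \<longlonglongrightarrow> indicator A \<omega> *\<^sub>R 1"
    proof (intro AE_I2 tendsto_scaleR tendsto_const)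
      fix \<omega> assume w: "\<omega> \<in> space M"
      have x0: "(\<lambda>n. x n k \<omega>) \<longlonglongrightarrow> 0" for k
        by (rule Lim_null_comparison[OF _ b_tendsto_0[of k]]) (use x_bound[OF w] in auto)
      have "(\<lambda>n. T n m \<omega>) \<longlonglongrightarrow> (\<Prod>k<m. 1 + \<i> * of_real 0)"
        unfolding T_def by (intro tendsto_intros x0)
      then have "(\<lambda>n. T n m \<omega>) \<longlonglongrightarrow> 1" by simp
      then show "(\<lambda>n. T n (if m \<le> K n then m else 0) \<omega>) \<longlonglongrightarrow> 1"
        by (rule Lim_transform_eventually) (use ev in \<open>auto elim: eventually_mono\<close>)
    qed
  qed (use bb in auto)
  then show ?thesis
    by (rule Lim_transform_eventually) (use ev eq in \<open>auto elim: eventually_mono\<close>)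
qed

text \<open>The extension from the filtration is available for real functions, hence the detour
  through \<open>Re (T n (K n)) - 1\<close> and \<open>Im (T n (K n))\<close>, both of which are
  weakly null.\<close>

lemma T_weak:
  assumes h: "integrable M h"
  shows "(\<lambda>n. \<integral>\<omega>. h \<omega> *\<^sub>R T n (K n) \<omega> \<partial>M) \<longlonglongrightarrow> complex_of_real (\<integral>\<omega>. h \<omega> \<partial>M)"
proof -
  have bd: "norm (T n (K n) \<omega>) \<le> exp (Q / 2)" if "\<omega> \<in> space M" for n \<omega>
    by (rule T_bound[OF that order_refl])
  have int: "integrable M (\<lambda>\<omega>. g \<omega> *\<^sub>R T n (K n) \<omega>)" if "integrable M g" for g n
  proof (rule Bochner_Integration.integrable_bound[OF integrable_mult_left[OF that, of "exp (Q / 2)"]])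
    show "AE \<omega> in M. norm (g \<omega> *\<^sub>R T n (K n) \<omega>) \<le> norm (g \<omega> * exp (Q / 2))"
      using bd by (intro AE_I2) (auto simp: abs_mult intro!: mult_left_mono)
  qed (use that in auto)
  have iA: "integrable M (indicator A :: 'a \<Rightarrow> real)" if "A \<in> sets (F m)" for A m
    using that F[of m] by (auto simp: subalgebra_def less_top[symmetric])
  have cre: "(\<integral>\<omega>. g \<omega> * (Re (T n (K n) \<omega>) - 1) \<partial>M) = Re ((\<integral>\<omega>. g \<omega> *\<^sub>R T n (K n) \<omega> \<partial>M) - of_real (\<integral>\<omega>. g \<omega> \<partial>M))"
    and cim: "(\<integral>\<omega>. g \<omega> * Im (T n (K n) \<omega>) \<partial>M) = Im ((\<integral>\<omega>. g \<omega> *\<^sub>R T n (K n) \<omega> \<partial>M) - of_real (\<integral>\<omega>. g \<omega> \<partial>M))"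
    if g: "integrable M g" for g n
  proof -
    have r: "Re (\<integral>\<omega>. g \<omega> *\<^sub>R T n (K n) \<omega> \<partial>M) = (\<integral>\<omega>. g \<omega> * Re (T n (K n) \<omega>) \<partial>M)"
      by (subst integral_Re[OF int[OF g], symmetric]) simp
    have i: "Im (\<integral>\<omega>. g \<omega> *\<^sub>R T n (K n) \<omega> \<partial>M) = (\<integral>\<omega>. g \<omega> * Im (T n (K n) \<omega>) \<partial>M)"
      by (subst integral_Im[OF int[OF g], symmetric]) simp
    have "integrable M (\<lambda>\<omega>. g \<omega> * Re (T n (K n) \<omega>))" using integrable_Re[OF int[OF g, of n]] by simp
    then show "(\<integral>\<omega>. g \<omega> * (Re (T n (K n) \<omega>) - 1) \<partial>M) = Re ((\<integral>\<omega>. g \<omega> *\<^sub>R T n (K n) \<omega> \<partial>M) - of_real (\<integral>\<omega>. g \<omega> \<partial>M))"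
      using g by (simp add: r right_diff_distrib)
    show "(\<integral>\<omega>. g \<omega> * Im (T n (K n) \<omega>) \<partial>M) = Im ((\<integral>\<omega>. g \<omega> *\<^sub>R T n (K n) \<omega> \<partial>M) - of_real (\<integral>\<omega>. g \<omega> \<partial>M))"
      by (simp add: i)
  qed
  have z: "(\<lambda>n. (\<integral>\<omega>. indicator A \<omega> *\<^sub>R T n (K n) \<omega> \<partial>M) - of_real (\<integral>\<omega>. indicator A \<omega> \<partial>M)) \<longlonglongrightarrow> 0"
    if "A \<in> sets (F m)" for A m
  proof -
    have "(\<integral>\<omega>. indicator A \<omega> *\<^sub>R (1::complex) \<partial>M) = of_real (\<integral>\<omega>. indicator A \<omega> \<partial>M)"
      by (simp add: scaleR_conv_of_real)
    then show ?thesis using T_weak_basic[OF that] LIM_zero by metis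
  qed
  have "(\<lambda>n. \<integral>\<omega>. h \<omega> * (Re (T n (K n) \<omega>) - 1) \<partial>M) \<longlonglongrightarrow> 0"
  proof (rule weak_null_extend[where F = F and K = K, OF F F_mono _ _ _ h])
    show "(\<lambda>\<omega>. Re (T n (K n) \<omega>) - 1) \<in> borel_measurable (F (K n))" for n
      using T_meas[of n "K n"] by measurable
    show "\<bar>Re (T n (K n) \<omega>) - 1\<bar> \<le> exp (Q / 2) + 1" if "\<omega> \<in> space M" for n \<omega>
      using bd[OF that, of n] abs_Re_le_cmod[of "T n (K n) \<omega>"] by linarith
    show "(\<lambda>n. \<integral>\<omega>. indicator A \<omega> * (Re (T n (K n) \<omega>) - 1) \<partial>M) \<longlonglongrightarrow> 0" if "A \<in> sets (F m)" for m A
      unfolding cre[OF iA[OF that]] using tendsto_Re[OF z[OF that]] by simp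
  qed
  then have r: "(\<lambda>n. Re ((\<integral>\<omega>. h \<omega> *\<^sub>R T n (K n) \<omega> \<partial>M) - of_real (\<integral>\<omega>. h \<omega> \<partial>M))) \<longlonglongrightarrow> 0"
    unfolding cre[OF h] .
  have "(\<lambda>n. \<integral>\<omega>. h \<omega> * Im (T n (K n) \<omega>) \<partial>M) \<longlonglongrightarrow> 0"
  proof (rule weak_null_extend[where F = F and K = K, OF F F_mono _ _ _ h])
    show "(\<lambda>\<omega>. Im (T n (K n) \<omega>)) \<in> borel_measurable (F (K n))" for n
      using T_meas[of n "K n"] by measurable
    show "\<bar>Im (T n (K n) \<omega>)\<bar> \<le> exp (Q / 2)" if "\<omega> \<in> space M" for n \<omega>
      using bd[OF that, of n] abs_Im_le_cmod[of "T n (K n) \<omega>"] by linarith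
    show "(\<lambda>n. \<integral>\<omega>. indicator A \<omega> * Im (T n (K n) \<omega>) \<partial>M) \<longlonglongrightarrow> 0" if "A \<in> sets (F m)" for m A
      unfolding cim[OF iA[OF that]] using tendsto_Im[OF z[OF that]] by simp
  qed
  then have i: "(\<lambda>n. Im ((\<integral>\<omega>. h \<omega> *\<^sub>R T n (K n) \<omega> \<partial>M) - of_real (\<integral>\<omega>. h \<omega> \<partial>M))) \<longlonglongrightarrow> 0"
    unfolding cim[OF h] .
  have "(\<lambda>n. (\<integral>\<omega>. h \<omega> *\<^sub>R T n (K n) \<omega> \<partial>M) - of_real (\<integral>\<omega>. h \<omega> \<partial>M)) \<longlonglongrightarrow> 0"
    using r i by (simp only: tendsto_complex_iff zero_complex.sel)
  then show ?thesis by (rule LIM_zero_cancel)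
qed

text \<open>The terms \<open>x^2 - v\<close> are again martingale differences and therefore
  orthogonal; each is bounded by \<open>b^2\<close>, so its second moment is at most
  \<open>b^4\<close>.\<close>

lemma quadratic_variation_error:
  "(\<integral>\<omega>. (\<Sum>k<m. (x n k \<omega>)\<^sup>2 - v n k \<omega>)\<^sup>2 \<partial>M) \<le> (\<Sum>k<m. b n k ^ 4)"
proof (induction m)
  case 0 show ?case by simp
next
  case (Suc m)
  define y where "y k \<omega> = (x n k \<omega>)\<^sup>2 - v n k \<omega>" for k \<omega>
  have [measurable]: "y k \<in> borel_measurable M" for k unfolding y_def by measurable
  have yb: "\<bar>y k \<omega>\<bar> \<le> (b n k)\<^sup>2" if "\<omega> \<in> space M" for k \<omega>
  proof -
    have "(x n k \<omega>)\<^sup>2 \<le> (b n k)\<^sup>2"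
      using x_bound[OF that, of n k] by (simp add: abs_le_square_iff[symmetric] b_nonneg)
    moreover have "0 \<le> (x n k \<omega>)\<^sup>2" by simp
    ultimately show ?thesis using v_bound[OF that, of n k] unfolding y_def by linarith
  qed
  define S where "S \<omega> = (\<Sum>k<m. y k \<omega>)" for \<omega>
  have [measurable]: "S \<in> borel_measurable M" unfolding S_def by measurable
  have Sb: "\<bar>S \<omega>\<bar> \<le> (\<Sum>k<m. (b n k)\<^sup>2)" if "\<omega> \<in> space M" for \<omega>
    unfolding S_def using yb[OF that] by (rule order_trans[OF sum_abs sum_mono])
  have Sm: "S \<in> borel_measurable (F m)"
  proof -
    have "x n k \<in> borel_measurable (F m)" "v n k \<in> borel_measurable (F m)" if "k < m" for k
      using measurable_from_subalg[OF F_le x_meas] measurable_from_subalg[OF F_le v_meas] that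
      by (meson Suc_leI, meson less_imp_le)
    then show ?thesis unfolding S_def y_def by (intro borel_measurable_sum borel_measurable_diff borel_measurable_power) auto
  qed
  let ?s = "\<Sum>k<m. (b n k)\<^sup>2"
  have s0: "0 \<le> ?s" by (intro sum_nonneg) simp
  have i1: "integrable M (\<lambda>\<omega>. (S \<omega>)\<^sup>2)"
    by (rule bounded_integrable[where B = "?s\<^sup>2"]) (use Sb s0 in \<open>auto simp: abs_le_square_iff[symmetric]\<close>)
  have i2: "integrable M (\<lambda>\<omega>. S \<omega> * (x n m \<omega>)\<^sup>2)"
  proof (rule bounded_integrable[where B = "?s * (b n m)\<^sup>2"])
    fix \<omega> assume w: "\<omega> \<in> space M"
    have "(x n m \<omega>)\<^sup>2 \<le> (b n m)\<^sup>2"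
      using x_bound[OF w, of n m] by (simp add: abs_le_square_iff[symmetric] b_nonneg)
    then show "norm (S \<omega> * (x n m \<omega>)\<^sup>2) \<le> ?s * (b n m)\<^sup>2"
      using Sb[OF w] s0 by (simp add: abs_mult mult_mono)
  qed simp
  have i3: "integrable M (\<lambda>\<omega>. S \<omega> * v n m \<omega>)"
  proof (rule bounded_integrable[where B = "?s * (b n m)\<^sup>2"])
    fix \<omega> assume w: "\<omega> \<in> space M"
    show "norm (S \<omega> * v n m \<omega>) \<le> ?s * (b n m)\<^sup>2"
      using Sb[OF w] s0 v_bound[OF w, of n m] by (simp add: abs_mult mult_mono)
  qed simp
  have ysq: "(y m \<omega>)\<^sup>2 \<le> ((b n m)\<^sup>2)\<^sup>2" if "\<omega> \<in> space M" for \<omega>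
    using yb[OF that, of m] by (subst abs_le_square_iff[symmetric]) simp
  have i4: "integrable M (\<lambda>\<omega>. (y m \<omega>)\<^sup>2)"
    by (rule bounded_integrable[where B = "((b n m)\<^sup>2)\<^sup>2"]) (use ysq in simp_all)
  have cross: "(\<integral>\<omega>. S \<omega> * y m \<omega> \<partial>M) = 0"
  proof -
    have "(\<integral>\<omega>. S \<omega> * y m \<omega> \<partial>M) = (\<integral>\<omega>. S \<omega> * (x n m \<omega>)\<^sup>2 \<partial>M) - (\<integral>\<omega>. S \<omega> * v n m \<omega> \<partial>M)"
      using i2 i3 by (simp add: y_def right_diff_distrib)
    also have "\<dots> = 0" using x_var[OF Sm] Sb by auto
    finally show ?thesis .
  qed
  have i5: "integrable M (\<lambda>\<omega>. S \<omega> * y m \<omega>)" using i2 i3 by (simp add: y_def right_diff_distrib)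
  have "(\<integral>\<omega>. (\<Sum>k<Suc m. (x n k \<omega>)\<^sup>2 - v n k \<omega>)\<^sup>2 \<partial>M) = (\<integral>\<omega>. (S \<omega>)\<^sup>2 + 2 * (S \<omega> * y m \<omega>) + (y m \<omega>)\<^sup>2 \<partial>M)"
    by (intro Bochner_Integration.integral_cong refl) (simp add: S_def y_def power2_eq_square algebra_simps)
  also have "\<dots> = (\<integral>\<omega>. (S \<omega>)\<^sup>2 \<partial>M) + 2 * (\<integral>\<omega>. S \<omega> * y m \<omega> \<partial>M) + (\<integral>\<omega>. (y m \<omega>)\<^sup>2 \<partial>M)"
    using i1 i4 i5 by simp
  also have "\<dots> = (\<integral>\<omega>. (S \<omega>)\<^sup>2 \<partial>M) + (\<integral>\<omega>. (y m \<omega>)\<^sup>2 \<partial>M)" by (simp add: cross)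
  also have "(\<integral>\<omega>. (y m \<omega>)\<^sup>2 \<partial>M) \<le> (\<integral>\<omega>. ((b n m)\<^sup>2)\<^sup>2 \<partial>M)"
    by (intro integral_mono i4 ysq) simp
  also have "(\<integral>\<omega>. ((b n m)\<^sup>2)\<^sup>2 \<partial>M) = b n m ^ 4" by (simp add: prob_space)
  also have "(\<integral>\<omega>. (S \<omega>)\<^sup>2 \<partial>M) \<le> (\<Sum>k<m. b n k ^ 4)" using Suc.IH by (simp add: S_def y_def)
  finally show ?case by simp
qed

text \<open>Up to an error of third order the exponential of the sum is the product \<open>T\<close>
  times \<open>exp (- X / 2)\<close>, with \<open>X\<close> the sum of the squares. In
  \<open>L1\<close>, \<open>X\<close> is close to the conditional variances \<open>U\<close> and
  these to \<open>V\<close>. After replacing \<open>X\<close> by \<open>V\<close>, only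
  \<open>T\<close> depends on \<open>n\<close>, and it is tested against the fixed function
  \<open>h\<close>.\<close>

theorem char_convergence:
  assumes V [measurable]: "V \<in> borel_measurable M" and V0: "\<And>\<omega>. \<omega> \<in> space M \<Longrightarrow> 0 \<le> V \<omega>"
    and v_lim: "AE \<omega> in M. (\<lambda>n. \<Sum>k<K n. v n k \<omega>) \<longlonglongrightarrow> V \<omega>"
    and H [measurable]: "H \<in> sets M"
  shows "(\<lambda>n. \<integral>\<omega>. indicator H \<omega> *\<^sub>R iexp (\<Sum>k<K n. x n k \<omega>) \<partial>M) \<longlonglongrightarrow>
      (\<integral>\<omega>. indicator H \<omega> *\<^sub>R complex_of_real (exp (- V \<omega> / 2)) \<partial>M)"
proof -
  define h where "h \<omega> = indicator H \<omega> * exp (- V \<omega> / 2)" for \<omega>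
  have h: "integrable M h" unfolding h_def
    by (rule bounded_integrable[where B = 1]) (use V0 in \<open>auto simp: indicator_def\<close>)
  have "(\<integral>\<omega>. indicator H \<omega> *\<^sub>R complex_of_real (exp (- V \<omega> / 2)) \<partial>M) = (\<integral>\<omega>. complex_of_real (h \<omega>) \<partial>M)"
    by (intro Bochner_Integration.integral_cong refl) (simp add: h_def scaleR_conv_of_real)
  then have lim_eq: "(\<integral>\<omega>. indicator H \<omega> *\<^sub>R complex_of_real (exp (- V \<omega> / 2)) \<partial>M) = complex_of_real (\<integral>\<omega>. h \<omega> \<partial>M)"
    by simp
  define X where "X n \<omega> = (\<Sum>k<K n. (x n k \<omega>)\<^sup>2)" for n \<omega>
  define U where "U n \<omega> = (\<Sum>k<K n. v n k \<omega>)" for n \<omega>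
  have [measurable]: "X n \<in> borel_measurable M" "U n \<in> borel_measurable M" for n
    unfolding X_def U_def by measurable
  have X0: "0 \<le> X n \<omega>" for n \<omega> unfolding X_def by (intro sum_nonneg) simp
  have Xb: "X n \<omega> \<le> Q" and Ub: "0 \<le> U n \<omega> \<and> U n \<omega> \<le> Q" if "\<omega> \<in> space M" for n \<omega>
  proof -
    have "X n \<omega> \<le> (\<Sum>k<K n. (b n k)\<^sup>2)" unfolding X_def
      using x_bound[OF that, of n] by (intro sum_mono) (simp add: abs_le_square_iff[symmetric] b_nonneg)
    then show "X n \<omega> \<le> Q" using b2[of n] by simp
    have "U n \<omega> \<le> (\<Sum>k<K n. (b n k)\<^sup>2)" unfolding U_def
      using v_bound[OF that, of n] by (intro sum_mono) simp
    then show "0 \<le> U n \<omega> \<and> U n \<omega> \<le> Q"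
      using b2[of n] v_bound[OF that, of n] unfolding U_def by (simp add: sum_nonneg)
  qed
  \<comment> \<open>The limit inherits the deterministic bound of the sums, which provides the
    dominating constant below.\<close>
  have VQ: "AE \<omega> in M. V \<omega> \<le> Q"
    using v_lim AE_space
  proof eventually_elim
    case (elim \<omega>)
    show ?case by (rule LIMSEQ_le_const2[OF elim(1)]) (use Ub[OF elim(2)] in \<open>auto simp: U_def\<close>)
  qed
  have iUV: "integrable M (\<lambda>\<omega>. \<bar>U n \<omega> - V \<omega>\<bar>)" for n
  proof (rule integrable_const_bound[where B = Q])
    show "AE \<omega> in M. norm \<bar>U n \<omega> - V \<omega>\<bar> \<le> Q" using VQ AE_space
    proof eventually_elim
      case (elim \<omega>)
      then show ?case using Ub[OF elim(2), of n] V0[OF elim(2)] by (simp add: abs_le_iff)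
    qed
  qed measurable
  have UV: "(\<lambda>n. \<integral>\<omega>. \<bar>U n \<omega> - V \<omega>\<bar> \<partial>M) \<longlonglongrightarrow> (\<integral>\<omega>. 0 \<partial>M)"
  proof (rule integral_dominated_convergence[where w = "\<lambda>_. Q"])
    show "AE \<omega> in M. (\<lambda>n. \<bar>U n \<omega> - V \<omega>\<bar>) \<longlonglongrightarrow> 0" using v_lim
      by eventually_elim (auto simp: U_def intro!: tendsto_rabs_zero LIM_zero)
    show "AE \<omega> in M. norm \<bar>U n \<omega> - V \<omega>\<bar> \<le> Q" for n using VQ AE_space
    proof eventually_elim
      case (elim \<omega>)
      then show ?case using Ub[OF elim(2), of n] V0[OF elim(2)] by (simp add: abs_le_iff)
    qed
  qed simp_all
  define \<beta> where "\<beta> n = (\<Sum>k<K n. b n k ^ 3)" for n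
  define \<delta> where "\<delta> n = (\<Sum>k<K n. b n k ^ 4)" for n
  have \<delta>0: "0 \<le> \<delta> n" for n unfolding \<delta>_def by (intro sum_nonneg) (simp add: b_nonneg)
  have \<beta>_le: "\<beta> n \<le> sqrt Q * sqrt (\<delta> n)" for n
  proof -
    \<comment> \<open>Cauchy-Schwarz with \<open>b^3 = b * b^2\<close> bounds the third powers by
      the second and fourth ones.\<close>
    have "\<beta> n = (\<Sum>k<K n. \<bar>b n k\<bar> * \<bar>(b n k)\<^sup>2\<bar>)"
      unfolding \<beta>_def by (intro sum.cong refl) (simp add: b_nonneg power2_eq_square power3_eq_cube)
    also have "\<dots> \<le> L2_set (b n) {..<K n} * L2_set (\<lambda>k. (b n k)\<^sup>2) {..<K n}" by (rule L2_set_mult_ineq)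
    also have "\<dots> = sqrt (\<Sum>k<K n. (b n k)\<^sup>2) * sqrt (\<delta> n)" by (simp add: L2_set_def \<delta>_def)
    also have "\<dots> \<le> sqrt Q * sqrt (\<delta> n)" using b2[of n] \<delta>0[of n] by (intro mult_right_mono) auto
    finally show ?thesis .
  qed
  have XU: "(\<integral>\<omega>. \<bar>X n \<omega> - U n \<omega>\<bar> \<partial>M) \<le> sqrt (\<delta> n)" and iXU: "integrable M (\<lambda>\<omega>. \<bar>X n \<omega> - U n \<omega>\<bar>)" for n
  proof -
    have bd: "\<bar>X n \<omega> - U n \<omega>\<bar> \<le> Q" if "\<omega> \<in> space M" for \<omega>
      using X0[of n \<omega>] Xb[OF that, of n] Ub[OF that, of n] by (simp add: abs_le_iff)
    have i: "integrable M (\<lambda>\<omega>. X n \<omega> - U n \<omega>)"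
      by (rule bounded_integrable[where B = Q]) (use bd in auto)
    then show "integrable M (\<lambda>\<omega>. \<bar>X n \<omega> - U n \<omega>\<bar>)" by simp
    have i2: "integrable M (\<lambda>\<omega>. (X n \<omega> - U n \<omega>)\<^sup>2)"
      by (rule bounded_integrable[where B = "Q\<^sup>2"]) (use bd Q_nonneg in \<open>auto simp: abs_le_square_iff[symmetric]\<close>)
    have "(\<integral>\<omega>. \<bar>X n \<omega> - U n \<omega>\<bar> \<partial>M) \<le> sqrt (\<integral>\<omega>. (X n \<omega> - U n \<omega>)\<^sup>2 \<partial>M)"
      by (rule expectation_abs_le_sqrt[OF i i2])
    also have "\<dots> \<le> sqrt (\<delta> n)"
      using quadratic_variation_error[of n "K n"] by (simp add: X_def U_def \<delta>_def sum_subtractf)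
    finally show "(\<integral>\<omega>. \<bar>X n \<omega> - U n \<omega>\<bar> \<partial>M) \<le> sqrt (\<delta> n)" .
  qed
  define E where "E n = 2 * (sqrt Q * sqrt (\<delta> n)) + exp (Q / 2) / 2 * (sqrt (\<delta> n) + (\<integral>\<omega>. \<bar>U n \<omega> - V \<omega>\<bar> \<partial>M))" for n
  have E0: "E \<longlonglongrightarrow> 0"
  proof -
    have "\<delta> \<longlonglongrightarrow> 0" using b4 by (simp add: \<delta>_def[abs_def])
    then have "(\<lambda>n. sqrt (\<delta> n)) \<longlonglongrightarrow> sqrt 0" by (intro tendsto_real_sqrt)
    then have "E \<longlonglongrightarrow> 2 * (sqrt Q * sqrt 0) + exp (Q / 2) / 2 * (sqrt 0 + (\<integral>\<omega>. 0 \<partial>M))"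
      unfolding E_def by (intro tendsto_add tendsto_mult tendsto_const UV)
    then show ?thesis by simp
  qed
  have main: "norm ((\<integral>\<omega>. indicator H \<omega> *\<^sub>R iexp (\<Sum>k<K n. x n k \<omega>) \<partial>M) - (\<integral>\<omega>. h \<omega> *\<^sub>R T n (K n) \<omega> \<partial>M)) \<le> E n" for n
  proof -
    have i1: "integrable M (\<lambda>\<omega>. indicator H \<omega> *\<^sub>R iexp (\<Sum>k<K n. x n k \<omega>))"
      by (rule bounded_integrable[where B = 1]) (auto simp: indicator_def)
    have i2: "integrable M (\<lambda>\<omega>. h \<omega> *\<^sub>R T n (K n) \<omega>)"
    proof (rule bounded_integrable[where B = "1 * exp (Q / 2)"])
      fix \<omega> assume w: "\<omega> \<in> space M"
      have "\<bar>h \<omega>\<bar> \<le> 1" using V0[OF w] by (simp add: h_def indicator_def)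
      then show "norm (h \<omega> *\<^sub>R T n (K n) \<omega>) \<le> 1 * exp (Q / 2)"
        unfolding norm_scaleR by (intro mult_mono T_bound w) auto
    qed (simp add: h_def)
    have pt: "norm (indicator H \<omega> *\<^sub>R iexp (\<Sum>k<K n. x n k \<omega>) - h \<omega> *\<^sub>R T n (K n) \<omega>) \<le>
       2 * \<beta> n + exp (Q / 2) / 2 * (\<bar>X n \<omega> - U n \<omega>\<bar> + \<bar>U n \<omega> - V \<omega>\<bar>)" if w: "\<omega> \<in> space M" for \<omega>
    proof -
      \<comment> \<open>The intermediate quantity: still the random sum of squares in the exponent,
        not yet its limit.\<close>
      define P where "P = T n (K n) \<omega> * of_real (exp (- X n \<omega> / 2))"
      have "norm (iexp (\<Sum>k<K n. x n k \<omega>) - P) =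
        norm ((\<Prod>k<K n. iexp (x n k \<omega>)) - (\<Prod>k<K n. (1 + \<i> * of_real (x n k \<omega>)) * of_real (exp (- ((x n k \<omega>)\<^sup>2) / 2))))"
      proof -
        have "iexp (\<Sum>k<K n. x n k \<omega>) = (\<Prod>k<K n. iexp (x n k \<omega>))"
          by (simp add: exp_sum sum_distrib_left)
        moreover have "exp (- X n \<omega> / 2) = (\<Prod>k<K n. exp (- ((x n k \<omega>)\<^sup>2) / 2))"
          unfolding X_def by (simp add: exp_sum[symmetric] sum_negf sum_divide_distrib)
        ultimately show ?thesis unfolding P_def T_def by (simp only: prod.distrib of_real_prod)
      qed
      also have "\<dots> \<le> (\<Sum>k<K n. norm (iexp (x n k \<omega>) - (1 + \<i> * of_real (x n k \<omega>)) * of_real (exp (- ((x n k \<omega>)\<^sup>2) / 2))))"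
        by (intro norm_prod_diff one_plus_mcleish_le) simp
      also have "\<dots> \<le> (\<Sum>k<K n. 2 * b n k ^ 3)"
      proof (rule sum_mono)
        fix k
        have "\<bar>x n k \<omega>\<bar> ^ 3 \<le> b n k ^ 3" by (intro power_mono x_bound w) simp
        with iexp_mcleish_approx[of "x n k \<omega>"]
        show "norm (iexp (x n k \<omega>) - (1 + \<i> * of_real (x n k \<omega>)) * of_real (exp (- ((x n k \<omega>)\<^sup>2) / 2))) \<le> 2 * b n k ^ 3"
          by linarith
      qed
      also have "\<dots> = 2 * \<beta> n" by (simp add: \<beta>_def sum_distrib_left)
      finally have 1: "norm (iexp (\<Sum>k<K n. x n k \<omega>) - P) \<le> 2 * \<beta> n" .
      have "norm (P - of_real (exp (- V \<omega> / 2)) * T n (K n) \<omega>) = norm (T n (K n) \<omega>) * \<bar>exp (- X n \<omega> / 2) - exp (- V \<omega> / 2)\<bar>"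
      proof -
        have "P - of_real (exp (- V \<omega> / 2)) * T n (K n) \<omega> = T n (K n) \<omega> * of_real (exp (- X n \<omega> / 2) - exp (- V \<omega> / 2))"
          unfolding P_def by (simp add: algebra_simps)
        then show ?thesis by (simp only: norm_mult norm_of_real)
      qed
      also have "\<dots> \<le> exp (Q / 2) * (\<bar>X n \<omega> - V \<omega>\<bar> / 2)"
      proof (rule mult_mono)
        \<comment> \<open>On the nonnegative half-line the decreasing exponential is
          1-Lipschitz.\<close>
        have lip: "exp (- s) - exp (- t) \<le> t - s" if "0 \<le> s" "s \<le> t" for s t :: real
        proof -
          have "exp (- s) - exp (- t) = exp (- s) * (1 - exp (- (t - s)))" by (simp add: algebra_simps exp_add[symmetric])
          also have "\<dots> \<le> 1 * (t - s)"
          proof (intro mult_mono)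
            have "1 + - (t - s) \<le> exp (- (t - s))" by (rule exp_ge_add_one_self)
            then show "1 - exp (- (t - s)) \<le> t - s" by linarith
          qed (use that in auto)
          finally show ?thesis by simp
        qed
        show "\<bar>exp (- X n \<omega> / 2) - exp (- V \<omega> / 2)\<bar> \<le> \<bar>X n \<omega> - V \<omega>\<bar> / 2"
          using lip[of "X n \<omega> / 2" "V \<omega> / 2"] lip[of "V \<omega> / 2" "X n \<omega> / 2"] X0[of n \<omega>] V0[OF w]
          by (cases "X n \<omega> \<le> V \<omega>") (auto simp: abs_real_def)
      qed (use T_bound[OF w order_refl] in auto)
      also have "\<dots> \<le> exp (Q / 2) * ((\<bar>X n \<omega> - U n \<omega>\<bar> + \<bar>U n \<omega> - V \<omega>\<bar>) / 2)"
        by (intro mult_left_mono divide_right_mono) auto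
      finally have 2: "norm (P - of_real (exp (- V \<omega> / 2)) * T n (K n) \<omega>) \<le> exp (Q / 2) / 2 * (\<bar>X n \<omega> - U n \<omega>\<bar> + \<bar>U n \<omega> - V \<omega>\<bar>)"
        by simp
      have "norm (iexp (\<Sum>k<K n. x n k \<omega>) - of_real (exp (- V \<omega> / 2)) * T n (K n) \<omega>) \<le>
         2 * \<beta> n + exp (Q / 2) / 2 * (\<bar>X n \<omega> - U n \<omega>\<bar> + \<bar>U n \<omega> - V \<omega>\<bar>)"
        by (rule norm_diff_triangle_le[OF 1 2])
      moreover have "norm (indicator H \<omega> *\<^sub>R iexp (\<Sum>k<K n. x n k \<omega>) - h \<omega> *\<^sub>R T n (K n) \<omega>) \<le>
         norm (iexp (\<Sum>k<K n. x n k \<omega>) - of_real (exp (- V \<omega> / 2)) * T n (K n) \<omega>)"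
        unfolding h_def by (cases "\<omega> \<in> H") (simp_all add: scaleR_conv_of_real)
      ultimately show ?thesis by linarith
    qed
    have "norm ((\<integral>\<omega>. indicator H \<omega> *\<^sub>R iexp (\<Sum>k<K n. x n k \<omega>) \<partial>M) - (\<integral>\<omega>. h \<omega> *\<^sub>R T n (K n) \<omega> \<partial>M))
      = norm (\<integral>\<omega>. indicator H \<omega> *\<^sub>R iexp (\<Sum>k<K n. x n k \<omega>) - h \<omega> *\<^sub>R T n (K n) \<omega> \<partial>M)"
      by (subst Bochner_Integration.integral_diff[OF i1 i2]) simp
    also have "\<dots> \<le> (\<integral>\<omega>. norm (indicator H \<omega> *\<^sub>R iexp (\<Sum>k<K n. x n k \<omega>) - h \<omega> *\<^sub>R T n (K n) \<omega>) \<partial>M)"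
      by (rule integral_norm_bound)
    also have "\<dots> \<le> (\<integral>\<omega>. 2 * \<beta> n + exp (Q / 2) / 2 * (\<bar>X n \<omega> - U n \<omega>\<bar> + \<bar>U n \<omega> - V \<omega>\<bar>) \<partial>M)"
    proof (rule integral_mono)
      show "integrable M (\<lambda>\<omega>. norm (indicator H \<omega> *\<^sub>R iexp (\<Sum>k<K n. x n k \<omega>) - h \<omega> *\<^sub>R T n (K n) \<omega>))"
        by (intro integrable_norm Bochner_Integration.integrable_diff i1 i2)
      show "integrable M (\<lambda>\<omega>. 2 * \<beta> n + exp (Q / 2) / 2 * (\<bar>X n \<omega> - U n \<omega>\<bar> + \<bar>U n \<omega> - V \<omega>\<bar>))"
        by (intro Bochner_Integration.integrable_add integrable_mult_right iXU iUV) simp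
    qed (rule pt)
    also have "\<dots> = 2 * \<beta> n + exp (Q / 2) / 2 * ((\<integral>\<omega>. \<bar>X n \<omega> - U n \<omega>\<bar> \<partial>M) + (\<integral>\<omega>. \<bar>U n \<omega> - V \<omega>\<bar> \<partial>M))"
      using iXU[of n] iUV[of n] by (simp add: prob_space)
    also have "\<dots> \<le> E n" unfolding E_def
      by (intro add_mono mult_left_mono \<beta>_le XU order_refl) auto
    finally show ?thesis .
  qed
  have "(\<lambda>n. (\<integral>\<omega>. indicator H \<omega> *\<^sub>R iexp (\<Sum>k<K n. x n k \<omega>) \<partial>M) - (\<integral>\<omega>. h \<omega> *\<^sub>R T n (K n) \<omega> \<partial>M)) \<longlonglongrightarrow> 0"
    by (rule Lim_null_comparison[OF _ E0]) (use main in auto)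
  from tendsto_add[OF this T_weak[OF h]] show ?thesis unfolding lim_eq by simp
qed

end

section \<open>Linear recursions\<close>

text \<open>Once the inputs are below \<open>e / 2\<close>, the excess over this level is multiplied
  by at most \<open>1 - \<epsilon>\<close> in every step, and the product of these factors vanishes
  because the steps are not summable.\<close>

lemma recursion_null:
  fixes y \<epsilon> \<delta> :: "nat \<Rightarrow> real"
  assumes y: "\<And>n. 0 \<le> y n" and \<epsilon>0: "eventually (\<lambda>n. 0 < \<epsilon> n) sequentially" and \<epsilon>: "\<epsilon> \<longlonglongrightarrow> 0"
    and div: "\<not> summable \<epsilon>" and \<delta>: "\<delta> \<longlonglongrightarrow> 0"
    and rec: "eventually (\<lambda>n. y (Suc n) \<le> (1 - \<epsilon> n) * y n + \<epsilon> n * \<delta> n) sequentially"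
  shows "y \<longlonglongrightarrow> 0"
proof (rule LIMSEQ_I)
  fix e :: real assume e: "0 < e"
  have "eventually (\<lambda>n. 0 < \<epsilon> n \<and> \<epsilon> n < 1 \<and> \<delta> n < e / 2 \<and> y (Suc n) \<le> (1 - \<epsilon> n) * y n + \<epsilon> n * \<delta> n) sequentially"
    using \<epsilon>0 rec order_tendstoD(2)[OF \<epsilon>, of 1] order_tendstoD(2)[OF \<delta>, of "e / 2"] e
    by (auto simp: eventually_conj_iff)
  then obtain N where N: "\<And>n. n \<ge> N \<Longrightarrow> 0 < \<epsilon> n \<and> \<epsilon> n < 1 \<and> \<delta> n < e / 2 \<and> y (Suc n) \<le> (1 - \<epsilon> n) * y n + \<epsilon> n * \<delta> n"
    by (auto simp: eventually_sequentially)
  \<comment> \<open>Excess over the level \<open>e / 2\<close>; it may be negative, hence the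
    absolute value at the start.\<close>
  define z where "z n = y (N + n) - e / 2" for n
  define s where "s n = (\<Sum>i<n. \<epsilon> (N + i))" for n
  have z: "z n \<le> exp (- s n) * \<bar>z 0\<bar>" for n
  proof (induction n)
    case 0 show ?case by (simp add: s_def)
  next
    case (Suc n)
    have n: "0 < \<epsilon> (N + n)" "\<epsilon> (N + n) < 1" "\<delta> (N + n) < e / 2"
      "y (Suc (N + n)) \<le> (1 - \<epsilon> (N + n)) * y (N + n) + \<epsilon> (N + n) * \<delta> (N + n)" using N[of "N + n"] by auto
    have "\<epsilon> (N + n) * \<delta> (N + n) \<le> \<epsilon> (N + n) * (e / 2)" using n by (intro mult_left_mono) auto
    then have "z (Suc n) \<le> (1 - \<epsilon> (N + n)) * z n" using n(4) by (simp add: z_def algebra_simps)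
    also have "\<dots> \<le> (1 - \<epsilon> (N + n)) * (exp (- s n) * \<bar>z 0\<bar>)" using Suc n by (intro mult_left_mono) auto
    also have "\<dots> \<le> exp (- \<epsilon> (N + n)) * (exp (- s n) * \<bar>z 0\<bar>)"
    proof (rule mult_right_mono)
      have "1 + - \<epsilon> (N + n) \<le> exp (- \<epsilon> (N + n))" by (rule exp_ge_add_one_self)
      then show "1 - \<epsilon> (N + n) \<le> exp (- \<epsilon> (N + n))" by simp
    qed simp
    also have "\<dots> = exp (- s (Suc n)) * \<bar>z 0\<bar>" by (simp add: s_def exp_add[symmetric])
    finally show ?case .
  qed
  have "\<not> summable (\<lambda>i. \<epsilon> (N + i))" using div summable_iff_shift[of \<epsilon> N] by (simp add: add.commute)
  \<comment> \<open>The threshold is chosen so that \<open>exp (- s m)\<close> times the initial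
    excess falls below \<open>e / 2\<close>.\<close>
  then obtain n0 where n0: "s n0 > ln (1 + \<bar>z 0\<bar> * 2 / e)"
    using summableI_nonneg_bounded[of "\<lambda>i. \<epsilon> (N + i)" "ln (1 + \<bar>z 0\<bar> * 2 / e)"] N
    unfolding s_def by (metis le_add1 less_imp_le linorder_not_le)
  have "norm (y n - 0) < e" if "n \<ge> N + n0" for n
  proof -
    define m where "m = n - N"
    have m: "m \<ge> n0" "n = N + m" using that by (auto simp: m_def)
    have "s n0 \<le> s m" unfolding s_def using N m by (intro sum_mono2) (auto intro: less_imp_le)
    with n0 have "ln (1 + \<bar>z 0\<bar> * 2 / e) < s m" by simp
    moreover have D: "0 < 1 + \<bar>z 0\<bar> * 2 / e" using e by (simp add: add_pos_nonneg)
    ultimately have "1 + \<bar>z 0\<bar> * 2 / e < exp (s m)" by (metis exp_less_cancel_iff exp_ln)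
    then have "exp (- s m) < 1 / (1 + \<bar>z 0\<bar> * 2 / e)"
      using less_imp_inverse_less[OF _ D] by (simp add: exp_minus inverse_eq_divide)
    then have "exp (- s m) * \<bar>z 0\<bar> \<le> 1 / (1 + \<bar>z 0\<bar> * 2 / e) * \<bar>z 0\<bar>" by (intro mult_right_mono) auto
    also have "\<dots> < e / 2"
      using e D by (simp add: divide_less_eq distrib_left)
    finally have "z m < e / 2" using z[of m] by simp
    then show ?thesis using y[of n] m by (simp add: z_def)
  qed
  then show "\<exists>no. \<forall>n\<ge>no. norm (y n - 0) < e" by blast
qed

text \<open>The square of the norm is at most
  \<open>1 - 3 * \<rho> * \<epsilon> + \<rho> * \<epsilon>\<close>, hence at most
  \<open>(1 - \<rho> * \<epsilon>)^2\<close>. The factor \<open>3 / 2\<close> leaves just enough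
  room to absorb the quadratic term.\<close>

lemma norm_one_minus_le:
  fixes b :: complex
  assumes "0 < \<epsilon>" "3 / 2 * \<rho> \<le> Re b" "\<epsilon> * (norm b)\<^sup>2 \<le> \<rho>" "\<rho> * \<epsilon> \<le> 1"
  shows "norm (1 - of_real \<epsilon> * b) \<le> 1 - \<rho> * \<epsilon>"
proof (rule power2_le_imp_le)
  have "(norm (1 - of_real \<epsilon> * b))\<^sup>2 = 1 - 2 * \<epsilon> * Re b + \<epsilon> * (\<epsilon> * (norm b)\<^sup>2)"
    unfolding cmod_power2 by (simp add: power2_eq_square algebra_simps)
  also have "\<dots> \<le> 1 - 2 * \<epsilon> * (3 / 2 * \<rho>) + \<epsilon> * \<rho>"
    using assms by (intro add_mono diff_mono mult_left_mono) auto
  also have "\<dots> \<le> (1 - \<rho> * \<epsilon>)\<^sup>2"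
    using zero_le_power2[of "\<rho> * \<epsilon>"] unfolding power2_diff by (simp add: algebra_simps)
  finally show "(norm (1 - of_real \<epsilon> * b))\<^sup>2 \<le> (1 - \<rho> * \<epsilon>)\<^sup>2" .
qed (use assms in simp)

text \<open>The quotient \<open>d / b\<close> is the fixed point of the limiting recursion, and the
  distance to it obeys \<open>recursion_null\<close>.\<close>

lemma recursion_limit:
  fixes y bb dd :: "nat \<Rightarrow> complex" and \<epsilon> :: "nat \<Rightarrow> real"
  assumes \<epsilon>0: "eventually (\<lambda>n. 0 < \<epsilon> n) sequentially" and \<epsilon>: "\<epsilon> \<longlonglongrightarrow> 0" and div: "\<not> summable \<epsilon>"
    and b: "bb \<longlonglongrightarrow> b" "0 < Re b" and d: "dd \<longlonglongrightarrow> d"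
    and rec: "eventually (\<lambda>n. y (Suc n) = (1 - of_real (\<epsilon> n) * bb n) * y n + of_real (\<epsilon> n) * dd n) sequentially"
  shows "y \<longlonglongrightarrow> d / b"
proof -
  \<comment> \<open>Half of the limiting rate: then \<open>3 / 2 * \<rho>\<close> is three quarters
    of \<open>Re b\<close>, which \<open>Re (bb n)\<close> eventually exceeds.\<close>
  define \<rho> where "\<rho> = Re b / 2"
  have \<rho>: "\<rho> > 0" using b by (simp add: \<rho>_def)
  have b0: "b \<noteq> 0" using b by auto
  define \<delta> where "\<delta> n = norm (dd n - bb n * (d / b)) / \<rho>" for n
  have "\<delta> \<longlonglongrightarrow> norm (d - b * (d / b)) / \<rho>" unfolding \<delta>_def using b d \<rho> by (intro tendsto_intros) auto
  then have \<delta>: "\<delta> \<longlonglongrightarrow> 0" using b0 by simp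
  have l1: "(\<lambda>n. Re (bb n)) \<longlonglongrightarrow> Re b" by (intro tendsto_intros b)
  have l2: "(\<lambda>n. \<epsilon> n * (norm (bb n))\<^sup>2) \<longlonglongrightarrow> 0 * (norm b)\<^sup>2" by (intro tendsto_intros b \<epsilon>)
  have l3: "(\<lambda>n. \<rho> * \<epsilon> n) \<longlonglongrightarrow> \<rho> * 0" by (intro tendsto_intros \<epsilon>)
  have "(\<lambda>n. norm (y n - d / b)) \<longlonglongrightarrow> 0"
  proof (rule recursion_null[where \<epsilon> = "\<lambda>n. \<rho> * \<epsilon> n" and \<delta> = \<delta>])
    show "eventually (\<lambda>n. 0 < \<rho> * \<epsilon> n) sequentially" using \<epsilon>0 by eventually_elim (use \<rho> in simp)
    show "\<not> summable (\<lambda>n. \<rho> * \<epsilon> n)" using div \<rho> by (simp add: summable_cmult_iff)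
    have "eventually (\<lambda>n. 3 / 2 * \<rho> < Re (bb n)) sequentially"
      using \<rho> by (intro order_tendstoD(1)[OF l1]) (simp add: \<rho>_def)
    moreover have "eventually (\<lambda>n. \<epsilon> n * (norm (bb n))\<^sup>2 < \<rho>) sequentially"
      using \<rho> by (intro order_tendstoD(2)[OF l2]) simp
    moreover have "eventually (\<lambda>n. \<rho> * \<epsilon> n < 1) sequentially"
      by (intro order_tendstoD(2)[OF l3]) simp
    ultimately show "eventually (\<lambda>n. norm (y (Suc n) - d / b) \<le> (1 - \<rho> * \<epsilon> n) * norm (y n - d / b) + \<rho> * \<epsilon> n * \<delta> n) sequentially"
      using rec \<epsilon>0
    proof eventually_elim
      case (elim n)
      have "y (Suc n) - d / b = (1 - of_real (\<epsilon> n) * bb n) * (y n - d / b) + of_real (\<epsilon> n) * (dd n - bb n * (d / b))"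
        unfolding elim(4) by (simp add: algebra_simps)
      then have "norm (y (Suc n) - d / b) \<le> norm (1 - of_real (\<epsilon> n) * bb n) * norm (y n - d / b) + \<epsilon> n * norm (dd n - bb n * (d / b))"
        using elim(5) by (metis abs_of_pos norm_mult norm_of_real norm_triangle_ineq)
      also have "\<dots> \<le> (1 - \<rho> * \<epsilon> n) * norm (y n - d / b) + \<epsilon> n * norm (dd n - bb n * (d / b))"
        using elim by (intro add_right_mono mult_right_mono norm_one_minus_le) auto
      also have "\<epsilon> n * norm (dd n - bb n * (d / b)) = \<rho> * \<epsilon> n * \<delta> n" using \<rho> by (simp add: \<delta>_def)
      finally show ?case .
    qed
  qed (use l3 \<delta> in simp_all)
  then show ?thesis by (rule LIM_zero_cancel[OF tendsto_norm_zero_cancel])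
qed

text \<open>The product of the factors \<open>1 + C / n^2\<close> converges. Explicitly,
  \<open>C / n^2\<close> is at most the decrease of \<open>2 * C / n\<close> in one step, so
  \<open>f n * exp (2 * C / n)\<close> is eventually decreasing.\<close>

lemma almost_contraction_bounded:
  fixes f :: "nat \<Rightarrow> real"
  assumes f: "\<And>n. 0 \<le> f n" and C: "0 \<le> C"
    and rec: "eventually (\<lambda>n. f (Suc n) \<le> (1 + C / (real n)\<^sup>2) * f n) sequentially"
  shows "\<exists>B. \<forall>n. f n \<le> B"
proof -
  obtain N where N: "\<And>n. n \<ge> N \<Longrightarrow> f (Suc n) \<le> (1 + C / (real n)\<^sup>2) * f n" using rec by (auto simp: eventually_sequentially)
  define m where "m = Suc N"
  have step: "f (Suc n) * exp (2 * C / real (Suc n)) \<le> f n * exp (2 * C / real n)" if n: "n \<ge> m" for n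
  proof -
    have n1: "n \<ge> 1" "n \<ge> N" using n by (auto simp: m_def)
    have q: "C / (real n)\<^sup>2 \<le> 2 * C / real n - 2 * C / real (Suc n)"
    proof -
      have "2 * C / real n - 2 * C / real (Suc n) = C * (2 / (real n * real (Suc n)))"
        using n1 by (simp add: field_simps)
      moreover have "1 / (real n)\<^sup>2 \<le> 2 / (real n * real (Suc n))"
      proof -
        have "real n * real (Suc n) \<le> 2 * (real n)\<^sup>2"
          using n1 by (simp add: power2_eq_square distrib_left)
        then have "2 / (2 * (real n)\<^sup>2) \<le> 2 / (real n * real (Suc n))"
          using n1 by (intro divide_left_mono) auto
        then show ?thesis by simp
      qed
      ultimately show ?thesis using C mult_left_mono[of "1 / (real n)\<^sup>2" "2 / (real n * real (Suc n))" C] by simp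
    qed
    have "f (Suc n) * exp (2 * C / real (Suc n)) \<le> ((1 + C / (real n)\<^sup>2) * f n) * exp (2 * C / real (Suc n))"
      using N[OF n1(2)] by (intro mult_right_mono) auto
    also have "\<dots> \<le> (exp (C / (real n)\<^sup>2) * f n) * exp (2 * C / real (Suc n))"
      using f by (intro mult_right_mono exp_ge_add_one_self) auto
    also have "\<dots> = f n * exp (C / (real n)\<^sup>2 + 2 * C / real (Suc n))" by (simp add: exp_add)
    also have "\<dots> \<le> f n * exp (2 * C / real n)" using q f by (intro mult_left_mono) auto
    finally show ?thesis .
  qed
  have "f n * exp (2 * C / real n) \<le> f m * exp (2 * C / real m)" if "n \<ge> m" for n
    using that
  proof (induction n rule: dec_induct)
    case (step n)
    then show ?case using \<open>\<And>n. n \<ge> m \<Longrightarrow> f (Suc n) * exp (2 * C / real (Suc n)) \<le> f n * exp (2 * C / real n)\<close>[of n] by linarith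
  qed simp
  moreover have "f n \<le> f n * exp (2 * C / real n)" for n
    using f[of n] C by (simp add: mult_le_cancel_left1)
  ultimately have 1: "f n \<le> f m * exp (2 * C / real m)" if "n \<ge> m" for n
    using that order_trans by blast
  have "f n \<le> max (f m * exp (2 * C / real m)) (Max (f ` {..m}))" for n
  proof (cases "n \<ge> m")
    case False
    then have "f n \<le> Max (f ` {..m})" by (intro Max_ge) auto
    then show ?thesis by simp
  qed (use 1 in \<open>simp add: le_max_iff_disj\<close>)
  then show ?thesis by blast
qed

text \<open>\<^term>\<open>A n\<close> is the squared scaling; multiplication by it turns the recursion with factors
  \<^term>\<open>1 - r n * \<beta>\<close> into a contraction with steps \<^term>\<open>\<epsilon> n\<close>, rate \<^term>\<open>b\<close> and input \<^term>\<open>d\<close>.\<close>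

definition contraction_rate ::
    "(nat \<Rightarrow> real) \<Rightarrow> (nat \<Rightarrow> real) \<Rightarrow> complex \<Rightarrow> complex \<Rightarrow> complex \<Rightarrow> real \<Rightarrow> bool" where
  "contraction_rate A r \<beta>1 \<beta>2 b d \<longleftrightarrow> (\<exists>\<epsilon> bb. (\<forall>\<^sub>F n in sequentially. 0 < \<epsilon> n \<and> 0 < A n) \<and> \<epsilon> \<longlonglongrightarrow> 0 \<and>
     \<not> summable \<epsilon> \<and> bb \<longlonglongrightarrow> b \<and> 0 < Re b \<and> (\<lambda>n. A (Suc n) * (r n)\<^sup>2 / \<epsilon> n) \<longlonglongrightarrow> d \<and>
     (\<forall>\<^sub>F n in sequentially. of_real (A (Suc n) / A n) * ((1 - of_real (r n) * \<beta>1) * (1 - of_real (r n) * \<beta>2))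
        = 1 - of_real (\<epsilon> n) * bb n))"

text \<open>Multiplying the recursion by \<open>A (Suc n)\<close> puts it into the form of
  \<open>recursion_limit\<close>. The source \<open>s\<close> allows two uses: the sums of squared
  weights have \<open>s = 1\<close>, the bare products have \<open>s = 0\<close> and thus limit
  0.\<close>

lemma contraction_rate_limit:
  assumes cr: "contraction_rate A r \<beta>1 \<beta>2 b d"
    and rec: "\<And>n. L (Suc n) = (1 - of_real (r n) * \<beta>1) * (1 - of_real (r n) * \<beta>2) * L n + s * of_real ((r n)\<^sup>2)"
  shows "(\<lambda>n. of_real (A n) * L n) \<longlonglongrightarrow> s * of_real d / b"
proof -
  obtain \<epsilon> bb where h: "\<forall>\<^sub>F n in sequentially. 0 < \<epsilon> n \<and> 0 < A n" "\<epsilon> \<longlonglongrightarrow> 0" "\<not> summable \<epsilon>" "bb \<longlonglongrightarrow> b" "0 < Re b"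
     "(\<lambda>n. A (Suc n) * (r n)\<^sup>2 / \<epsilon> n) \<longlonglongrightarrow> d"
     "\<forall>\<^sub>F n in sequentially. of_real (A (Suc n) / A n) * ((1 - of_real (r n) * \<beta>1) * (1 - of_real (r n) * \<beta>2))
        = 1 - of_real (\<epsilon> n) * bb n"
    using cr unfolding contraction_rate_def by blast
  show ?thesis
  proof (rule recursion_limit[OF _ h(2,3,4,5)])
    show "\<forall>\<^sub>F n in sequentially. 0 < \<epsilon> n" using h(1) by eventually_elim simp
    show "(\<lambda>n. s * of_real (A (Suc n) * (r n)\<^sup>2 / \<epsilon> n)) \<longlonglongrightarrow> s * of_real d"
      by (intro tendsto_intros h(6))
    show "\<forall>\<^sub>F n in sequentially. of_real (A (Suc n)) * L (Suc n) =
       (1 - of_real (\<epsilon> n) * bb n) * (of_real (A n) * L n) + of_real (\<epsilon> n) * (s * of_real (A (Suc n) * (r n)\<^sup>2 / \<epsilon> n))"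
      using h(1) h(7)
    proof eventually_elim
      case (elim n)
      then have "A (Suc n) / A n * A n = A (Suc n)" "\<epsilon> n * (A (Suc n) * (r n)\<^sup>2 / \<epsilon> n) = A (Suc n) * (r n)\<^sup>2"
        by auto
      then have "of_real (A (Suc n) / A n) * of_real (A n) = (of_real (A (Suc n)) :: complex)"
        "of_real (\<epsilon> n) * of_real (A (Suc n) * (r n)\<^sup>2 / \<epsilon> n) = (of_real (A (Suc n)) * of_real ((r n)\<^sup>2) :: complex)"
        by (metis of_real_mult)+
      moreover have "a' * (x * l + s * R) = (q * x) * (a * l) + e * (s * w)"
        if "q * a = a'" "e * w = a' * R" for q a a' e w R x l :: complex
      proof -
        have "(q * x) * (a * l) + e * (s * w) = (q * a) * (x * l) + s * (e * w)" by (simp add: ac_simps)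
        also have "\<dots> = a' * (x * l + s * R)" by (simp only: that) (simp add: algebra_simps)
        finally show ?thesis by simp
      qed
      ultimately show ?case unfolding elim(2)[symmetric] rec by blast
    qed
  qed
qed

text \<open>For conjugate factors the fourth power of the modulus, scaled by the square of
  \<open>A\<close>, is the square of \<open>1 - \<epsilon> * bb\<close>, so the limiting rate
  doubles. The input acquires an additional factor \<epsilon> and vanishes, which forces the limit
  0.\<close>

lemma contraction_rate_fourth:
  assumes cr: "contraction_rate A r \<beta> (cnj \<beta>) b d"
    and rec: "\<And>n. f (Suc n) = (norm (1 - of_real (r n) * \<beta>)) ^ 4 * f n + (r n) ^ 4"
  shows "(\<lambda>n. (A n)\<^sup>2 * f n) \<longlonglongrightarrow> 0"
proof -
  obtain \<epsilon> bb where h: "\<forall>\<^sub>F n in sequentially. 0 < \<epsilon> n \<and> 0 < A n" "\<epsilon> \<longlonglongrightarrow> 0" "\<not> summable \<epsilon>" "bb \<longlonglongrightarrow> b" "0 < Re b"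
     "(\<lambda>n. A (Suc n) * (r n)\<^sup>2 / \<epsilon> n) \<longlonglongrightarrow> d"
     "\<forall>\<^sub>F n in sequentially. of_real (A (Suc n) / A n) * ((1 - of_real (r n) * \<beta>) * (1 - of_real (r n) * cnj \<beta>))
        = 1 - of_real (\<epsilon> n) * bb n"
    using cr unfolding contraction_rate_def by blast
  have "(\<lambda>n. complex_of_real ((A n)\<^sup>2 * f n)) \<longlonglongrightarrow> 0 / (2 * b - 0 * b\<^sup>2)"
  proof (rule recursion_limit[OF _ h(2,3)])
    show "\<forall>\<^sub>F n in sequentially. 0 < \<epsilon> n" using h(1) by eventually_elim simp
    show "(\<lambda>n. 2 * bb n - of_real (\<epsilon> n) * (bb n)\<^sup>2) \<longlonglongrightarrow> 2 * b - 0 * b\<^sup>2"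
      using tendsto_of_real[OF h(2), where 'a = complex] by (intro tendsto_intros h(4)) simp
    have "(\<lambda>n. complex_of_real ((A (Suc n) * (r n)\<^sup>2 / \<epsilon> n)\<^sup>2 * \<epsilon> n)) \<longlonglongrightarrow> of_real (d\<^sup>2 * 0)"
      by (intro tendsto_intros h(2,6))
    then show "(\<lambda>n. complex_of_real ((A (Suc n) * (r n)\<^sup>2 / \<epsilon> n)\<^sup>2 * \<epsilon> n)) \<longlonglongrightarrow> 0" by simp
    show "\<forall>\<^sub>F n in sequentially. complex_of_real ((A (Suc n))\<^sup>2 * f (Suc n)) =
       (1 - of_real (\<epsilon> n) * (2 * bb n - of_real (\<epsilon> n) * (bb n)\<^sup>2)) * of_real ((A n)\<^sup>2 * f n)
         + of_real (\<epsilon> n) * of_real ((A (Suc n) * (r n)\<^sup>2 / \<epsilon> n)\<^sup>2 * \<epsilon> n)"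
      using h(1) h(7)
    proof eventually_elim
      case (elim n)
      have cn: "(1 - of_real (r n) * \<beta>) * (1 - of_real (r n) * cnj \<beta>) = of_real ((norm (1 - of_real (r n) * \<beta>))\<^sup>2)"
        unfolding complex_norm_square by simp
      have "1 - of_real (\<epsilon> n) * (2 * bb n - of_real (\<epsilon> n) * (bb n)\<^sup>2) = (1 - of_real (\<epsilon> n) * bb n)\<^sup>2"
        by (simp add: power2_eq_square algebra_simps)
      also have "\<dots> = complex_of_real ((A (Suc n) / A n * (norm (1 - of_real (r n) * \<beta>))\<^sup>2)\<^sup>2)"
        unfolding elim(2)[symmetric] cn by simp
      finally have 1: "1 - of_real (\<epsilon> n) * (2 * bb n - of_real (\<epsilon> n) * (bb n)\<^sup>2) =
        complex_of_real ((A (Suc n) / A n * (norm (1 - of_real (r n) * \<beta>))\<^sup>2)\<^sup>2)" .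
      have "(A (Suc n))\<^sup>2 * f (Suc n) = (A (Suc n) / A n * (norm (1 - of_real (r n) * \<beta>))\<^sup>2)\<^sup>2 * ((A n)\<^sup>2 * f n)
         + \<epsilon> n * ((A (Suc n) * (r n)\<^sup>2 / \<epsilon> n)\<^sup>2 * \<epsilon> n)"
        using elim(1) by (simp add: rec power_mult_distrib power_divide field_simps power2_eq_square numeral_eq_Suc)
      then show ?case unfolding 1 of_real_mult[symmetric] of_real_add[symmetric] by simp
    qed
  qed (use h(5) in simp)
  then have "(\<lambda>n. complex_of_real ((A n)\<^sup>2 * f n)) \<longlonglongrightarrow> of_real 0" by simp
  then show ?thesis by (simp only: tendsto_of_real_iff)
qed

text \<open>To first order \<open>A (Suc n) / A n\<close> is
  \<open>1 + \<kappa> * \<epsilon>\<close> and the two factors give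
  \<open>1 - c * \<epsilon> * (\<beta>1 + \<beta>2)\<close>. The rate is therefore the contraction
  \<open>c * (\<beta>1 + \<beta>2)\<close> minus the growth \<kappa> of the scaling.\<close>

lemma contraction_rateI:
  assumes pos: "\<forall>\<^sub>F n in sequentially. 0 < \<epsilon> n \<and> 0 < A n" and \<epsilon>: "\<epsilon> \<longlonglongrightarrow> 0" "\<not> summable \<epsilon>"
    and A1: "(\<lambda>n. A (Suc n) / A n) \<longlonglongrightarrow> 1" and A\<epsilon>: "(\<lambda>n. (1 - A (Suc n) / A n) / \<epsilon> n) \<longlonglongrightarrow> - \<kappa>"
    and r: "r \<longlonglongrightarrow> 0" "(\<lambda>n. r n / \<epsilon> n) \<longlonglongrightarrow> c" and d: "(\<lambda>n. A (Suc n) * (r n)\<^sup>2 / \<epsilon> n) \<longlonglongrightarrow> d"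
    and b: "0 < Re (of_real c * (\<beta>1 + \<beta>2) - of_real \<kappa>)"
  shows "contraction_rate A r \<beta>1 \<beta>2 (of_real c * (\<beta>1 + \<beta>2) - of_real \<kappa>) d"
proof -
  define bb where "bb n = of_real ((1 - A (Suc n) / A n) / \<epsilon> n) +
     of_real (A (Suc n) / A n) * of_real (r n / \<epsilon> n) * (\<beta>1 + \<beta>2 - of_real (r n) * (\<beta>1 * \<beta>2))" for n
  have "bb \<longlonglongrightarrow> of_real (- \<kappa>) + of_real 1 * of_real c * (\<beta>1 + \<beta>2 - of_real 0 * (\<beta>1 * \<beta>2))"
    unfolding bb_def by (intro tendsto_intros A1 A\<epsilon> r)
  then have "bb \<longlonglongrightarrow> of_real c * (\<beta>1 + \<beta>2) - of_real \<kappa>" by simp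
  moreover have "\<forall>\<^sub>F n in sequentially. of_real (A (Suc n) / A n) * ((1 - of_real (r n) * \<beta>1) * (1 - of_real (r n) * \<beta>2))
        = 1 - of_real (\<epsilon> n) * bb n"
    using pos
  proof eventually_elim
    case (elim n)
    have 1: "of_real (\<epsilon> n) * of_real ((1 - A (Suc n) / A n) / \<epsilon> n) = (1 - of_real (A (Suc n) / A n) :: complex)"
    proof -
      have "\<epsilon> n * ((1 - A (Suc n) / A n) / \<epsilon> n) = 1 - A (Suc n) / A n" using elim by simp
      then show ?thesis by (metis of_real_1 of_real_diff of_real_mult)
    qed
    have 2: "of_real (\<epsilon> n) * of_real (r n / \<epsilon> n) = (of_real (r n) :: complex)"
    proof -
      have "\<epsilon> n * (r n / \<epsilon> n) = r n" using elim by simp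
      then show ?thesis by (metis of_real_mult)
    qed
    have "of_real (\<epsilon> n) * bb n = of_real (\<epsilon> n) * of_real ((1 - A (Suc n) / A n) / \<epsilon> n) +
       of_real (A (Suc n) / A n) * (of_real (\<epsilon> n) * of_real (r n / \<epsilon> n)) * (\<beta>1 + \<beta>2 - of_real (r n) * (\<beta>1 * \<beta>2))"
      unfolding bb_def by (simp only: distrib_left ac_simps)
    moreover have "q * ((1 - \<rho> * \<beta>1) * (1 - \<rho> * \<beta>2)) = 1 - e * w"
      if "e * w = 1 - q + q * \<rho> * (\<beta>1 + \<beta>2 - \<rho> * (\<beta>1 * \<beta>2))" for q \<rho> e w :: complex
      using that by algebra
    ultimately show ?case unfolding 1 2 by blast
  qed
  ultimately show ?thesis unfolding contraction_rate_def using pos \<epsilon> b d by blast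
qed

section \<open>Rates for the scalings of the three regimes\<close>

lemma not_summable_powr: "\<gamma> \<le> 1 \<Longrightarrow> \<not> summable (\<lambda>n. real n powr (- \<gamma>))"
  by (simp add: summable_real_powr_iff)

text \<open>The terms dominate the increments of \<open>ln (ln n)\<close>, which is unbounded. These
  are the step sizes of the resonant case.\<close>

lemma not_summable_inverse_n_ln: "\<not> summable (\<lambda>n. 1 / (real n * ln (real n)))"
proof
  assume S: "summable (\<lambda>n. 1 / (real n * ln (real n)))"
  define f where "f n = ln (ln (real n))" for n
  have "summable (\<lambda>n. f (Suc n) - f n)"
  proof (rule summable_comparison_test_ev[OF _ S])
    show "\<forall>\<^sub>F n in sequentially. norm (f (Suc n) - f n) \<le> 1 / (real n * ln (real n))"
      using eventually_ge_at_top[of 3]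
    proof eventually_elim
      case (elim n)
      then have l: "0 < ln (real n)" "ln (real n) \<le> ln (real (Suc n))" by simp_all
      have "f (Suc n) - f n = ln (ln (real (Suc n)) / ln (real n))"
        using l by (simp add: f_def ln_div)
      also have "\<dots> \<le> ln (real (Suc n)) / ln (real n) - 1" using l by (intro ln_le_minus_one divide_pos_pos) linarith+
      also have "\<dots> = ln (real (Suc n) / real n) / ln (real n)" using l elim by (simp add: ln_div field_simps)
      also have "\<dots> \<le> (real (Suc n) / real n - 1) / ln (real n)"
        using l elim by (intro divide_right_mono ln_le_minus_one) auto
      also have "\<dots> = 1 / (real n * ln (real n))" using elim by (simp add: field_simps)
      finally have "f (Suc n) - f n \<le> 1 / (real n * ln (real n))" .
      moreover have "ln (ln (real n)) \<le> ln (ln (real (Suc n)))"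
        by (rule iffD2[OF ln_le_cancel_iff]) (use l in linarith)+
      then have "0 \<le> f (Suc n) - f n" by (simp add: f_def)
      ultimately show ?case by simp
    qed
  qed
  then obtain l where "(\<lambda>n. \<Sum>i<n. f (Suc i) - f i) \<longlonglongrightarrow> l"
    by (auto simp: summable_def sums_def)
  then have "(\<lambda>n. f n - f 0 + f 0) \<longlonglongrightarrow> l + f 0"
    unfolding sum_lessThan_telescope by (intro tendsto_add tendsto_const)
  then have "convergent f" by (auto simp: convergent_def)
  then have "Bseq f" by (rule convergent_imp_Bseq)
  then obtain B where B: "\<And>n. f n \<le> B" by (metis Bseq_def abs_le_D1 real_norm_def)
  have "filterlim f at_top sequentially" unfolding f_def by real_asymp
  then have "eventually (\<lambda>n. f n \<ge> B + 1) sequentially" by (simp add: filterlim_at_top)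
  then obtain n where "f n \<ge> B + 1" by (auto simp: eventually_sequentially)
  with B[of n] show False by simp
qed

text \<open>Steps of size \<open>n powr (- \<gamma>)\<close> dominate the relative growth of the
  scaling, which is of order \<open>1 / n\<close>; so nothing is subtracted from the rate. The input
  is of order \<open>n powr (\<gamma> - 1)\<close> and vanishes: at this scale the components along
  \<open>u 2, ..., u N\<close> leave no trace in the limit.\<close>

lemma contraction_rate_power:
  assumes r: "(\<lambda>n. real n powr \<gamma> * r n) \<longlonglongrightarrow> c" and \<gamma>: "1 / 2 < \<gamma>" "\<gamma> < 1"
    and b: "0 < Re (of_real c * (\<beta>1 + \<beta>2))"
  shows "contraction_rate (\<lambda>n. real n powr (2 * \<gamma> - 1)) r \<beta>1 \<beta>2 (of_real c * (\<beta>1 + \<beta>2)) 0"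
proof -
  have "contraction_rate (\<lambda>n. real n powr (2 * \<gamma> - 1)) r \<beta>1 \<beta>2 (of_real c * (\<beta>1 + \<beta>2) - of_real 0) 0"
  proof (rule contraction_rateI[where \<epsilon> = "\<lambda>n. real n powr (- \<gamma>)"])
    show "\<forall>\<^sub>F n in sequentially. 0 < real n powr - \<gamma> \<and> 0 < real n powr (2 * \<gamma> - 1)"
      using eventually_gt_at_top[of 0] by eventually_elim simp
    have g0: "0 < \<gamma>" using \<gamma> by simp
    show e0: "(\<lambda>n. real n powr - \<gamma>) \<longlonglongrightarrow> 0" using g0 by real_asymp
    show "\<not> summable (\<lambda>n. real n powr - \<gamma>)" using not_summable_powr \<gamma> by simp
    show "(\<lambda>n. real (Suc n) powr (2 * \<gamma> - 1) / real n powr (2 * \<gamma> - 1)) \<longlonglongrightarrow> 1" by real_asymp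
    show "(\<lambda>n. (1 - real (Suc n) powr (2 * \<gamma> - 1) / real n powr (2 * \<gamma> - 1)) / real n powr - \<gamma>) \<longlonglongrightarrow> - 0"
      using \<gamma> by simp real_asymp
    have "\<forall>\<^sub>F n in sequentially. real n powr - \<gamma> * (real n powr \<gamma> * r n) = r n"
      using eventually_gt_at_top[of 0] by eventually_elim (simp add: powr_minus)
    from Lim_transform_eventually[OF tendsto_mult[OF e0 r] this] show "r \<longlonglongrightarrow> 0" by simp
    show "(\<lambda>n. r n / real n powr - \<gamma>) \<longlonglongrightarrow> c" using r by (simp add: powr_minus field_simps)
    have "(\<lambda>n. real (Suc n) powr (2 * \<gamma> - 1) / real n powr \<gamma>) \<longlonglongrightarrow> 0" using \<gamma> by real_asymp
    then have "(\<lambda>n. real (Suc n) powr (2 * \<gamma> - 1) / real n powr \<gamma> * (real n powr \<gamma> * r n)\<^sup>2) \<longlonglongrightarrow> 0 * c\<^sup>2"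
      by (intro tendsto_mult tendsto_power r)
    moreover have "\<forall>\<^sub>F n in sequentially. real (Suc n) powr (2 * \<gamma> - 1) / real n powr \<gamma> * (real n powr \<gamma> * r n)\<^sup>2
       = real (Suc n) powr (2 * \<gamma> - 1) * (r n)\<^sup>2 / real n powr - \<gamma>"
      using eventually_gt_at_top[of 0]
      by eventually_elim (simp add: powr_minus field_simps power2_eq_square)
    ultimately show "(\<lambda>n. real (Suc n) powr (2 * \<gamma> - 1) * (r n)\<^sup>2 / real n powr - \<gamma>) \<longlonglongrightarrow> 0"
      by (simp add: Lim_transform_eventually)
  qed (use b in simp)
  then show ?thesis by simp
qed

lemma r_null:
  assumes "(\<lambda>n. real n * r n) \<longlonglongrightarrow> c"
  shows "r \<longlonglongrightarrow> 0"
proof -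
  have "(\<lambda>n. 1 / real n * (real n * r n)) \<longlonglongrightarrow> 0 * c" by (intro tendsto_mult assms) real_asymp
  moreover have "\<forall>\<^sub>F n in sequentially. 1 / real n * (real n * r n) = r n"
    using eventually_gt_at_top[of 0] by eventually_elim simp
  ultimately show ?thesis by (simp add: Lim_transform_eventually)
qed

lemma not_summable_inverse_n: "\<not> summable (\<lambda>n. 1 / real n)"
  using not_summable_powr[of 1] by (simp add: powr_minus_divide)

text \<open>Here the scaling grows by exactly \<open>1 / n\<close>, as large as the steps. This is
  the origin of the \<open>- 1\<close> in the rate, of the threshold in the hypothesis and of the
  denominator in \<open>S_hat\<close>.\<close>

lemma contraction_rate_linear:
  assumes r: "(\<lambda>n. real n * r n) \<longlonglongrightarrow> c" and b: "1 < Re (of_real c * (\<beta>1 + \<beta>2))"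
  shows "contraction_rate (\<lambda>n. real n) r \<beta>1 \<beta>2 (of_real c * (\<beta>1 + \<beta>2) - 1) (c\<^sup>2)"
proof -
  have "contraction_rate (\<lambda>n. real n) r \<beta>1 \<beta>2 (of_real c * (\<beta>1 + \<beta>2) - of_real 1) (c\<^sup>2)"
  proof (rule contraction_rateI[where \<epsilon> = "\<lambda>n. 1 / real n"])
    show "\<forall>\<^sub>F n in sequentially. 0 < 1 / real n \<and> 0 < real n"
      using eventually_gt_at_top[of 0] by eventually_elim simp
    show "(\<lambda>n. 1 / real n) \<longlonglongrightarrow> 0" by real_asymp
    show "(\<lambda>n. real (Suc n) / real n) \<longlonglongrightarrow> 1" by real_asymp
    show "(\<lambda>n. (1 - real (Suc n) / real n) / (1 / real n)) \<longlonglongrightarrow> - 1" by real_asymp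
    have "(\<lambda>n. real (Suc n) / real n * (real n * r n)\<^sup>2) \<longlonglongrightarrow> 1 * c\<^sup>2"
      by (intro tendsto_mult tendsto_power r) real_asymp
    moreover have "\<forall>\<^sub>F n in sequentially. real (Suc n) / real n * (real n * r n)\<^sup>2 = real (Suc n) * (r n)\<^sup>2 / (1 / real n)"
      using eventually_gt_at_top[of 0]
      by eventually_elim (simp add: field_simps power2_eq_square)
    ultimately show "(\<lambda>n. real (Suc n) * (r n)\<^sup>2 / (1 / real n)) \<longlonglongrightarrow> c\<^sup>2"
      by (simp add: Lim_transform_eventually)
  qed (use b r r_null[OF r] in \<open>auto simp: not_summable_inverse_n mult.commute\<close>)
  then show ?thesis by simp
qed

text \<open>The logarithm changes the relative growth of the scaling only at order
  \<open>1 / (n * ln n)\<close>, so the rate is as without it, while the input is divided by a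
  logarithm and disappears.\<close>

lemma contraction_rate_log_strict:
  assumes r: "(\<lambda>n. real n * r n) \<longlonglongrightarrow> c" and b: "1 < Re (of_real c * (\<beta>1 + \<beta>2))"
  shows "contraction_rate (\<lambda>n. real n / ln (real n)) r \<beta>1 \<beta>2 (of_real c * (\<beta>1 + \<beta>2) - 1) 0"
proof -
  have "contraction_rate (\<lambda>n. real n / ln (real n)) r \<beta>1 \<beta>2 (of_real c * (\<beta>1 + \<beta>2) - of_real 1) 0"
  proof (rule contraction_rateI[where \<epsilon> = "\<lambda>n. 1 / real n"])
    show "\<forall>\<^sub>F n in sequentially. 0 < 1 / real n \<and> 0 < real n / ln (real n)"
      using eventually_gt_at_top[of 2] by eventually_elim simp
    show "(\<lambda>n. 1 / real n) \<longlonglongrightarrow> 0" by real_asymp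
    show "(\<lambda>n. real (Suc n) / ln (real (Suc n)) / (real n / ln (real n))) \<longlonglongrightarrow> 1" by real_asymp
    \<comment> \<open>This is \<open>n\<close> times one minus the quotient of consecutive scalings,
      put over the common denominator \<open>ln (Suc n)\<close>.\<close>
    have "(\<lambda>n. real n * (ln (real (Suc n)) - ln (real n)) / ln (real (Suc n)) - ln (real n) / ln (real (Suc n))) \<longlonglongrightarrow> 0 - 1"
    proof (intro tendsto_diff)
      have "(\<lambda>n. real n * (ln (real (Suc n)) - ln (real n)) * (1 / ln (real (Suc n)))) \<longlonglongrightarrow> 1 * 0"
        by (intro tendsto_mult) real_asymp+
      then show "(\<lambda>n. real n * (ln (real (Suc n)) - ln (real n)) / ln (real (Suc n))) \<longlonglongrightarrow> 0" by simp
    qed real_asymp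
    moreover have "\<forall>\<^sub>F n in sequentially. real n * (ln (real (Suc n)) - ln (real n)) / ln (real (Suc n)) - ln (real n) / ln (real (Suc n))
       = (1 - real (Suc n) / ln (real (Suc n)) / (real n / ln (real n))) / (1 / real n)"
      using eventually_gt_at_top[of 2]
    proof eventually_elim
      case (elim n)
      then have "0 < ln (real n)" "0 < ln (real (Suc n))" by simp_all
      then show ?case using elim by (simp add: field_simps)
    qed
    ultimately show "(\<lambda>n. (1 - real (Suc n) / ln (real (Suc n)) / (real n / ln (real n))) / (1 / real n)) \<longlonglongrightarrow> - 1"
      by (simp add: Lim_transform_eventually)
    have "(\<lambda>n. real (Suc n) / ln (real (Suc n)) / real n * (real n * r n)\<^sup>2) \<longlonglongrightarrow> 0 * c\<^sup>2"
      by (intro tendsto_mult tendsto_power r) real_asymp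
    moreover have "\<forall>\<^sub>F n in sequentially. real (Suc n) / ln (real (Suc n)) / real n * (real n * r n)\<^sup>2
        = real (Suc n) / ln (real (Suc n)) * (r n)\<^sup>2 / (1 / real n)"
      using eventually_gt_at_top[of 0]
      by eventually_elim (simp add: field_simps power2_eq_square)
    ultimately show "(\<lambda>n. real (Suc n) / ln (real (Suc n)) * (r n)\<^sup>2 / (1 / real n)) \<longlonglongrightarrow> 0"
      by (simp add: Lim_transform_eventually)
  qed (use b r r_null[OF r] in \<open>auto simp: not_summable_inverse_n mult.commute\<close>)
  then show ?thesis by simp
qed

text \<open>Used with \<^term>\<open>\<kappa>\<close> purely imaginary: then \<^term>\<open>1 - \<kappa> / n\<close> does not contract, and the errors have
  to be summable.\<close>

lemma critical_factor:
  fixes \<beta>1 \<beta>2 \<kappa> :: complex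
  assumes r: "(\<lambda>n. real n * r n) \<longlonglongrightarrow> c" and O: "(\<lambda>n. real n * r n - c) \<in> O(\<lambda>n. 1 / real n)"
    and \<kappa>: "\<kappa> = of_real c * (\<beta>1 + \<beta>2) - 1"
  obtains C f where "0 \<le> C"
    "\<forall>\<^sub>F n in sequentially. norm (f n) \<le> C / (real n)\<^sup>2"
    "\<forall>\<^sub>F n in sequentially. of_real (real (Suc n) / real n) * ((1 - of_real (r n) * \<beta>1) * (1 - of_real (r n) * \<beta>2))
        = 1 - \<kappa> / of_nat n + f n"
    "\<forall>\<^sub>F n in sequentially. \<bar>real (Suc n) * (r n)\<^sup>2 - c\<^sup>2 / real n\<bar> \<le> C / (real n)\<^sup>2"
proof -
  obtain C1 where C1: "C1 > 0" "\<forall>\<^sub>F n in sequentially. \<bar>real n * r n - c\<bar> \<le> C1 * \<bar>1 / real n\<bar>"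
    using O by (auto elim!: landau_o.bigE)
  define \<rho> where "\<rho> n = r n - c / real n" for n
  have \<rho>: "\<forall>\<^sub>F n in sequentially. \<bar>\<rho> n\<bar> \<le> C1 / (real n)\<^sup>2"
    using C1(2) eventually_gt_at_top[of 0]
  proof eventually_elim
    case (elim n)
    have "\<rho> n = (real n * r n - c) / real n" using elim(2) by (simp add: \<rho>_def diff_divide_distrib)
    then have "\<bar>\<rho> n\<bar> = \<bar>real n * r n - c\<bar> / real n" by simp
    also have "\<dots> \<le> C1 * \<bar>1 / real n\<bar> / real n" using elim by (intro divide_right_mono) auto
    finally show ?case by (simp add: power2_eq_square)
  qed
  define R where "R = \<bar>c\<bar> + 1"
  have R: "\<forall>\<^sub>F n in sequentially. \<bar>r n\<bar> \<le> R / real n"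
  proof -
    have "\<forall>\<^sub>F n in sequentially. \<bar>real n * r n\<bar> < R"
      by (rule order_tendstoD(2)[OF tendsto_rabs[OF r]]) (simp add: R_def)
    then show ?thesis using eventually_gt_at_top[of 0]
      by eventually_elim (simp add: abs_mult field_simps)
  qed
  define f where "f n = of_real (real (Suc n) / real n) * ((1 - of_real (r n) * \<beta>1) * (1 - of_real (r n) * \<beta>2))
        - (1 - \<kappa> / of_nat n)" for n
  define C where "C = norm (of_real c * (\<beta>1 + \<beta>2)) + 2 * (C1 * norm (\<beta>1 + \<beta>2) + R\<^sup>2 * norm (\<beta>1 * \<beta>2))
     + (R\<^sup>2 + C1 * (R + \<bar>c\<bar>))"
  have C0: "0 \<le> C" using C1(1) unfolding C_def R_def by (intro add_nonneg_nonneg mult_nonneg_nonneg) auto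
  have "\<forall>\<^sub>F n in sequentially. norm (f n) \<le> C / (real n)\<^sup>2"
    using \<rho> R eventually_gt_at_top[of 0]
  proof eventually_elim
    case (elim n)
    have n: "(of_nat n :: complex) \<noteq> 0" using elim(3) by simp
    have rr: "of_real (r n) = of_real c / of_nat n + (of_real (\<rho> n) :: complex)" by (simp add: \<rho>_def)
    define w where "w = (of_real (r n) :: complex)"
    \<comment> \<open>With \<open>r n = c / n + \<rho> n\<close> all terms of order
      \<open>1 / n\<close> cancel against \<kappa>; only products of two small quantities and the
      terms with \<open>\<rho> n\<close> remain.\<close>
    have "f n = - (of_real c * (\<beta>1 + \<beta>2)) / (of_nat n)\<^sup>2 + (1 + 1 / of_nat n) * (- of_real (\<rho> n) * (\<beta>1 + \<beta>2) + w\<^sup>2 * (\<beta>1 * \<beta>2))"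
    proof -
      have "of_real (real (Suc n) / real n) = 1 + 1 / (of_nat n :: complex)"
        using n by (simp add: field_simps)
      moreover have "(1 - w * \<beta>1) * (1 - w * \<beta>2) = 1 - w * (\<beta>1 + \<beta>2) + w\<^sup>2 * (\<beta>1 * \<beta>2)"
        by (simp add: algebra_simps power2_eq_square)
      ultimately have "f n = (1 + 1 / of_nat n) * (1 - w * (\<beta>1 + \<beta>2) + w\<^sup>2 * (\<beta>1 * \<beta>2)) - (1 - \<kappa> / of_nat n)"
        by (simp add: f_def w_def)
      also have "\<dots> = (1 + 1 / of_nat n) * (1 - (of_real c / of_nat n + of_real (\<rho> n)) * (\<beta>1 + \<beta>2) + w\<^sup>2 * (\<beta>1 * \<beta>2)) - (1 - \<kappa> / of_nat n)"
        unfolding rr[symmetric] w_def by (simp add: distrib_left)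
      finally show ?thesis unfolding \<kappa> using n by (simp add: field_simps power2_eq_square)
    qed
    also have "norm \<dots> \<le> norm (of_real c * (\<beta>1 + \<beta>2)) / (real n)\<^sup>2 + 2 * (C1 / (real n)\<^sup>2 * norm (\<beta>1 + \<beta>2) + (R / real n)\<^sup>2 * norm (\<beta>1 * \<beta>2))"
    proof (rule norm_triangle_mono)
      show "norm (- (of_real c * (\<beta>1 + \<beta>2)) / (of_nat n)\<^sup>2) \<le> norm (of_real c * (\<beta>1 + \<beta>2)) / (real n)\<^sup>2"
        by (simp add: norm_divide norm_power norm_mult)
      show "norm ((1 + 1 / of_nat n) * (- of_real (\<rho> n) * (\<beta>1 + \<beta>2) + w\<^sup>2 * (\<beta>1 * \<beta>2)))
        \<le> 2 * (C1 / (real n)\<^sup>2 * norm (\<beta>1 + \<beta>2) + (R / real n)\<^sup>2 * norm (\<beta>1 * \<beta>2))"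
        unfolding norm_mult[of "1 + 1 / of_nat n"]
      proof (rule mult_mono)
        have "norm (1 + 1 / of_nat n :: complex) \<le> 1 + 1 / real n"
          by (rule order_trans[OF norm_triangle_ineq]) (simp add: norm_divide)
        also have "\<dots> \<le> 2" using elim(3) by simp
        finally show "norm (1 + 1 / of_nat n :: complex) \<le> 2" .
        show "norm (- of_real (\<rho> n) * (\<beta>1 + \<beta>2) + w\<^sup>2 * (\<beta>1 * \<beta>2)) \<le> C1 / (real n)\<^sup>2 * norm (\<beta>1 + \<beta>2) + (R / real n)\<^sup>2 * norm (\<beta>1 * \<beta>2)"
        proof (rule norm_triangle_mono)
          show "norm (- of_real (\<rho> n) * (\<beta>1 + \<beta>2)) \<le> C1 / (real n)\<^sup>2 * norm (\<beta>1 + \<beta>2)"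
            unfolding norm_mult using elim(1) by (intro mult_right_mono) auto
          show "norm (w\<^sup>2 * (\<beta>1 * \<beta>2)) \<le> (R / real n)\<^sup>2 * norm (\<beta>1 * \<beta>2)"
            unfolding norm_mult[of "w\<^sup>2"] norm_power using elim(2)
            by (intro mult_right_mono power_mono) (auto simp: w_def)
        qed
      qed (use C1(1) in auto)
    qed
    also have "\<dots> = (norm (of_real c * (\<beta>1 + \<beta>2)) + 2 * (C1 * norm (\<beta>1 + \<beta>2) + R\<^sup>2 * norm (\<beta>1 * \<beta>2))) / (real n)\<^sup>2"
      by (simp add: power_divide add_divide_distrib)
    also have "\<dots> \<le> C / (real n)\<^sup>2"
      using C1(1) by (intro divide_right_mono) (auto simp: C_def R_def)
    finally show ?case .
  qed
  moreover have "\<forall>\<^sub>F n in sequentially. of_real (real (Suc n) / real n) * ((1 - of_real (r n) * \<beta>1) * (1 - of_real (r n) * \<beta>2))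
        = 1 - \<kappa> / of_nat n + f n"
    by (simp add: f_def)
  moreover have "\<forall>\<^sub>F n in sequentially. \<bar>real (Suc n) * (r n)\<^sup>2 - c\<^sup>2 / real n\<bar> \<le> C / (real n)\<^sup>2"
    using \<rho> R eventually_gt_at_top[of 0]
  proof eventually_elim
    case (elim n)
    have "real (Suc n) * (r n)\<^sup>2 - c\<^sup>2 / real n = (r n)\<^sup>2 + real n * (\<rho> n * (r n + c / real n))"
      using elim(3) by (simp add: \<rho>_def field_simps power2_eq_square)
    also have "\<bar>\<dots>\<bar> \<le> (R / real n)\<^sup>2 + real n * (C1 / (real n)\<^sup>2 * (R / real n + \<bar>c\<bar> / real n))"
    proof -
      have "\<bar>(r n)\<^sup>2\<bar> \<le> (R / real n)\<^sup>2" using power_mono[OF elim(2), of 2] by simp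
      moreover have "\<bar>real n * (\<rho> n * (r n + c / real n))\<bar> \<le> real n * (C1 / (real n)\<^sup>2 * (R / real n + \<bar>c\<bar> / real n))"
        unfolding abs_mult
      proof (intro mult_mono)
        have "\<bar>r n + c / real n\<bar> \<le> \<bar>r n\<bar> + \<bar>c / real n\<bar>" by (rule abs_triangle_ineq)
        then show "\<bar>r n + c / real n\<bar> \<le> R / real n + \<bar>c\<bar> / real n" using elim(2) by (simp add: abs_divide)
      qed (use elim C1(1) in auto)
      ultimately show ?thesis by linarith
    qed
    also have "\<dots> = (R\<^sup>2 + C1 * (R + \<bar>c\<bar>)) / (real n)\<^sup>2"
      using elim(3) by (simp add: field_simps power2_eq_square)
    also have "\<dots> \<le> C / (real n)\<^sup>2"
      using C1(1) by (intro divide_right_mono) (auto simp: C_def R_def)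
    finally show ?case .
  qed
  ultimately show ?thesis using that C0 by blast
qed

text \<open>The contraction of order \<open>1 / n\<close> cancels completely against the growth of
  \<open>n\<close>. What is left comes from the logarithm: \<open>ln n / ln (Suc n)\<close> is about
  \<open>1 - 1 / (n * ln n)\<close>, which yields these step sizes and the rate 1. Errors of order
  \<open>1 / n^2\<close> remain negligible after division by such a step.\<close>

lemma contraction_rate_log_resonant:
  assumes r: "(\<lambda>n. real n * r n) \<longlonglongrightarrow> c" and O: "(\<lambda>n. real n * r n - c) \<in> O(\<lambda>n. 1 / real n)"
    and b: "of_real c * (\<beta>1 + \<beta>2) = 1"
  shows "contraction_rate (\<lambda>n. real n / ln (real n)) r \<beta>1 \<beta>2 1 (c\<^sup>2)"
proof -
  obtain C f where C: "0 \<le> C"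
    "\<forall>\<^sub>F n in sequentially. norm (f n) \<le> C / (real n)\<^sup>2"
    "\<forall>\<^sub>F n in sequentially. of_real (real (Suc n) / real n) * ((1 - of_real (r n) * \<beta>1) * (1 - of_real (r n) * \<beta>2))
        = 1 - 0 / of_nat n + f n"
    "\<forall>\<^sub>F n in sequentially. \<bar>real (Suc n) * (r n)\<^sup>2 - c\<^sup>2 / real n\<bar> \<le> C / (real n)\<^sup>2"
    by (rule critical_factor[OF r O, of 0 \<beta>1 \<beta>2]) (use b in simp)
  define \<epsilon> where "\<epsilon> n = 1 / (real n * ln (real n))" for n
  define q where "q n = ln (real n) / ln (real (Suc n))" for n
  define bb where "bb n = of_real ((1 - q n) / \<epsilon> n) - of_real (q n) * (f n * of_real (1 / \<epsilon> n))" for n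
  have big: "\<forall>\<^sub>F n in sequentially. n > 2" by (rule eventually_gt_at_top)
  have q1: "q \<longlonglongrightarrow> 1" unfolding q_def by real_asymp
  have "(\<lambda>n. real n * (ln (real (Suc n)) - ln (real n)) * q n) \<longlonglongrightarrow> 1 * 1"
    by (intro tendsto_mult q1) real_asymp
  moreover have "\<forall>\<^sub>F n in sequentially. real n * (ln (real (Suc n)) - ln (real n)) * q n = (1 - q n) / \<epsilon> n"
    using big
  proof eventually_elim
    case (elim n)
    then have "0 < ln (real n)" "0 < ln (real (Suc n))" by simp_all
    then show ?case using elim by (simp add: q_def \<epsilon>_def field_simps)
  qed
  ultimately have "(\<lambda>n. (1 - q n) / \<epsilon> n) \<longlonglongrightarrow> 1 * 1" by (rule Lim_transform_eventually)
  then have l1: "(\<lambda>n. (1 - q n) / \<epsilon> n) \<longlonglongrightarrow> 1" by simp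
  have "(\<lambda>n. C * (ln (real n) / real n)) \<longlonglongrightarrow> C * 0" by (intro tendsto_mult tendsto_const) real_asymp
  then have g0: "(\<lambda>n. C * (ln (real n) / real n)) \<longlonglongrightarrow> 0" by simp
  have l2: "(\<lambda>n. f n * of_real (1 / \<epsilon> n)) \<longlonglongrightarrow> 0"
  proof (rule Lim_null_comparison[OF _ g0])
    show "\<forall>\<^sub>F n in sequentially. norm (f n * of_real (1 / \<epsilon> n)) \<le> C * (ln (real n) / real n)"
      using C(2) big
    proof eventually_elim
      case (elim n)
      have "norm (f n * of_real (1 / \<epsilon> n)) = norm (f n) * (real n * ln (real n))"
        using elim by (simp add: \<epsilon>_def norm_mult abs_mult)
      also have "\<dots> \<le> C / (real n)\<^sup>2 * (real n * ln (real n))"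
        using elim by (intro mult_right_mono) auto
      also have "\<dots> = C * (ln (real n) / real n)" using elim by (simp add: power2_eq_square)
      finally show ?case .
    qed
  qed
  have "bb \<longlonglongrightarrow> of_real 1 - of_real 1 * 0" unfolding bb_def
    by (intro tendsto_intros l1 l2 q1)
  then have bb: "bb \<longlonglongrightarrow> 1" by simp
  have id: "\<forall>\<^sub>F n in sequentially. of_real ((real (Suc n) / ln (real (Suc n))) / (real n / ln (real n))) * ((1 - of_real (r n) * \<beta>1) * (1 - of_real (r n) * \<beta>2))
        = 1 - of_real (\<epsilon> n) * bb n"
    using C(3) big
  proof eventually_elim
    case (elim n)
    then have p: "0 < ln (real n)" "0 < ln (real (Suc n))" by simp_all
    then have e: "\<epsilon> n \<noteq> 0" using elim by (simp add: \<epsilon>_def)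
    have "(real (Suc n) / ln (real (Suc n))) / (real n / ln (real n)) = q n * (real (Suc n) / real n)"
      using p elim by (simp add: q_def)
    then have "of_real ((real (Suc n) / ln (real (Suc n))) / (real n / ln (real n))) * ((1 - of_real (r n) * \<beta>1) * (1 - of_real (r n) * \<beta>2))
       = of_real (q n) * (1 + f n)"
      using elim(1) by (simp only: of_real_mult mult.assoc div_0 diff_0_right)
    also have "\<dots> = 1 - of_real (\<epsilon> n) * bb n"
    proof -
      have "\<epsilon> n * ((1 - q n) / \<epsilon> n) = 1 - q n" "\<epsilon> n * (1 / \<epsilon> n) = 1" using e by simp_all
      then have "of_real (\<epsilon> n) * of_real ((1 - q n) / \<epsilon> n) = (1 - of_real (q n) :: complex)"
        "of_real (\<epsilon> n) * of_real (1 / \<epsilon> n) = (1::complex)" by (metis of_real_1 of_real_diff of_real_mult)+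
      moreover have "q' * (1 + f') = 1 - e * (a - q' * (f' * i))" if "e * a = 1 - q'" "e * i = 1" for q' f' e a i :: complex
      proof -
        have "e * (a - q' * (f' * i)) = e * a - (e * i) * (q' * f')" by (simp add: algebra_simps)
        then show ?thesis unfolding that by (simp add: algebra_simps)
      qed
      ultimately show ?thesis unfolding bb_def by blast
    qed
    finally show ?case .
  qed
  have d: "(\<lambda>n. real (Suc n) / ln (real (Suc n)) * (r n)\<^sup>2 / \<epsilon> n) \<longlonglongrightarrow> c\<^sup>2"
  proof -
    have "(\<lambda>n. real (Suc n) / real n * q n * (real n * r n)\<^sup>2) \<longlonglongrightarrow> 1 * 1 * c\<^sup>2"
      by (intro tendsto_mult tendsto_power r q1) real_asymp
    moreover have "\<forall>\<^sub>F n in sequentially. real (Suc n) / real n * q n * (real n * r n)\<^sup>2 = real (Suc n) / ln (real (Suc n)) * (r n)\<^sup>2 / \<epsilon> n"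
      using big by eventually_elim (simp add: q_def \<epsilon>_def field_simps power2_eq_square)
    ultimately show ?thesis by (simp add: Lim_transform_eventually)
  qed
  have ep: "\<forall>\<^sub>F n in sequentially. 0 < \<epsilon> n \<and> 0 < real n / ln (real n)"
    using big by eventually_elim (simp add: \<epsilon>_def)
  have e0: "\<epsilon> \<longlonglongrightarrow> 0" unfolding \<epsilon>_def by real_asymp
  have "\<not> summable \<epsilon>" using not_summable_inverse_n_ln by (simp add: \<epsilon>_def[abs_def])
  then show ?thesis unfolding contraction_rate_def using ep e0 bb d id by (intro exI[of _ \<epsilon>] exI[of _ bb]) simp
qed

text \<open>At a purely imaginary nonzero rate there is no logarithmic growth: after subtracting the fixed
  point of the limiting recursion, \<^term>\<open>n * L n\<close> stays bounded.\<close>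

lemma critical_nonresonant_limit:
  assumes r: "(\<lambda>n. real n * r n) \<longlonglongrightarrow> c" and O: "(\<lambda>n. real n * r n - c) \<in> O(\<lambda>n. 1 / real n)"
    and b: "Re (of_real c * (\<beta>1 + \<beta>2)) = 1" "of_real c * (\<beta>1 + \<beta>2) \<noteq> 1"
    and rec: "\<And>n. L (Suc n) = (1 - of_real (r n) * \<beta>1) * (1 - of_real (r n) * \<beta>2) * L n + s * of_real ((r n)\<^sup>2)"
  shows "(\<lambda>n. of_real (real n / ln (real n)) * L n) \<longlonglongrightarrow> 0"
proof -
  define \<kappa> where "\<kappa> = of_real c * (\<beta>1 + \<beta>2) - 1"
  have \<kappa>: "Re \<kappa> = 0" "\<kappa> \<noteq> 0" using b by (auto simp: \<kappa>_def)
  obtain C f where C: "0 \<le> C"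
    "\<forall>\<^sub>F n in sequentially. norm (f n) \<le> C / (real n)\<^sup>2"
    "\<forall>\<^sub>F n in sequentially. of_real (real (Suc n) / real n) * ((1 - of_real (r n) * \<beta>1) * (1 - of_real (r n) * \<beta>2))
        = 1 - \<kappa> / of_nat n + f n"
    "\<forall>\<^sub>F n in sequentially. \<bar>real (Suc n) * (r n)\<^sup>2 - c\<^sup>2 / real n\<bar> \<le> C / (real n)\<^sup>2"
    by (rule critical_factor[OF r O \<kappa>_def])
  \<comment> \<open>Fixed point: at this value the loss \<open>\<kappa> * k / n\<close> balances the
    input \<open>s * c^2 / n\<close>.\<close>
  define k where "k = s * of_real (c\<^sup>2) / \<kappa>"
  define e where "e n = of_nat n * L n - k" for n
  define D where "D = (norm \<kappa>)\<^sup>2 + C + (C * norm k + norm s * C)"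
  have D0: "D \<ge> 0" using C(1) unfolding D_def by (intro add_nonneg_nonneg) auto
  \<comment> \<open>Adding 1 to the norm turns the additive error \<open>D / n^2\<close> into a part
    of the multiplicative factor.\<close>
  have "\<forall>\<^sub>F n in sequentially. norm (e (Suc n)) + 1 \<le> (1 + D / (real n)\<^sup>2) * (norm (e n) + 1)"
    using C(2,3,4) eventually_gt_at_top[of 0]
  proof eventually_elim
    case (elim n)
    define g where "g = real (Suc n) * (r n)\<^sup>2 - c\<^sup>2 / real n"
    have n: "(of_nat n :: complex) \<noteq> 0" using elim by simp
    have "of_nat (Suc n) * L (Suc n) = (of_real (real (Suc n) / real n) * ((1 - of_real (r n) * \<beta>1) * (1 - of_real (r n) * \<beta>2))) * (of_nat n * L n)
       + s * of_real (real (Suc n) * (r n)\<^sup>2)"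
      using n by (simp add: rec distrib_left field_simps)
    also have "real (Suc n) * (r n)\<^sup>2 = c\<^sup>2 / real n + g" by (simp add: g_def)
    finally have "e (Suc n) = (1 - \<kappa> / of_nat n + f n) * (e n + k) + s * of_real (c\<^sup>2 / real n + g) - k"
      unfolding elim(2) by (simp add: e_def)
    also have "\<dots> = (1 - \<kappa> / of_nat n + f n) * e n + (f n * k + s * of_real g)"
    proof -
      define x where "x = \<kappa> / of_nat n"
      define R where "R = (of_real (c\<^sup>2 / real n) :: complex)"
      have "x * k = s * R" using \<kappa> n by (simp add: k_def x_def R_def)
      then show ?thesis unfolding of_real_add x_def[symmetric] R_def[symmetric] by (simp add: algebra_simps)
    qed
    finally have "norm (e (Suc n)) \<le> norm (1 - \<kappa> / of_nat n + f n) * norm (e n) + norm (f n * k + s * of_real g)"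
      by (metis norm_mult norm_triangle_ineq)
    moreover have "norm (1 - \<kappa> / of_nat n + f n) \<le> 1 + ((norm \<kappa>)\<^sup>2 + C) / (real n)\<^sup>2"
    proof -
      \<comment> \<open>A purely imaginary perturbation of 1 changes the modulus only to second
        order.\<close>
      have "norm (1 - \<kappa> / of_nat n) \<le> 1 + (norm \<kappa>)\<^sup>2 / (real n)\<^sup>2"
      proof (rule power2_le_imp_le)
        have "\<kappa> / of_nat n = Complex 0 (Im \<kappa> / real n)" using \<kappa>(1) by (simp add: complex_eq_iff Re_divide_of_nat Im_divide_of_nat)
        then have "(norm (1 - \<kappa> / of_nat n))\<^sup>2 = 1 + (Im \<kappa> / real n)\<^sup>2" by (simp add: cmod_power2)
        also have "\<dots> = 1 + (norm \<kappa>)\<^sup>2 / (real n)\<^sup>2" using \<kappa>(1) by (simp add: cmod_power2 power_divide)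
        also have "\<dots> \<le> (1 + (norm \<kappa>)\<^sup>2 / (real n)\<^sup>2)\<^sup>2"
          using self_le_power[of "1 + (norm \<kappa>)\<^sup>2 / (real n)\<^sup>2" 2] by simp
        finally show "(norm (1 - \<kappa> / of_nat n))\<^sup>2 \<le> (1 + (norm \<kappa>)\<^sup>2 / (real n)\<^sup>2)\<^sup>2" .
      qed simp
      then show ?thesis using elim(1) norm_triangle_ineq[of "1 - \<kappa> / of_nat n" "f n"] by (simp add: add_divide_distrib)
    qed
    moreover have "norm (f n * k + s * of_real g) \<le> (C * norm k + norm s * C) / (real n)\<^sup>2"
    proof -
      have "norm (f n * k + s * of_real g) \<le> norm (f n) * norm k + norm s * \<bar>g\<bar>"
        by (rule order_trans[OF norm_triangle_ineq]) (simp add: norm_mult)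
      also have "\<dots> \<le> C / (real n)\<^sup>2 * norm k + norm s * (C / (real n)\<^sup>2)"
        using elim(1,3) by (intro add_mono mult_right_mono mult_left_mono) (auto simp: g_def)
      finally show ?thesis by (simp add: add_divide_distrib)
    qed
    ultimately have "norm (e (Suc n)) \<le> (1 + ((norm \<kappa>)\<^sup>2 + C) / (real n)\<^sup>2) * norm (e n) + (C * norm k + norm s * C) / (real n)\<^sup>2"
      by (meson add_mono mult_right_mono norm_ge_zero order_trans)
    also have "\<dots> \<le> (1 + D / (real n)\<^sup>2) * norm (e n) + D / (real n)\<^sup>2"
      using C(1) by (intro add_mono mult_right_mono add_left_mono divide_right_mono) (auto simp: D_def)
    finally show ?case by (simp add: algebra_simps add_divide_distrib)
  qed
  then obtain B where B: "\<And>n. norm (e n) + 1 \<le> B"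
    using almost_contraction_bounded[of "\<lambda>n. norm (e n) + 1" D] D0 by auto
  have "(\<lambda>n. (B + norm k) * (1 / ln (real n))) \<longlonglongrightarrow> (B + norm k) * 0"
    by (intro tendsto_mult tendsto_const) real_asymp
  then have g0: "(\<lambda>n. (B + norm k) * (1 / ln (real n))) \<longlonglongrightarrow> 0" by simp
  show ?thesis
  proof (rule Lim_null_comparison[OF _ g0])
    show "\<forall>\<^sub>F n in sequentially. norm (of_real (real n / ln (real n)) * L n) \<le> (B + norm k) * (1 / ln (real n))"
      using eventually_gt_at_top[of 2]
    proof eventually_elim
      case (elim n)
      have "of_real (real n / ln (real n)) * L n = (e n + k) * of_real (1 / ln (real n))"
        by (simp add: e_def)
      then have "norm (of_real (real n / ln (real n)) * L n) = norm (e n + k) * \<bar>1 / ln (real n)\<bar>"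
        by (simp only: norm_mult norm_of_real)
      also have "\<dots> \<le> (B + norm k) * (1 / ln (real n))"
      proof -
        have 1: "norm (e n + k) \<le> B + norm k" using B[of n] norm_triangle_ineq[of "e n" k] by linarith
        with norm_ge_zero have 2: "0 \<le> B + norm k" by (rule order_trans)
        show ?thesis using elim by (intro mult_mono 1 2) auto
      qed
      finally show ?case .
    qed
  qed
qed

text \<open>Stolz-Cesaro for tails: eventually \<open>w n\<close> lies within a small multiple of
  \<open>b n - b (Suc n)\<close> from \<open>l\<close> times this increment, and summing over the
  tail telescopes to \<open>b n\<close>.\<close>

lemma tail_limit:
  fixes w b :: "nat \<Rightarrow> real"
  assumes w: "\<And>n. 0 \<le> w n" and b0: "b \<longlonglongrightarrow> 0" and dec: "\<forall>\<^sub>F n in sequentially. b (Suc n) < b n"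
    and lim: "(\<lambda>n. w n / (b n - b (Suc n))) \<longlonglongrightarrow> l"
  shows "summable w" "(\<lambda>n. (\<Sum>k. w (k + n)) / b n) \<longlonglongrightarrow> l"
proof -
  have sd: "summable (\<lambda>n. b n - b (Suc n))" "(\<Sum>k. b (k + n) - b (Suc (k + n))) = b n" for n
  proof -
    have "(\<lambda>k. b (k + n)) \<longlonglongrightarrow> 0" using b0 by (simp add: LIMSEQ_ignore_initial_segment)
    from telescope_sums'[OF this] show "(\<Sum>k. b (k + n) - b (Suc (k + n))) = b n"
      by (simp add: sums_iff)
    show "summable (\<lambda>n. b n - b (Suc n))" using telescope_sums'[OF b0] by (simp add: sums_iff)
  qed
  have ev: "\<forall>\<^sub>F n in sequentially. b (Suc n) < b n \<and> \<bar>w n - l * (b n - b (Suc n))\<bar> \<le> e * (b n - b (Suc n))" if "0 < e" for e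
    using dec tendstoD[OF lim that]
  proof eventually_elim
    case (elim n)
    then have p: "0 < b n - b (Suc n)" by simp
    have "w n - l * (b n - b (Suc n)) = (w n / (b n - b (Suc n)) - l) * (b n - b (Suc n))"
      using p by (simp add: left_diff_distrib)
    then have "\<bar>w n - l * (b n - b (Suc n))\<bar> = \<bar>w n / (b n - b (Suc n)) - l\<bar> * (b n - b (Suc n))"
      using p by (simp add: abs_mult)
    also have "\<dots> \<le> e * (b n - b (Suc n))"
      using elim(2) p by (intro mult_right_mono) (auto simp: dist_real_def)
    finally show ?case using elim(1) by simp
  qed
  show sw: "summable w"
  proof (rule summable_comparison_test_ev)
    show "\<forall>\<^sub>F n in sequentially. norm (w n) \<le> (l + 1) * (b n - b (Suc n))"
      using ev[OF zero_less_one]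
    proof eventually_elim
      case (elim n)
      then have "w n - l * (b n - b (Suc n)) \<le> 1 * (b n - b (Suc n))" by (meson abs_le_D1)
      then show ?case using w[of n] by (simp add: algebra_simps)
    qed
    show "summable (\<lambda>n. (l + 1) * (b n - b (Suc n)))" by (intro summable_mult sd)
  qed
  have sw': "summable (\<lambda>k. w (k + n))" and sd': "summable (\<lambda>k. b (k + n) - b (Suc (k + n)))" for n
    using sw sd(1) summable_iff_shift[of w n] summable_iff_shift[of "\<lambda>n. b n - b (Suc n)" n] by auto
  show "(\<lambda>n. (\<Sum>k. w (k + n)) / b n) \<longlonglongrightarrow> l"
  proof (rule LIMSEQ_I)
    fix e :: real assume e: "0 < e"
    obtain N where N: "\<And>n. n \<ge> N \<Longrightarrow> b (Suc n) < b n \<and> \<bar>w n - l * (b n - b (Suc n))\<bar> \<le> e / 2 * (b n - b (Suc n))"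
      using ev[of "e / 2"] e by (auto simp: eventually_sequentially)
    have "norm ((\<Sum>k. w (k + n)) / b n - l) < e" if n: "n \<ge> N" for n
    proof -
      \<comment> \<open>A sequence that decreases to 0 from here on is nonnegative at the next
        index; the strict decrease gives positivity at \<open>n\<close>.\<close>
      have bn: "b n > 0"
      proof -
        have "0 \<le> b (Suc n)"
        proof (rule decseq_ge[OF decseq_SucI LIMSEQ_ignore_initial_segment[OF b0, of "Suc n"], of 0, simplified])
          show "b (Suc (Suc (k + n))) \<le> b (Suc (k + n))" for k using N[of "Suc (k + n)"] n by simp
        qed
        then show ?thesis using N[of n] n by linarith
      qed
      have sdiff: "summable (\<lambda>k. w (k + n) - l * (b (k + n) - b (Suc (k + n))))"
        by (intro summable_diff sw' summable_mult sd')
      have "(\<Sum>k. w (k + n)) - l * b n = (\<Sum>k. w (k + n) - l * (b (k + n) - b (Suc (k + n))))"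
        using suminf_diff[OF sw' summable_mult[OF sd'], of n l n] suminf_mult[OF sd', of l n] sd(2)[of n] by simp
      also have "norm \<dots> \<le> (\<Sum>k. e / 2 * (b (k + n) - b (Suc (k + n))))"
        by (rule norm_suminf_le) (use N n in \<open>auto intro!: summable_mult sd'\<close>)
      also have "\<dots> = e / 2 * b n" using suminf_mult[OF sd', of "e / 2" n] sd(2)[of n] by simp
      finally have "norm ((\<Sum>k. w (k + n)) - l * b n) \<le> e / 2 * b n" .
      moreover have "(\<Sum>k. w (k + n)) / b n - l = ((\<Sum>k. w (k + n)) - l * b n) / b n"
        using bn by (simp add: diff_divide_distrib)
      ultimately have "norm ((\<Sum>k. w (k + n)) / b n - l) \<le> e / 2"
        using bn by (simp add: divide_le_eq)
      then show ?thesis using e by simp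
    qed
    then show "\<exists>no. \<forall>n\<ge>no. norm ((\<Sum>k. w (k + n)) / b n - l) < e" by blast
  qed
qed

text \<open>The comparison sequence is \<open>n powr (- p)\<close> with
  \<open>p = 2 * \<gamma> - 1\<close>: its decrements behave like
  \<open>p * n powr (- 2 * \<gamma>)\<close> and the squared steps like
  \<open>c^2 * n powr (- 2 * \<gamma>)\<close>.\<close>

lemma step_sizes_tail:
  assumes r: "(\<lambda>n. real n powr \<gamma> * r n) \<longlonglongrightarrow> c" and \<gamma>: "1 / 2 < \<gamma>" "\<gamma> \<le> 1"
  shows "summable (\<lambda>n. (r n)\<^sup>2)" "(\<lambda>n. real n powr (2 * \<gamma> - 1) * (\<Sum>k. (r (k + n))\<^sup>2)) \<longlonglongrightarrow> c\<^sup>2 / (2 * \<gamma> - 1)"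
proof -
  define p where "p = 2 * \<gamma> - 1"
  have p: "p > 0" using \<gamma> by (simp add: p_def)
  define b where "b n = real n powr (- p)" for n
  have b0: "b \<longlonglongrightarrow> 0" unfolding b_def using p by real_asymp
  have dec: "\<forall>\<^sub>F n in sequentially. b (Suc n) < b n"
    using eventually_gt_at_top[of 0] by eventually_elim (use p in \<open>simp add: b_def powr_less_mono2_neg\<close>)
  have l1: "(\<lambda>n. real n powr (2 * \<gamma>) * (b n - b (Suc n))) \<longlonglongrightarrow> p"
  proof -
    have "(\<lambda>n. real n powr (p + 1) * (real n powr (- p) - real (Suc n) powr (- p))) \<longlonglongrightarrow> p"
      using p by real_asymp
    then show ?thesis by (simp add: b_def p_def)
  qed
  have "(\<lambda>n. (real n powr \<gamma> * r n)\<^sup>2 / (real n powr (2 * \<gamma>) * (b n - b (Suc n)))) \<longlonglongrightarrow> c\<^sup>2 / p"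
    using p by (intro tendsto_intros r l1) simp
  moreover have "\<forall>\<^sub>F n in sequentially. (real n powr \<gamma> * r n)\<^sup>2 / (real n powr (2 * \<gamma>) * (b n - b (Suc n))) = (r n)\<^sup>2 / (b n - b (Suc n))"
    using eventually_gt_at_top[of 0]
  proof eventually_elim
    case (elim n)
    have "(real n powr \<gamma>)\<^sup>2 = real n powr (2 * \<gamma>)" by (simp add: power2_eq_square powr_add[symmetric])
    then show ?case using elim by (simp add: power_mult_distrib)
  qed
  ultimately have lim: "(\<lambda>n. (r n)\<^sup>2 / (b n - b (Suc n))) \<longlonglongrightarrow> c\<^sup>2 / p"
    by (simp add: Lim_transform_eventually)
  show "summable (\<lambda>n. (r n)\<^sup>2)" by (rule tail_limit(1)[OF _ b0 dec lim]) simp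
  have "(\<lambda>n. (\<Sum>k. (r (k + n))\<^sup>2) / b n) \<longlonglongrightarrow> c\<^sup>2 / p" by (rule tail_limit(2)[OF _ b0 dec lim]) simp
  moreover have "s / b n = real n powr p * s" for s n by (simp add: b_def powr_minus divide_inverse)
  ultimately show "(\<lambda>n. real n powr (2 * \<gamma> - 1) * (\<Sum>k. (r (k + n))\<^sup>2)) \<longlonglongrightarrow> c\<^sup>2 / (2 * \<gamma> - 1)"
    by (simp only: p_def[symmetric])
qed

section \<open>Martingale differences of the model\<close>

text \<open>Toeplitz argument: on a fixed initial block the weights vanish, and beyond it \<eta> is
  small while the total weight is at most \<open>Q\<close>.\<close>

lemma weighted_average_null:
  fixes a :: "nat \<Rightarrow> nat \<Rightarrow> real" and \<eta> :: "nat \<Rightarrow> real"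
  assumes a: "\<And>n k. 0 \<le> a n k" "\<And>n. (\<Sum>k<K n. a n k) \<le> Q" "\<And>k. (\<lambda>n. a n k) \<longlonglongrightarrow> 0"
    and \<eta>: "\<eta> \<longlonglongrightarrow> 0" "\<And>k. 0 \<le> \<eta> k"
  shows "(\<lambda>n. \<Sum>k<K n. a n k * \<eta> k) \<longlonglongrightarrow> 0"
proof (rule LIMSEQ_I)
  fix e :: real assume e: "0 < e"
  have Q: "0 \<le> Q" using a(1,2) by (meson order_trans sum_nonneg)
  define d where "d = e / (2 * (Q + 1))"
  have d: "d > 0" using e Q by (simp add: d_def)
  obtain k0 where k0: "\<And>k. k \<ge> k0 \<Longrightarrow> \<eta> k < d"
    using order_tendstoD(2)[OF \<eta>(1) d] by (auto simp: eventually_sequentially)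
  have "(\<lambda>n. \<Sum>k<k0. a n k * \<eta> k) \<longlonglongrightarrow> (\<Sum>k<k0. 0 * \<eta> k)" by (intro tendsto_intros a)
  then have "(\<lambda>n. \<Sum>k<k0. a n k * \<eta> k) \<longlonglongrightarrow> 0" by simp
  then obtain N where N: "\<And>n. n \<ge> N \<Longrightarrow> (\<Sum>k<k0. a n k * \<eta> k) < e / 2"
    using order_tendstoD(2)[of _ 0 sequentially "e / 2"] e by (auto simp: eventually_sequentially)
  have "norm ((\<Sum>k<K n. a n k * \<eta> k) - 0) < e" if "n \<ge> N" for n
  proof -
    have "(\<Sum>k<K n. a n k * \<eta> k) \<le> (\<Sum>k<K n. (if k < k0 then a n k * \<eta> k else 0) + a n k * d)"
    proof (rule sum_mono)
      fix k
      show "a n k * \<eta> k \<le> (if k < k0 then a n k * \<eta> k else 0) + a n k * d"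
        using k0[of k] a(1)[of n k] d by (cases "k < k0") (auto intro: mult_left_mono less_imp_le)
    qed
    also have "\<dots> = (\<Sum>k\<in>{..<K n} \<inter> {k. k < k0}. a n k * \<eta> k) + (\<Sum>k<K n. a n k) * d"
      by (simp add: sum.distrib sum_distrib_right sum.If_cases)
    also have "\<dots> \<le> (\<Sum>k<k0. a n k * \<eta> k) + Q * d"
      using a \<eta> d by (intro add_mono mult_right_mono sum_mono2) (auto intro: mult_nonneg_nonneg)
    also have "Q * d \<le> e / 2" using e Q by (simp add: d_def field_simps)
    finally have "(\<Sum>k<K n. a n k * \<eta> k) < e" using N[OF that] by simp
    moreover have "0 \<le> (\<Sum>k<K n. a n k * \<eta> k)" using a \<eta> by (intro sum_nonneg mult_nonneg_nonneg) auto
    ultimately show ?thesis by simp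
  qed
  then show "\<exists>no. \<forall>n\<ge>no. norm ((\<Sum>k<K n. a n k * \<eta> k) - 0) < e" by blast
qed

context interacting_rsp
begin

abbreviation F :: "nat \<Rightarrow> 'a measure" where "F n \<equiv> history M (Z 0) X n"

text \<open>The vector of conditional success probabilities of \<open>X (Suc k)\<close> given
  \<open>F k\<close>, so that \<open>D k\<close> below is a martingale difference.\<close>

definition p :: "nat \<Rightarrow> 'a \<Rightarrow> real^'n" where "p k \<omega> = transpose W *v Z k \<omega>"

definition D :: "nat \<Rightarrow> 'a \<Rightarrow> real^'n" where "D k \<omega> = X (Suc k) \<omega> - p k \<omega>"

lemma sets_history:
  "sets (F n) = sigma_sets (space M)
     ({Z 0 -` B \<inter> space M | B. B \<in> sets borel} \<union> {X m -` B \<inter> space M | m B. m \<in> {1..n} \<and> B \<in> sets borel})"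
  "space (F n) = space M"
  unfolding history_def by (subst sets_measure_of space_measure_of; auto)+

lemma subalgebra_history: "subalgebra M (F n)"
  unfolding subalgebra_def sets_history
  by (intro conjI refl sets.sigma_sets_subset)
     (auto intro!: measurable_sets[OF Z0_measurable] measurable_sets[OF X_measurable])

lemma history_mono: "sets (F n) \<subseteq> sets (F (Suc n))"
  proof -
  have "{X m -` B \<inter> space M | m B. m \<in> {1..n} \<and> B \<in> sets borel} \<subseteq>
      {X m -` B \<inter> space M | m B. m \<in> {1..Suc n} \<and> B \<in> sets borel}"
  proof -
    have "m \<in> {1..n} \<Longrightarrow> m \<in> {1..Suc n}" for m by simp
    then show ?thesis by blast
  qed
  then show ?thesis unfolding sets_history by (intro sigma_sets_mono' Un_mono order_refl)
qed

lemma X_history: "1 \<le> m \<Longrightarrow> m \<le> n \<Longrightarrow> X m \<in> borel_measurable (F n)"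
proof (rule measurableI)
  fix A :: "(real^'n) set"
  assume m: "1 \<le> m" "m \<le> n" and A: "A \<in> sets borel"
  from m have "m \<in> {1..n}" by simp
  with A show "X m -` A \<inter> space (F n) \<in> sets (F n)"
    unfolding sets_history by (intro sigma_sets.Basic UnI2) blast
qed simp

lemma Z_history: "Z n \<in> borel_measurable (F n)"
proof (induction n)
  case 0
  show ?case by (rule measurableI) (auto simp: sets_history intro!: sigma_sets.Basic)
next
  case (Suc n)
  have "subalgebra (F (Suc n)) (F n)" using history_mono by (simp add: subalgebra_def sets_history(2))
  from measurable_from_subalg[OF this Suc]
  have "(\<lambda>\<omega>. (1 - r n) *\<^sub>R Z n \<omega> + r n *\<^sub>R X (Suc n) \<omega>) \<in> borel_measurable (F (Suc n))"
    using X_history[of "Suc n" "Suc n"] by measurable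
  moreover have "Z (Suc n) \<in> borel_measurable (F (Suc n)) \<longleftrightarrow>
     (\<lambda>\<omega>. (1 - r n) *\<^sub>R Z n \<omega> + r n *\<^sub>R X (Suc n) \<omega>) \<in> borel_measurable (F (Suc n))"
    by (rule measurable_cong) (simp add: sets_history(2) Z_step)
  ultimately show ?case by simp
qed

lemma Z_measurable [measurable]: "Z n \<in> borel_measurable M"
  by (rule measurable_from_subalg[OF subalgebra_history Z_history])

lemma Z_range: "\<omega> \<in> space M \<Longrightarrow> 0 \<le> Z n \<omega> $ j \<and> Z n \<omega> $ j \<le> 1"
proof (induction n)
  case 0
  then show ?case using Z0_range[of \<omega> j] by simp
next
  case (Suc n)
  have x: "X (Suc n) \<omega> $ j = 0 \<or> X (Suc n) \<omega> $ j = 1" using X_range[of "Suc n" \<omega> j] Suc.prems by simp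
  have z: "Z (Suc n) \<omega> $ j = (1 - r n) * Z n \<omega> $ j + r n * X (Suc n) \<omega> $ j" using Z_step[OF Suc.prems, of n] by simp
  have "(1 - r n) * Z n \<omega> $ j + r n * X (Suc n) \<omega> $ j \<le> (1 - r n) * 1 + r n * 1"
    using r_range[of n] Suc x by (intro add_mono mult_left_mono) auto
  moreover have "0 \<le> (1 - r n) * Z n \<omega> $ j + r n * X (Suc n) \<omega> $ j"
    using r_range[of n] Suc x by (intro add_nonneg_nonneg mult_nonneg_nonneg) auto
  ultimately show ?case using z by simp
qed

lemma W_column_sum: "(\<Sum>i\<in>UNIV. W $ i $ j) = 1"
proof -
  have "(transpose W *v 1) $ j = (\<Sum>i\<in>UNIV. W $ i $ j)"
    by (simp add: matrix_vector_mult_def transpose_def)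
  then show ?thesis using W_columns by simp
qed

lemma p_component: "p k \<omega> $ j = (\<Sum>i\<in>UNIV. W $ i $ j * Z k \<omega> $ i)"
  by (simp add: p_def matrix_vector_mult_def transpose_def)

lemma p_range: "\<omega> \<in> space M \<Longrightarrow> 0 \<le> p k \<omega> $ j \<and> p k \<omega> $ j \<le> 1"
proof -
  assume w: "\<omega> \<in> space M"
  have "(\<Sum>i\<in>UNIV. W $ i $ j * Z k \<omega> $ i) \<le> (\<Sum>i\<in>UNIV. W $ i $ j * 1)"
    using W_nonneg Z_range[OF w] by (intro sum_mono mult_left_mono) auto
  moreover have "0 \<le> (\<Sum>i\<in>UNIV. W $ i $ j * Z k \<omega> $ i)"
    using W_nonneg Z_range[OF w] by (intro sum_nonneg mult_nonneg_nonneg) auto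
  ultimately show ?thesis using W_column_sum by (simp add: p_component)
qed

lemma vec_nth_measurable: "f \<in> borel_measurable N \<Longrightarrow> (\<lambda>\<omega>. f \<omega> $ j) \<in> borel_measurable N"
  for f :: "'c \<Rightarrow> real^'d"
  by (rule borel_measurable_continuous_on[where f = "\<lambda>x. x $ j"]) (auto intro: continuous_intros)

lemma p_history: "(\<lambda>\<omega>. p k \<omega> $ j) \<in> borel_measurable (F k)"
  unfolding p_component using vec_nth_measurable[OF Z_history[of k]] by measurable

lemma X_component: "\<omega> \<in> space M \<Longrightarrow> X (Suc n) \<omega> $ j = indicator {\<omega>' \<in> space M. X (Suc n) \<omega>' $ j = 1} \<omega>"
proof -
  assume w: "\<omega> \<in> space M"
  have "X (Suc n) \<omega> $ j \<in> {0, 1}" by (rule X_range[OF _ w]) simp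
  then show ?thesis using w by (elim insertE) (simp_all add: indicator_def)
qed

lemma X_event: "{\<omega>' \<in> space M. X (Suc n) \<omega>' $ j \<in> A} \<in> sets M" if "A \<in> sets borel"
proof -
  have "(\<lambda>\<omega>. X (Suc n) \<omega> $ j) \<in> borel_measurable M"
    by (rule vec_nth_measurable[OF X_measurable]) simp
  from measurable_sets[OF this that] show ?thesis by (simp add: vimage_def Int_def conj_commute)
qed

lemma X_event_1: "{\<omega>' \<in> space M. X (Suc n) \<omega>' $ j = 1} \<in> sets M"
  using X_event[of "{1}"] by simp

text \<open>Translates an almost sure statement on conditional probabilities into the integrals
  against test functions that \<open>martingale_array\<close> asks for.\<close>

lemma integral_cond_prob:
  fixes G :: "'a \<Rightarrow> real"
  assumes G: "G \<in> borel_measurable (F k)" and B: "\<And>\<omega>. \<omega> \<in> space M \<Longrightarrow> \<bar>G \<omega>\<bar> \<le> B" and A: "A \<in> sets M"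
    and g: "AE \<omega> in M. cond_prob M (F k) A \<omega> = g \<omega>" and gm: "g \<in> borel_measurable (F k)"
  shows "(\<integral>\<omega>. G \<omega> * indicator A \<omega> \<partial>M) = (\<integral>\<omega>. G \<omega> * g \<omega> \<partial>M)"
proof -
  interpret S: finite_measure_subalgebra M "F k" by unfold_locales (rule subalgebra_history)
  have [measurable]: "G \<in> borel_measurable M" "g \<in> borel_measurable M"
    using measurable_from_subalg[OF subalgebra_history] G gm by auto
  have "0 \<le> B" using B not_empty by (metis abs_ge_zero all_not_in_conv order_trans)
  then have "integrable M (\<lambda>\<omega>. G \<omega> * indicator A \<omega>)"
    by (intro integrable_const_bound[of _ B]) (use B A in \<open>auto simp: indicator_def\<close>)
  then have "(\<integral>\<omega>. G \<omega> * indicator A \<omega> \<partial>M) = (\<integral>\<omega>. G \<omega> * real_cond_exp M (F k) (indicator A) \<omega> \<partial>M)"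
    using S.real_cond_exp_intg(2)[OF _ G, of "indicator A"] A by simp
  also have "\<dots> = (\<integral>\<omega>. G \<omega> * g \<omega> \<partial>M)"
    by (rule integral_cong_AE) (use g in \<open>auto simp: cond_prob_def\<close>)
  finally show ?thesis .
qed

lemma integral_X:
  fixes G :: "'a \<Rightarrow> real"
  assumes G: "G \<in> borel_measurable (F k)" and B: "\<And>\<omega>. \<omega> \<in> space M \<Longrightarrow> \<bar>G \<omega>\<bar> \<le> B"
  shows "(\<integral>\<omega>. G \<omega> * X (Suc k) \<omega> $ j \<partial>M) = (\<integral>\<omega>. G \<omega> * p k \<omega> $ j \<partial>M)"
proof -
  have "(\<integral>\<omega>. G \<omega> * X (Suc k) \<omega> $ j \<partial>M) = (\<integral>\<omega>. G \<omega> * indicator {\<omega>' \<in> space M. X (Suc k) \<omega>' $ j = 1} \<omega> \<partial>M)"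
    by (intro Bochner_Integration.integral_cong refl arg_cong2[where f = "(*)"] X_component)
  also have "\<dots> = (\<integral>\<omega>. G \<omega> * p k \<omega> $ j \<partial>M)"
    by (rule integral_cond_prob[OF G B X_event_1 _ p_history]) (use X_cond_prob[of k j] in \<open>auto simp: p_component\<close>)
  finally show ?thesis .
qed

text \<open>The product of two distinct 0-1 components is the indicator of the event that both are
  1. Conditional independence is applied with \<open>{1}\<close> at \<open>i\<close> and
  \<open>j\<close> and \<open>UNIV\<close> elsewhere; the remaining factors have conditional
  probability 1.\<close>

lemma integral_XX:
  fixes G :: "'a \<Rightarrow> real"
  assumes G: "G \<in> borel_measurable (F k)" and B: "\<And>\<omega>. \<omega> \<in> space M \<Longrightarrow> \<bar>G \<omega>\<bar> \<le> B" and ij: "i \<noteq> j"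
  shows "(\<integral>\<omega>. G \<omega> * (X (Suc k) \<omega> $ i * X (Suc k) \<omega> $ j) \<partial>M) = (\<integral>\<omega>. G \<omega> * (p k \<omega> $ i * p k \<omega> $ j) \<partial>M)"
proof -
  interpret S: finite_measure_subalgebra M "F k" by unfold_locales (rule subalgebra_history)
  define A :: "'n \<Rightarrow> real set" where "A l = (if l = i \<or> l = j then {1} else UNIV)" for l
  define E where "E = {\<omega>' \<in> space M. \<forall>l. X (Suc k) \<omega>' $ l \<in> A l}"
  have Ab: "A l \<in> sets borel" for l by (simp add: A_def)
  have "E = (\<Inter>l. {\<omega>' \<in> space M. X (Suc k) \<omega>' $ l \<in> A l})" by (auto simp: E_def)
  then have E: "E \<in> sets M" using X_event[OF Ab] by (auto intro!: sets.finite_INT)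
  have one: "AE \<omega> in M. cond_prob M (F k) (space M) \<omega> = 1"
  proof -
    have "AE \<omega> in M. real_cond_exp M (F k) (indicator (space M)) \<omega> = indicator (space M) \<omega>"
      using sets.top[of "F k"] by (intro S.real_cond_exp_F_meas) (auto simp: sets_history(2) less_top[symmetric])
    then show ?thesis using AE_space by eventually_elim (simp add: cond_prob_def)
  qed
  have single: "AE \<omega> in M. \<forall>l. cond_prob M (F k) {\<omega>' \<in> space M. X (Suc k) \<omega>' $ l \<in> A l} \<omega> = (if l = i \<or> l = j then p k \<omega> $ l else 1)"
  proof -
    have "AE \<omega> in M. \<forall>l\<in>UNIV. cond_prob M (F k) {\<omega>' \<in> space M. X (Suc k) \<omega>' $ l \<in> A l} \<omega> = (if l = i \<or> l = j then p k \<omega> $ l else 1)"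
    proof (rule AE_finite_allI)
      fix l
      show "AE \<omega> in M. cond_prob M (F k) {\<omega>' \<in> space M. X (Suc k) \<omega>' $ l \<in> A l} \<omega> = (if l = i \<or> l = j then p k \<omega> $ l else 1)"
        using one X_cond_prob[of k l] by (cases "l = i \<or> l = j") (auto simp: A_def p_component)
    qed simp
    then show ?thesis by simp
  qed
  have "AE \<omega> in M. cond_prob M (F k) E \<omega> = p k \<omega> $ i * p k \<omega> $ j"
  proof -
    have "AE \<omega> in M. cond_prob M (F k) E \<omega> = (\<Prod>l\<in>UNIV. cond_prob M (F k) {\<omega>' \<in> space M. X (Suc k) \<omega>' $ l \<in> A l} \<omega>)"
      using X_cond_indep[of k] Ab unfolding cond_indep_components_def E_def by blast
    then show ?thesis using single
    proof eventually_elim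
      case (elim \<omega>)
      have "(\<Prod>l\<in>UNIV. if l = i \<or> l = j then p k \<omega> $ l else 1) = (\<Prod>l\<in>{i, j}. p k \<omega> $ l)"
        by (rule prod.mono_neutral_cong_right) auto
      then show ?case using elim ij by simp
    qed
  qed
  from integral_cond_prob[OF G B E this]
  have "(\<integral>\<omega>. G \<omega> * indicator E \<omega> \<partial>M) = (\<integral>\<omega>. G \<omega> * (p k \<omega> $ i * p k \<omega> $ j) \<partial>M)"
    using p_history by (auto intro: borel_measurable_times)
  moreover have "X (Suc k) \<omega> $ i * X (Suc k) \<omega> $ j = indicator E \<omega>" if "\<omega> \<in> space M" for \<omega>
    using X_range[of "Suc k" \<omega> i] X_range[of "Suc k" \<omega> j] that by (auto simp: E_def A_def indicator_def)
  then have "(\<integral>\<omega>. G \<omega> * (X (Suc k) \<omega> $ i * X (Suc k) \<omega> $ j) \<partial>M) = (\<integral>\<omega>. G \<omega> * indicator E \<omega> \<partial>M)"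
    by (intro Bochner_Integration.integral_cong refl) simp
  ultimately show ?thesis by simp
qed

lemma D_bound: "\<omega> \<in> space M \<Longrightarrow> \<bar>D k \<omega> $ j\<bar> \<le> 1"
proof -
  assume w: "\<omega> \<in> space M"
  have "X (Suc k) \<omega> $ j \<in> {0, 1}" by (rule X_range[OF _ w]) simp
  then have "0 \<le> X (Suc k) \<omega> $ j" "X (Suc k) \<omega> $ j \<le> 1" by auto
  then show "\<bar>D k \<omega> $ j\<bar> \<le> 1" using p_range[OF w, of k j] by (simp add: D_def abs_le_iff)
qed

lemma D_norm: "\<omega> \<in> space M \<Longrightarrow> norm (D k \<omega>) \<le> real CARD('n)"
proof -
  assume "\<omega> \<in> space M"
  then have "(\<Sum>j\<in>UNIV. \<bar>D k \<omega> $ j\<bar>) \<le> (\<Sum>j\<in>(UNIV::'n set). 1)" by (intro sum_mono D_bound)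
  with norm_le_l1_cart[of "D k \<omega>"] show ?thesis by simp
qed

lemma D_history: "(\<lambda>\<omega>. D k \<omega> $ j) \<in> borel_measurable (F (Suc k))"
proof -
  have "subalgebra (F (Suc k)) (F k)" using history_mono by (simp add: subalgebra_def sets_history(2))
  from measurable_from_subalg[OF this p_history[of k j]]
  show ?thesis unfolding D_def using vec_nth_measurable[OF X_history[of "Suc k" "Suc k"]] by simp
qed

lemma D_measurable: "(\<lambda>\<omega>. D k \<omega> $ j) \<in> borel_measurable M"
  by (rule measurable_from_subalg[OF subalgebra_history D_history])

lemma G_integrable:
  fixes G g :: "'a \<Rightarrow> real"
  assumes "G \<in> borel_measurable (F k)" "\<And>\<omega>. \<omega> \<in> space M \<Longrightarrow> \<bar>G \<omega>\<bar> \<le> B"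
    and "g \<in> borel_measurable M" "\<And>\<omega>. \<omega> \<in> space M \<Longrightarrow> \<bar>g \<omega>\<bar> \<le> 1"
  shows "integrable M (\<lambda>\<omega>. G \<omega> * g \<omega>)"
proof (rule integrable_const_bound[of _ "B * 1"])
  show "AE \<omega> in M. norm (G \<omega> * g \<omega>) \<le> B * 1"
  proof (intro AE_I2)
    fix \<omega> assume w: "\<omega> \<in> space M"
    show "norm (G \<omega> * g \<omega>) \<le> B * 1"
      unfolding real_norm_def abs_mult
      by (rule mult_mono[OF assms(2)[OF w] assms(4)[OF w]]) (use order_trans[OF abs_ge_zero assms(2)[OF w]] in auto)
  qed
  show "(\<lambda>\<omega>. G \<omega> * g \<omega>) \<in> borel_measurable M"
    using assms(3) measurable_from_subalg[OF subalgebra_history assms(1)] by measurable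
qed

lemma X_comp_measurable: "(\<lambda>\<omega>. X (Suc k) \<omega> $ j) \<in> borel_measurable M"
  by (rule vec_nth_measurable[OF X_measurable]) simp

lemma p_measurable: "(\<lambda>\<omega>. p k \<omega> $ j) \<in> borel_measurable M"
  by (rule measurable_from_subalg[OF subalgebra_history p_history])

lemma X_abs: "\<omega> \<in> space M \<Longrightarrow> \<bar>X (Suc k) \<omega> $ j\<bar> \<le> 1"
proof -
  assume w: "\<omega> \<in> space M"
  have "X (Suc k) \<omega> $ j \<in> {0, 1}" by (rule X_range[OF _ w]) simp
  then show "\<bar>X (Suc k) \<omega> $ j\<bar> \<le> 1" by auto
qed

lemma p_abs: "\<omega> \<in> space M \<Longrightarrow> \<bar>p k \<omega> $ j\<bar> \<le> 1"
  using p_range[of \<omega> k j] by (simp add: abs_le_iff)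

lemma integral_D:
  fixes G :: "'a \<Rightarrow> real"
  assumes G: "G \<in> borel_measurable (F k)" and B: "\<And>\<omega>. \<omega> \<in> space M \<Longrightarrow> \<bar>G \<omega>\<bar> \<le> B"
  shows "(\<integral>\<omega>. G \<omega> * D k \<omega> $ j \<partial>M) = 0"
proof -
  have "(\<integral>\<omega>. G \<omega> * D k \<omega> $ j \<partial>M) = (\<integral>\<omega>. G \<omega> * X (Suc k) \<omega> $ j - G \<omega> * p k \<omega> $ j \<partial>M)"
    by (simp add: D_def right_diff_distrib)
  also have "\<dots> = (\<integral>\<omega>. G \<omega> * X (Suc k) \<omega> $ j \<partial>M) - (\<integral>\<omega>. G \<omega> * p k \<omega> $ j \<partial>M)"
    by (intro Bochner_Integration.integral_diff G_integrable[OF G B] X_comp_measurable X_abs p_measurable p_abs)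
  also have "\<dots> = 0" using integral_X[OF G B] by simp
  finally show ?thesis .
qed

text \<open>Off the diagonal the mixed moment cancels against the product of the means. On the
  diagonal \<open>X^2 = X\<close> turns the second moment into \<open>p\<close>, which leaves
  \<open>p * (1 - p)\<close>.\<close>

lemma integral_DD:
  fixes G :: "'a \<Rightarrow> real"
  assumes G: "G \<in> borel_measurable (F k)" and B: "\<And>\<omega>. \<omega> \<in> space M \<Longrightarrow> \<bar>G \<omega>\<bar> \<le> B"
  shows "(\<integral>\<omega>. G \<omega> * (D k \<omega> $ i * D k \<omega> $ j) \<partial>M) = (if i = j then \<integral>\<omega>. G \<omega> * (p k \<omega> $ i * (1 - p k \<omega> $ i)) \<partial>M else 0)"
proof -
  have Gp: "(\<lambda>\<omega>. G \<omega> * p k \<omega> $ l) \<in> borel_measurable (F k)" for l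
    by (intro borel_measurable_times G p_history)
  have GpB: "\<bar>G \<omega> * p k \<omega> $ l\<bar> \<le> B" if "\<omega> \<in> space M" for l \<omega>
  proof -
    have "\<bar>G \<omega>\<bar> * \<bar>p k \<omega> $ l\<bar> \<le> B * 1"
      by (rule mult_mono[OF B[OF that] p_abs[OF that]]) (use order_trans[OF abs_ge_zero B[OF that]] in auto)
    then show ?thesis by (simp add: abs_mult)
  qed
  have XX: "\<bar>X (Suc k) \<omega> $ i * X (Suc k) \<omega> $ j\<bar> \<le> 1" if "\<omega> \<in> space M" for \<omega>
    using mult_mono[OF X_abs[OF that] X_abs[OF that], of k j k i] by (simp add: abs_mult)
  have iXX: "integrable M (\<lambda>\<omega>. G \<omega> * (X (Suc k) \<omega> $ i * X (Suc k) \<omega> $ j))"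
    by (intro G_integrable[OF G B] borel_measurable_times X_comp_measurable XX)
  have ipX: "integrable M (\<lambda>\<omega>. G \<omega> * p k \<omega> $ l * X (Suc k) \<omega> $ l')" for l l'
    by (intro G_integrable[OF Gp GpB] X_comp_measurable X_abs)
  have ipp: "integrable M (\<lambda>\<omega>. G \<omega> * p k \<omega> $ l * p k \<omega> $ l')" for l l'
    by (intro G_integrable[OF Gp GpB] p_measurable p_abs)
  have "(\<integral>\<omega>. G \<omega> * (D k \<omega> $ i * D k \<omega> $ j) \<partial>M) =
     (\<integral>\<omega>. G \<omega> * (X (Suc k) \<omega> $ i * X (Suc k) \<omega> $ j) - G \<omega> * p k \<omega> $ i * X (Suc k) \<omega> $ j
        - G \<omega> * p k \<omega> $ j * X (Suc k) \<omega> $ i + G \<omega> * p k \<omega> $ i * p k \<omega> $ j \<partial>M)"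
    by (intro Bochner_Integration.integral_cong refl) (simp add: D_def algebra_simps)
  also have "\<dots> = (\<integral>\<omega>. G \<omega> * (X (Suc k) \<omega> $ i * X (Suc k) \<omega> $ j) \<partial>M) - (\<integral>\<omega>. G \<omega> * p k \<omega> $ i * X (Suc k) \<omega> $ j \<partial>M)
        - (\<integral>\<omega>. G \<omega> * p k \<omega> $ j * X (Suc k) \<omega> $ i \<partial>M) + (\<integral>\<omega>. G \<omega> * p k \<omega> $ i * p k \<omega> $ j \<partial>M)"
    using iXX ipX ipp by simp
  also have "(\<integral>\<omega>. G \<omega> * p k \<omega> $ i * X (Suc k) \<omega> $ j \<partial>M) = (\<integral>\<omega>. G \<omega> * p k \<omega> $ i * p k \<omega> $ j \<partial>M)"
    by (rule integral_X[OF Gp GpB])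
  also have "(\<integral>\<omega>. G \<omega> * p k \<omega> $ j * X (Suc k) \<omega> $ i \<partial>M) = (\<integral>\<omega>. G \<omega> * p k \<omega> $ i * p k \<omega> $ j \<partial>M)"
    using integral_X[OF Gp GpB, of j i] by (simp add: ac_simps)
  finally have *: "(\<integral>\<omega>. G \<omega> * (D k \<omega> $ i * D k \<omega> $ j) \<partial>M) =
     (\<integral>\<omega>. G \<omega> * (X (Suc k) \<omega> $ i * X (Suc k) \<omega> $ j) \<partial>M) - (\<integral>\<omega>. G \<omega> * p k \<omega> $ i * p k \<omega> $ j \<partial>M)" by simp
  show ?thesis
  proof (cases "i = j")
    case False
    then show ?thesis using * integral_XX[OF G B False] by (simp add: mult.assoc)
  next
    case True
    have "(\<integral>\<omega>. G \<omega> * (X (Suc k) \<omega> $ i * X (Suc k) \<omega> $ i) \<partial>M) = (\<integral>\<omega>. G \<omega> * X (Suc k) \<omega> $ i \<partial>M)"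
      using X_range by (intro Bochner_Integration.integral_cong refl) force
    also have "\<dots> = (\<integral>\<omega>. G \<omega> * p k \<omega> $ i \<partial>M)" by (rule integral_X[OF G B])
    finally have "(\<integral>\<omega>. G \<omega> * (D k \<omega> $ i * D k \<omega> $ j) \<partial>M) = (\<integral>\<omega>. G \<omega> * p k \<omega> $ i \<partial>M) - (\<integral>\<omega>. G \<omega> * p k \<omega> $ i * p k \<omega> $ i \<partial>M)"
      using * True by simp
    also have "\<dots> = (\<integral>\<omega>. G \<omega> * p k \<omega> $ i - G \<omega> * p k \<omega> $ i * p k \<omega> $ i \<partial>M)"
      by (intro Bochner_Integration.integral_diff[symmetric] ipp G_integrable[OF G B] p_measurable p_abs)
    finally show ?thesis using True by (simp add: algebra_simps)
  qed
qed

end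

text \<open>Orthogonality of martingale differences. The bound does not depend on \<open>n\<close>
  at time \<open>K n\<close> and provides the tightness.\<close>

lemma (in martingale_array) second_moment:
  "integrable M (\<lambda>\<omega>. (\<Sum>k<m. x n k \<omega>)\<^sup>2) \<and> (\<integral>\<omega>. (\<Sum>k<m. x n k \<omega>)\<^sup>2 \<partial>M) \<le> (\<Sum>k<m. (b n k)\<^sup>2)"
proof (induction m)
  case 0 show ?case by simp
next
  case (Suc m)
  define S where "S \<omega> = (\<Sum>k<m. x n k \<omega>)" for \<omega>
  have [measurable]: "S \<in> borel_measurable M" unfolding S_def by measurable
  let ?s = "\<Sum>k<m. b n k"
  have Sb: "\<bar>S \<omega>\<bar> \<le> ?s" if "\<omega> \<in> space M" for \<omega>
    unfolding S_def by (rule order_trans[OF sum_abs sum_mono]) (use x_bound[OF that] in auto)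
  have s0: "0 \<le> ?s" by (intro sum_nonneg b_nonneg)
  have Sm: "S \<in> borel_measurable (F m)"
  proof -
    have "x n k \<in> borel_measurable (F m)" if "k < m" for k
      using measurable_from_subalg[OF F_le x_meas] that by (meson Suc_leI)
    then show ?thesis unfolding S_def by (intro borel_measurable_sum) auto
  qed
  have cross: "(\<integral>\<omega>. S \<omega> * x n m \<omega> \<partial>M) = 0" using x_mean[OF Sm] Sb by blast
  have i1: "integrable M (\<lambda>\<omega>. (S \<omega>)\<^sup>2)" using Suc by (simp add: S_def)
  have i2: "integrable M (\<lambda>\<omega>. S \<omega> * x n m \<omega>)"
  proof (rule bounded_integrable[where B = "?s * b n m"])
    fix \<omega> assume w: "\<omega> \<in> space M"
    show "norm (S \<omega> * x n m \<omega>) \<le> ?s * b n m"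
      unfolding real_norm_def abs_mult by (rule mult_mono[OF Sb[OF w] x_bound[OF w] s0]) simp
  qed simp
  have xsq: "(x n m \<omega>)\<^sup>2 \<le> (b n m)\<^sup>2" if "\<omega> \<in> space M" for \<omega>
    using x_bound[OF that, of n m] by (subst abs_le_square_iff[symmetric]) (simp add: b_nonneg)
  have i3: "integrable M (\<lambda>\<omega>. (x n m \<omega>)\<^sup>2)"
    by (rule bounded_integrable[where B = "(b n m)\<^sup>2"]) (use xsq in simp_all)
  have eq: "(\<Sum>k<Suc m. x n k \<omega>)\<^sup>2 = (S \<omega>)\<^sup>2 + 2 * (S \<omega> * x n m \<omega>) + (x n m \<omega>)\<^sup>2" for \<omega>
    by (simp add: S_def power2_eq_square algebra_simps)
  have "(\<integral>\<omega>. (\<Sum>k<Suc m. x n k \<omega>)\<^sup>2 \<partial>M) = (\<integral>\<omega>. (S \<omega>)\<^sup>2 \<partial>M) + 2 * (\<integral>\<omega>. S \<omega> * x n m \<omega> \<partial>M) + (\<integral>\<omega>. (x n m \<omega>)\<^sup>2 \<partial>M)"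
    unfolding eq using i1 i2 i3 by simp
  also have "\<dots> \<le> (\<Sum>k<m. (b n k)\<^sup>2) + 2 * 0 + (\<integral>\<omega>. (b n m)\<^sup>2 \<partial>M)"
  proof (intro add_mono)
    show "(\<integral>\<omega>. (S \<omega>)\<^sup>2 \<partial>M) \<le> (\<Sum>k<m. (b n k)\<^sup>2)" using Suc by (simp add: S_def)
    show "(\<integral>\<omega>. (x n m \<omega>)\<^sup>2 \<partial>M) \<le> (\<integral>\<omega>. (b n m)\<^sup>2 \<partial>M)" by (intro integral_mono i3 xsq) simp
  qed (simp add: cross)
  finally have "(\<integral>\<omega>. (\<Sum>k<Suc m. x n k \<omega>)\<^sup>2 \<partial>M) \<le> (\<Sum>k<Suc m. (b n k)\<^sup>2)" by (simp add: prob_space)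
  moreover have "integrable M (\<lambda>\<omega>. (\<Sum>k<Suc m. x n k \<omega>)\<^sup>2)" unfolding eq using i1 i2 i3 by simp
  ultimately show ?case by simp
qed

section \<open>Weighted sums of the martingale differences\<close>

context interacting_rsp
begin

definition s :: "nat \<Rightarrow> 'a \<Rightarrow> 'n \<Rightarrow> real" where "s k \<omega> j = p k \<omega> $ j * (1 - p k \<omega> $ j)"

lemma s_range: "\<omega> \<in> space M \<Longrightarrow> 0 \<le> s k \<omega> j \<and> s k \<omega> j \<le> 1"
  unfolding s_def using p_range[of \<omega> k j] by (simp add: mult_le_one)

text \<open>As the conditional covariance of \<open>D k\<close> is diagonal, the conditional
  variance of a weighted term is a weighted sum of the variances \<open>s k\<close>. The factor
  \<open>CARD('n)\<close> is a crude bound for the norm of \<open>D k\<close>.\<close>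

lemma weighted_martingale_array:
  fixes wt :: "nat \<Rightarrow> nat \<Rightarrow> real^'n"
  assumes K: "filterlim K at_top sequentially"
    and c2: "\<And>n. (\<Sum>k<K n. (norm (wt n k))\<^sup>2) \<le> Q" and c4: "(\<lambda>n. \<Sum>k<K n. norm (wt n k) ^ 4) \<longlonglongrightarrow> 0"
  shows "martingale_array M F K (\<lambda>n k \<omega>. wt n k \<bullet> D k \<omega>) (\<lambda>n k \<omega>. \<Sum>j\<in>UNIV. (wt n k $ j)\<^sup>2 * s k \<omega> j)
     (\<lambda>n k. norm (wt n k) * CARD('n)) (Q * (real CARD('n))\<^sup>2)"
proof
  show "subalgebra M (F m)" for m by (rule subalgebra_history)
  show "sets (F m) \<subseteq> sets (F (Suc m))" for m by (rule history_mono)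
  show "filterlim K sequentially sequentially" by (rule K)
  show "(\<lambda>\<omega>. wt n k \<bullet> D k \<omega>) \<in> borel_measurable (F (Suc k))" for n k
    unfolding inner_vec_def inner_real_def by (intro borel_measurable_sum borel_measurable_times D_history) simp
  show "(\<lambda>\<omega>. \<Sum>j\<in>UNIV. (wt n k $ j)\<^sup>2 * s k \<omega> j) \<in> borel_measurable (F k)" for n k
    unfolding s_def by (intro borel_measurable_sum borel_measurable_times borel_measurable_diff p_history) simp_all
  show "\<bar>wt n k \<bullet> D k \<omega>\<bar> \<le> norm (wt n k) * CARD('n)" if "\<omega> \<in> space M" for n k \<omega>
    by (rule order_trans[OF Cauchy_Schwarz_ineq2 mult_left_mono[OF D_norm[OF that]]]) simp
  show "0 \<le> (\<Sum>j\<in>UNIV. (wt n k $ j)\<^sup>2 * s k \<omega> j) \<and> (\<Sum>j\<in>UNIV. (wt n k $ j)\<^sup>2 * s k \<omega> j) \<le> (norm (wt n k) * CARD('n))\<^sup>2"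
    if "\<omega> \<in> space M" for n k \<omega>
  proof
    show "0 \<le> (\<Sum>j\<in>UNIV. (wt n k $ j)\<^sup>2 * s k \<omega> j)"
      using s_range[OF that] by (intro sum_nonneg mult_nonneg_nonneg) auto
    have "(\<Sum>j\<in>UNIV. (wt n k $ j)\<^sup>2 * s k \<omega> j) \<le> (\<Sum>j\<in>UNIV. (wt n k $ j)\<^sup>2 * 1)"
      using s_range[OF that] by (intro sum_mono mult_left_mono) auto
    also have "\<dots> = (norm (wt n k))\<^sup>2 * 1"
      by (simp add: norm_vec_def L2_set_def sum_nonneg)
    also have "\<dots> \<le> (norm (wt n k))\<^sup>2 * (real CARD('n))\<^sup>2"
      by (intro mult_left_mono one_le_power) (simp_all add: Suc_leI)
    finally show "(\<Sum>j\<in>UNIV. (wt n k $ j)\<^sup>2 * s k \<omega> j) \<le> (norm (wt n k) * CARD('n))\<^sup>2"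
      by (simp add: power_mult_distrib)
  qed
  show "(\<integral>\<omega>. G \<omega> * (wt n k \<bullet> D k \<omega>) \<partial>M) = 0"
    if G: "G \<in> borel_measurable (F k)" and B: "\<exists>B. \<forall>\<omega>\<in>space M. \<bar>G \<omega>\<bar> \<le> B" for n k and G :: "'a \<Rightarrow> real"
  proof -
    obtain B where B: "\<And>\<omega>. \<omega> \<in> space M \<Longrightarrow> \<bar>G \<omega>\<bar> \<le> B" using B by blast
    have "(\<integral>\<omega>. G \<omega> * (wt n k \<bullet> D k \<omega>) \<partial>M) = (\<integral>\<omega>. (\<Sum>j\<in>UNIV. wt n k $ j * (G \<omega> * D k \<omega> $ j)) \<partial>M)"
      by (intro Bochner_Integration.integral_cong refl) (simp add: inner_vec_def sum_distrib_left ac_simps)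
    also have "\<dots> = (\<Sum>j\<in>UNIV. wt n k $ j * (\<integral>\<omega>. G \<omega> * D k \<omega> $ j \<partial>M))"
      by (subst Bochner_Integration.integral_sum)
         (auto intro!: integrable_mult_right G_integrable[OF G B] D_measurable D_bound)
    finally show ?thesis using integral_D[OF G B] by simp
  qed
  show "(\<integral>\<omega>. G \<omega> * (wt n k \<bullet> D k \<omega>)\<^sup>2 \<partial>M) = (\<integral>\<omega>. G \<omega> * (\<Sum>j\<in>UNIV. (wt n k $ j)\<^sup>2 * s k \<omega> j) \<partial>M)"
    if G: "G \<in> borel_measurable (F k)" and B: "\<exists>B. \<forall>\<omega>\<in>space M. \<bar>G \<omega>\<bar> \<le> B" for n k and G :: "'a \<Rightarrow> real"
  proof -
    obtain B where B: "\<And>\<omega>. \<omega> \<in> space M \<Longrightarrow> \<bar>G \<omega>\<bar> \<le> B" using B by blast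
    have DD: "\<bar>D k \<omega> $ i * D k \<omega> $ j\<bar> \<le> 1" if "\<omega> \<in> space M" for \<omega> i j
      using mult_mono[OF D_bound[OF that] D_bound[OF that], of k j k i] by (simp add: abs_mult)
    have iD: "integrable M (\<lambda>\<omega>. G \<omega> * (D k \<omega> $ i * D k \<omega> $ j))" for i j
      by (intro G_integrable[OF G B] borel_measurable_times D_measurable DD)
    have sm: "(\<lambda>\<omega>. s k \<omega> j) \<in> borel_measurable M" for j
      unfolding s_def using p_measurable by measurable
    have ints: "integrable M (\<lambda>\<omega>. G \<omega> * s k \<omega> j)" for j
      by (rule G_integrable[OF G B sm]) (use s_range in auto)
    have "(\<integral>\<omega>. G \<omega> * (wt n k \<bullet> D k \<omega>)\<^sup>2 \<partial>M) =
        (\<integral>\<omega>. (\<Sum>i\<in>UNIV. \<Sum>j\<in>UNIV. wt n k $ i * wt n k $ j * (G \<omega> * (D k \<omega> $ i * D k \<omega> $ j))) \<partial>M)"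
      by (intro Bochner_Integration.integral_cong refl)
         (simp add: inner_vec_def power2_eq_square sum_product sum_distrib_left ac_simps)
    also have "\<dots> = (\<Sum>i\<in>UNIV. \<Sum>j\<in>UNIV. wt n k $ i * wt n k $ j * (\<integral>\<omega>. G \<omega> * (D k \<omega> $ i * D k \<omega> $ j) \<partial>M))"
      by (subst Bochner_Integration.integral_sum, intro Bochner_Integration.integrable_sum integrable_mult_right iD,
          intro sum.cong refl, subst Bochner_Integration.integral_sum, intro integrable_mult_right iD)
         simp
    also have "\<dots> = (\<Sum>i\<in>UNIV. \<Sum>j\<in>UNIV. if i = j then wt n k $ i * wt n k $ j * (\<integral>\<omega>. G \<omega> * s k \<omega> i \<partial>M) else 0)"
      by (intro sum.cong refl, subst integral_DD[OF G B]) (auto simp: s_def)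
    also have "\<dots> = (\<Sum>j\<in>UNIV. (wt n k $ j)\<^sup>2 * (\<integral>\<omega>. G \<omega> * s k \<omega> j \<partial>M))"
      by (simp add: power2_eq_square)
    also have "\<dots> = (\<integral>\<omega>. (\<Sum>j\<in>UNIV. (wt n k $ j)\<^sup>2 * (G \<omega> * s k \<omega> j)) \<partial>M)"
      by (subst Bochner_Integration.integral_sum) (auto intro!: integrable_mult_right ints)
    also have "\<dots> = (\<integral>\<omega>. G \<omega> * (\<Sum>j\<in>UNIV. (wt n k $ j)\<^sup>2 * s k \<omega> j) \<partial>M)"
      by (intro Bochner_Integration.integral_cong refl) (simp add: sum_distrib_left ac_simps)
    finally show ?thesis .
  qed
  show "(\<Sum>k<K n. (norm (wt n k) * CARD('n))\<^sup>2) \<le> Q * (real CARD('n))\<^sup>2" for n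
    using c2[of n] by (simp add: power_mult_distrib sum_distrib_right[symmetric] mult_right_mono)
  have "(\<lambda>n. (\<Sum>k<K n. norm (wt n k) ^ 4) * (real CARD('n)) ^ 4) \<longlonglongrightarrow> 0 * (real CARD('n)) ^ 4"
    by (intro tendsto_mult c4 tendsto_const)
  then show "(\<lambda>n. \<Sum>k<K n. (norm (wt n k) * CARD('n)) ^ 4) \<longlonglongrightarrow> 0"
    by (simp add: power_mult_distrib sum_distrib_right)
qed

text \<open>The columns of \<open>W\<close> sum to 1, so its transpose fixes constant vectors and
  \<open>p k\<close> has the same limit as \<open>Z k\<close>.\<close>

lemma s_limit:
  assumes lim: "(\<lambda>n. Z n \<omega>) \<longlonglongrightarrow> z *\<^sub>R 1"
  shows "(\<lambda>k. s k \<omega> j) \<longlonglongrightarrow> z * (1 - z)"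
proof -
  have "(\<lambda>k. p k \<omega> $ j) \<longlonglongrightarrow> (\<Sum>i\<in>UNIV. W $ i $ j * (z *\<^sub>R (1::real^'n)) $ i)"
    unfolding p_component by (intro tendsto_intros lim)
  then have "(\<lambda>k. p k \<omega> $ j) \<longlonglongrightarrow> z" by (simp add: sum_distrib_right[symmetric] W_column_sum)
  then show ?thesis unfolding s_def by (intro tendsto_intros)
qed

text \<open>All component variances converge to the same limit. The weights at any fixed time die
  out, hence \<open>weighted_average_null\<close> reduces the conditional variance of the sum to
  that limit times the sum of the squared weights.\<close>

lemma weighted_sum_char:
  fixes wt :: "nat \<Rightarrow> nat \<Rightarrow> real^'n" and Zinf :: "'a \<Rightarrow> real"
  assumes K: "filterlim K at_top sequentially"
    and c2: "(\<lambda>n. \<Sum>k<K n. (norm (wt n k))\<^sup>2) \<longlonglongrightarrow> q" and c4: "(\<lambda>n. \<Sum>k<K n. norm (wt n k) ^ 4) \<longlonglongrightarrow> 0"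
    and Zm: "Zinf \<in> borel_measurable M" and Zr: "\<And>\<omega>. \<omega> \<in> space M \<Longrightarrow> Zinf \<omega> \<in> {0..1}"
    and Zl: "AE \<omega> in M. (\<lambda>n. Z n \<omega>) \<longlonglongrightarrow> Zinf \<omega> *\<^sub>R 1"
  shows "\<exists>C. \<forall>n. integrable M (\<lambda>\<omega>. \<bar>\<Sum>k<K n. wt n k \<bullet> D k \<omega>\<bar>) \<and> (\<integral>\<omega>. \<bar>\<Sum>k<K n. wt n k \<bullet> D k \<omega>\<bar> \<partial>M) \<le> C"
    and "H \<in> sets M \<Longrightarrow> (\<lambda>n. \<integral>\<omega>. indicator H \<omega> *\<^sub>R iexp (\<Sum>k<K n. wt n k \<bullet> D k \<omega>) \<partial>M) \<longlonglongrightarrow>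
      (\<integral>\<omega>. indicator H \<omega> *\<^sub>R complex_of_real (exp (- (q * (Zinf \<omega> * (1 - Zinf \<omega>))) / 2)) \<partial>M)"
proof -
  have "Bseq (\<lambda>n. \<Sum>k<K n. (norm (wt n k))\<^sup>2)" using c2 by (auto intro: convergent_imp_Bseq convergentI)
  then obtain Q where "\<And>n. norm (\<Sum>k<K n. (norm (wt n k))\<^sup>2) \<le> Q"
    unfolding Bseq_def by blast
  then have Q: "(\<Sum>k<K n. (norm (wt n k))\<^sup>2) \<le> Q" for n using abs_le_D1 by (metis real_norm_def)
  interpret A: martingale_array M F K "\<lambda>n k \<omega>. wt n k \<bullet> D k \<omega>" "\<lambda>n k \<omega>. \<Sum>j\<in>UNIV. (wt n k $ j)\<^sup>2 * s k \<omega> j"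
     "\<lambda>n k. norm (wt n k) * CARD('n)" "Q * (real CARD('n))\<^sup>2"
    by (rule weighted_martingale_array[OF K Q c4])
  have q0: "0 \<le> q" by (rule LIMSEQ_le_const[OF c2]) (auto intro!: sum_nonneg)
  show "\<exists>C. \<forall>n. integrable M (\<lambda>\<omega>. \<bar>\<Sum>k<K n. wt n k \<bullet> D k \<omega>\<bar>) \<and> (\<integral>\<omega>. \<bar>\<Sum>k<K n. wt n k \<bullet> D k \<omega>\<bar> \<partial>M) \<le> C"
  proof (intro exI allI conjI)
    fix n
    have i2: "integrable M (\<lambda>\<omega>. (\<Sum>k<K n. wt n k \<bullet> D k \<omega>)\<^sup>2)" using A.second_moment by blast
    have i: "integrable M (\<lambda>\<omega>. \<Sum>k<K n. wt n k \<bullet> D k \<omega>)"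
      by (rule square_integrable_imp_integrable[OF _ i2]) (intro borel_measurable_sum A.xM)
    then show "integrable M (\<lambda>\<omega>. \<bar>\<Sum>k<K n. wt n k \<bullet> D k \<omega>\<bar>)" by simp
    have "(\<integral>\<omega>. \<bar>\<Sum>k<K n. wt n k \<bullet> D k \<omega>\<bar> \<partial>M) \<le> sqrt (\<integral>\<omega>. (\<Sum>k<K n. wt n k \<bullet> D k \<omega>)\<^sup>2 \<partial>M)"
      by (rule expectation_abs_le_sqrt[OF i i2])
    also have "\<dots> \<le> sqrt (Q * (real CARD('n))\<^sup>2)"
      using A.second_moment[of n "K n"] A.b2[of n] by (intro real_sqrt_le_mono) linarith
    finally show "(\<integral>\<omega>. \<bar>\<Sum>k<K n. wt n k \<bullet> D k \<omega>\<bar> \<partial>M) \<le> sqrt (Q * (real CARD('n))\<^sup>2)" .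
  qed
  assume H: "H \<in> sets M"
  have c0: "(\<lambda>n. (norm (wt n k))\<^sup>2) \<longlonglongrightarrow> 0" for k
  proof -
    have "(\<lambda>n. (norm (wt n k) * CARD('n) / CARD('n))\<^sup>2) \<longlonglongrightarrow> (0 / CARD('n))\<^sup>2"
      by (intro tendsto_intros A.b_tendsto_0) simp
    then show ?thesis by simp
  qed
  show "(\<lambda>n. \<integral>\<omega>. indicator H \<omega> *\<^sub>R iexp (\<Sum>k<K n. wt n k \<bullet> D k \<omega>) \<partial>M) \<longlonglongrightarrow>
      (\<integral>\<omega>. indicator H \<omega> *\<^sub>R complex_of_real (exp (- (q * (Zinf \<omega> * (1 - Zinf \<omega>))) / 2)) \<partial>M)"
  proof (rule A.char_convergence[OF _ _ _ H])
    show "(\<lambda>\<omega>. q * (Zinf \<omega> * (1 - Zinf \<omega>))) \<in> borel_measurable M" using Zm by measurable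
    show "0 \<le> q * (Zinf \<omega> * (1 - Zinf \<omega>))" if "\<omega> \<in> space M" for \<omega>
      using q0 Zr[OF that] by (intro mult_nonneg_nonneg) auto
    show "AE \<omega> in M. (\<lambda>n. \<Sum>k<K n. \<Sum>j\<in>UNIV. (wt n k $ j)\<^sup>2 * s k \<omega> j) \<longlonglongrightarrow> q * (Zinf \<omega> * (1 - Zinf \<omega>))"
      using Zl
    proof eventually_elim
      case (elim \<omega>)
      define V where "V = Zinf \<omega> * (1 - Zinf \<omega>)"
      define \<eta> where "\<eta> k = (\<Sum>j\<in>UNIV. \<bar>s k \<omega> j - V\<bar>)" for k
      have "\<eta> \<longlonglongrightarrow> (\<Sum>j\<in>(UNIV::'n set). \<bar>V - V\<bar>)"
        unfolding \<eta>_def V_def by (intro tendsto_intros s_limit elim)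
      then have \<eta>: "\<eta> \<longlonglongrightarrow> 0" by simp
      have n2: "(\<Sum>j\<in>UNIV. (wt n k $ j)\<^sup>2) = (norm (wt n k))\<^sup>2" for n k
        by (simp add: norm_vec_def L2_set_def sum_nonneg)
      have b: "\<bar>(\<Sum>j\<in>UNIV. (wt n k $ j)\<^sup>2 * s k \<omega> j) - (norm (wt n k))\<^sup>2 * V\<bar> \<le> (norm (wt n k))\<^sup>2 * \<eta> k" for n k
      proof -
        have "(\<Sum>j\<in>UNIV. (wt n k $ j)\<^sup>2 * s k \<omega> j) - (norm (wt n k))\<^sup>2 * V = (\<Sum>j\<in>UNIV. (wt n k $ j)\<^sup>2 * (s k \<omega> j - V))"
          unfolding n2[symmetric] by (simp add: sum_distrib_right sum_subtractf right_diff_distrib)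
        also have "\<bar>\<dots>\<bar> \<le> (\<Sum>j\<in>UNIV. \<bar>(wt n k $ j)\<^sup>2 * (s k \<omega> j - V)\<bar>)" by (rule sum_abs)
        also have "\<dots> \<le> (\<Sum>j\<in>UNIV. (norm (wt n k))\<^sup>2 * \<bar>s k \<omega> j - V\<bar>)"
        proof (rule sum_mono)
          fix j
          have "(wt n k $ j)\<^sup>2 \<le> (norm (wt n k))\<^sup>2"
            using component_le_norm_cart[of "wt n k" j] by (subst abs_le_square_iff[symmetric]) simp
          then show "\<bar>(wt n k $ j)\<^sup>2 * (s k \<omega> j - V)\<bar> \<le> (norm (wt n k))\<^sup>2 * \<bar>s k \<omega> j - V\<bar>"
            by (simp add: abs_mult mult_right_mono)
        qed
        finally show ?thesis by (simp add: \<eta>_def sum_distrib_left)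
      qed
      have "(\<lambda>n. \<Sum>k<K n. (norm (wt n k))\<^sup>2 * \<eta> k) \<longlonglongrightarrow> 0"
        by (rule weighted_average_null[OF _ Q c0 \<eta>]) (auto simp: \<eta>_def intro!: sum_nonneg)
      then have "(\<lambda>n. (\<Sum>k<K n. \<Sum>j\<in>UNIV. (wt n k $ j)\<^sup>2 * s k \<omega> j) - (\<Sum>k<K n. (norm (wt n k))\<^sup>2) * V) \<longlonglongrightarrow> 0"
      proof (rule Lim_null_comparison[rotated], intro always_eventually allI)
        fix n
        have "(\<Sum>k<K n. \<Sum>j\<in>UNIV. (wt n k $ j)\<^sup>2 * s k \<omega> j) - (\<Sum>k<K n. (norm (wt n k))\<^sup>2) * V =
           (\<Sum>k<K n. (\<Sum>j\<in>UNIV. (wt n k $ j)\<^sup>2 * s k \<omega> j) - (norm (wt n k))\<^sup>2 * V)"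
          by (simp add: sum_subtractf sum_distrib_right)
        also have "norm \<dots> \<le> (\<Sum>k<K n. (norm (wt n k))\<^sup>2 * \<eta> k)"
          by (rule order_trans[OF norm_sum sum_mono]) (use b in simp)
        finally show "norm ((\<Sum>k<K n. \<Sum>j\<in>UNIV. (wt n k $ j)\<^sup>2 * s k \<omega> j) - (\<Sum>k<K n. (norm (wt n k))\<^sup>2) * V) \<le> (\<Sum>k<K n. (norm (wt n k))\<^sup>2 * \<eta> k)" .
      qed
      from tendsto_add[OF this tendsto_mult[OF c2 tendsto_const[of V]]]
      show ?case by (simp add: V_def)
    qed
  qed
qed

end

section \<open>Reduction to sums of squared weights\<close>

lemma norm_iexp_diff_le: "norm (iexp a - iexp b) \<le> \<bar>a - b\<bar>"
proof -
  have "iexp b * iexp (a - b) = iexp a" by (simp add: exp_add[symmetric] right_diff_distrib)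
  then have "iexp a - iexp b = iexp b * (iexp (a - b) - 1)" by (simp add: right_diff_distrib)
  then have "norm (iexp a - iexp b) = norm (iexp (a - b) - 1)" by (simp add: norm_mult)
  also have "\<dots> \<le> \<bar>a - b\<bar>" using iexp_approx1[of "a - b" 0] by simp
  finally show ?thesis .
qed

lemma scaled_matrix_quadratic: "w \<bullet> ((t *\<^sub>R S) *v w) = t * (w \<bullet> (S *v w))" for S :: "real^'n^'n"
  by (simp add: scaleR_matrix_vector_assoc[symmetric])

text \<open>Crude comparison with the largest summand. It carries fourth power estimates from the
  single eigencomponents to the weights.\<close>

lemma sum_power4_le:
  fixes f :: "'c \<Rightarrow> real"
  shows "finite I \<Longrightarrow> (\<Sum>i\<in>I. \<bar>f i\<bar>) ^ 4 \<le> real (card I) ^ 4 * (\<Sum>i\<in>I. \<bar>f i\<bar> ^ 4)"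
proof (cases "I = {}")
  case False
  assume I: "finite I"
  define m where "m = Max ((\<lambda>i. \<bar>f i\<bar>) ` I)"
  have m: "\<bar>f i\<bar> \<le> m" if "i \<in> I" for i unfolding m_def using I that by (intro Max_ge) auto
  have "m \<in> (\<lambda>i. \<bar>f i\<bar>) ` I" unfolding m_def using I False by (intro Max_in) auto
  then obtain i0 where i0: "i0 \<in> I" "m = \<bar>f i0\<bar>" by auto
  have "(\<Sum>i\<in>I. \<bar>f i\<bar>) \<le> real (card I) * m" using sum_bounded_above[of I "\<lambda>i. \<bar>f i\<bar>" m] m by simp
  then have "(\<Sum>i\<in>I. \<bar>f i\<bar>) ^ 4 \<le> (real (card I) * m) ^ 4" by (intro power_mono sum_nonneg) auto
  also have "\<dots> = real (card I) ^ 4 * m ^ 4" by (simp add: power_mult_distrib)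
  also have "m ^ 4 \<le> (\<Sum>i\<in>I. \<bar>f i\<bar> ^ 4)" unfolding i0(2) using I i0(1) by (intro member_le_sum) auto
  finally show ?thesis by (simp add: mult_left_mono)
qed simp

context interacting_rsp
begin

text \<open>The weights solve the adjoint recursion: \<open>w k \<bullet> Z k\<close> is the
  predictable part of \<open>w (Suc k) \<bullet> Z (Suc k)\<close>, so one step back in time
  releases exactly one martingale difference.\<close>

lemma backward_representation:
  fixes w :: "nat \<Rightarrow> real^'n"
  assumes w: "\<And>k. k < n \<Longrightarrow> w k = (1 - r k) *\<^sub>R w (Suc k) + r k *\<^sub>R (W *v w (Suc k))" and \<omega>: "\<omega> \<in> space M"
  shows "w n \<bullet> Z n \<omega> = w 0 \<bullet> Z 0 \<omega> + (\<Sum>k<n. r k * (w (Suc k) \<bullet> D k \<omega>))"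
proof -
  have "m \<le> n \<Longrightarrow> w m \<bullet> Z m \<omega> = w 0 \<bullet> Z 0 \<omega> + (\<Sum>k<m. r k * (w (Suc k) \<bullet> D k \<omega>))" for m
  proof (induction m)
    case (Suc m)
    have "w (Suc m) \<bullet> Z (Suc m) \<omega> = w (Suc m) \<bullet> ((1 - r m) *\<^sub>R Z m \<omega> + r m *\<^sub>R p m \<omega>) + r m * (w (Suc m) \<bullet> D m \<omega>)"
      unfolding Z_step[OF \<omega>] by (simp add: D_def inner_simps algebra_simps)
    also have "w (Suc m) \<bullet> ((1 - r m) *\<^sub>R Z m \<omega> + r m *\<^sub>R p m \<omega>) = w m \<bullet> Z m \<omega>"
    proof -
      have "w (Suc m) \<bullet> p m \<omega> = (W *v w (Suc m)) \<bullet> Z m \<omega>"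
        unfolding p_def by (metis dot_lmul_matrix inner_commute vector_transpose_matrix)
      then show ?thesis using w[of m] Suc.prems by (simp add: inner_simps)
    qed
    finally show ?case using Suc by simp
  qed simp
  from this[OF order_refl] show ?thesis .
qed

text \<open>The projection on \<open>t\<close> splits as
  \<open>(t - (t \<bullet> 1) \<nu>) \<bullet> Z n\<close> plus \<open>t \<bullet> 1\<close> times
  \<open>\<nu> \<bullet> Z n - Zinf\<close>. The first part is unrolled back to time 0 with the
  weights \<open>w t n\<close>; the second is minus the tail of the martingale
  \<open>\<nu> \<bullet> Z\<close>. The first contributes \<open>q t\<close> to the variance, the
  second the term with \<tau>.\<close>

lemma stable_limit:
  fixes a :: "nat \<Rightarrow> real" and \<nu> :: "real^'n" and S :: "real^'n^'n" and Zinf :: "'a \<Rightarrow> real"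
    and w :: "real^'n \<Rightarrow> nat \<Rightarrow> nat \<Rightarrow> real^'n" and q :: "real^'n \<Rightarrow> real"
  assumes Zm: "Zinf \<in> borel_measurable M" and Zr: "\<And>\<omega>. \<omega> \<in> space M \<Longrightarrow> Zinf \<omega> \<in> {0..1}"
    and Zl: "AE \<omega> in M. (\<lambda>n. Z n \<omega>) \<longlonglongrightarrow> Zinf \<omega> *\<^sub>R 1"
    and \<nu>: "W *v \<nu> = \<nu>" "\<nu> \<bullet> 1 = 1"
    and w_end: "\<And>t n. w t n n = t - (t \<bullet> 1) *\<^sub>R \<nu>"
    and w_rec: "\<And>t n k. k < n \<Longrightarrow> w t n k = (1 - r k) *\<^sub>R w t n (Suc k) + r k *\<^sub>R (W *v w t n (Suc k))"
    and w_init: "\<And>t. (\<lambda>n. a n * norm (w t n 0)) \<longlonglongrightarrow> 0"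
    and w_2: "\<And>t. (\<lambda>n. (a n)\<^sup>2 * (\<Sum>k<n. (r k)\<^sup>2 * (norm (w t n (Suc k)))\<^sup>2)) \<longlonglongrightarrow> q t"
    and w_4: "\<And>t. (\<lambda>n. (a n) ^ 4 * (\<Sum>k<n. (r k) ^ 4 * norm (w t n (Suc k)) ^ 4)) \<longlonglongrightarrow> 0"
    and r2: "summable (\<lambda>k. (r k)\<^sup>2)" and tail: "(\<lambda>n. (a n)\<^sup>2 * (\<Sum>k. (r (k + n))\<^sup>2)) \<longlonglongrightarrow> \<tau>"
    and sup: "\<eta> \<longlonglongrightarrow> 0" "\<And>n k. n \<le> k \<Longrightarrow> (a n)\<^sup>2 * (r k)\<^sup>2 \<le> \<eta> n"
    and psd: "pos_semidef S" and quad: "\<And>t. t \<bullet> (S *v t) = q t + (t \<bullet> 1)\<^sup>2 * (norm \<nu>)\<^sup>2 * \<tau>"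
  shows "stably_to_gaussian M (\<lambda>n \<omega>. a n *\<^sub>R (Z n \<omega> - Zinf \<omega> *\<^sub>R 1)) (\<lambda>\<omega>. (Zinf \<omega> * (1 - Zinf \<omega>)) *\<^sub>R S)"
proof -
  have [measurable]: "Zinf \<in> borel_measurable M" by (rule Zm)
  have \<nu>Z_rep: "\<nu> \<bullet> Z m \<omega> = \<nu> \<bullet> Z 0 \<omega> + (\<Sum>k<m. r k * (\<nu> \<bullet> D k \<omega>))" if "\<omega> \<in> space M" for m \<omega>
    by (rule backward_representation[of m "\<lambda>_. \<nu>", OF _ that]) (simp add: \<nu> scaleR_left_distrib[symmetric])
  define \<rho> where "\<rho> m \<omega> = \<nu> \<bullet> Z m \<omega> - Zinf \<omega>" for m \<omega>
  have \<rho>m [measurable]: "\<rho> m \<in> borel_measurable M" for m unfolding \<rho>_def by measurable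
  have Zn: "norm (Z m \<omega>) \<le> CARD('n)" if "\<omega> \<in> space M" for m \<omega>
  proof -
    have "(\<Sum>j\<in>UNIV. \<bar>Z m \<omega> $ j\<bar>) \<le> (\<Sum>j\<in>(UNIV::'n set). 1)"
      using Z_range[OF that, of m] by (intro sum_mono) (simp add: abs_le_iff)
    with norm_le_l1_cart[of "Z m \<omega>"] show ?thesis by simp
  qed
  define B where "B = norm \<nu> * CARD('n) + 1"
  have \<rho>B: "\<bar>\<rho> m \<omega>\<bar> \<le> B" if "\<omega> \<in> space M" for m \<omega>
  proof -
    have "\<bar>\<nu> \<bullet> Z m \<omega>\<bar> \<le> norm \<nu> * CARD('n)"
      by (rule order_trans[OF Cauchy_Schwarz_ineq2 mult_left_mono[OF Zn[OF that]]]) simp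
    then show ?thesis using Zr[OF that] unfolding \<rho>_def B_def by auto
  qed
  have \<rho>i: "integrable M (\<lambda>\<omega>. \<bar>\<rho> m \<omega>\<bar>)" for m
    by (rule integrable_const_bound[of _ B]) (use \<rho>B in auto)
  have \<rho>0: "(\<lambda>m. \<integral>\<omega>. \<bar>\<rho> m \<omega>\<bar> \<partial>M) \<longlonglongrightarrow> (\<integral>\<omega>. 0 \<partial>M)"
  proof (rule integral_dominated_convergence[where w = "\<lambda>_. B"])
    show "AE \<omega> in M. (\<lambda>m. \<bar>\<rho> m \<omega>\<bar>) \<longlonglongrightarrow> 0" using Zl
    proof eventually_elim
      case (elim \<omega>)
      have "(\<lambda>m. \<nu> \<bullet> Z m \<omega> - Zinf \<omega>) \<longlonglongrightarrow> \<nu> \<bullet> (Zinf \<omega> *\<^sub>R 1) - Zinf \<omega>" by (intro tendsto_intros elim)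
      then show ?case by (intro tendsto_rabs_zero) (simp add: \<rho>_def \<nu>)
    qed
    show "AE \<omega> in M. norm \<bar>\<rho> m \<omega>\<bar> \<le> B" for m using \<rho>B by (intro AE_I2) simp
  qed simp_all
  have r2n: "summable (\<lambda>k. (r (k + n))\<^sup>2)" for n using r2 summable_iff_shift[of "\<lambda>k. (r k)\<^sup>2" n] by blast
  have tail0: "(\<lambda>m. \<Sum>k. (r (k + m))\<^sup>2) \<longlonglongrightarrow> 0" by (rule suminf_exist_split2[OF r2])
  \<comment> \<open>Two demands on the cut: the squared weights beyond it are negligible, and so is
    the scaled remainder \<open>\<rho>\<close> in \<open>L1\<close>. Both can be met for fixed
    \<open>n\<close>, whatever the size of \<open>a n\<close>.\<close>
  have exK: "\<exists>m. n \<le> m \<and> (a n)\<^sup>2 * (\<Sum>k. (r (k + m))\<^sup>2) < 1 / Suc n \<and> \<bar>a n\<bar> * (\<integral>\<omega>. \<bar>\<rho> m \<omega>\<bar> \<partial>M) < 1 / Suc n" for n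
  proof -
    have "(\<lambda>m. (a n)\<^sup>2 * (\<Sum>k. (r (k + m))\<^sup>2)) \<longlonglongrightarrow> (a n)\<^sup>2 * 0" by (intro tendsto_mult tendsto_const tail0)
    then have "\<forall>\<^sub>F m in sequentially. (a n)\<^sup>2 * (\<Sum>k. (r (k + m))\<^sup>2) < 1 / Suc n" by (rule order_tendstoD(2)) simp
    moreover have "(\<lambda>m. \<bar>a n\<bar> * (\<integral>\<omega>. \<bar>\<rho> m \<omega>\<bar> \<partial>M)) \<longlonglongrightarrow> \<bar>a n\<bar> * (\<integral>\<omega>. 0 \<partial>M)" by (intro tendsto_mult tendsto_const \<rho>0)
    then have "\<forall>\<^sub>F m in sequentially. \<bar>a n\<bar> * (\<integral>\<omega>. \<bar>\<rho> m \<omega>\<bar> \<partial>M) < 1 / Suc n" by (rule order_tendstoD(2)) simp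
    ultimately have "\<forall>\<^sub>F m in sequentially. n \<le> m \<and> (a n)\<^sup>2 * (\<Sum>k. (r (k + m))\<^sup>2) < 1 / Suc n \<and> \<bar>a n\<bar> * (\<integral>\<omega>. \<bar>\<rho> m \<omega>\<bar> \<partial>M) < 1 / Suc n"
      using eventually_ge_at_top[of n] by eventually_elim simp
    then show ?thesis by (auto simp: eventually_sequentially)
  qed
  then obtain K where K: "\<And>n. n \<le> K n" "\<And>n. (a n)\<^sup>2 * (\<Sum>k. (r (k + K n))\<^sup>2) < 1 / Suc n"
    "\<And>n. \<bar>a n\<bar> * (\<integral>\<omega>. \<bar>\<rho> (K n) \<omega>\<bar> \<partial>M) < 1 / Suc n" by metis
  have Ktop: "filterlim K at_top sequentially"
    by (rule filterlim_at_top_mono[OF filterlim_ident]) (use K(1) in auto)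
  have inv0: "(\<lambda>n. 1 / real (Suc n)) \<longlonglongrightarrow> 0" using LIMSEQ_inverse_real_of_nat by (simp add: inverse_eq_divide)
  \<comment> \<open>The minus sign after time \<open>n\<close> appears because
    \<open>\<nu> \<bullet> Z n - Zinf\<close> is the negative of what the martingale still
    gains.\<close>
  define wt where "wt t n k = (a n * r k) *\<^sub>R (if k < n then w t n (Suc k) else (- (t \<bullet> 1)) *\<^sub>R \<nu>)" for t n k
  have split: "(\<Sum>k<K n. f k) = (\<Sum>k<n. f k) + (\<Sum>k=n..<K n. f k)" for n and f :: "nat \<Rightarrow> real"
    using sum.atLeastLessThan_concat[of 0 n "K n" f] K(1)[of n] by (simp add: atLeast0LessThan)
  have seg: "(\<Sum>k=n..<K n. (r k)\<^sup>2) = (\<Sum>k. (r (k + n))\<^sup>2) - (\<Sum>k. (r (k + K n))\<^sup>2)" for n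
  proof -
    have "(\<Sum>k. (r (k + n))\<^sup>2) = (\<Sum>k. (r (k + (K n - n) + n))\<^sup>2) + (\<Sum>k<K n - n. (r (k + n))\<^sup>2)"
      by (rule suminf_split_initial_segment[OF r2n])
    moreover have "(\<Sum>k<K n - n. (r (k + n))\<^sup>2) = (\<Sum>k=n..<K n. (r k)\<^sup>2)"
      using K(1)[of n] sum.shift_bounds_nat_ivl[of "\<lambda>k. (r k)\<^sup>2" 0 n "K n - n"] by (simp add: atLeast0LessThan)
    ultimately show ?thesis using K(1)[of n] by (simp add: add.assoc)
  qed
  have seg_lim: "(\<lambda>n. (a n)\<^sup>2 * (\<Sum>k=n..<K n. (r k)\<^sup>2)) \<longlonglongrightarrow> \<tau>"
  proof -
    have "(\<lambda>n. (a n)\<^sup>2 * (\<Sum>k. (r (k + K n))\<^sup>2)) \<longlonglongrightarrow> 0"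
      by (rule Lim_null_comparison[OF _ inv0])
         (use K(2) r2n in \<open>auto intro!: always_eventually less_imp_le simp: abs_mult abs_of_nonneg suminf_nonneg\<close>)
    from tendsto_diff[OF tail this] show ?thesis by (simp add: seg right_diff_distrib)
  qed
  have wt2: "(\<lambda>n. \<Sum>k<K n. (norm (wt t n k))\<^sup>2) \<longlonglongrightarrow> t \<bullet> (S *v t)" for t
  proof -
    have "(\<Sum>k<K n. (norm (wt t n k))\<^sup>2) = (a n)\<^sup>2 * (\<Sum>k<n. (r k)\<^sup>2 * (norm (w t n (Suc k)))\<^sup>2) +
       (t \<bullet> 1)\<^sup>2 * (norm \<nu>)\<^sup>2 * ((a n)\<^sup>2 * (\<Sum>k=n..<K n. (r k)\<^sup>2))" for n
      unfolding split by (simp add: wt_def power_mult_distrib sum_distrib_left ac_simps)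
    moreover have "(\<lambda>n. (a n)\<^sup>2 * (\<Sum>k<n. (r k)\<^sup>2 * (norm (w t n (Suc k)))\<^sup>2) +
       (t \<bullet> 1)\<^sup>2 * (norm \<nu>)\<^sup>2 * ((a n)\<^sup>2 * (\<Sum>k=n..<K n. (r k)\<^sup>2))) \<longlonglongrightarrow> q t + (t \<bullet> 1)\<^sup>2 * (norm \<nu>)\<^sup>2 * \<tau>"
      by (intro tendsto_add tendsto_mult tendsto_const seg_lim w_2)
    ultimately show ?thesis by (simp add: quad)
  qed
  have wt4: "(\<lambda>n. \<Sum>k<K n. norm (wt t n k) ^ 4) \<longlonglongrightarrow> 0" for t
  proof -
    have "(\<Sum>k<K n. norm (wt t n k) ^ 4) = (a n) ^ 4 * (\<Sum>k<n. (r k) ^ 4 * norm (w t n (Suc k)) ^ 4) +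
       (t \<bullet> 1) ^ 4 * norm \<nu> ^ 4 * (\<Sum>k=n..<K n. (a n)\<^sup>2 * (r k)\<^sup>2 * ((a n)\<^sup>2 * (r k)\<^sup>2))" for n
      unfolding split by (simp add: wt_def power_mult_distrib sum_distrib_left power_even_abs ac_simps flip: power_add)
    \<comment> \<open>One of the two factors \<open>(a n)^2 * (r k)^2\<close> is at most
      \<open>\<eta> n\<close> and tends to 0, while the sum over the other one converges.\<close>
    moreover have "(\<lambda>n. \<Sum>k=n..<K n. (a n)\<^sup>2 * (r k)\<^sup>2 * ((a n)\<^sup>2 * (r k)\<^sup>2)) \<longlonglongrightarrow> 0"
    proof (rule Lim_null_comparison)
      show "\<forall>\<^sub>F n in sequentially. norm (\<Sum>k=n..<K n. (a n)\<^sup>2 * (r k)\<^sup>2 * ((a n)\<^sup>2 * (r k)\<^sup>2)) \<le> \<eta> n * ((a n)\<^sup>2 * (\<Sum>k=n..<K n. (r k)\<^sup>2))"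
      proof (intro always_eventually allI)
        fix n
        have "(\<Sum>k=n..<K n. (a n)\<^sup>2 * (r k)\<^sup>2 * ((a n)\<^sup>2 * (r k)\<^sup>2)) \<le> (\<Sum>k=n..<K n. \<eta> n * ((a n)\<^sup>2 * (r k)\<^sup>2))"
          by (intro sum_mono mult_right_mono sup) auto
        also have "\<dots> = \<eta> n * ((a n)\<^sup>2 * (\<Sum>k=n..<K n. (r k)\<^sup>2))" by (simp add: sum_distrib_left)
        finally show "norm (\<Sum>k=n..<K n. (a n)\<^sup>2 * (r k)\<^sup>2 * ((a n)\<^sup>2 * (r k)\<^sup>2)) \<le> \<eta> n * ((a n)\<^sup>2 * (\<Sum>k=n..<K n. (r k)\<^sup>2))"
          by (simp add: abs_of_nonneg sum_nonneg)
      qed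
      show "(\<lambda>n. \<eta> n * ((a n)\<^sup>2 * (\<Sum>k=n..<K n. (r k)\<^sup>2))) \<longlonglongrightarrow> 0"
        using tendsto_mult[OF sup(1) seg_lim] by simp
    qed
    then have "(\<lambda>n. (a n) ^ 4 * (\<Sum>k<n. (r k) ^ 4 * norm (w t n (Suc k)) ^ 4) +
       (t \<bullet> 1) ^ 4 * norm \<nu> ^ 4 * (\<Sum>k=n..<K n. (a n)\<^sup>2 * (r k)\<^sup>2 * ((a n)\<^sup>2 * (r k)\<^sup>2))) \<longlonglongrightarrow> 0 + (t \<bullet> 1) ^ 4 * norm \<nu> ^ 4 * 0"
      by (intro tendsto_add tendsto_mult tendsto_const w_4)
    ultimately show ?thesis by simp
  qed
  note A = weighted_sum_char[OF Ktop wt2 wt4 Zm Zr Zl]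
  define Y where "Y n \<omega> = a n *\<^sub>R (Z n \<omega> - Zinf \<omega> *\<^sub>R 1)" for n \<omega>
  define L where "L t n \<omega> = (\<Sum>k<K n. wt t n k \<bullet> D k \<omega>)" for t n \<omega>
  define R where "R t n \<omega> = a n * (w t n 0 \<bullet> Z 0 \<omega>) + (t \<bullet> 1) * (a n * \<rho> (K n) \<omega>)" for t n \<omega>
  have Ym [measurable]: "Y n \<in> borel_measurable M" for n unfolding Y_def by measurable
  have Lm [measurable]: "L t n \<in> borel_measurable M" for t n
    unfolding L_def inner_vec_def inner_real_def by (intro borel_measurable_sum borel_measurable_times D_measurable) simp
  have dec: "t \<bullet> Y n \<omega> = L t n \<omega> + R t n \<omega>" if "\<omega> \<in> space M" for t n \<omega>
  proof -
    have "t \<bullet> Y n \<omega> = a n * ((t - (t \<bullet> 1) *\<^sub>R \<nu>) \<bullet> Z n \<omega> + (t \<bullet> 1) * (\<nu> \<bullet> Z n \<omega> - Zinf \<omega>))"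
      by (simp add: Y_def inner_simps algebra_simps)
    also have "(t - (t \<bullet> 1) *\<^sub>R \<nu>) \<bullet> Z n \<omega> = w t n 0 \<bullet> Z 0 \<omega> + (\<Sum>k<n. r k * (w t n (Suc k) \<bullet> D k \<omega>))"
      using backward_representation[of n "w t n", OF w_rec that] by (simp add: w_end)
    also have "\<nu> \<bullet> Z n \<omega> - Zinf \<omega> = \<rho> (K n) \<omega> - (\<Sum>k=n..<K n. r k * (\<nu> \<bullet> D k \<omega>))"
      unfolding \<rho>_def \<nu>Z_rep[OF that, of n] \<nu>Z_rep[OF that, of "K n"] split by simp
    finally have "t \<bullet> Y n \<omega> = R t n \<omega> + (a n * (\<Sum>k<n. r k * (w t n (Suc k) \<bullet> D k \<omega>)) - a n * (t \<bullet> 1) * (\<Sum>k=n..<K n. r k * (\<nu> \<bullet> D k \<omega>)))"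
      by (simp add: R_def algebra_simps)
    also have "a n * (\<Sum>k<n. r k * (w t n (Suc k) \<bullet> D k \<omega>)) - a n * (t \<bullet> 1) * (\<Sum>k=n..<K n. r k * (\<nu> \<bullet> D k \<omega>)) = L t n \<omega>"
      unfolding L_def split by (simp add: wt_def sum_distrib_left sum_negf ac_simps)
    finally show ?thesis by simp
  qed
  define E where "E t n = \<bar>a n * norm (w t n 0)\<bar> * CARD('n) + \<bar>t \<bullet> 1\<bar> * (1 / Suc n)" for t n
  have Rm [measurable]: "R t n \<in> borel_measurable M" for t n unfolding R_def using Z0_measurable by measurable
  have RB: "\<bar>R t n \<omega>\<bar> \<le> \<bar>a n * norm (w t n 0)\<bar> * CARD('n) + \<bar>t \<bullet> 1\<bar> * (\<bar>a n\<bar> * \<bar>\<rho> (K n) \<omega>\<bar>)" if "\<omega> \<in> space M" for t n \<omega>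
  proof -
    have "\<bar>w t n 0 \<bullet> Z 0 \<omega>\<bar> \<le> norm (w t n 0) * CARD('n)"
      by (rule order_trans[OF Cauchy_Schwarz_ineq2 mult_left_mono[OF Zn[OF that]]]) simp
    then have "\<bar>a n * (w t n 0 \<bullet> Z 0 \<omega>)\<bar> \<le> \<bar>a n * norm (w t n 0)\<bar> * CARD('n)"
      unfolding abs_mult mult.assoc by (intro mult_left_mono) simp_all
    moreover have "\<bar>(t \<bullet> 1) * (a n * \<rho> (K n) \<omega>)\<bar> = \<bar>t \<bullet> 1\<bar> * (\<bar>a n\<bar> * \<bar>\<rho> (K n) \<omega>\<bar>)" by (simp add: abs_mult)
    ultimately show ?thesis unfolding R_def by linarith
  qed
  have iRB: "integrable M (\<lambda>\<omega>. \<bar>a n * norm (w t n 0)\<bar> * CARD('n) + \<bar>t \<bullet> 1\<bar> * (\<bar>a n\<bar> * \<bar>\<rho> (K n) \<omega>\<bar>))" for t n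
    using \<rho>i[of "K n"] by simp
  have Ri: "integrable M (\<lambda>\<omega>. \<bar>R t n \<omega>\<bar>)" for t n
    by (rule Bochner_Integration.integrable_bound[OF iRB[of n t]]) (use RB in \<open>auto intro!: AE_I2 intro: order_trans[OF _ abs_ge_self]\<close>)
  have RE: "(\<integral>\<omega>. \<bar>R t n \<omega>\<bar> \<partial>M) \<le> E t n" for t n
  proof -
    have "(\<integral>\<omega>. \<bar>R t n \<omega>\<bar> \<partial>M) \<le> (\<integral>\<omega>. \<bar>a n * norm (w t n 0)\<bar> * CARD('n) + \<bar>t \<bullet> 1\<bar> * (\<bar>a n\<bar> * \<bar>\<rho> (K n) \<omega>\<bar>) \<partial>M)"
      by (rule integral_mono[OF Ri iRB RB])
    also have "\<dots> = \<bar>a n * norm (w t n 0)\<bar> * CARD('n) + \<bar>t \<bullet> 1\<bar> * (\<bar>a n\<bar> * (\<integral>\<omega>. \<bar>\<rho> (K n) \<omega>\<bar> \<partial>M))"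
      using \<rho>i[of "K n"] by (simp add: prob_space)
    also have "\<dots> \<le> E t n" unfolding E_def
      by (intro add_left_mono mult_left_mono K(3)[THEN less_imp_le]) simp
    finally show ?thesis .
  qed
  have E0: "E t \<longlonglongrightarrow> 0" for t
  proof -
    have "(\<lambda>n. \<bar>a n * norm (w t n 0)\<bar> * CARD('n) + \<bar>t \<bullet> 1\<bar> * (1 / Suc n)) \<longlonglongrightarrow> 0 * real CARD('n) + \<bar>t \<bullet> 1\<bar> * 0"
      by (intro tendsto_add tendsto_mult tendsto_const inv0 tendsto_rabs_zero w_init)
    then show ?thesis unfolding E_def[abs_def] by (simp only: mult_zero_left mult_zero_right add_0_left)
  qed
  have first: "\<exists>C. \<forall>n. integrable M (\<lambda>\<omega>. \<bar>t \<bullet> Y n \<omega>\<bar>) \<and> (\<integral>\<omega>. \<bar>t \<bullet> Y n \<omega>\<bar> \<partial>M) \<le> C" for t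
  proof -
    obtain C where C: "\<And>n. integrable M (\<lambda>\<omega>. \<bar>L t n \<omega>\<bar>)" "\<And>n. (\<integral>\<omega>. \<bar>L t n \<omega>\<bar> \<partial>M) \<le> C"
      using A(1)[of t] unfolding L_def by blast
    have "Bseq (E t)" using E0 by (auto intro: convergent_imp_Bseq convergentI)
    then obtain C' where C': "\<And>n. norm (E t n) \<le> C'" unfolding Bseq_def by blast
    show ?thesis
    proof (intro exI allI conjI)
      fix n
      have i: "integrable M (\<lambda>\<omega>. \<bar>L t n \<omega>\<bar> + \<bar>R t n \<omega>\<bar>)" using C(1) Ri by simp
      show iY: "integrable M (\<lambda>\<omega>. \<bar>t \<bullet> Y n \<omega>\<bar>)"
      proof (rule Bochner_Integration.integrable_bound[OF i])
        show "AE \<omega> in M. norm \<bar>t \<bullet> Y n \<omega>\<bar> \<le> norm (\<bar>L t n \<omega>\<bar> + \<bar>R t n \<omega>\<bar>)"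
          using dec by (intro AE_I2) simp
      qed measurable
      have "(\<integral>\<omega>. \<bar>t \<bullet> Y n \<omega>\<bar> \<partial>M) \<le> (\<integral>\<omega>. \<bar>L t n \<omega>\<bar> + \<bar>R t n \<omega>\<bar> \<partial>M)"
        by (rule integral_mono[OF iY i]) (simp add: dec abs_triangle_ineq)
      also have "\<dots> = (\<integral>\<omega>. \<bar>L t n \<omega>\<bar> \<partial>M) + (\<integral>\<omega>. \<bar>R t n \<omega>\<bar> \<partial>M)"
        by (rule Bochner_Integration.integral_add[OF C(1) Ri])
      also have "\<dots> \<le> C + C'" using C(2)[of n] RE[of t n] C'[of n] by simp
      finally show "(\<integral>\<omega>. \<bar>t \<bullet> Y n \<omega>\<bar> \<partial>M) \<le> C + C'" .
    qed
  qed
  then obtain C where C: "\<And>t n. integrable M (\<lambda>\<omega>. \<bar>t \<bullet> Y n \<omega>\<bar>)" "\<And>t n. (\<integral>\<omega>. \<bar>t \<bullet> Y n \<omega>\<bar> \<partial>M) \<le> C t" by metis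
  \<comment> \<open>The first moment of the norm is bounded coordinatewise, by taking the coordinate
    vectors for \<open>t\<close>.\<close>
  have axis: "axis j 1 \<bullet> y = y $ j" for j and y :: "real^'n" by (simp add: inner_axis')
  have "stably_to_gaussian M Y (\<lambda>\<omega>. (Zinf \<omega> * (1 - Zinf \<omega>)) *\<^sub>R S)"
  proof (rule stably_to_gaussianI[where C = "\<Sum>j\<in>UNIV. C (axis j 1)"])
    show "(\<lambda>\<omega>. (Zinf \<omega> * (1 - Zinf \<omega>)) *\<^sub>R S) \<in> borel_measurable M" by measurable
    show "pos_semidef ((Zinf \<omega> * (1 - Zinf \<omega>)) *\<^sub>R S)" if "\<omega> \<in> space M" for \<omega>
      unfolding pos_semidef_def
    proof (intro conjI allI)
      show "transpose ((Zinf \<omega> * (1 - Zinf \<omega>)) *\<^sub>R S) = (Zinf \<omega> * (1 - Zinf \<omega>)) *\<^sub>R S"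
        using pos_semidef_sym[OF psd] by (simp add: transpose_def vec_eq_iff)
      show "0 \<le> x \<bullet> (((Zinf \<omega> * (1 - Zinf \<omega>)) *\<^sub>R S) *v x)" for x
        unfolding scaled_matrix_quadratic using psd Zr[OF that] by (simp add: pos_semidef_def)
    qed
    have i: "integrable M (\<lambda>\<omega>. \<Sum>j\<in>UNIV. \<bar>axis j 1 \<bullet> Y n \<omega>\<bar>)" for n
      by (intro Bochner_Integration.integrable_sum C)
    show iY: "integrable M (\<lambda>\<omega>. norm (Y n \<omega>))" for n
      by (rule Bochner_Integration.integrable_bound[OF i[of n]]) (auto intro!: AE_I2 simp: axis norm_le_l1_cart sum_nonneg)
    show "\<forall>\<^sub>F n in sequentially. (\<integral>\<omega>. norm (Y n \<omega>) \<partial>M) \<le> (\<Sum>j\<in>UNIV. C (axis j 1))"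
    proof (intro always_eventually allI)
      fix n
      have "(\<integral>\<omega>. norm (Y n \<omega>) \<partial>M) \<le> (\<integral>\<omega>. (\<Sum>j\<in>UNIV. \<bar>axis j 1 \<bullet> Y n \<omega>\<bar>) \<partial>M)"
        by (rule integral_mono[OF iY i]) (simp add: axis norm_le_l1_cart)
      also have "\<dots> = (\<Sum>j\<in>UNIV. (\<integral>\<omega>. \<bar>axis j 1 \<bullet> Y n \<omega>\<bar> \<partial>M))"
        by (rule Bochner_Integration.integral_sum) (rule C)
      also have "\<dots> \<le> (\<Sum>j\<in>UNIV. C (axis j 1))" by (intro sum_mono C)
      finally show "(\<integral>\<omega>. norm (Y n \<omega>) \<partial>M) \<le> (\<Sum>j\<in>UNIV. C (axis j 1))" .
    qed
    show "(\<lambda>n. \<integral>\<omega>. indicator H \<omega> *\<^sub>R iexp (t \<bullet> Y n \<omega>) \<partial>M) \<longlonglongrightarrow>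
        (\<integral>\<omega>. indicator H \<omega> *\<^sub>R complex_of_real (exp (- (t \<bullet> (((Zinf \<omega> * (1 - Zinf \<omega>)) *\<^sub>R S) *v t)) / 2)) \<partial>M)"
      if H: "H \<in> sets M" for H t
    proof -
      have d0: "(\<lambda>n. (\<integral>\<omega>. indicator H \<omega> *\<^sub>R iexp (t \<bullet> Y n \<omega>) \<partial>M) - (\<integral>\<omega>. indicator H \<omega> *\<^sub>R iexp (L t n \<omega>) \<partial>M)) \<longlonglongrightarrow> 0"
      proof (rule Lim_null_comparison[OF _ E0[of t]], intro always_eventually allI)
        fix n
        have i1: "integrable M (\<lambda>\<omega>. indicator H \<omega> *\<^sub>R iexp (t \<bullet> Y n \<omega>))"
          by (rule integrable_const_bound[of _ 1]) (use H in \<open>auto simp: indicator_def\<close>)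
        have i2: "integrable M (\<lambda>\<omega>. indicator H \<omega> *\<^sub>R iexp (L t n \<omega>))"
          by (rule integrable_const_bound[of _ 1]) (use H in \<open>auto simp: indicator_def\<close>)
        have "norm ((\<integral>\<omega>. indicator H \<omega> *\<^sub>R iexp (t \<bullet> Y n \<omega>) \<partial>M) - (\<integral>\<omega>. indicator H \<omega> *\<^sub>R iexp (L t n \<omega>) \<partial>M))
          = norm (\<integral>\<omega>. indicator H \<omega> *\<^sub>R iexp (t \<bullet> Y n \<omega>) - indicator H \<omega> *\<^sub>R iexp (L t n \<omega>) \<partial>M)"
          by (subst Bochner_Integration.integral_diff[OF i1 i2]) simp
        also have "\<dots> \<le> (\<integral>\<omega>. norm (indicator H \<omega> *\<^sub>R iexp (t \<bullet> Y n \<omega>) - indicator H \<omega> *\<^sub>R iexp (L t n \<omega>)) \<partial>M)"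
          by (rule integral_norm_bound)
        also have "\<dots> \<le> (\<integral>\<omega>. \<bar>R t n \<omega>\<bar> \<partial>M)"
        proof (rule integral_mono[OF _ Ri])
          show "integrable M (\<lambda>\<omega>. norm (indicator H \<omega> *\<^sub>R iexp (t \<bullet> Y n \<omega>) - indicator H \<omega> *\<^sub>R iexp (L t n \<omega>)))"
            by (intro integrable_norm Bochner_Integration.integrable_diff i1 i2)
          fix \<omega> assume "\<omega> \<in> space M"
          from dec[OF this, of t n] norm_iexp_diff_le[of "t \<bullet> Y n \<omega>" "L t n \<omega>"]
          show "norm (indicator H \<omega> *\<^sub>R iexp (t \<bullet> Y n \<omega>) - indicator H \<omega> *\<^sub>R iexp (L t n \<omega>)) \<le> \<bar>R t n \<omega>\<bar>"
            by (simp add: indicator_def)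
        qed
        also have "\<dots> \<le> E t n" by (rule RE)
        finally show "norm ((\<integral>\<omega>. indicator H \<omega> *\<^sub>R iexp (t \<bullet> Y n \<omega>) \<partial>M) - (\<integral>\<omega>. indicator H \<omega> *\<^sub>R iexp (L t n \<omega>) \<partial>M)) \<le> E t n" .
      qed
      have "(\<lambda>n. \<integral>\<omega>. indicator H \<omega> *\<^sub>R iexp (L t n \<omega>) \<partial>M) \<longlonglongrightarrow>
        (\<integral>\<omega>. indicator H \<omega> *\<^sub>R complex_of_real (exp (- (t \<bullet> (S *v t) * (Zinf \<omega> * (1 - Zinf \<omega>))) / 2)) \<partial>M)"
        unfolding L_def by (rule A(2)[OF _ H])
      from tendsto_add[OF d0 this] show ?thesis by (simp add: scaled_matrix_quadratic mult.commute)
    qed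
  qed measurable
  then show ?thesis unfolding Y_def .
qed

end

section \<open>Spectral decomposition\<close>

definition cvec :: "real^'n \<Rightarrow> complex^'n" where "cvec x = (\<chi> i. complex_of_real (x $ i))"

lemma cvec_nth [simp]: "cvec x $ i = complex_of_real (x $ i)" by (simp add: cvec_def)

lemma dot_cvec: "dot (cvec x) (cvec y) = complex_of_real (x \<bullet> y)"
  by (simp add: dot_def inner_vec_def)

lemma norm_cvec: "norm (cvec x) = norm x"
  by (simp add: norm_vec_def)

lemma dot_sum_left: "dot (\<Sum>j\<in>J. f j *s x j) y = (\<Sum>j\<in>J. f j * dot (x j) y)"
  unfolding dot_def by (simp add: sum_distrib_left sum_distrib_right sum.swap[of _ UNIV J] mult.assoc)

lemma dot_sum_right: "dot y (\<Sum>j\<in>J. f j *s x j) = (\<Sum>j\<in>J. f j * dot y (x j))"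
  unfolding dot_def by (simp add: sum_distrib_left sum.swap[of _ UNIV J] ac_simps)

lemma dot_diff_right: "dot x (y - z) = dot x y - dot x z"
  by (simp add: dot_def right_diff_distrib sum_subtractf)

lemma dot_matrix: "dot (x v* A) y = dot x (A *v y)"
proof -
  have "dot (x v* A) y = (\<Sum>i\<in>UNIV. \<Sum>k\<in>UNIV. x $ k * A $ k $ i * y $ i)"
    by (simp add: dot_def vector_matrix_mult_def sum_distrib_right sum_distrib_left ac_simps)
  also have "\<dots> = (\<Sum>k\<in>UNIV. \<Sum>i\<in>UNIV. x $ k * A $ k $ i * y $ i)" by (rule sum.swap)
  also have "\<dots> = dot x (A *v y)"
    by (simp add: dot_def matrix_vector_mult_def sum_distrib_left mult.assoc)
  finally show ?thesis .
qed

text \<open>Maximum principle: where \<open>f\<close> attains its maximum, the averaging puts no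
  weight on the set \<open>S\<close> of smaller values. So \<open>W\<close> vanishes from
  \<open>S\<close> to its complement, and irreducibility makes \<open>S\<close> empty.\<close>

lemma harmonic_constant:
  fixes W :: "real^'n^'n" and f :: "real^'n"
  assumes nonneg: "\<And>j k. 0 \<le> W $ j $ k" and col: "\<And>j. (\<Sum>i\<in>UNIV. W $ i $ j) = 1"
    and irr: "irreducible_matrix W" and harm: "\<And>j. (\<Sum>i\<in>UNIV. W $ i $ j * f $ i) = f $ j"
  shows "f $ i = f $ j"
proof -
  define m where "m = Max (range (\<lambda>i. f $ i))"
  have fm: "f $ i \<le> m" for i unfolding m_def by (intro Max_ge) auto
  have "m \<in> range (\<lambda>i. f $ i)" unfolding m_def by (intro Max_in) auto
  then obtain i0 where i0: "f $ i0 = m" by auto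
  define S where "S = {i. f $ i < m}"
  have "W $ i $ j = 0" if "i \<in> S" "j \<in> - S" for i j
  proof -
    have fj: "f $ j = m" using that(2) fm[of j] by (auto simp: S_def)
    have "(\<Sum>i\<in>UNIV. W $ i $ j * (m - f $ i)) = 0"
      using harm[of j] col[of j] fj by (simp add: right_diff_distrib sum_subtractf sum_distrib_right[symmetric])
    then have "W $ i $ j * (m - f $ i) = 0"
      using nonneg fm by (subst (asm) sum_nonneg_eq_0_iff) auto
    then show ?thesis using that(1) by (auto simp: S_def)
  qed
  then have "S = {} \<or> S = UNIV" using irr unfolding irreducible_matrix_def by blast
  moreover have "i0 \<notin> S" using i0 by (simp add: S_def)
  ultimately have "S = {}" by auto
  have "\<not> f $ i < m" for i using \<open>S = {}\<close> by (auto simp: S_def)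
  with fm have "f $ i = m" for i by (meson antisym_conv2)
  then show ?thesis by simp
qed

section \<open>Eigenvalues and the invariant vector\<close>

locale rsp_spectral = interacting_rsp M W r c \<gamma> Z X + spectral_data W lam u v
  for M :: "'a measure" and W :: "real^'n^'n" and r c \<gamma> Z X lam u v
begin

lemma one_index: "1 \<in> {1..CARD('n)}" by (simp add: Suc_leI)

lemma u1_nth: "u (Suc 0) $ i = 1 / complex_of_real (sqrt CARD('n))"
  using u_1 by simp

lemma index_split: "{1..CARD('n)} = insert 1 {2..CARD('n)}"
  using one_index by auto

text \<open>By duality the difference of both sides is annihilated by every \<open>u h\<close>,
  hence by their span, which contains the coordinate vectors.\<close>

lemma eigen_expansion: "x = (\<Sum>j\<in>{1..CARD('n)}. dot (u j) x *s v j)"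
proof -
  define y where "y = x - (\<Sum>j\<in>{1..CARD('n)}. dot (u j) x *s v j)"
  have y: "dot (u h) y = 0" if h: "h \<in> {1..CARD('n)}" for h
  proof -
    have "dot (u h) (\<Sum>j\<in>{1..CARD('n)}. dot (u j) x *s v j) = (\<Sum>j\<in>{1..CARD('n)}. dot (u j) x * (if h = j then 1 else 0))"
      unfolding dot_sum_right by (intro sum.cong refl) (simp add: uv_dual[OF h])
    also have "\<dots> = (\<Sum>j\<in>{1..CARD('n)}. if h = j then dot (u j) x else 0)" by (intro sum.cong refl) simp
    also have "\<dots> = dot (u h) x" using h by (subst sum.delta') auto
    finally show ?thesis by (simp add: y_def dot_diff_right)
  qed
  have "z \<in> vec.span (u ` {1..CARD('n)}) \<Longrightarrow> dot z y = 0" for z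
  proof (induction rule: vec.span_induct_alt)
    case base show ?case by (simp add: dot_def)
  next
    case (step k x z)
    have "dot (k *s x + z) y = k * dot x y + dot z y"
      by (simp add: dot_def distrib_right sum.distrib sum_distrib_left mult.assoc)
    then show ?case using step y by auto
  qed
  then have "dot (axis i 1) y = 0" for i using u_basis(3) by auto
  moreover have "dot (axis i 1) y = y $ i" for i
    by (simp add: dot_def axis_def if_distrib[of "\<lambda>a. a * _"] cong: if_cong)
  ultimately have "y = 0" by (simp add: vec_eq_iff)
  then show ?thesis by (simp add: y_def)
qed

lemma cW_mult: "(map_matrix complex_of_real W *v x) $ i = (\<Sum>k\<in>UNIV. of_real (W $ i $ k) * x $ k)"
  by (simp add: matrix_vector_mult_def map_matrix_def)

lemma u_eigen_component:
  assumes "j \<in> {1..CARD('n)}"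
  shows "(\<Sum>i\<in>UNIV. of_real (W $ i $ k) * u j $ i) = lam j * u j $ k"
proof -
  have "(u j v* map_matrix complex_of_real W) $ k = (\<Sum>i\<in>UNIV. of_real (W $ i $ k) * u j $ i)"
    by (simp add: vector_matrix_mult_def map_matrix_def ac_simps)
  then show ?thesis using u_eigen[OF assms] by simp
qed

lemma u_nonzero: "j \<in> {1..CARD('n)} \<Longrightarrow> u j \<noteq> 0"
  using u_norm[of j] by auto

text \<open>Evaluate the eigenvector equation at a component of largest modulus: the other side is a
  convex combination of components.\<close>

lemma norm_lam_le:
  assumes j: "j \<in> {1..CARD('n)}"
  shows "norm (lam j) \<le> 1"
proof -
  define m where "m = Max (range (\<lambda>i. norm (u j $ i)))"
  have fm: "norm (u j $ i) \<le> m" for i unfolding m_def by (intro Max_ge) auto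
  have "m \<in> range (\<lambda>i. norm (u j $ i))" unfolding m_def by (intro Max_in) auto
  then obtain k where k: "norm (u j $ k) = m" by auto
  have m: "m > 0"
  proof (rule ccontr)
    assume "\<not> m > 0"
    then have "u j $ i = 0" for i using fm[of i] by (metis norm_le_zero_iff linorder_not_less order_trans)
    then show False using u_nonzero[OF j] by (simp add: vec_eq_iff)
  qed
  have "norm (lam j) * m = norm (\<Sum>i\<in>UNIV. of_real (W $ i $ k) * u j $ i)"
    using k by (simp add: u_eigen_component[OF j] norm_mult)
  also have "\<dots> \<le> (\<Sum>i\<in>UNIV. norm (of_real (W $ i $ k) * u j $ i))" by (rule norm_sum)
  also have "\<dots> \<le> (\<Sum>i\<in>UNIV. W $ i $ k * m)"
    by (intro sum_mono) (simp add: norm_mult W_nonneg mult_left_mono fm)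
  also have "\<dots> = m" by (simp add: sum_distrib_right[symmetric] W_column_sum)
  finally show ?thesis using m by simp
qed

text \<open>Real and imaginary part of a left eigenvector for 1 are harmonic and so constant. The
  vector would be a multiple of \<open>u 1\<close>, and \<open>dot (u 1) (v j) = 0\<close> would
  force \<open>dot (u j) (v j) = 0\<close>.\<close>

lemma lam_ne_1:
  assumes j: "j \<in> {2..CARD('n)}"
  shows "lam j \<noteq> 1"
proof
  assume l: "lam j = 1"
  have jj: "j \<in> {1..CARD('n)}" "j \<noteq> 1" using j by auto
  have h: "(\<Sum>i\<in>UNIV. of_real (W $ i $ k) * u j $ i) = u j $ k" for k
    using u_eigen_component[OF jj(1), of k] l by simp
  have "(\<Sum>i\<in>UNIV. W $ i $ k * Re (u j $ i)) = Re (u j $ k)" "(\<Sum>i\<in>UNIV. W $ i $ k * Im (u j $ i)) = Im (u j $ k)" for k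
    using arg_cong[OF h[of k], of Re] arg_cong[OF h[of k], of Im] by simp_all
  then have "Re (u j $ i) = Re (u j $ k)" "Im (u j $ i) = Im (u j $ k)" for i k
    using harmonic_constant[OF W_nonneg W_column_sum W_irreducible, of "\<chi> i. Re (u j $ i)" i k]
      harmonic_constant[OF W_nonneg W_column_sum W_irreducible, of "\<chi> i. Im (u j $ i)" i k] by simp_all
  then have const: "u j $ i = u j $ k" for i k by (simp add: complex_eq_iff)
  obtain z where z: "\<And>i. u j $ i = z" using const by blast
  have "u j $ i = (z * of_real (sqrt CARD('n))) * u 1 $ i" for i
    by (simp add: u1_nth z del: of_real_divide)
  then have "dot (u j) (v j) = (z * of_real (sqrt CARD('n))) * dot (u 1) (v j)"
    unfolding dot_def sum_distrib_left by (simp only: mult.assoc)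
  then show False using uv_dual[OF jj(1) jj(1)] uv_dual[OF one_index jj(1)] jj(2) by simp
qed

text \<open>The closed unit disc meets the line of real part 1 only in the point 1.\<close>

lemma Re_lam_less_1:
  assumes j: "j \<in> {2..CARD('n)}"
  shows "Re (lam j) < 1"
proof (rule ccontr)
  assume "\<not> Re (lam j) < 1"
  moreover have n: "norm (lam j) \<le> 1" using norm_lam_le j by auto
  ultimately have re: "Re (lam j) = 1" using complex_Re_le_cmod[of "lam j"] by linarith
  then have "1 + (Im (lam j))\<^sup>2 \<le> 1"
    using power_mono[OF n, of 2] by (simp add: cmod_power2)
  then have "Im (lam j) = 0" by simp
  with re lam_ne_1[OF j] show False by (simp add: complex_eq_iff)
qed

text \<open>Normalised so that the entries sum to 1; then \<open>\<nu> \<bullet> Z\<close> is a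
  martingale with limit \<open>Zinf\<close>. Taking real parts loses nothing since
  \<open>v 1\<close> is real.\<close>

definition \<nu> :: "real^'n" where "\<nu> = (\<chi> i. Re (v 1 $ i) / sqrt CARD('n))"

text \<open>As \<open>W\<close> is real, the conjugate of \<open>v 1\<close> is fixed by
  \<open>W\<close> too. It is annihilated by every \<open>u j\<close> with \<open>j\<close> at least
  2, because \<open>lam j\<close> differs from 1, and pairs to 1 with the real vector
  \<open>u 1\<close>; by the expansion it equals \<open>v 1\<close>.\<close>

lemma v1_real: "Im (v 1 $ i) = 0"
proof -
  define x where "x = (\<chi> i. cnj (v 1 $ i))"
  have Wv: "map_matrix complex_of_real W *v v 1 = v 1" using v_eigen[OF one_index] lam_1 by simp
  have Wx: "map_matrix complex_of_real W *v x = x"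
  proof (rule vec_eq_iff[THEN iffD2], rule allI)
    fix i
    have "(map_matrix complex_of_real W *v x) $ i = cnj ((map_matrix complex_of_real W *v v 1) $ i)"
      unfolding cW_mult by (simp add: x_def)
    then show "(map_matrix complex_of_real W *v x) $ i = x $ i" by (simp only: Wv x_def vec_lambda_beta)
  qed
  have d0: "dot (u j) x = 0" if "j \<in> {2..CARD('n)}" for j
  proof -
    have "lam j * dot (u j) x = dot (lam j *s u j) x" by (simp add: dot_def sum_distrib_left mult.assoc)
    also have "\<dots> = dot (u j) x" using u_eigen[of j] that by (simp add: Wx dot_matrix flip: u_eigen)
    finally have "(lam j - 1) * dot (u j) x = 0" by (simp add: left_diff_distrib)
    then show ?thesis using lam_ne_1[OF that] by simp
  qed
  have "dot (u 1) x = cnj (dot (u 1) (v 1))" by (simp add: dot_def x_def u1_nth)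
  also have "\<dots> = 1" using uv_dual[OF one_index one_index] by simp
  finally have d1: "dot (u 1) x = 1" .
  have "x = (\<Sum>j\<in>insert 1 {2..CARD('n)}. dot (u j) x *s v j)" using eigen_expansion[of x] unfolding index_split .
  also have "\<dots> = v 1 + (\<Sum>j\<in>{2..CARD('n)}. dot (u j) x *s v j)" using d1 by simp
  also have "(\<Sum>j\<in>{2..CARD('n)}. dot (u j) x *s v j) = 0" by (rule sum.neutral) (simp add: d0)
  finally have "x $ i = v 1 $ i" by simp
  then show ?thesis by (simp add: x_def complex_eq_iff)
qed

lemma cvec_\<nu>: "cvec \<nu> = (1 / of_real (sqrt CARD('n))) *s v 1"
  using v1_real by (simp add: vec_eq_iff \<nu>_def complex_eq_iff)

lemma \<nu>_sum: "\<nu> \<bullet> 1 = 1"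
proof -
  have "complex_of_real (\<nu> \<bullet> 1) = dot (u 1) (v 1)"
    using v1_real by (simp add: dot_def u1_nth \<nu>_def inner_vec_def complex_eq_iff)
  then show ?thesis using uv_dual[OF one_index one_index] by (metis of_real_eq_1_iff)
qed

lemma W_\<nu>: "W *v \<nu> = \<nu>"
proof (rule vec_eq_iff[THEN iffD2], rule allI)
  fix i
  have "(\<Sum>k\<in>UNIV. of_real (W $ i $ k) * v 1 $ k) = v 1 $ i"
    using v_eigen[OF one_index] lam_1 cW_mult[of "v 1" i] by simp
  from arg_cong[OF this, of Re] have "(\<Sum>k\<in>UNIV. W $ i $ k * Re (v 1 $ k)) = Re (v 1 $ i)" by simp
  then show "(W *v \<nu>) $ i = \<nu> $ i"
    by (simp add: matrix_vector_mult_def \<nu>_def sum_divide_distrib[symmetric])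
qed

lemma norm_\<nu>: "(norm \<nu>)\<^sup>2 = (norm (v 1))\<^sup>2 / CARD('n)"
proof -
  have "norm \<nu> = norm (cvec \<nu>)" by (simp add: norm_cvec)
  also have "\<dots> = norm (v 1) / sqrt CARD('n)"
    unfolding cvec_\<nu> norm_vec_def by (simp add: norm_mult norm_divide L2_set_def power_divide sum_divide_distrib[symmetric] real_sqrt_divide)
  finally show ?thesis by (simp add: power_divide)
qed

lemma v1_nonzero: "v 1 \<noteq> 0"
  using uv_dual[OF one_index one_index] by (auto simp: dot_def)

section \<open>The backward weights in the eigenbasis\<close>

definition \<beta> :: "nat \<Rightarrow> complex" where "\<beta> j = 1 - lam j"

text \<open>The factor acquired by the component along \<open>v j\<close> when the weights are
  carried from time \<open>n\<close> back to time \<open>k\<close>.\<close>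

definition P :: "nat \<Rightarrow> nat \<Rightarrow> nat \<Rightarrow> complex" where
  "P j k n = (\<Prod>l\<in>{k..<n}. 1 - of_real (r l) * \<beta> j)"

lemma P_same [simp]: "P j n n = 1" by (simp add: P_def)

lemma P_rec_start: "k < n \<Longrightarrow> P j k n = (1 - of_real (r k) * \<beta> j) * P j (Suc k) n"
  by (simp add: P_def prod.atLeast_Suc_lessThan)

lemma P_rec_end: "k \<le> n \<Longrightarrow> P j k (Suc n) = (1 - of_real (r n) * \<beta> j) * P j k n"
  by (simp add: P_def mult.commute)

text \<open>Recursion on the distance \<open>d\<close> from the final time, so that the time reached
  is \<open>n - d\<close>; it is meant for \<open>d\<close> at most \<open>n\<close>. Only the real
  matrix \<open>W\<close> enters, which keeps the weights real.\<close>

primrec backward :: "real^'n \<Rightarrow> nat \<Rightarrow> nat \<Rightarrow> real^'n" where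
  "backward x 0 n = x"
| "backward x (Suc d) n = (1 - r (n - Suc d)) *\<^sub>R backward x d n + r (n - Suc d) *\<^sub>R (W *v backward x d n)"

text \<open>\<open>W\<close> acts on \<open>v j\<close> as \<open>lam j\<close>, so each step
  multiplies its coefficient by \<open>1 - r + r * lam j\<close>, that is
  \<open>1 - r * \<beta> j\<close>.\<close>

lemma cvec_backward:
  assumes x: "cvec x = (\<Sum>j\<in>{2..CARD('n)}. \<alpha> j *s v j)"
  shows "d \<le> n \<Longrightarrow> cvec (backward x d n) = (\<Sum>j\<in>{2..CARD('n)}. (\<alpha> j * P j (n - d) n) *s v j)"
proof (induction d)
  case 0 show ?case using x by simp
next
  case (Suc d)
  define k where "k = n - Suc d"
  have k: "Suc k = n - d" "k < n" using Suc.prems by (auto simp: k_def)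
  have IH: "cvec (backward x d n) = (\<Sum>j\<in>{2..CARD('n)}. (\<alpha> j * P j (Suc k) n) *s v j)" using Suc by (simp add: k)
  have "cvec (backward x (Suc d) n) = of_real (1 - r k) *s cvec (backward x d n) + of_real (r k) *s (map_matrix complex_of_real W *v cvec (backward x d n))"
    by (simp add: vec_eq_iff cW_mult k_def matrix_vector_mult_def left_diff_distrib)
  also have "map_matrix complex_of_real W *v cvec (backward x d n) = (\<Sum>j\<in>{2..CARD('n)}. (\<alpha> j * P j (Suc k) n) *s (lam j *s v j))"
  proof -
    have "map_matrix complex_of_real W *v cvec (backward x d n) =
      (\<Sum>j\<in>{2..CARD('n)}. (\<alpha> j * P j (Suc k) n) *s (map_matrix complex_of_real W *v v j))"
      unfolding IH by (simp add: vec.linear_sum[OF matrix_vector_mul_linear_gen]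
          vec.linear_scale[OF matrix_vector_mul_linear_gen])
    also have "\<dots> = (\<Sum>j\<in>{2..CARD('n)}. (\<alpha> j * P j (Suc k) n) *s (lam j *s v j))"
      by (intro sum.cong refl) (simp add: v_eigen)
    finally show ?thesis .
  qed
  also have "of_real (1 - r k) *s cvec (backward x d n) + of_real (r k) *s (\<Sum>j\<in>{2..CARD('n)}. (\<alpha> j * P j (Suc k) n) *s (lam j *s v j))
     = (\<Sum>j\<in>{2..CARD('n)}. (\<alpha> j * P j k n) *s v j)"
    unfolding IH vec.scale_sum_right sum.distrib[symmetric] P_rec_start[OF k(2)]
    by (intro sum.cong refl) (simp add: vec_eq_iff \<beta>_def algebra_simps)
  finally show ?case by (simp add: k_def)
qed

definition \<alpha> :: "real^'n \<Rightarrow> nat \<Rightarrow> complex" where "\<alpha> t j = dot (u j) (cvec t)"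

definition w :: "real^'n \<Rightarrow> nat \<Rightarrow> nat \<Rightarrow> real^'n" where
  "w t n k = backward (t - (t \<bullet> 1) *\<^sub>R \<nu>) (n - k) n"

lemma w_end: "w t n n = t - (t \<bullet> 1) *\<^sub>R \<nu>" by (simp add: w_def)

lemma w_rec: "k < n \<Longrightarrow> w t n k = (1 - r k) *\<^sub>R w t n (Suc k) + r k *\<^sub>R (W *v w t n (Suc k))"
proof -
  assume k: "k < n"
  then have 1: "n - k = Suc (n - Suc k)" and 2: "n - Suc (n - Suc k) = k" by simp_all
  show ?thesis unfolding w_def 1 backward.simps 2 ..
qed

text \<open>Subtracting \<open>t \<bullet> 1\<close> times \<nu> removes precisely the component
  along \<open>v 1\<close>, which is why the sum starts at 2.\<close>

lemma cvec_w:
  assumes "k \<le> n"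
  shows "cvec (w t n k) = (\<Sum>j\<in>{2..CARD('n)}. (\<alpha> t j * P j k n) *s v j)"
proof -
  have "cvec t = (\<Sum>j\<in>insert 1 {2..CARD('n)}. dot (u j) (cvec t) *s v j)" using eigen_expansion[of "cvec t"] unfolding index_split .
  also have "\<dots> = dot (u 1) (cvec t) *s v 1 + (\<Sum>j\<in>{2..CARD('n)}. \<alpha> t j *s v j)" by (simp add: \<alpha>_def)
  also have "dot (u 1) (cvec t) *s v 1 = of_real (t \<bullet> 1) *s cvec \<nu>"
    unfolding cvec_\<nu> by (simp add: vec_eq_iff dot_def u1_nth inner_vec_def sum_divide_distrib)
  finally have "cvec (t - (t \<bullet> 1) *\<^sub>R \<nu>) = (\<Sum>j\<in>{2..CARD('n)}. \<alpha> t j *s v j)"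
    by (simp add: vec_eq_iff algebra_simps)
  from cvec_backward[OF this, of "n - k" n] assms show ?thesis by (simp add: w_def)
qed

end

section \<open>Covariances as limits of bilinear forms\<close>

context rsp_spectral
begin

lemma \<alpha>_axis: "\<alpha> (axis a 1) j = u j $ a"
  by (simp add: \<alpha>_def dot_def axis_def if_distrib[of "\<lambda>x. _ * x"] if_distrib[of complex_of_real] cong: if_cong)

lemma \<alpha>_linear: "\<alpha> t j = (\<Sum>a\<in>UNIV. of_real (t $ a) * \<alpha> (axis a 1) j)"
  unfolding \<alpha>_axis by (simp add: \<alpha>_def dot_def mult.commute)

text \<open>The bilinear form of the matrix \<open>U S U^T\<close> in eigencoordinates. It is used
  for all \<open>t\<close> and \<open>t'\<close>, since real limits at all pairs of coordinate
  vectors show that the matrix is real.\<close>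

definition G :: "(nat \<Rightarrow> nat \<Rightarrow> complex) \<Rightarrow> real^'n \<Rightarrow> real^'n \<Rightarrow> complex" where
  "G S t t' = (\<Sum>h\<in>{2..CARD('n)}. \<Sum>j\<in>{2..CARD('n)}. \<alpha> t h * S h j * \<alpha> t' j)"

lemma G_left: "G S t t' = (\<Sum>a\<in>UNIV. of_real (t $ a) * G S (axis a 1) t')"
proof -
  define d where "d h = (\<Sum>j\<in>{2..CARD('n)}. S h j * \<alpha> t' j)" for h
  have G: "G S x t' = (\<Sum>h\<in>{2..CARD('n)}. \<alpha> x h * d h)" for x
    by (simp add: G_def d_def sum_distrib_left mult.assoc)
  have "G S t t' = (\<Sum>h\<in>{2..CARD('n)}. \<Sum>a\<in>UNIV. of_real (t $ a) * (\<alpha> (axis a 1) h * d h))"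
    unfolding G by (intro sum.cong refl, subst \<alpha>_linear) (simp add: sum_distrib_right mult.assoc)
  also have "\<dots> = (\<Sum>a\<in>UNIV. \<Sum>h\<in>{2..CARD('n)}. of_real (t $ a) * (\<alpha> (axis a 1) h * d h))" by (rule sum.swap)
  finally show ?thesis unfolding G by (simp add: sum_distrib_left)
qed

lemma G_right: "G S t t' = (\<Sum>a\<in>UNIV. of_real (t' $ a) * G S t (axis a 1))"
proof -
  define d where "d j = (\<Sum>h\<in>{2..CARD('n)}. \<alpha> t h * S h j)" for j
  have G: "G S t x = (\<Sum>j\<in>{2..CARD('n)}. \<alpha> x j * d j)" for x
    unfolding G_def d_def sum_distrib_left by (subst sum.swap) (simp add: ac_simps)
  have "G S t t' = (\<Sum>h\<in>{2..CARD('n)}. \<Sum>a\<in>UNIV. of_real (t' $ a) * (\<alpha> (axis a 1) h * d h))"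
    unfolding G by (intro sum.cong refl, subst \<alpha>_linear) (simp add: sum_distrib_right mult.assoc)
  also have "\<dots> = (\<Sum>a\<in>UNIV. \<Sum>h\<in>{2..CARD('n)}. of_real (t' $ a) * (\<alpha> (axis a 1) h * d h))" by (rule sum.swap)
  finally show ?thesis unfolding G by (simp add: sum_distrib_left)
qed

lemma G_axis: "G S (axis a 1) (axis b 1) = U_S_Ut u S $ a $ b"
  by (simp add: G_def \<alpha>_axis U_S_Ut_def)

definition pair_sum :: "nat \<Rightarrow> nat \<Rightarrow> nat \<Rightarrow> complex" where
  "pair_sum h j n = (\<Sum>k<n. of_real ((r k)\<^sup>2) * (P h (Suc k) n * P j (Suc k) n))"

text \<open>Old terms gain one factor from each of the two products; the new term
  \<open>k = n\<close> carries empty products. The explicit \<open>1 *\<close> is the source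
  \<open>s\<close> of the limit lemmas for recursions.\<close>

lemma pair_sum_Suc:
  "pair_sum h j (Suc n) = (1 - of_real (r n) * \<beta> h) * (1 - of_real (r n) * \<beta> j) * pair_sum h j n + 1 * of_real ((r n)\<^sup>2)"
proof -
  have "(\<Sum>k<n. of_real ((r k)\<^sup>2) * (P h (Suc k) (Suc n) * P j (Suc k) (Suc n))) =
     (\<Sum>k<n. (1 - of_real (r n) * \<beta> h) * (1 - of_real (r n) * \<beta> j) * (of_real ((r k)\<^sup>2) * (P h (Suc k) n * P j (Suc k) n)))"
    by (intro sum.cong refl) (simp add: P_rec_end)
  then show ?thesis by (simp add: pair_sum_def sum_distrib_left)
qed

lemma inner_w:
  assumes "k \<le> n"
  shows "complex_of_real (w t n k \<bullet> w t' n k) =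
    (\<Sum>h\<in>{2..CARD('n)}. \<Sum>j\<in>{2..CARD('n)}. \<alpha> t h * dot (v h) (v j) * \<alpha> t' j * (P h k n * P j k n))"
  unfolding dot_cvec[symmetric] cvec_w[OF assms] dot_sum_left
  unfolding dot_sum_right
  by (simp add: sum_distrib_left ac_simps)

text \<open>Expanding both weights in the eigenbasis and interchanging the finite sums isolates the
  dependence on \<open>n\<close> in the scaled \<open>pair_sum\<close>.\<close>

lemma bilinear_limit:
  assumes l: "\<And>h j. h \<in> {2..CARD('n)} \<Longrightarrow> j \<in> {2..CARD('n)} \<Longrightarrow> (\<lambda>n. of_real ((a n)\<^sup>2) * pair_sum h j n) \<longlonglongrightarrow> l h j"
  shows "(\<lambda>n. complex_of_real ((a n)\<^sup>2 * (\<Sum>k<n. (r k)\<^sup>2 * (w t n (Suc k) \<bullet> w t' n (Suc k))))) \<longlonglongrightarrow> G (\<lambda>h j. l h j * dot (v h) (v j)) t t'"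
proof -
  have "complex_of_real ((a n)\<^sup>2 * (\<Sum>k<n. (r k)\<^sup>2 * (w t n (Suc k) \<bullet> w t' n (Suc k)))) =
     (\<Sum>h\<in>{2..CARD('n)}. \<Sum>j\<in>{2..CARD('n)}. \<alpha> t h * dot (v h) (v j) * \<alpha> t' j * (of_real ((a n)\<^sup>2) * pair_sum h j n))" for n
  proof -
    have "complex_of_real (\<Sum>k<n. (r k)\<^sup>2 * (w t n (Suc k) \<bullet> w t' n (Suc k))) =
      (\<Sum>k<n. \<Sum>h\<in>{2..CARD('n)}. \<Sum>j\<in>{2..CARD('n)}. \<alpha> t h * dot (v h) (v j) * \<alpha> t' j * (of_real ((r k)\<^sup>2) * (P h (Suc k) n * P j (Suc k) n)))"
      unfolding of_real_sum of_real_mult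
      by (intro sum.cong refl) (simp add: inner_w sum_distrib_left ac_simps)
    also have "\<dots> = (\<Sum>h\<in>{2..CARD('n)}. \<Sum>k<n. \<Sum>j\<in>{2..CARD('n)}. \<alpha> t h * dot (v h) (v j) * \<alpha> t' j * (of_real ((r k)\<^sup>2) * (P h (Suc k) n * P j (Suc k) n)))"
      by (rule sum.swap)
    also have "\<dots> = (\<Sum>h\<in>{2..CARD('n)}. \<Sum>j\<in>{2..CARD('n)}. \<Sum>k<n. \<alpha> t h * dot (v h) (v j) * \<alpha> t' j * (of_real ((r k)\<^sup>2) * (P h (Suc k) n * P j (Suc k) n)))"
      by (rule sum.cong[OF refl sum.swap])
    also have "\<dots> = (\<Sum>h\<in>{2..CARD('n)}. \<Sum>j\<in>{2..CARD('n)}. \<alpha> t h * dot (v h) (v j) * \<alpha> t' j * pair_sum h j n)"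
      unfolding pair_sum_def sum_distrib_left ..
    finally show ?thesis unfolding of_real_mult by (simp add: sum_distrib_left ac_simps)
  qed
  moreover have "(\<lambda>n. \<Sum>h\<in>{2..CARD('n)}. \<Sum>j\<in>{2..CARD('n)}. \<alpha> t h * dot (v h) (v j) * \<alpha> t' j * (of_real ((a n)\<^sup>2) * pair_sum h j n))
     \<longlonglongrightarrow> (\<Sum>h\<in>{2..CARD('n)}. \<Sum>j\<in>{2..CARD('n)}. \<alpha> t h * dot (v h) (v j) * \<alpha> t' j * l h j)"
    by (intro tendsto_sum tendsto_mult tendsto_const l)
  ultimately show ?thesis by (simp add: G_def ac_simps)
qed

lemma norm_w_le:
  assumes "k \<le> n"
  shows "norm (w t n k) \<le> (\<Sum>j\<in>{2..CARD('n)}. norm (\<alpha> t j) * norm (v j) * norm (P j k n))"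
proof -
  have ns: "norm (c *s x) = norm c * norm x" for c and x :: "complex^'n"
    by (simp add: norm_vec_def norm_mult L2_set_right_distrib)
  have "norm (w t n k) = norm (\<Sum>j\<in>{2..CARD('n)}. (\<alpha> t j * P j k n) *s v j)"
    using norm_cvec[of "w t n k"] cvec_w[OF assms, of t] by simp
  also have "\<dots> \<le> (\<Sum>j\<in>{2..CARD('n)}. norm ((\<alpha> t j * P j k n) *s v j))" by (rule norm_sum)
  finally show ?thesis by (simp add: ns norm_mult ac_simps)
qed

text \<open>The limit form \<open>G\<close> is complex by its formula but a limit of real forms
  \<open>B\<close> that are symmetric and nonnegative on the diagonal. So its matrix is real and
  positive semi-definite, although the eigenvectors need not be real. The constant matrix
  \<open>E\<close> encodes the contribution of the martingale tail.\<close>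

lemma stable_limit_spectral:
  fixes a :: "nat \<Rightarrow> real" and Zinf :: "'a \<Rightarrow> real" and l :: "nat \<Rightarrow> nat \<Rightarrow> complex"
  assumes Zm: "Zinf \<in> borel_measurable M" and Zr: "\<And>\<omega>. \<omega> \<in> space M \<Longrightarrow> Zinf \<omega> \<in> {0..1}"
    and Zl: "AE \<omega> in M. (\<lambda>n. Z n \<omega>) \<longlonglongrightarrow> Zinf \<omega> *\<^sub>R 1"
    and l: "\<And>h j. h \<in> {2..CARD('n)} \<Longrightarrow> j \<in> {2..CARD('n)} \<Longrightarrow> (\<lambda>n. of_real ((a n)\<^sup>2) * pair_sum h j n) \<longlonglongrightarrow> l h j"
    and init: "\<And>j. j \<in> {2..CARD('n)} \<Longrightarrow> (\<lambda>n. (a n)\<^sup>2 * (norm (P j 0 n))\<^sup>2) \<longlonglongrightarrow> 0"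
    and four: "\<And>j. j \<in> {2..CARD('n)} \<Longrightarrow> (\<lambda>n. (a n) ^ 4 * (\<Sum>k<n. (r k) ^ 4 * norm (P j (Suc k) n) ^ 4)) \<longlonglongrightarrow> 0"
    and r2: "summable (\<lambda>k. (r k)\<^sup>2)" and tail: "(\<lambda>n. (a n)\<^sup>2 * (\<Sum>k. (r (k + n))\<^sup>2)) \<longlonglongrightarrow> \<tau>"
    and sup: "\<eta> \<longlonglongrightarrow> 0" "\<And>n k. n \<le> k \<Longrightarrow> (a n)\<^sup>2 * (r k)\<^sup>2 \<le> \<eta> n"
  shows "\<exists>Sh :: real^'n^'n. map_matrix complex_of_real Sh = U_S_Ut u (\<lambda>h j. l h j * dot (v h) (v j)) \<and>
    stably_to_gaussian M (\<lambda>n \<omega>. a n *\<^sub>R (Z n \<omega> - Zinf \<omega> *\<^sub>R 1))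
      (\<lambda>\<omega>. (Zinf \<omega> * (1 - Zinf \<omega>)) *\<^sub>R (Sh + (\<chi> i j. (norm (v 1))\<^sup>2 / CARD('n) * \<tau>)))"
proof -
  define S where "S h j = l h j * dot (v h) (v j)" for h j
  define B where "B t t' n = (a n)\<^sup>2 * (\<Sum>k<n. (r k)\<^sup>2 * (w t n (Suc k) \<bullet> w t' n (Suc k)))" for t t' n
  have B: "(\<lambda>n. complex_of_real (B t t' n)) \<longlonglongrightarrow> G S t t'" for t t'
    unfolding B_def S_def by (rule bilinear_limit[OF l])
  have BRe: "B t t' \<longlonglongrightarrow> Re (G S t t')" for t t'
    using tendsto_Re[OF B[of t t']] by simp
  have GIm: "Im (G S t t') = 0" for t t'
    using LIMSEQ_unique[OF tendsto_Im[OF B[of t t']], of 0] by simp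
  have Gre: "G S t t' = of_real (Re (G S t t'))" for t t' using GIm by (simp add: complex_eq_iff)
  define Sh :: "real^'n^'n" where "Sh = (\<chi> i j. Re (G S (axis i 1) (axis j 1)))"
  have map: "map_matrix complex_of_real Sh = U_S_Ut u S"
    by (simp add: vec_eq_iff Sh_def Gre[symmetric] G_axis[symmetric])
  have Gsym: "Re (G S t t') = Re (G S t' t)" for t t'
  proof (rule LIMSEQ_unique[OF BRe[of t t']])
    show "B t t' \<longlonglongrightarrow> Re (G S t' t)" proof -
      have "B t t' = B t' t" by (rule ext) (simp add: B_def inner_commute)
      then show ?thesis using BRe[of t' t] by simp
    qed
  qed
  have Sh_quad: "t \<bullet> (Sh *v t) = Re (G S t t)" for t
  proof -
    have "G S t t = (\<Sum>i\<in>UNIV. of_real (t $ i) * (\<Sum>j\<in>UNIV. of_real (t $ j) * G S (axis i 1) (axis j 1)))"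
      by (subst G_left, intro sum.cong refl arg_cong2[where f = "(*)"], rule G_right)
    also have "Re \<dots> = t \<bullet> (Sh *v t)"
      by (simp add: inner_matrix_vector_sum Sh_def sum_distrib_left ac_simps)
    finally show ?thesis ..
  qed
  have \<tau>0: "0 \<le> \<tau>"
    by (rule LIMSEQ_le_const[OF tail]) (auto intro!: mult_nonneg_nonneg suminf_nonneg simp: summable_iff_shift[of "\<lambda>k. (r k)\<^sup>2"] r2)
  define E :: "real^'n^'n" where "E = (\<chi> i j. (norm (v 1))\<^sup>2 / CARD('n) * \<tau>)"
  have E_quad: "t \<bullet> (E *v t) = (t \<bullet> 1)\<^sup>2 * (norm \<nu>)\<^sup>2 * \<tau>" for t
  proof -
    define e where "e = (norm \<nu>)\<^sup>2 * \<tau>"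
    have "E = (\<chi> i j. e)" unfolding E_def e_def norm_\<nu> by simp
    then have "(E *v t) $ i = e * (t \<bullet> 1)" for i
      by (simp add: matrix_vector_mult_def inner_vec_def sum_distrib_left)
    then have "t \<bullet> (E *v t) = (\<Sum>i\<in>UNIV. t $ i) * (e * (t \<bullet> 1))"
      by (simp add: inner_vec_def[of t "E *v t"] sum_distrib_right)
    also have "(\<Sum>i\<in>UNIV. t $ i) = t \<bullet> 1" by (simp add: inner_vec_def)
    finally show ?thesis by (simp add: e_def power2_eq_square ac_simps)
  qed
  have quad: "t \<bullet> ((Sh + E) *v t) = Re (G S t t) + (t \<bullet> 1)\<^sup>2 * (norm \<nu>)\<^sup>2 * \<tau>" for t
    by (simp add: matrix_vector_mult_add_rdistrib inner_add_right Sh_quad E_quad)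
  have B0: "0 \<le> B t t n" for t n
    unfolding B_def by (intro mult_nonneg_nonneg sum_nonneg) auto
  have psd: "pos_semidef (Sh + E)"
    unfolding pos_semidef_def
  proof (intro conjI allI)
    show "transpose (Sh + E) = Sh + E"
      using Gsym by (simp add: transpose_def vec_eq_iff Sh_def E_def)
    show "0 \<le> x \<bullet> ((Sh + E) *v x)" for x
      unfolding quad using \<tau>0 LIMSEQ_le_const[OF BRe[of x x], of 0] B0 by (intro add_nonneg_nonneg mult_nonneg_nonneg) auto
  qed
  have "stably_to_gaussian M (\<lambda>n \<omega>. a n *\<^sub>R (Z n \<omega> - Zinf \<omega> *\<^sub>R 1)) (\<lambda>\<omega>. (Zinf \<omega> * (1 - Zinf \<omega>)) *\<^sub>R (Sh + E))"
  proof (rule stable_limit[OF Zm Zr Zl W_\<nu> \<nu>_sum w_end w_rec _ _ _ r2 tail sup psd quad])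
    show "(\<lambda>n. a n * norm (w t n 0)) \<longlonglongrightarrow> 0" for t
    proof (rule Lim_null_comparison)
      have "(\<lambda>n. \<bar>a n\<bar> * norm (P j 0 n)) \<longlonglongrightarrow> 0" if "j \<in> {2..CARD('n)}" for j
      proof -
        have "(\<lambda>n. sqrt ((a n)\<^sup>2 * (norm (P j 0 n))\<^sup>2)) \<longlonglongrightarrow> sqrt 0" by (intro tendsto_real_sqrt init that)
        then show ?thesis by (simp add: real_sqrt_mult)
      qed
      then have "(\<lambda>n. \<Sum>j\<in>{2..CARD('n)}. norm (\<alpha> t j) * norm (v j) * (\<bar>a n\<bar> * norm (P j 0 n))) \<longlonglongrightarrow> (\<Sum>j\<in>{2..CARD('n)}. norm (\<alpha> t j) * norm (v j) * 0)"
        by (intro tendsto_sum tendsto_mult tendsto_const)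
      then show "(\<lambda>n. \<Sum>j\<in>{2..CARD('n)}. norm (\<alpha> t j) * norm (v j) * (\<bar>a n\<bar> * norm (P j 0 n))) \<longlonglongrightarrow> 0" by simp
      show "\<forall>\<^sub>F n in sequentially. norm (a n * norm (w t n 0)) \<le> (\<Sum>j\<in>{2..CARD('n)}. norm (\<alpha> t j) * norm (v j) * (\<bar>a n\<bar> * norm (P j 0 n)))"
      proof (intro always_eventually allI)
        fix n
        have "\<bar>a n\<bar> * norm (w t n 0) \<le> \<bar>a n\<bar> * (\<Sum>j\<in>{2..CARD('n)}. norm (\<alpha> t j) * norm (v j) * norm (P j 0 n))"
          by (intro mult_left_mono norm_w_le) auto
        then show "norm (a n * norm (w t n 0)) \<le> (\<Sum>j\<in>{2..CARD('n)}. norm (\<alpha> t j) * norm (v j) * (\<bar>a n\<bar> * norm (P j 0 n)))"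
          by (simp add: abs_mult sum_distrib_left ac_simps)
      qed
    qed
    show "(\<lambda>n. (a n)\<^sup>2 * (\<Sum>k<n. (r k)\<^sup>2 * (norm (w t n (Suc k)))\<^sup>2)) \<longlonglongrightarrow> Re (G S t t)" for t
      using BRe[of t t] by (simp add: B_def[abs_def] power2_norm_eq_inner)
    show "(\<lambda>n. (a n) ^ 4 * (\<Sum>k<n. (r k) ^ 4 * norm (w t n (Suc k)) ^ 4)) \<longlonglongrightarrow> 0" for t
    proof (rule Lim_null_comparison)
      define C where "C j = (norm (\<alpha> t j) * norm (v j)) ^ 4" for j
      define b where "b n = real (card {2..CARD('n)}) ^ 4 * (\<Sum>j\<in>{2..CARD('n)}. C j * ((a n) ^ 4 * (\<Sum>k<n. (r k) ^ 4 * norm (P j (Suc k) n) ^ 4)))" for n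
      have "b \<longlonglongrightarrow> real (card {2..CARD('n)}) ^ 4 * (\<Sum>j\<in>{2..CARD('n)}. C j * 0)"
        unfolding b_def by (intro tendsto_mult tendsto_sum tendsto_const four)
      then show "b \<longlonglongrightarrow> 0" by simp
      show "\<forall>\<^sub>F n in sequentially. norm ((a n) ^ 4 * (\<Sum>k<n. (r k) ^ 4 * norm (w t n (Suc k)) ^ 4)) \<le> b n"
      proof (intro always_eventually allI)
        fix n
        have "norm (w t n (Suc k)) ^ 4 \<le> real (card {2..CARD('n)}) ^ 4 * (\<Sum>j\<in>{2..CARD('n)}. C j * norm (P j (Suc k) n) ^ 4)" if "k < n" for k
        proof -
          have "norm (w t n (Suc k)) ^ 4 \<le> (\<Sum>j\<in>{2..CARD('n)}. \<bar>norm (\<alpha> t j) * norm (v j) * norm (P j (Suc k) n)\<bar>) ^ 4"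
            using norm_w_le[of "Suc k" n t] that by (intro power_mono) auto
          also have "\<dots> \<le> real (card {2..CARD('n)}) ^ 4 * (\<Sum>j\<in>{2..CARD('n)}. \<bar>norm (\<alpha> t j) * norm (v j) * norm (P j (Suc k) n)\<bar> ^ 4)"
            by (rule sum_power4_le) simp
          finally show ?thesis by (simp add: C_def power_mult_distrib)
        qed
        then have "(a n) ^ 4 * (\<Sum>k<n. (r k) ^ 4 * norm (w t n (Suc k)) ^ 4) \<le>
           (a n) ^ 4 * (\<Sum>k<n. (r k) ^ 4 * (real (card {2..CARD('n)}) ^ 4 * (\<Sum>j\<in>{2..CARD('n)}. C j * norm (P j (Suc k) n) ^ 4)))"
          by (intro mult_left_mono sum_mono) auto
        also have "\<dots> = b n"
        proof -
          have "(\<Sum>k<n. (r k) ^ 4 * (real (card {2..CARD('n)}) ^ 4 * (\<Sum>j\<in>{2..CARD('n)}. C j * norm (P j (Suc k) n) ^ 4)))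
            = real (card {2..CARD('n)}) ^ 4 * (\<Sum>k<n. \<Sum>j\<in>{2..CARD('n)}. C j * ((r k) ^ 4 * norm (P j (Suc k) n) ^ 4))"
            unfolding sum_distrib_left by (intro sum.cong refl) (simp only: ac_simps)
          also have "(\<Sum>k<n. \<Sum>j\<in>{2..CARD('n)}. C j * ((r k) ^ 4 * norm (P j (Suc k) n) ^ 4)) =
             (\<Sum>j\<in>{2..CARD('n)}. \<Sum>k<n. C j * ((r k) ^ 4 * norm (P j (Suc k) n) ^ 4))" by (rule sum.swap)
          finally show ?thesis unfolding b_def by (simp only: sum_distrib_left ac_simps)
        qed
        finally show "norm ((a n) ^ 4 * (\<Sum>k<n. (r k) ^ 4 * norm (w t n (Suc k)) ^ 4)) \<le> b n"
          by (simp add: abs_of_nonneg sum_nonneg)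
      qed
    qed
  qed
  with map show ?thesis unfolding S_def E_def by blast
qed

text \<open>With \<beta> and its conjugate as the two parameters, the product of the factors is the
  squared modulus. The squared products have no source term and their scaled limit is 0; the fourth
  powers are covered by \<open>contraction_rate_fourth\<close>.\<close>

lemma contraction_rate_P_limits:
  assumes cr: "contraction_rate (\<lambda>n. (a n)\<^sup>2) r (\<beta> j) (cnj (\<beta> j)) b d"
  shows "(\<lambda>n. (a n)\<^sup>2 * (norm (P j 0 n))\<^sup>2) \<longlonglongrightarrow> 0"
    and "(\<lambda>n. (a n) ^ 4 * (\<Sum>k<n. (r k) ^ 4 * norm (P j (Suc k) n) ^ 4)) \<longlonglongrightarrow> 0"
proof -
  have "(\<lambda>n. complex_of_real ((a n)\<^sup>2) * of_real ((norm (P j 0 n))\<^sup>2)) \<longlonglongrightarrow> 0 * of_real d / b"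
  proof (rule contraction_rate_limit[OF cr])
    fix n
    show "complex_of_real ((norm (P j 0 (Suc n)))\<^sup>2) =
        (1 - of_real (r n) * \<beta> j) * (1 - of_real (r n) * cnj (\<beta> j)) * of_real ((norm (P j 0 n))\<^sup>2) + 0 * of_real ((r n)\<^sup>2)"
      unfolding complex_norm_square by (simp add: P_rec_end ac_simps)
  qed
  then have "(\<lambda>n. complex_of_real ((a n)\<^sup>2 * (norm (P j 0 n))\<^sup>2)) \<longlonglongrightarrow> of_real 0" by simp
  then show "(\<lambda>n. (a n)\<^sup>2 * (norm (P j 0 n))\<^sup>2) \<longlonglongrightarrow> 0" by (simp only: tendsto_of_real_iff)
  have "(\<lambda>n. ((a n)\<^sup>2)\<^sup>2 * (\<Sum>k<n. (r k) ^ 4 * norm (P j (Suc k) n) ^ 4)) \<longlonglongrightarrow> 0"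
  proof (rule contraction_rate_fourth[OF cr])
    fix n
    have "(\<Sum>k<n. (r k) ^ 4 * norm (P j (Suc k) (Suc n)) ^ 4) = (\<Sum>k<n. norm (1 - of_real (r n) * \<beta> j) ^ 4 * ((r k) ^ 4 * norm (P j (Suc k) n) ^ 4))"
      by (intro sum.cong refl) (simp add: P_rec_end norm_mult power_mult_distrib)
    then show "(\<Sum>k<Suc n. (r k) ^ 4 * norm (P j (Suc k) (Suc n)) ^ 4) = norm (1 - of_real (r n) * \<beta> j) ^ 4 * (\<Sum>k<n. (r k) ^ 4 * norm (P j (Suc k) n) ^ 4) + (r n) ^ 4"
      by (simp add: sum_distrib_left)
  qed
  then show "(\<lambda>n. (a n) ^ 4 * (\<Sum>k<n. (r k) ^ 4 * norm (P j (Suc k) n) ^ 4)) \<longlonglongrightarrow> 0" by simp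
qed

end

section \<open>The theorem\<close>

text \<open>Boundedness of \<open>k powr \<gamma> * r k\<close> gives a bound on the later steps
  that decreases in \<open>k\<close>, so its value at \<open>k = n\<close> is the largest
  one.\<close>

lemma (in interacting_rsp) step_size_sup:
  assumes a: "(\<lambda>n. (a n)\<^sup>2 * real n powr (- 2 * \<gamma>)) \<longlonglongrightarrow> 0"
  shows "\<exists>\<eta>. \<eta> \<longlonglongrightarrow> 0 \<and> (\<forall>n k. n \<le> k \<longrightarrow> (a n)\<^sup>2 * (r k)\<^sup>2 \<le> \<eta> n)"
proof -
  have "Bseq (\<lambda>n. real n powr \<gamma> * r n)" using r_limit by (auto intro: convergent_imp_Bseq convergentI)
  then obtain C where C: "\<And>k. norm (real k powr \<gamma> * r k) \<le> C" unfolding Bseq_def by blast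
  \<comment> \<open>Since \<open>0 powr x = 0\<close>, the general formula would be too small at
    \<open>n = 0\<close>; there \<open>r k < 1\<close> is used instead.\<close>
  define \<eta> where "\<eta> n = (if n = 0 then (a n)\<^sup>2 else (a n)\<^sup>2 * real n powr (- 2 * \<gamma>) * C\<^sup>2)" for n
  have "(\<lambda>n. (a n)\<^sup>2 * real n powr (- 2 * \<gamma>) * C\<^sup>2) \<longlonglongrightarrow> 0 * C\<^sup>2" by (intro tendsto_mult a tendsto_const)
  then have "(\<lambda>n. (a n)\<^sup>2 * real n powr (- 2 * \<gamma>) * C\<^sup>2) \<longlonglongrightarrow> 0" by simp
  moreover have "\<forall>\<^sub>F n in sequentially. (a n)\<^sup>2 * real n powr (- 2 * \<gamma>) * C\<^sup>2 = \<eta> n"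
    using eventually_gt_at_top[of 0] by eventually_elim (simp add: \<eta>_def)
  ultimately have "\<eta> \<longlonglongrightarrow> 0" by (rule Lim_transform_eventually)
  moreover have "(a n)\<^sup>2 * (r k)\<^sup>2 \<le> \<eta> n" if nk: "n \<le> k" for n k
  proof (cases "n = 0")
    case True
    have "(r k)\<^sup>2 \<le> 1" using r_range[of k] by (simp add: power_le_one)
    then show ?thesis using True by (simp add: \<eta>_def mult_left_le)
  next
    case False
    then have k: "0 < real n" "real n \<le> real k" using nk by auto
    have "(r k)\<^sup>2 = real k powr (- 2 * \<gamma>) * (real k powr \<gamma> * r k)\<^sup>2"
      using k by (simp add: power_mult_distrib power2_eq_square powr_add[symmetric] flip: mult.assoc)
    also have "\<dots> \<le> real n powr (- 2 * \<gamma>) * C\<^sup>2"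
    proof (rule mult_mono)
      show "real k powr (- 2 * \<gamma>) \<le> real n powr (- 2 * \<gamma>)" using k \<gamma>_range by (intro powr_mono2') auto
      show "(real k powr \<gamma> * r k)\<^sup>2 \<le> C\<^sup>2" using power_mono[OF C[of k], of 2] by simp
    qed auto
    finally show ?thesis using False mult_left_mono[of "(r k)\<^sup>2" "real n powr (- 2 * \<gamma>) * C\<^sup>2" "(a n)\<^sup>2"] by (simp add: \<eta>_def mult.assoc)
  qed
  ultimately show ?thesis by blast
qed

theorem theorem3p2:
  fixes M :: "'a measure"
    and W :: "real^'n^'n"
    and r :: "nat \<Rightarrow> real"
    and c \<gamma> :: real
    and Z X :: "nat \<Rightarrow> 'a \<Rightarrow> real^'n"
    and Zinf :: "'a \<Rightarrow> real"
    and lam :: "nat \<Rightarrow> complex"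
    and lamstar :: complex
    and u v :: "nat \<Rightarrow> complex^'n"
  assumes model: "interacting_rsp M W r c \<gamma> Z X"
    and Zinf_measurable: "Zinf \<in> borel_measurable M"
    and Zinf_range: "\<And>\<omega>. \<omega> \<in> space M \<Longrightarrow> Zinf \<omega> \<in> {0..1}"
    and Zinf_limit: "AE \<omega> in M. (\<lambda>n. Z n \<omega>) \<longlonglongrightarrow> Zinf \<omega> *\<^sub>R 1"
    and spectral: "spectral_data W lam u v"
    and lamstar: "2 \<le> CARD('n) \<Longrightarrow> is_arg_max Re (\<lambda>l. l \<in> lam ` {2..CARD('n)}) lamstar"
  shows
    "(\<gamma> < 1 \<longrightarrow>
        0 < sigma_tilde_sq c \<gamma> (v 1) \<and>
        stably_to_gaussian M
          (\<lambda>n \<omega>. (real n powr (\<gamma> - 1/2)) *\<^sub>R (Z n \<omega> - Zinf \<omega> *\<^sub>R 1))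
          (\<lambda>\<omega>. (Zinf \<omega> * (1 - Zinf \<omega>)) *\<^sub>R Sigma_tilde c \<gamma> (v 1)))
   \<and> (\<gamma> = 1 \<and> (2 \<le> CARD('n) \<longrightarrow> Re lamstar < 1 - 1 / (2 * c)) \<longrightarrow>
        (\<exists>Sigma_hat :: real^'n^'n.
           map_matrix complex_of_real Sigma_hat = U_S_Ut u (S_hat c lam v) \<and>
           stably_to_gaussian M
             (\<lambda>n \<omega>. sqrt (real n) *\<^sub>R (Z n \<omega> - Zinf \<omega> *\<^sub>R 1))
             (\<lambda>\<omega>. (Zinf \<omega> * (1 - Zinf \<omega>)) *\<^sub>R (Sigma_tilde c 1 (v 1) + Sigma_hat))))
   \<and> (\<gamma> = 1 \<and> 2 \<le> CARD('n) \<and> Re lamstar = 1 - 1 / (2 * c) \<and>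
        (\<lambda>n. real n * r n - c) \<in> O(\<lambda>n. 1 / real n) \<longrightarrow>
        (\<exists>Sigma_hat_star :: real^'n^'n.
           map_matrix complex_of_real Sigma_hat_star = U_S_Ut u (S_hat_star c lam v) \<and>
           stably_to_gaussian M
             (\<lambda>n \<omega>. (sqrt (real n) / sqrt (ln (real n))) *\<^sub>R (Z n \<omega> - Zinf \<omega> *\<^sub>R 1))
             (\<lambda>\<omega>. (Zinf \<omega> * (1 - Zinf \<omega>)) *\<^sub>R Sigma_hat_star)))"
proof -
  interpret S: rsp_spectral M W r c \<gamma> Z X lam u v by (rule rsp_spectral.intro[OF model spectral])
  note lim = S.stable_limit_spectral[OF Zinf_measurable Zinf_range Zinf_limit]
  have c: "0 < c" by (rule S.c_pos)
  \<comment> \<open>The index range is empty when \<open>N = 1\<close>; otherwise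
    \<open>lamstar\<close> is a maximiser.\<close>
  have lam_le: "Re (lam j) \<le> Re lamstar" if "j \<in> {2..CARD('n)}" for j
  proof -
    have "2 \<le> CARD('n)" using that by simp
    then have "\<not> Re lamstar < Re (lam j)" using lamstar that unfolding is_arg_max_def by blast
    then show ?thesis by simp
  qed
  have Re_sum: "Re (of_real c * (S.\<beta> h + S.\<beta> j)) = c * (2 - Re (lam h) - Re (lam j))" for h j
    by (simp add: S.\<beta>_def algebra_simps)
  have Re_cnj: "Re (of_real c * (S.\<beta> j + cnj (S.\<beta> j))) = c * (2 - 2 * Re (lam j))" for j
    by (simp add: S.\<beta>_def algebra_simps)
  have "\<gamma> < 1 \<longrightarrow>
        0 < sigma_tilde_sq c \<gamma> (v 1) \<and>
        stably_to_gaussian M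
          (\<lambda>n \<omega>. (real n powr (\<gamma> - 1/2)) *\<^sub>R (Z n \<omega> - Zinf \<omega> *\<^sub>R 1))
          (\<lambda>\<omega>. (Zinf \<omega> * (1 - Zinf \<omega>)) *\<^sub>R Sigma_tilde c \<gamma> (v 1))"
  proof (intro impI conjI)
    assume \<gamma>: "\<gamma> < 1"
    show "0 < sigma_tilde_sq c \<gamma> (v 1)"
      unfolding sigma_tilde_sq_def using c S.\<gamma>_range S.v1_nonzero by (intro divide_pos_pos mult_pos_pos) auto
    define a where "a n = real n powr (\<gamma> - 1 / 2)" for n
    have a2: "(a n)\<^sup>2 = real n powr (2 * \<gamma> - 1)" for n
      by (simp add: a_def power2_eq_square powr_add[symmetric])
    have pos: "0 < Re (of_real c * (S.\<beta> h + S.\<beta> j))" if "h \<in> {2..CARD('n)}" "j \<in> {2..CARD('n)}" for h j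
      unfolding Re_sum using S.Re_lam_less_1[OF that(1)] S.Re_lam_less_1[OF that(2)] c by (intro mult_pos_pos) linarith+
    have pos': "0 < Re (of_real c * (S.\<beta> j + cnj (S.\<beta> j)))" if "j \<in> {2..CARD('n)}" for j
      unfolding Re_cnj using S.Re_lam_less_1[OF that] c by (intro mult_pos_pos) linarith+
    note rate = contraction_rate_power[OF S.r_limit S.\<gamma>_range(1) \<gamma>]
    have "(\<lambda>n. (a n)\<^sup>2 * real n powr (- 2 * \<gamma>)) \<longlonglongrightarrow> 0" unfolding a2 using S.\<gamma>_range(1) by real_asymp
    then obtain \<eta> where \<eta>: "\<eta> \<longlonglongrightarrow> 0" "\<And>n k. n \<le> k \<Longrightarrow> (a n)\<^sup>2 * (r k)\<^sup>2 \<le> \<eta> n"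
      using S.step_size_sup[of a] by blast
    have "\<exists>Sh :: real^'n^'n. map_matrix complex_of_real Sh = U_S_Ut u (\<lambda>h j. 0 * dot (v h) (v j)) \<and>
      stably_to_gaussian M (\<lambda>n \<omega>. a n *\<^sub>R (Z n \<omega> - Zinf \<omega> *\<^sub>R 1))
        (\<lambda>\<omega>. (Zinf \<omega> * (1 - Zinf \<omega>)) *\<^sub>R (Sh + (\<chi> i j. (norm (v 1))\<^sup>2 / CARD('n) * (c\<^sup>2 / (2 * \<gamma> - 1)))))"
    proof (rule lim[where \<eta> = \<eta>])
      show "(\<lambda>n. of_real ((a n)\<^sup>2) * S.pair_sum h j n) \<longlonglongrightarrow> 0" if "h \<in> {2..CARD('n)}" "j \<in> {2..CARD('n)}" for h j
        using contraction_rate_limit[OF rate[OF pos[OF that]] S.pair_sum_Suc] by (simp add: a2)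
      show "(\<lambda>n. (a n)\<^sup>2 * (norm (S.P j 0 n))\<^sup>2) \<longlonglongrightarrow> 0"
        "(\<lambda>n. (a n) ^ 4 * (\<Sum>k<n. (r k) ^ 4 * norm (S.P j (Suc k) n) ^ 4)) \<longlonglongrightarrow> 0" if "j \<in> {2..CARD('n)}" for j
        using S.contraction_rate_P_limits[of a j, unfolded a2, OF rate[OF pos'[OF that]]] by (simp_all add: a2)
    qed (use step_sizes_tail[OF S.r_limit S.\<gamma>_range] \<eta> in \<open>simp_all add: a2\<close>)
    then obtain Sh :: "real^'n^'n" where Sh: "map_matrix complex_of_real Sh = U_S_Ut u (\<lambda>h j. 0 * dot (v h) (v j))"
      "stably_to_gaussian M (\<lambda>n \<omega>. a n *\<^sub>R (Z n \<omega> - Zinf \<omega> *\<^sub>R 1))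
        (\<lambda>\<omega>. (Zinf \<omega> * (1 - Zinf \<omega>)) *\<^sub>R (Sh + (\<chi> i j. (norm (v 1))\<^sup>2 / CARD('n) * (c\<^sup>2 / (2 * \<gamma> - 1)))))" by blast
    \<comment> \<open>All scaled pair sums tend to 0 in this regime, so only the common fluctuation
      of the limit survives.\<close>
    have "Sh = 0" using Sh(1) by (simp add: vec_eq_iff U_S_Ut_def)
    moreover have "(\<chi> i j. (norm (v 1))\<^sup>2 / CARD('n) * (c\<^sup>2 / (2 * \<gamma> - 1))) = Sigma_tilde c \<gamma> (v 1)"
      by (simp add: vec_eq_iff Sigma_tilde_def sigma_tilde_sq_def mult.commute)
    ultimately show "stably_to_gaussian M
          (\<lambda>n \<omega>. (real n powr (\<gamma> - 1/2)) *\<^sub>R (Z n \<omega> - Zinf \<omega> *\<^sub>R 1))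
          (\<lambda>\<omega>. (Zinf \<omega> * (1 - Zinf \<omega>)) *\<^sub>R Sigma_tilde c \<gamma> (v 1))"
      using Sh(2) by (simp add: a_def)
  qed
  moreover have "\<gamma> = 1 \<and> (2 \<le> CARD('n) \<longrightarrow> Re lamstar < 1 - 1 / (2 * c)) \<longrightarrow>
        (\<exists>Sigma_hat :: real^'n^'n.
           map_matrix complex_of_real Sigma_hat = U_S_Ut u (S_hat c lam v) \<and>
           stably_to_gaussian M
             (\<lambda>n \<omega>. sqrt (real n) *\<^sub>R (Z n \<omega> - Zinf \<omega> *\<^sub>R 1))
             (\<lambda>\<omega>. (Zinf \<omega> * (1 - Zinf \<omega>)) *\<^sub>R (Sigma_tilde c 1 (v 1) + Sigma_hat)))"
  proof
    assume asm: "\<gamma> = 1 \<and> (2 \<le> CARD('n) \<longrightarrow> Re lamstar < 1 - 1 / (2 * c))"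
    then have \<gamma>: "\<gamma> = 1" by simp
    have r: "(\<lambda>n. real n * r n) \<longlonglongrightarrow> c" using S.r_limit by (simp add: \<gamma>)
    have gap: "1 < 2 * c * (1 - Re (lam j))" if "j \<in> {2..CARD('n)}" for j
    proof -
      have "Re (lam j) < 1 - 1 / (2 * c)" using lam_le[OF that] asm that by force
      then show ?thesis using c by (simp add: field_simps)
    qed
    have pos: "1 < Re (of_real c * (S.\<beta> h + S.\<beta> j))" if "h \<in> {2..CARD('n)}" "j \<in> {2..CARD('n)}" for h j
      unfolding Re_sum using gap[OF that(1)] gap[OF that(2)] by (simp add: algebra_simps)
    have pos': "1 < Re (of_real c * (S.\<beta> j + cnj (S.\<beta> j)))" if "j \<in> {2..CARD('n)}" for j
      unfolding Re_cnj using gap[OF that] by (simp add: algebra_simps)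
    note rate = contraction_rate_linear[OF r]
    have "(\<lambda>n. (sqrt (real n))\<^sup>2 * real n powr (- 2 * \<gamma>)) \<longlonglongrightarrow> 0" unfolding \<gamma> by real_asymp
    then obtain \<eta> where \<eta>: "\<eta> \<longlonglongrightarrow> 0" "\<And>n k. n \<le> k \<Longrightarrow> (sqrt (real n))\<^sup>2 * (r k)\<^sup>2 \<le> \<eta> n"
      using S.step_size_sup[of "\<lambda>n. sqrt (real n)"] by blast
    have tail: "(\<lambda>n. (sqrt (real n))\<^sup>2 * (\<Sum>k. (r (k + n))\<^sup>2)) \<longlonglongrightarrow> c\<^sup>2"
      using step_sizes_tail(2)[OF S.r_limit S.\<gamma>_range] by (simp add: \<gamma>)
    \<comment> \<open>Input over rate of the limiting recursion; with
      \<open>\<beta> = 1 - lam\<close> the denominator is that of \<open>S_hat\<close>.\<close>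
    define l where "l h j = of_real (c\<^sup>2) / (of_real c * (S.\<beta> h + S.\<beta> j) - 1)" for h j
    have "\<exists>Sh :: real^'n^'n. map_matrix complex_of_real Sh = U_S_Ut u (\<lambda>h j. l h j * dot (v h) (v j)) \<and>
      stably_to_gaussian M (\<lambda>n \<omega>. sqrt (real n) *\<^sub>R (Z n \<omega> - Zinf \<omega> *\<^sub>R 1))
        (\<lambda>\<omega>. (Zinf \<omega> * (1 - Zinf \<omega>)) *\<^sub>R (Sh + (\<chi> i j. (norm (v 1))\<^sup>2 / CARD('n) * c\<^sup>2)))"
    proof (rule lim[where \<eta> = \<eta>])
      show "(\<lambda>n. of_real ((sqrt (real n))\<^sup>2) * S.pair_sum h j n) \<longlonglongrightarrow> l h j" if "h \<in> {2..CARD('n)}" "j \<in> {2..CARD('n)}" for h j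
        using contraction_rate_limit[OF rate[OF pos[OF that]] S.pair_sum_Suc] by (simp add: l_def)
      show "(\<lambda>n. (sqrt (real n))\<^sup>2 * (norm (S.P j 0 n))\<^sup>2) \<longlonglongrightarrow> 0"
        "(\<lambda>n. (sqrt (real n)) ^ 4 * (\<Sum>k<n. (r k) ^ 4 * norm (S.P j (Suc k) n) ^ 4)) \<longlonglongrightarrow> 0" if "j \<in> {2..CARD('n)}" for j
        using S.contraction_rate_P_limits[of "\<lambda>n. sqrt (real n)" j] rate[OF pos'[OF that]] by simp_all
      show "summable (\<lambda>k. (r k)\<^sup>2)" by (rule step_sizes_tail(1)[OF S.r_limit S.\<gamma>_range])
    qed (assumption | rule tail \<eta>)+
    then obtain Sh :: "real^'n^'n" where Sh: "map_matrix complex_of_real Sh = U_S_Ut u (\<lambda>h j. l h j * dot (v h) (v j))"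
      "stably_to_gaussian M (\<lambda>n \<omega>. sqrt (real n) *\<^sub>R (Z n \<omega> - Zinf \<omega> *\<^sub>R 1))
        (\<lambda>\<omega>. (Zinf \<omega> * (1 - Zinf \<omega>)) *\<^sub>R (Sh + (\<chi> i j. (norm (v 1))\<^sup>2 / CARD('n) * c\<^sup>2)))" by blast
    have e1: "(\<lambda>h j. l h j * dot (v h) (v j)) = S_hat c lam v"
      by (intro ext) (simp add: l_def S_hat_def S.\<beta>_def algebra_simps)
    have e2: "Sh + (\<chi> i j. (norm (v 1))\<^sup>2 / CARD('n) * c\<^sup>2) = Sigma_tilde c 1 (v 1) + Sh"
      by (simp add: vec_eq_iff Sigma_tilde_def sigma_tilde_sq_def mult.commute)
    show "\<exists>Sigma_hat :: real^'n^'n.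
           map_matrix complex_of_real Sigma_hat = U_S_Ut u (S_hat c lam v) \<and>
           stably_to_gaussian M
             (\<lambda>n \<omega>. sqrt (real n) *\<^sub>R (Z n \<omega> - Zinf \<omega> *\<^sub>R 1))
             (\<lambda>\<omega>. (Zinf \<omega> * (1 - Zinf \<omega>)) *\<^sub>R (Sigma_tilde c 1 (v 1) + Sigma_hat))"
      using Sh unfolding e1 e2 by blast
  qed
  moreover have "\<gamma> = 1 \<and> 2 \<le> CARD('n) \<and> Re lamstar = 1 - 1 / (2 * c) \<and>
        (\<lambda>n. real n * r n - c) \<in> O(\<lambda>n. 1 / real n) \<longrightarrow>
        (\<exists>Sigma_hat_star :: real^'n^'n.
           map_matrix complex_of_real Sigma_hat_star = U_S_Ut u (S_hat_star c lam v) \<and>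
           stably_to_gaussian M
             (\<lambda>n \<omega>. (sqrt (real n) / sqrt (ln (real n))) *\<^sub>R (Z n \<omega> - Zinf \<omega> *\<^sub>R 1))
             (\<lambda>\<omega>. (Zinf \<omega> * (1 - Zinf \<omega>)) *\<^sub>R Sigma_hat_star))"
  proof
    assume asm: "\<gamma> = 1 \<and> 2 \<le> CARD('n) \<and> Re lamstar = 1 - 1 / (2 * c) \<and> (\<lambda>n. real n * r n - c) \<in> O(\<lambda>n. 1 / real n)"
    then have \<gamma>: "\<gamma> = 1" and O: "(\<lambda>n. real n * r n - c) \<in> O(\<lambda>n. 1 / real n)" by simp_all
    have r: "(\<lambda>n. real n * r n) \<longlonglongrightarrow> c" using S.r_limit by (simp add: \<gamma>)
    have gap: "1 \<le> 2 * c * (1 - Re (lam j))" if "j \<in> {2..CARD('n)}" for j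
    proof -
      have "Re (lam j) \<le> 1 - 1 / (2 * c)" using lam_le[OF that] asm by simp
      then show ?thesis using c by (simp add: field_simps)
    qed
    have ge: "1 \<le> Re (of_real c * (S.\<beta> h + S.\<beta> j))" if "h \<in> {2..CARD('n)}" "j \<in> {2..CARD('n)}" for h j
      unfolding Re_sum using gap[OF that(1)] gap[OF that(2)] by (simp add: algebra_simps)
    have ge': "1 \<le> Re (of_real c * (S.\<beta> j + cnj (S.\<beta> j)))" if "j \<in> {2..CARD('n)}" for j
      unfolding Re_cnj using gap[OF that] by (simp add: algebra_simps)
    define a where "a n = sqrt (real n) / sqrt (ln (real n))" for n
    \<comment> \<open>At \<open>n = 1\<close> both sides are 0 through division by
      \<open>ln 1 = 0\<close>, at \<open>n = 0\<close> through the numerator.\<close>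
    have a2: "(a n)\<^sup>2 = real n / ln (real n)" for n
      by (cases "n = 0") (simp_all add: a_def power_divide)
    have "(\<lambda>n. (a n)\<^sup>2 * real n powr (- 2 * \<gamma>)) \<longlonglongrightarrow> 0" unfolding a2 \<gamma> by real_asymp
    then obtain \<eta> where \<eta>: "\<eta> \<longlonglongrightarrow> 0" "\<And>n k. n \<le> k \<Longrightarrow> (a n)\<^sup>2 * (r k)\<^sup>2 \<le> \<eta> n"
      using S.step_size_sup[of a] by blast
    \<comment> \<open>The martingale tail is of order \<open>1 / n\<close>, too small by a logarithm
      to be seen at this scale; \<open>Sigma_tilde\<close> therefore drops out.\<close>
    have tail: "(\<lambda>n. (a n)\<^sup>2 * (\<Sum>k. (r (k + n))\<^sup>2)) \<longlonglongrightarrow> 0"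
    proof -
      have "(\<lambda>n. 1 / ln (real n) * (real n * (\<Sum>k. (r (k + n))\<^sup>2))) \<longlonglongrightarrow> 0 * c\<^sup>2"
      proof (rule tendsto_mult)
        show "(\<lambda>n. 1 / ln (real n)) \<longlonglongrightarrow> 0" by real_asymp
        show "(\<lambda>n. real n * (\<Sum>k. (r (k + n))\<^sup>2)) \<longlonglongrightarrow> c\<^sup>2"
          using step_sizes_tail(2)[OF S.r_limit S.\<gamma>_range] by (simp add: \<gamma>)
      qed
      then show ?thesis by (simp add: a2)
    qed
    define l where "l h j = (if lam h + lam j = 2 - of_real (1 / c) then of_real (c\<^sup>2) else 0 :: complex)" for h j
    have resonant: "lam h + lam j = 2 - of_real (1 / c) \<longleftrightarrow> of_real c * (S.\<beta> h + S.\<beta> j) = 1" for h j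
      using c by (auto simp: S.\<beta>_def field_simps)
    have "\<exists>Sh :: real^'n^'n. map_matrix complex_of_real Sh = U_S_Ut u (\<lambda>h j. l h j * dot (v h) (v j)) \<and>
      stably_to_gaussian M (\<lambda>n \<omega>. a n *\<^sub>R (Z n \<omega> - Zinf \<omega> *\<^sub>R 1))
        (\<lambda>\<omega>. (Zinf \<omega> * (1 - Zinf \<omega>)) *\<^sub>R (Sh + (\<chi> i j. (norm (v 1))\<^sup>2 / CARD('n) * 0)))"
    proof (rule lim[where \<eta> = \<eta>])
      show "(\<lambda>n. of_real ((a n)\<^sup>2) * S.pair_sum h j n) \<longlonglongrightarrow> l h j" if hj: "h \<in> {2..CARD('n)}" "j \<in> {2..CARD('n)}" for h j
      \<comment> \<open>A rate above 1 is strictly contracting and loses against the logarithm. At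
        real part 1, exact equality gives logarithmic growth and the limit \<open>c^2\<close>, while
        a nonzero imaginary part only rotates.\<close>
      proof (cases "1 < Re (of_real c * (S.\<beta> h + S.\<beta> j))")
        case True
        then have "of_real c * (S.\<beta> h + S.\<beta> j) \<noteq> 1" by (metis less_irrefl one_complex.sel(1))
        then have "l h j = 0" unfolding l_def resonant by simp
        then show ?thesis
          using contraction_rate_limit[OF contraction_rate_log_strict[OF r True] S.pair_sum_Suc] by (simp add: a2)
      next
        case False
        then have eq: "Re (of_real c * (S.\<beta> h + S.\<beta> j)) = 1" using ge[OF hj] by linarith
        show ?thesis
        proof (cases "of_real c * (S.\<beta> h + S.\<beta> j) = 1")
          case True
          then have "l h j = of_real (c\<^sup>2)" unfolding l_def resonant by simp
          then show ?thesis
            using contraction_rate_limit[OF contraction_rate_log_resonant[OF r O True] S.pair_sum_Suc] by (simp add: a2)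
        next
          case False
          then have "l h j = 0" unfolding l_def resonant by simp
          then show ?thesis
            using critical_nonresonant_limit[OF r O eq False S.pair_sum_Suc] by (simp add: a2)
        qed
      qed
      show "(\<lambda>n. (a n)\<^sup>2 * (norm (S.P j 0 n))\<^sup>2) \<longlonglongrightarrow> 0"
        "(\<lambda>n. (a n) ^ 4 * (\<Sum>k<n. (r k) ^ 4 * norm (S.P j (Suc k) n) ^ 4)) \<longlonglongrightarrow> 0" if j: "j \<in> {2..CARD('n)}" for j
      proof -
        have "\<exists>b d. contraction_rate (\<lambda>n. (a n)\<^sup>2) r (S.\<beta> j) (cnj (S.\<beta> j)) b d"
        proof (cases "1 < Re (of_real c * (S.\<beta> j + cnj (S.\<beta> j)))")
          case True
          show ?thesis unfolding a2 using contraction_rate_log_strict[OF r True] by blast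
        next
          case False
          then have "Re (of_real c * (S.\<beta> j + cnj (S.\<beta> j))) = 1" using ge'[OF j] by linarith
          \<comment> \<open>For a conjugate pair the quantity is real, so real part 1 already means
            exact resonance and rotation cannot occur.\<close>
          then have "of_real c * (S.\<beta> j + cnj (S.\<beta> j)) = 1" by (simp add: complex_eq_iff)
          from contraction_rate_log_resonant[OF r O this] show ?thesis unfolding a2 by blast
        qed
        then show "(\<lambda>n. (a n)\<^sup>2 * (norm (S.P j 0 n))\<^sup>2) \<longlonglongrightarrow> 0"
          "(\<lambda>n. (a n) ^ 4 * (\<Sum>k<n. (r k) ^ 4 * norm (S.P j (Suc k) n) ^ 4)) \<longlonglongrightarrow> 0"
          using S.contraction_rate_P_limits by blast+
      qed
      show "summable (\<lambda>k. (r k)\<^sup>2)" by (rule step_sizes_tail(1)[OF S.r_limit S.\<gamma>_range])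
    qed (assumption | rule tail \<eta>)+
    then obtain Sh :: "real^'n^'n" where Sh: "map_matrix complex_of_real Sh = U_S_Ut u (\<lambda>h j. l h j * dot (v h) (v j))"
      "stably_to_gaussian M (\<lambda>n \<omega>. a n *\<^sub>R (Z n \<omega> - Zinf \<omega> *\<^sub>R 1))
        (\<lambda>\<omega>. (Zinf \<omega> * (1 - Zinf \<omega>)) *\<^sub>R (Sh + (\<chi> i j. (norm (v 1))\<^sup>2 / CARD('n) * 0)))" by blast
    have e1: "(\<lambda>h j. l h j * dot (v h) (v j)) = S_hat_star c lam v"
      by (intro ext) (simp add: l_def S_hat_star_def)
    have e2: "Sh + (\<chi> i j. (norm (v 1))\<^sup>2 / CARD('n) * 0) = Sh" by (simp add: vec_eq_iff)
    show "\<exists>Sigma_hat_star :: real^'n^'n.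
           map_matrix complex_of_real Sigma_hat_star = U_S_Ut u (S_hat_star c lam v) \<and>
           stably_to_gaussian M
             (\<lambda>n \<omega>. (sqrt (real n) / sqrt (ln (real n))) *\<^sub>R (Z n \<omega> - Zinf \<omega> *\<^sub>R 1))
             (\<lambda>\<omega>. (Zinf \<omega> * (1 - Zinf \<omega>)) *\<^sub>R Sigma_hat_star)"
      using Sh unfolding e1 e2 a_def by blast
  qed
  ultimately show ?thesis by blast
qed

end
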